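(* Fix a finite set $\Lambda$ with $m=\#\Lambda\ge 2$ and $\mathbf{a}=(a_i)_{i\in\Lambda}\in\mathbb{C}^\Lambda$ with all the $a_i$ different. Then there is a set $E\subset\mathbb{D}\setminus\mathbb{R}$ of zero Hausdorff dimension such that for any $\lambda\in\mathbb{D}\setminus(E\cup\mathbb{R})$ and any $p\in\mathbb{P}_\Lambda$ such that $s(\lambda,p)>2$, the measure $\nu_{\lambda,\mathbf{a}}^p$ is absolutely continuous, and has a density in $L^q$ for some $q=q(\lambda)>1$. In particular, if $\lambda\in\mathbb{D}\setminus(E\cup\mathbb{R})$ and $|\lambda|^2 m>1$, then $A_{\lambda,\mathbf{a}}$ has positive Lebesgue measure.
   Context: $\mathbb{D}$ is the open unit disk in $\mathbb{C}$. Absolute continuity is with respect to Lebesgue measure on $\mathbb{C}\cong\mathbb{R}^2$. For a finite index set $\Lambda$, $\mathbb{P}_\Lambda$ is the open simplex of probability vectors $p=(p_i)_{i\in\Lambda}$ with all $p_i>0$. Given $p\in\mathbb{P}_\Lambda$, $\mathbf{a}=(a_i)_{i\in\Lambda}\in\mathbb{C}^\Lambda$ and $\lambda\in\mathbb{D}$, $\nu_{\lambda,\mathbf{a}}^p$ is the unique Borel probability measure on $\mathbb{C}$ satisfying $\nu_{\lambda,\mathbf{a}}^p=\sum_{i\in\Lambda}p_i\,f_i\nu_{\lambda,\mathbf{a}}^p$, where $f_i(z)=\lambda z+a_i$ and $g\mu(A)=\mu(g^{-1}A)$ is the push-forward. The set $A_{\lambda,\mathbf{a}}$ is its topological support, i.e.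 the attractor of the iterated function system $(z\mapsto\lambda z+a_i)_{i\in\Lambda}$. The similarity dimension is $s(\lambda,p)=h(p)/(-\log|\lambda|)$, where $h(p)=-\sum_{i\in\Lambda}p_i\log p_i$.
   Formalization: The exponent q>1 is allowed to depend on p as well as on λ; a q depending on λ alone cannot exist, since non-uniform p with s(λ,p) slightly above 2 violate the necessary condition Σ p_i^q ≤ |λ|^{2(q-1)}. *)

theory Defs
  imports "HOL-Probability.Probability"
begin

section \<open>Hausdorff dimension\<close>

text \<open>
  Countable covers by sets of diameter at most \<open>\<delta>\<close>. Boundedness is required because \<^const>\<open>diameter\<close>
  is an unspecified real number for unbounded sets.
\<close>

definition hausdorff_covers :: "real \<Rightarrow> 'a::metric_space set \<Rightarrow> (nat \<Rightarrow> 'a set) set" where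
  "hausdorff_covers \<delta> S =
     {U. S \<subseteq> (\<Union>n. U n) \<and> (\<forall>n. bounded (U n) \<and> diameter (U n) \<le> \<delta>)}"

text \<open>
  The \<open>s\<close>-dimensional Hausdorff (outer) measure, up to the usual normalising constant. It is
  only used for \<open>s > 0\<close>, where \<open>0 powr s = 0\<close> is the right value for empty sets and singletons.
\<close>

definition hausdorff_premeasure :: "real \<Rightarrow> real \<Rightarrow> 'a::metric_space set \<Rightarrow> ennreal" where
  "hausdorff_premeasure s \<delta> S =
     (INF U \<in> hausdorff_covers \<delta> S. \<Sum>n. ennreal (diameter (U n) powr s))"

definition hausdorff_measure :: "real \<Rightarrow> 'a::metric_space set \<Rightarrow> ennreal" where
  "hausdorff_measure s S = (SUP \<delta> \<in> {0<..}. hausdorff_premeasure s \<delta> S)"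

definition hausdorff_dim :: "'a::metric_space set \<Rightarrow> ennreal" where
  "hausdorff_dim S = (INF s \<in> {s. 0 < s \<and> hausdorff_measure s S = 0}. ennreal s)"


section \<open>Self-similar measures and attractors\<close>

definition prob_simplex :: "'i set \<Rightarrow> ('i \<Rightarrow> real) set" where
  "prob_simplex \<Lambda> = {p. (\<forall>i\<in>\<Lambda>. 0 < p i) \<and> (\<Sum>i\<in>\<Lambda>. p i) = 1}"

definition ifs_map :: "complex \<Rightarrow> ('i \<Rightarrow> complex) \<Rightarrow> 'i \<Rightarrow> complex \<Rightarrow> complex" where
  "ifs_map lam a i z = lam * z + a i"

definition is_self_similar_measure ::
  "'i set \<Rightarrow> complex \<Rightarrow> ('i \<Rightarrow> complex) \<Rightarrow> ('i \<Rightarrow> real) \<Rightarrow> complex measure \<Rightarrow> bool" where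
  "is_self_similar_measure \<Lambda> lam a p \<nu> \<longleftrightarrow>
     prob_space \<nu> \<and> sets \<nu> = sets borel \<and>
     (\<forall>A \<in> sets borel. measure \<nu> A = (\<Sum>i\<in>\<Lambda>. p i * measure (distr \<nu> borel (ifs_map lam a i)) A))"

text \<open>Existence and uniqueness, for \<open>\<bar>lam\<bar> < 1\<close>, are proved below.\<close>

definition self_similar_measure ::
  "'i set \<Rightarrow> complex \<Rightarrow> ('i \<Rightarrow> complex) \<Rightarrow> ('i \<Rightarrow> real) \<Rightarrow> complex measure" where
  "self_similar_measure \<Lambda> lam a p = (THE \<nu>. is_self_similar_measure \<Lambda> lam a p \<nu>)"

definition topological_support :: "'a::topological_space measure \<Rightarrow> 'a set" where
  "topological_support \<mu> = {x. \<forall>U. open U \<longrightarrow> x \<in> U \<longrightarrow> 0 < emeasure \<mu> U}"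

definition is_attractor :: "'i set \<Rightarrow> complex \<Rightarrow> ('i \<Rightarrow> complex) \<Rightarrow> complex set \<Rightarrow> bool" where
  "is_attractor \<Lambda> lam a K \<longleftrightarrow>
     K \<noteq> {} \<and> compact K \<and> K = (\<Union>i\<in>\<Lambda>. ifs_map lam a i ` K)"

text \<open>
  Existence, uniqueness and the equality with the support of any of the self-similar measures
  are proved below.
\<close>

definition attractor :: "'i set \<Rightarrow> complex \<Rightarrow> ('i \<Rightarrow> complex) \<Rightarrow> complex set" where
  "attractor \<Lambda> lam a = (THE K. is_attractor \<Lambda> lam a K)"

definition shannon_entropy :: "'i set \<Rightarrow> ('i \<Rightarrow> real) \<Rightarrow> real" where
  "shannon_entropy \<Lambda> p = - (\<Sum>i\<in>\<Lambda>. p i * ln (p i))"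

definition similarity_dim :: "'i set \<Rightarrow> complex \<Rightarrow> ('i \<Rightarrow> real) \<Rightarrow> real" where
  "similarity_dim \<Lambda> lam p = shannon_entropy \<Lambda> p / (- ln (norm lam))"

definition has_Lq_density :: "real \<Rightarrow> complex measure \<Rightarrow> bool" where
  "has_Lq_density q \<nu> \<longleftrightarrow>
     (\<exists>g. g \<in> borel_measurable lborel \<and> (\<forall>z. 0 \<le> g z) \<and>
          \<nu> = density lborel (\<lambda>z. ennreal (g z)) \<and>
          integrable lborel (\<lambda>z. g z powr q))"


section \<open>Well-definedness\<close>

lemma continuous_on_ifs_map [continuous_intros]: "continuous_on S (ifs_map lam a i)"
  unfolding ifs_map_def by (intro continuous_intros)

lemma measurable_ifs_map [measurable]: "ifs_map lam a i \<in> borel_measurable borel"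
  by (intro borel_measurable_continuous_onI continuous_intros)

lemma dist_ifs_map: "dist (ifs_map lam a i x) (ifs_map lam a i y) = norm lam * dist x y"
proof -
  have "ifs_map lam a i x - ifs_map lam a i y = lam * (x - y)"
    by (simp add: ifs_map_def algebra_simps)
  then show ?thesis by (simp add: dist_norm norm_mult)
qed

lemma self_similar_measure_vimage:
  assumes "is_self_similar_measure \<Lambda> lam a p \<nu>" "A \<in> sets borel"
  shows "measure \<nu> A = (\<Sum>i\<in>\<Lambda>. p i * measure \<nu> (ifs_map lam a i -` A))"
proof -
  have s: "sets \<nu> = sets borel" using assms unfolding is_self_similar_measure_def by blast
  have sp: "space \<nu> = UNIV" using sets_eq_imp_space_eq[OF s] by simp
  have m: "ifs_map lam a i \<in> measurable \<nu> borel" for i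
    using measurable_ifs_map by (simp add: measurable_cong_sets[OF s refl])
  have "measure \<nu> A = (\<Sum>i\<in>\<Lambda>. p i * measure (distr \<nu> borel (ifs_map lam a i)) A)"
    using assms unfolding is_self_similar_measure_def by blast
  also have "\<dots> = (\<Sum>i\<in>\<Lambda>. p i * measure \<nu> (ifs_map lam a i -` A))"
    by (simp only: measure_distr[OF m assms(2)] sp Int_UNIV_right)
  finally show ?thesis .
qed

definition closed_nbhd :: "complex set \<Rightarrow> real \<Rightarrow> complex set" where
  "closed_nbhd C r = (if C = {} then {} else {x. infdist x C \<le> r})"

lemma closed_closed_nbhd: "closed (closed_nbhd C r)"
  unfolding closed_nbhd_def
  by (auto intro!: closed_Collect_le continuous_intros)

lemma closed_nbhd_mono: "r \<le> s \<Longrightarrow> closed_nbhd C r \<subseteq> closed_nbhd C s"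
  unfolding closed_nbhd_def by auto

lemma closed_nbhd_vimage:
  assumes "closed C" "norm lam * r \<le> s"
  shows "closed_nbhd (ifs_map lam a i -` C) r \<subseteq> ifs_map lam a i -` closed_nbhd C s"
proof
  fix x assume x: "x \<in> closed_nbhd (ifs_map lam a i -` C) r"
  let ?P = "ifs_map lam a i -` C"
  have ne: "?P \<noteq> {}" and le: "infdist x ?P \<le> r"
    using x by (auto simp: closed_nbhd_def split: if_splits)
  have "closed ?P"
    using assms(1) by (intro closed_vimage continuous_on_ifs_map)
  then obtain y where y: "y \<in> ?P" "infdist x ?P = dist x y"
    using infdist_attains_inf ne by metis
  have "dist (ifs_map lam a i x) (ifs_map lam a i y) = norm lam * dist x y"
    by (rule dist_ifs_map)
  also have "\<dots> \<le> norm lam * r"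
    using y le by (intro mult_left_mono) auto
  finally have "infdist (ifs_map lam a i x) C \<le> s"
    using infdist_le2[of "ifs_map lam a i y" C] y(1) assms(2) by fastforce
  then show "x \<in> ifs_map lam a i -` closed_nbhd C s"
    using y(1) by (auto simp: closed_nbhd_def)
qed

lemma prob_space_ball_large:
  fixes \<nu> :: "complex measure"
  assumes "prob_space \<nu>" "sets \<nu> = sets borel" "0 < e"
  shows "\<exists>R. \<forall>r\<ge>R. measure \<nu> (ball 0 r) > 1 - e"
proof -
  interpret prob_space \<nu> by fact
  have sp: "space \<nu> = UNIV" using sets_eq_imp_space_eq[OF assms(2)] by simp
  have "(\<lambda>n. measure \<nu> (ball 0 (real n))) \<longlonglongrightarrow> measure \<nu> (\<Union>n. ball 0 (real n))"
  proof (rule finite_Lim_measure_incseq)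
    show "range (\<lambda>n. ball 0 (real n)) \<subseteq> sets \<nu>" by (simp add: assms(2) image_subset_iff)
    show "incseq (\<lambda>n. ball (0::complex) (real n))" by (intro incseq_SucI subset_ball) simp
  qed
  moreover have "(\<Union>n. ball (0::complex) (real n)) = UNIV"
    using reals_Archimedean2 by (intro set_eqI) simp
  ultimately have "(\<lambda>n. measure \<nu> (ball 0 (real n))) \<longlonglongrightarrow> 1"
    using prob_space sp by simp
  then have "eventually (\<lambda>n. measure \<nu> (ball 0 (real n)) > 1 - e) sequentially"
    using \<open>0 < e\<close> by (intro order_tendstoD) auto
  then obtain n where n: "measure \<nu> (ball 0 (real n)) > 1 - e"
    by (auto simp: eventually_sequentially)
  have "measure \<nu> (ball 0 r) > 1 - e" if "r \<ge> real n" for r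
  proof -
    have "measure \<nu> (ball 0 (real n)) \<le> measure \<nu> (ball 0 r)"
      using that assms(2) by (intro finite_measure_mono) auto
    then show ?thesis using n by simp
  qed
  then show ?thesis by blast
qed

lemma self_similar_measure_le:
  assumes \<nu>: "is_self_similar_measure \<Lambda> lam a p \<nu>" and \<mu>: "is_self_similar_measure \<Lambda> lam a p \<mu>"
    and p: "p \<in> prob_simplex \<Lambda>" and lam: "norm lam < 1" and C: "closed C"
  shows "measure \<nu> C \<le> measure \<mu> C"
proof -
  interpret N: prob_space \<nu> using \<nu> unfolding is_self_similar_measure_def by blast
  interpret M: prob_space \<mu> using \<mu> unfolding is_self_similar_measure_def by blast
  have sN: "sets \<nu> = sets borel" and sM: "sets \<mu> = sets borel"
    using \<nu> \<mu> unfolding is_self_similar_measure_def by blast+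
  have spN: "space \<nu> = UNIV" and spM: "space \<mu> = UNIV"
    using sets_eq_imp_space_eq[OF sN] sets_eq_imp_space_eq[OF sM] by simp_all
  define Q where
    "Q r e \<longleftrightarrow> (\<forall>C. closed C \<longrightarrow> measure \<nu> C \<le> measure \<mu> (closed_nbhd C r) + e)" for r e
  have step: "Q s e" if "Q r e" "norm lam * r \<le> s" for r s e
    unfolding Q_def
  proof (intro allI impI)
    fix C :: "complex set" assume C: "closed C"
    have "measure \<nu> (ifs_map lam a i -` C)
        \<le> measure \<mu> (ifs_map lam a i -` closed_nbhd C s) + e" for i
    proof -
      have "closed (ifs_map lam a i -` C)"
        using C by (intro closed_vimage continuous_on_ifs_map)
      then have "measure \<nu> (ifs_map lam a i -` C)
          \<le> measure \<mu> (closed_nbhd (ifs_map lam a i -` C) r) + e"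
        using \<open>Q r e\<close> by (auto simp: Q_def)
      also have "measure \<mu> (closed_nbhd (ifs_map lam a i -` C) r)
          \<le> measure \<mu> (ifs_map lam a i -` closed_nbhd C s)"
      proof (rule M.finite_measure_mono)
        show "ifs_map lam a i -` closed_nbhd C s \<in> sets \<mu>"
          unfolding sM
          by (intro borel_closed closed_vimage continuous_on_ifs_map closed_closed_nbhd)
      qed (rule closed_nbhd_vimage[OF C that(2)])
      finally show ?thesis by simp
    qed
    then have "measure \<nu> C
        \<le> (\<Sum>i\<in>\<Lambda>. p i * (measure \<mu> (ifs_map lam a i -` closed_nbhd C s) + e))"
      using p C
      by (subst self_similar_measure_vimage[OF \<nu>])
         (auto simp: prob_simplex_def intro!: sum_mono mult_left_mono intro: less_imp_le)
    also have "\<dots> = measure \<mu> (closed_nbhd C s) + e"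
      using p
      by (subst self_similar_measure_vimage[OF \<mu>])
         (auto simp: prob_simplex_def distrib_left sum.distrib borel_closed closed_closed_nbhd
               simp flip: sum_distrib_right)
    finally show "measure \<nu> C \<le> measure \<mu> (closed_nbhd C s) + e" .
  qed
  have large: "\<exists>T. 0 < T \<and> Q T e" if e: "0 < e" for e
  proof -
    obtain R where R: "\<And>r. r \<ge> R \<Longrightarrow> measure \<nu> (ball 0 r) > 1 - e"
      using prob_space_ball_large[OF N.prob_space_axioms sN e] by blast
    obtain R' where R': "\<And>r. r \<ge> R' \<Longrightarrow> measure \<mu> (ball 0 r) > 1 - e"
      using prob_space_ball_large[OF M.prob_space_axioms sM e] by blast
    define T where "T = \<bar>R\<bar> + \<bar>R'\<bar> + 1"
    have "Q T e"
      unfolding Q_def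
    proof (intro allI impI)
      fix C :: "complex set" assume C: "closed C"
      show "measure \<nu> C \<le> measure \<mu> (closed_nbhd C T) + e"
      proof (cases "C \<inter> ball 0 \<bar>R\<bar> = {}")
        case True
        have "measure \<nu> C \<le> measure \<nu> (space \<nu> - ball 0 \<bar>R\<bar>)"
          using True sN spN by (intro N.finite_measure_mono) auto
        also have "\<dots> = 1 - measure \<nu> (ball 0 \<bar>R\<bar>)"
          using sN by (intro N.prob_compl) auto
        finally have "measure \<nu> C < e"
          using R[OF abs_ge_self] by linarith
        then show ?thesis
          using measure_nonneg[of \<mu> "closed_nbhd C T"] by linarith
      next
        case False
        then obtain y where y: "y \<in> C" "norm y < \<bar>R\<bar>" by auto
        have "ball 0 \<bar>R'\<bar> \<subseteq> closed_nbhd C T"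
        proof
          fix x :: complex assume "x \<in> ball 0 \<bar>R'\<bar>"
          then have "dist x y \<le> T"
            using y norm_triangle_ineq4[of x y] by (auto simp: T_def dist_norm)
          then show "x \<in> closed_nbhd C T"
            using infdist_le2[OF y(1)] y by (auto simp: closed_nbhd_def)
        qed
        then have "measure \<mu> (ball 0 \<bar>R'\<bar>) \<le> measure \<mu> (closed_nbhd C T)"
          using sM by (intro M.finite_measure_mono) (auto intro: borel_closed closed_closed_nbhd)
        then have "1 \<le> measure \<mu> (closed_nbhd C T) + e"
          using R'[OF abs_ge_self] by linarith
        then show ?thesis
          using N.prob_le_1[of C] by linarith
      qed
    qed
    then show ?thesis by (intro exI[of _ T]) (auto simp: T_def)
  qed
  have pow: "Q (norm lam ^ n * T) e" if "Q T e" for n T e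
  proof (induction n)
    case (Suc n)
    then show ?case by (rule step) simp
  qed (use that in simp)
  have small: "Q r e" if re: "0 < r" "0 < e" for r e
  proof -
    obtain T where T: "0 < T" "Q T e" using large re by blast
    have "(\<lambda>n. norm lam ^ n * T) \<longlonglongrightarrow> 0 * T"
      using lam by (intro tendsto_mult LIMSEQ_power_zero tendsto_const) auto
    then have "eventually (\<lambda>n. norm lam ^ n * T < r) sequentially"
      using re by (intro order_tendstoD) auto
    then obtain n where n: "norm lam ^ n * T < r"
      by (auto simp: eventually_sequentially)
    have "norm lam * (norm lam ^ n * T) \<le> norm lam ^ n * T"
      using lam T by (intro mult_left_le_one_le) auto
    then show ?thesis
      using step[OF pow[OF T(2), of n], of r] n by simp
  qed
  have le: "measure \<nu> C \<le> measure \<mu> (closed_nbhd C r)" if "0 < r" for r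
  proof (rule field_le_epsilon)
    fix e :: real assume "0 < e"
    then show "measure \<nu> C \<le> measure \<mu> (closed_nbhd C r) + e"
      using small[OF that] C unfolding Q_def by blast
  qed
  show ?thesis
  proof (cases "C = {}")
    case False
    have "(\<lambda>n. measure \<mu> (closed_nbhd C (1 / real (Suc n))))
        \<longlonglongrightarrow> measure \<mu> (\<Inter>n. closed_nbhd C (1 / real (Suc n)))"
    proof (rule M.finite_Lim_measure_decseq)
      show "range (\<lambda>n. closed_nbhd C (1 / real (Suc n))) \<subseteq> sets \<mu>"
        unfolding sM by (intro image_subsetI borel_closed closed_closed_nbhd)
      show "decseq (\<lambda>n. closed_nbhd C (1 / real (Suc n)))"
        by (intro decseq_SucI closed_nbhd_mono) (simp add: field_simps)
    qed
    moreover have "(\<Inter>n. closed_nbhd C (1 / real (Suc n))) = C"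
    proof (intro equalityI subsetI)
      fix x assume x: "x \<in> (\<Inter>n. closed_nbhd C (1 / real (Suc n)))"
      have "infdist x C \<le> 0"
      proof (rule ccontr)
        assume "\<not> infdist x C \<le> 0"
        then obtain n where "inverse (real (Suc n)) < infdist x C"
          using reals_Archimedean[of "infdist x C"] by auto
        moreover have "infdist x C \<le> 1 / real (Suc n)"
          using x False by (auto simp: closed_nbhd_def simp del: of_nat_Suc)
        ultimately show False by (simp add: inverse_eq_divide)
      qed
      then have "infdist x C = 0" using infdist_nonneg[of x C] by linarith
      then show "x \<in> C" using C False by (simp add: in_closed_iff_infdist_zero)
    qed (auto simp: closed_nbhd_def)
    ultimately have "(\<lambda>n. measure \<mu> (closed_nbhd C (1 / real (Suc n)))) \<longlonglongrightarrow> measure \<mu> C"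
      by simp
    then show ?thesis
      by (rule LIMSEQ_le_const) (auto intro!: le simp del: of_nat_Suc)
  qed auto
qed

lemma self_similar_measure_unique:
  assumes \<nu>: "is_self_similar_measure \<Lambda> lam a p \<nu>" and \<mu>: "is_self_similar_measure \<Lambda> lam a p \<mu>"
    and p: "p \<in> prob_simplex \<Lambda>" and lam: "norm lam < 1"
  shows "\<nu> = \<mu>"
proof (rule measure_eqI_generator_eq)
  interpret N: prob_space \<nu> using \<nu> unfolding is_self_similar_measure_def by blast
  interpret M: prob_space \<mu> using \<mu> unfolding is_self_similar_measure_def by blast
  show "Int_stable (Collect closed :: complex set set)" by (auto simp: Int_stable_def)
  show "Collect closed \<subseteq> Pow (UNIV :: complex set)" by simp
  show "sets \<nu> = sigma_sets UNIV (Collect closed)" "sets \<mu> = sigma_sets UNIV (Collect closed)"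
    using \<nu> \<mu> unfolding is_self_similar_measure_def borel_eq_closed by simp_all
  show "range (\<lambda>_::nat. UNIV) \<subseteq> (Collect closed :: complex set set)" by auto
  show "emeasure \<nu> UNIV \<noteq> \<infinity>" by simp
  fix X :: "complex set" assume "X \<in> Collect closed"
  then have "measure \<nu> X = measure \<mu> X"
    using self_similar_measure_le[OF \<nu> \<mu> p lam] self_similar_measure_le[OF \<mu> \<nu> p lam]
    by (intro antisym) auto
  then show "emeasure \<nu> X = emeasure \<mu> X"
    by (simp add: N.emeasure_eq_measure M.emeasure_eq_measure)
qed simp

text \<open>The measure is realised as the law of \<open>\<Sum>n. lam ^ n * a (\<omega>\<^sub>n)\<close> with \<open>\<omega>\<^sub>n\<close> i.i.d. of law \<open>p\<close>.\<close>

lemma self_similar_measure_exists: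
  assumes fin: "finite \<Lambda>" and p: "p \<in> prob_simplex \<Lambda>" and lam: "norm lam < 1"
  shows "\<exists>\<nu>. is_self_similar_measure \<Lambda> lam a p \<nu> \<and> (\<exists>R. measure \<nu> (- cball 0 R) = 0)"
proof -
  define b where "b i = (if i \<in> \<Lambda> then a i else 0)" for i
  define w where "w i = (if i \<in> \<Lambda> then p i else 0)" for i
  define P where "P = embed_pmf w"
  have w0: "0 \<le> w i" for i using p by (auto simp: w_def prob_simplex_def less_imp_le)
  have "(\<integral>\<^sup>+i. ennreal (w i) \<partial>count_space UNIV) = (\<Sum>i\<in>\<Lambda>. ennreal (w i))"
    using fin by (intro nn_integral_count_space') (auto simp: w_def)
  also have "\<dots> = 1"
    using p w0 by (subst sum_ennreal) (auto simp: w_def prob_simplex_def cong: sum.cong)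
  finally have w1: "(\<integral>\<^sup>+i. ennreal (w i) \<partial>count_space UNIV) = 1" .
  have pmf: "pmf P i = w i" for i unfolding P_def by (rule pmf_embed_pmf[OF w0 w1])
  have setP: "set_pmf P = \<Lambda>"
    using p by (auto simp: set_pmf_eq pmf w_def prob_simplex_def)
  let ?S = "stream_space (measure_pmf P)"
  interpret S: prob_space ?S by (rule prob_space.prob_space_stream_space[OF prob_space_measure_pmf])
  define M where "M = (\<Sum>i\<in>\<Lambda>. norm (a i))"
  have bM: "norm (b i) \<le> M" for i
    using fin by (auto simp: b_def M_def intro!: member_le_sum sum_nonneg)
  define X where "X \<omega> = (\<Sum>n. lam ^ n * b (\<omega> !! n))" for \<omega>
  have geo: "summable (\<lambda>n. norm lam ^ n * M)"
    using lam by (intro summable_mult2 summable_geometric) auto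
  have nb: "norm (lam ^ n * b (\<omega> !! n)) \<le> norm lam ^ n * M" for n \<omega>
    using bM by (auto simp: norm_mult norm_power intro!: mult_left_mono)
  have summ: "summable (\<lambda>n. lam ^ n * b (\<omega> !! n))" for \<omega>
    by (rule summable_comparison_test'[OF geo nb])
  have X_bound: "norm (X \<omega>) \<le> (\<Sum>n. norm lam ^ n * M)" for \<omega>
    unfolding X_def by (rule norm_suminf_le[OF nb geo])
  have X_meas [measurable]: "X \<in> borel_measurable ?S"
    unfolding X_def
  proof (intro borel_measurable_suminf borel_measurable_times borel_measurable_const)
    fix n
    have "b \<in> borel_measurable (measure_pmf P)" by simp
    then show "(\<lambda>\<omega>. b (\<omega> !! n)) \<in> borel_measurable ?S"
      by (rule measurable_compose[OF measurable_snth])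
  qed
  have X_Cons: "X (i ## \<omega>) = ifs_map lam a i (X \<omega>)" if "i \<in> \<Lambda>" for i \<omega>
  proof -
    have "X (i ## \<omega>) = lam ^ 0 * b ((i ## \<omega>) !! 0) + (\<Sum>n. lam ^ Suc n * b ((i ## \<omega>) !! Suc n))"
      unfolding X_def using suminf_split_head[OF summ[of "i ## \<omega>"]] by simp
    also have "(\<Sum>n. lam ^ Suc n * b ((i ## \<omega>) !! Suc n)) = lam * X \<omega>"
      unfolding X_def by (subst suminf_mult[OF summ, symmetric]) (simp add: mult_ac)
    finally show ?thesis using that by (simp add: b_def ifs_map_def)
  qed
  define \<nu> where "\<nu> = distr ?S borel X"
  interpret N: prob_space \<nu> unfolding \<nu>_def by (rule S.prob_space_distr) simp
  have law: "emeasure \<nu> B = (\<integral>\<^sup>+\<omega>. indicator B (X \<omega>) \<partial>?S)" if B: "B \<in> sets borel" for B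
  proof -
    have "emeasure \<nu> B = (\<integral>\<^sup>+z. indicator B z \<partial>\<nu>)"
      using B by (simp add: \<nu>_def)
    also have "\<dots> = (\<integral>\<^sup>+\<omega>. indicator B (X \<omega>) \<partial>?S)"
      unfolding \<nu>_def using B by (intro nn_integral_distr X_meas) simp
    finally show ?thesis .
  qed
  have em: "emeasure \<nu> A = (\<Sum>i\<in>\<Lambda>. ennreal (p i) * emeasure \<nu> (ifs_map lam a i -` A))"
    if A [measurable]: "A \<in> sets borel" for A
  proof -
    have pre: "ifs_map lam a i -` A \<in> sets borel" for i
      using measurable_sets[OF measurable_ifs_map A] by simp
    have "emeasure \<nu> A = (\<integral>\<^sup>+\<omega>. indicator A (X \<omega>) \<partial>?S)"
      by (rule law[OF A])
    also have "\<dots> = (\<integral>\<^sup>+i. (\<integral>\<^sup>+\<omega>. indicator A (X (i ## \<omega>)) \<partial>?S) \<partial>measure_pmf P)"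
      by (rule prob_space.nn_integral_stream_space[OF prob_space_measure_pmf]) simp
    also have "\<dots> = (\<Sum>i\<in>\<Lambda>. (\<integral>\<^sup>+\<omega>. indicator A (X (i ## \<omega>)) \<partial>?S) * ennreal (p i))"
      using fin by (subst nn_integral_measure_pmf_finite) (auto simp: setP pmf w_def)
    also have "\<dots> = (\<Sum>i\<in>\<Lambda>. ennreal (p i) * emeasure \<nu> (ifs_map lam a i -` A))"
    proof (rule sum.cong[OF refl])
      fix i assume i: "i \<in> \<Lambda>"
      have "(\<integral>\<^sup>+\<omega>. indicator A (X (i ## \<omega>)) \<partial>?S)
          = (\<integral>\<^sup>+\<omega>. indicator (ifs_map lam a i -` A) (X \<omega>) \<partial>?S)"
        using i by (simp add: X_Cons indicator_def)
      also have "\<dots> = emeasure \<nu> (ifs_map lam a i -` A)"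
        by (rule law[OF pre, symmetric])
      finally show "(\<integral>\<^sup>+\<omega>. indicator A (X (i ## \<omega>)) \<partial>?S) * ennreal (p i)
          = ennreal (p i) * emeasure \<nu> (ifs_map lam a i -` A)"
        by (simp add: mult.commute)
    qed
    finally show ?thesis .
  qed
  have "measure \<nu> A = (\<Sum>i\<in>\<Lambda>. p i * measure (distr \<nu> borel (ifs_map lam a i)) A)"
    if A: "A \<in> sets borel" for A
  proof -
    have m: "ifs_map lam a i \<in> measurable \<nu> borel" for i unfolding \<nu>_def by simp
    have "ennreal (measure \<nu> A) = ennreal (\<Sum>i\<in>\<Lambda>. p i * measure \<nu> (ifs_map lam a i -` A))"
      using em[OF A] p
      by (subst sum_ennreal[symmetric])
         (auto simp: N.emeasure_eq_measure ennreal_mult prob_simplex_def less_imp_le)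
    then have "measure \<nu> A = (\<Sum>i\<in>\<Lambda>. p i * measure \<nu> (ifs_map lam a i -` A))"
      using p by (subst (asm) ennreal_inj)
         (auto simp: prob_simplex_def intro!: sum_nonneg mult_nonneg_nonneg intro: less_imp_le)
    also have "\<dots> = (\<Sum>i\<in>\<Lambda>. p i * measure (distr \<nu> borel (ifs_map lam a i)) A)"
      using measure_distr[OF m A] by (simp add: \<nu>_def)
    finally show ?thesis .
  qed
  then have ss: "is_self_similar_measure \<Lambda> lam a p \<nu>"
    unfolding is_self_similar_measure_def using N.prob_space_axioms by (auto simp: \<nu>_def)
  have "X -` (- cball 0 (\<Sum>n. norm lam ^ n * M)) = {}"
    using X_bound by (auto simp: not_le[symmetric])
  then have "measure \<nu> (- cball 0 (\<Sum>n. norm lam ^ n * M)) = 0"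
    unfolding \<nu>_def by (subst measure_distr) auto
  then show ?thesis using ss by blast
qed

theorem self_similar_measure:
  assumes "finite \<Lambda>" "p \<in> prob_simplex \<Lambda>" "norm lam < 1"
  shows "\<exists>!\<nu>. is_self_similar_measure \<Lambda> lam a p \<nu>"
    and "is_self_similar_measure \<Lambda> lam a p (self_similar_measure \<Lambda> lam a p)"
proof -
  show *: "\<exists>!\<nu>. is_self_similar_measure \<Lambda> lam a p \<nu>"
    using self_similar_measure_exists[OF assms] self_similar_measure_unique assms by metis
  show "is_self_similar_measure \<Lambda> lam a p (self_similar_measure \<Lambda> lam a p)"
    unfolding self_similar_measure_def by (rule theI'[OF *])
qed

lemma attractor_subset:
  assumes K: "is_attractor \<Lambda> lam a K" and L: "is_attractor \<Lambda> lam a L" and lam: "norm lam < 1"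
  shows "K \<subseteq> L"
proof -
  have Lc: "closed L" "L \<noteq> {}" and Kc: "compact K" "K \<noteq> {}"
    using K L by (auto simp: is_attractor_def compact_imp_closed)
  have "continuous_on K (\<lambda>x. infdist x L)" by (intro continuous_intros)
  then obtain x where x: "x \<in> K" "\<And>y. y \<in> K \<Longrightarrow> infdist y L \<le> infdist x L"
    using continuous_attains_sup[OF Kc] by blast
  obtain i x' where i: "i \<in> \<Lambda>" "x' \<in> K" "x = ifs_map lam a i x'"
    using x(1) K unfolding is_attractor_def by blast
  obtain y where y: "y \<in> L" "infdist x' L = dist x' y"
    using infdist_attains_inf[OF Lc] by metis
  have yL: "ifs_map lam a i y \<in> L" using y(1) i(1) L unfolding is_attractor_def by blast
  have "infdist x L \<le> dist x (ifs_map lam a i y)" by (rule infdist_le[OF yL])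
  also have "\<dots> = norm lam * infdist x' L"
    by (simp add: i(3) y(2) dist_ifs_map)
  also have "\<dots> \<le> norm lam * infdist x L"
    using x(2)[OF i(2)] by (intro mult_left_mono) auto
  finally have "(1 - norm lam) * infdist x L \<le> 0" by (simp add: algebra_simps)
  then have le: "infdist x L \<le> 0" using lam by (simp add: mult_le_0_iff)
  show ?thesis
  proof
    fix z assume "z \<in> K"
    then have "infdist z L = 0" using x(2)[of z] le infdist_nonneg[of z L] by linarith
    then show "z \<in> L" using Lc by (simp add: in_closed_iff_infdist_zero)
  qed
qed

lemma emeasure_disjoint_topological_support:
  fixes \<nu> :: "complex measure"
  assumes s: "sets \<nu> = sets borel" and U: "open U" "U \<inter> topological_support \<nu> = {}"
  shows "emeasure \<nu> U = 0"
proof -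
  define F where "F = {V. open V \<and> emeasure \<nu> V = 0}"
  obtain F' where F': "F' \<subseteq> F" "countable F'" "\<Union>F' = \<Union>F"
    using Lindelof[of F] by (auto simp: F_def)
  have "(\<Union>V\<in>F'. V) \<in> null_sets \<nu>"
    using F' s by (intro null_sets_UN') (auto simp: F_def null_sets_def)
  moreover have "U \<subseteq> (\<Union>V\<in>F'. V)"
  proof
    fix x assume "x \<in> U"
    then have "x \<notin> topological_support \<nu>" using U by blast
    then have "x \<in> \<Union>F" by (auto simp: topological_support_def F_def zero_less_iff_neq_zero)
    then show "x \<in> (\<Union>V\<in>F'. V)" using F' by simp
  qed
  ultimately have "U \<in> null_sets \<nu>"
    using null_sets_subset[of "\<Union>V\<in>F'. V" \<nu> U] s U by auto
  then show ?thesis by auto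
qed

lemma is_attractor_topological_support:
  assumes fin: "finite \<Lambda>" and p: "p \<in> prob_simplex \<Lambda>" and lam: "norm lam < 1"
  shows "is_attractor \<Lambda> lam a (topological_support (self_similar_measure \<Lambda> lam a p))"
proof -
  define \<nu> where "\<nu> = self_similar_measure \<Lambda> lam a p"
  let ?K = "topological_support \<nu>"
  have ss: "is_self_similar_measure \<Lambda> lam a p \<nu>"
    unfolding \<nu>_def by (rule self_similar_measure[OF assms])
  interpret prob_space \<nu> using ss unfolding is_self_similar_measure_def by blast
  have s: "sets \<nu> = sets borel" using ss unfolding is_self_similar_measure_def by blast
  have sp: "space \<nu> = UNIV" using sets_eq_imp_space_eq[OF s] by simp
  obtain R where R: "measure \<nu> (- cball 0 R) = 0"
    using self_similar_measure_exists[OF assms] self_similar_measure_unique[OF ss _ p lam] by blast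
  have "?K \<subseteq> cball 0 R"
    using R by (auto simp: topological_support_def emeasure_eq_measure dest!: spec[of _ "- cball 0 R"])
  then have bdd: "bounded ?K" by (rule bounded_subset[OF bounded_cball])
  have "open (- ?K)"
  proof (subst open_subopen, intro ballI)
    fix x assume "x \<in> - ?K"
    then obtain V where "open V" "x \<in> V" "emeasure \<nu> V = 0"
      by (auto simp: topological_support_def zero_less_iff_neq_zero)
    then show "\<exists>T. open T \<and> x \<in> T \<and> T \<subseteq> - ?K"
      by (intro exI[of _ V]) (auto simp: topological_support_def)
  qed
  then have cK: "compact ?K" using bdd by (simp add: compact_eq_bounded_closed closed_def)
  have ne: "?K \<noteq> {}"
  proof
    assume "?K = {}"
    then have "emeasure \<nu> UNIV = 0" by (intro emeasure_disjoint_topological_support[OF s]) auto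
    then show False using emeasure_space_1 sp by simp
  qed
  have ov: "open (ifs_map lam a i -` U)" if "open U" for i U
    using that by (intro open_vimage continuous_on_ifs_map)
  have "(\<Union>i\<in>\<Lambda>. ifs_map lam a i ` ?K) \<subseteq> ?K"
  proof (clarify)
    fix i x assume i: "i \<in> \<Lambda>" and x: "x \<in> ?K"
    show "ifs_map lam a i x \<in> ?K"
      unfolding topological_support_def
    proof (clarify)
      fix U assume U: "open U" "ifs_map lam a i x \<in> U"
      have "0 < emeasure \<nu> (ifs_map lam a i -` U)"
        using x U ov[OF U(1)] by (auto simp: topological_support_def)
      then have "0 < p i * measure \<nu> (ifs_map lam a i -` U)"
        using p i by (auto simp: emeasure_eq_measure prob_simplex_def)
      also have "\<dots> \<le> (\<Sum>i\<in>\<Lambda>. p i * measure \<nu> (ifs_map lam a i -` U))"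
        using fin i p
        by (intro member_le_sum[of i \<Lambda> "\<lambda>i. p i * measure \<nu> (ifs_map lam a i -` U)"])
           (auto simp: prob_simplex_def less_imp_le)
      also have "\<dots> = measure \<nu> U"
        using U by (intro self_similar_measure_vimage[OF ss, symmetric]) auto
      finally show "0 < emeasure \<nu> U" by (simp add: emeasure_eq_measure)
    qed
  qed
  moreover have "?K \<subseteq> (\<Union>i\<in>\<Lambda>. ifs_map lam a i ` ?K)"
  proof (rule ccontr)
    let ?L = "\<Union>i\<in>\<Lambda>. ifs_map lam a i ` ?K"
    assume "\<not> ?K \<subseteq> ?L"
    then obtain x where x: "x \<in> ?K" "x \<notin> ?L" by blast
    have "compact ?L"
      using fin by (intro compact_UN compact_continuous_image continuous_on_ifs_map cK)
    then have oL: "open (- ?L)" unfolding open_closed double_complement by (rule compact_imp_closed)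
    have "emeasure \<nu> (ifs_map lam a i -` (- ?L)) = 0" if "i \<in> \<Lambda>" for i
      using that by (intro emeasure_disjoint_topological_support[OF s] ov[OF oL]) auto
    then have "measure \<nu> (- ?L) = 0"
      using oL by (subst self_similar_measure_vimage[OF ss]) (auto simp: measure_def)
    then show False
      using x oL by (auto simp: topological_support_def emeasure_eq_measure)
  qed
  ultimately show ?thesis
    unfolding is_attractor_def \<nu>_def[symmetric] using ne cK by blast
qed

theorem attractor:
  assumes "finite \<Lambda>" "\<Lambda> \<noteq> {}" "norm lam < 1"
  shows "\<exists>!K. is_attractor \<Lambda> lam a K"
    and "is_attractor \<Lambda> lam a (attractor \<Lambda> lam a)"
proof -
  have "(\<lambda>_. 1 / real (card \<Lambda>)) \<in> prob_simplex \<Lambda>"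
    using assms by (auto simp: prob_simplex_def card_gt_0_iff)
  then show *: "\<exists>!K. is_attractor \<Lambda> lam a K"
    using is_attractor_topological_support[OF assms(1) _ assms(3)]
      attractor_subset[OF _ _ assms(3)] by (metis subset_antisym)
  show "is_attractor \<Lambda> lam a (attractor \<Lambda> lam a)"
    unfolding attractor_def by (rule theI'[OF *])
qed

theorem topological_support_self_similar_measure:
  assumes "finite \<Lambda>" "p \<in> prob_simplex \<Lambda>" "norm lam < 1"
  shows "topological_support (self_similar_measure \<Lambda> lam a p) = attractor \<Lambda> lam a"
proof -
  have "\<Lambda> \<noteq> {}" using assms(2) by (auto simp: prob_simplex_def)
  then show ?thesis
    using attractor[OF assms(1) _ assms(3)] is_attractor_topological_support[OF assms] by metis
qed

end

theory Submission
 imports Defs "HOL-Complex_Analysis.Complex_Analysis"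
begin

text \<open>
 Let \<open>\<theta>\<close> be a non-real ratio and \<open>X k\<close> the sum of the first \<open>k\<close> random digits. Smoothing the random series by
 uniform noise at all levels \<open>\<ge> l\<close> gives densities \<open>rho l\<close> whose entropy drops \<open>e l\<close> decrease with \<open>l\<close> by
 submodularity. Suppose their limit is positive. Then a fair choice between two points at distance about \<open>|\<theta>| ^ l\<close>
 adds a definite amount of entropy at scales near \<open>l\<close>, since otherwise many such choices, which fill a
 two-dimensional grid, would be free. Concavity over mixtures of pairs then forbids the mass of a ball around \<open>X k\<close> to
 shrink with its radius, from about \<open>|\<theta>| ^ (2 * k)\<close> at radius \<open>|\<theta>| ^ k\<close> down to a single atom at radius
 \<open>|\<theta>| ^ (M * k)\<close>, which separation and \<open>H(\<alpha>) > - 2 ln |\<theta>|\<close> require. So \<open>e\<close> tends to \<open>0\<close>, and a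
 submultiplicative estimate of \<open>(1 + t)\<close>-th moments bounds the mass that \<open>X m\<close> puts on balls of radius \<open>|\<theta>| ^ m\<close> by
 \<open>|\<theta>| ^ (2 * m) * exp (\<tau> * m)\<close> off an exponentially small event.

 For \<open>\<theta> = lam ^ N\<close> with \<open>N\<close> large, one digit of each block of \<open>N\<close> supplies Fourier decay and the others still have
 excess entropy. By Plancherel the transfer operator applied to a Gaussian converges exponentially fast in \<open>L\<^sup>1\<close>; the limit
 is the density, and it lies in some \<open>L\<^sup>q\<close> since the iterates have suprema at most \<open>|lam| ^ (- 2 * l)\<close>.

 Two sets of parameters are excluded: those with digit sums closer than \<open>|lam| ^ (M * k)\<close> for every \<open>M\<close> and those
 without Fourier decay (Erdos and Kahane). Both are covered by exponentially many balls whose radii decay at a rate that is,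
 relative to the number of balls, arbitrarily large.
\<close>

section \<open>Differential entropy\<close>

text \<open>The exceptional set must serve all \<open>p\<close> at once. Both excluded sets are
  therefore stated without probabilities: one through the differences of the \<open>a i\<close>, the
  other through distances of \<open>Re (u * w ^ k)\<close> from the integers with
  \<open>w = inverse (lam ^ N)\<close>, for every \<open>N\<close>, since \<open>N\<close> is chosen
  after \<open>p\<close>. Two kinds of smoothing are used. Entropies are taken of bounded densities
  with bounded support, so all of them are finite and their differences can be rearranged freely.
  Fourier estimates use Gaussians, because for finite Gaussian mixtures Plancherel's identity is an
  explicit finite computation. The entropy inequalities compare losses over windows of levels of
  fixed length. As \<open>e\<close> decreases to \<open>E\<close>, such a loss is the length times
  \<open>E\<close> up to a vanishing error, so inequalities can be transported over arbitrarily many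
  levels. A vanishing \<open>e\<close> controls only the mean logarithm of ball masses. The passage
  to exponentially small probabilities rests on a small power \<open>t\<close> of the mass, whose
  mean is governed by that logarithm over one long block, and on the multiplication of such bounds
  over successive blocks.\<close>

definition bsf :: "(complex \<Rightarrow> real) \<Rightarrow> bool" where
 "bsf f \<longleftrightarrow> f \<in> borel_measurable borel \<and> (\<exists>b. \<forall>z. \<bar>f z\<bar> \<le> b) \<and> (\<exists>R. \<forall>z. R < norm z \<longrightarrow> f z = 0)"

text \<open>The sigma-algebra is left open on purpose: \<open>measure_pmf\<close> carries all sets
  and \<open>dm f\<close> the Borel sets, and both serve as smoothing kernels. Bounded support keeps
  \<open>bsf\<close> stable under \<open>conv\<close>.\<close>

definition bprob :: "complex measure \<Rightarrow> bool" where
 "bprob M \<longleftrightarrow> prob_space M \<and> (\<lambda>y. y) \<in> borel_measurable M \<and> (\<exists>R. AE y in M. norm y \<le> R)"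

definition conv :: "complex measure \<Rightarrow> (complex \<Rightarrow> real) \<Rightarrow> complex \<Rightarrow> real" where
 "conv M f z = (\<integral>y. f (z - y) \<partial>M)"

lemma bsf_measurable [measurable_dest]: "bsf f \<Longrightarrow> f \<in> borel_measurable borel"
 by (simp add: bsf_def)

lemma bsfE:
 assumes "bsf f"
 obtains b R where "f \<in> borel_measurable borel" "\<And>z. \<bar>f z\<bar> \<le> b" "\<And>z. R < norm z \<Longrightarrow> f z = 0" "0 \<le> b" "0 \<le> R"
proof -
 from assms obtain b R where *: "f \<in> borel_measurable borel" "\<And>z. \<bar>f z\<bar> \<le> b" "\<And>z. R < norm z \<Longrightarrow> f z = 0"
  unfolding bsf_def by blast
 have "0 \<le> b" using *(2)[of 0] by linarith
 thus ?thesis using that[of b "\<bar>R\<bar>"] * by auto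
qed

lemma bsf_integrable:
 assumes "bsf f" shows "integrable lborel f"
proof -
 obtain b R where *: "f \<in> borel_measurable borel" "\<And>z. \<bar>f z\<bar> \<le> b" "\<And>z. R < norm z \<Longrightarrow> f z = 0"
  using bsfE[OF assms] by metis
 have "integrable lborel (\<lambda>z::complex. b * indicator (cball 0 R) z)"
  by (intro integrable_mult_right integrable_real_indicator) (use emeasure_bounded_finite[of "cball 0 R"] in auto)
 thus ?thesis
  by (rule Bochner_Integration.integrable_bound)
    (use * in \<open>auto simp: indicator_def not_le intro: order_trans[OF _ abs_ge_self]\<close>)
qed

lemma bsf_subset:
 assumes "bsf f" "g \<in> borel_measurable borel" "\<And>z. \<bar>g z\<bar> \<le> c * \<bar>f z\<bar>"
 shows "bsf g"
proof -
 obtain b R where *: "f \<in> borel_measurable borel" "\<And>z. \<bar>f z\<bar> \<le> b" "\<And>z. R < norm z \<Longrightarrow> f z = 0"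
  using bsfE[OF assms(1)] by metis
 have "\<bar>g z\<bar> \<le> \<bar>c\<bar> * b" for z
 proof -
  have "\<bar>g z\<bar> \<le> \<bar>c\<bar> * \<bar>f z\<bar>" using assms(3)[of z] by (meson abs_ge_self abs_ge_zero mult_right_mono order_trans)
  also have "... \<le> \<bar>c\<bar> * b" using *(2)[of z] by (intro mult_left_mono) auto
  finally show ?thesis .
 qed
 moreover have "g z = 0" if "R < norm z" for z using assms(3)[of z] *(3)[OF that] by simp
 ultimately show ?thesis using assms(2) unfolding bsf_def by blast
qed

lemma bsf_sum:
 assumes "finite I" "\<And>i. i \<in> I \<Longrightarrow> bsf (f i)"
 shows "bsf (\<lambda>z. \<Sum>i\<in>I. f i z)"
 using assms
proof (induction I)
 case empty thus ?case unfolding bsf_def by (auto intro!: exI[of _ 0])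
next
 case (insert i I)
 obtain b R where *: "f i \<in> borel_measurable borel" "\<And>z. \<bar>f i z\<bar> \<le> b" "\<And>z. R < norm z \<Longrightarrow> f i z = 0"
  using bsfE[OF insert.prems[OF insertI1]] by metis
 have ih: "bsf (\<lambda>z. \<Sum>i\<in>I. f i z)" using insert by simp
 obtain b' R' where **: "(\<lambda>z. \<Sum>i\<in>I. f i z) \<in> borel_measurable borel" "\<And>z. \<bar>\<Sum>i\<in>I. f i z\<bar> \<le> b'" "\<And>z. R' < norm z \<Longrightarrow> (\<Sum>i\<in>I. f i z) = 0"
  by (rule bsfE[OF ih]) blast
 show ?case unfolding bsf_def sum.insert[OF insert.hyps]
 proof (intro conjI exI allI impI)
  show "(\<lambda>z. f i z + (\<Sum>i\<in>I. f i z)) \<in> borel_measurable borel" using * ** by simp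
  show "\<bar>f i z + (\<Sum>i\<in>I. f i z)\<bar> \<le> b + b'" for z using *(2)[of z] **(2)[of z] by linarith
  show "f i z + (\<Sum>i\<in>I. f i z) = 0" if "max R R' < norm z" for z using that *(3) **(3) by simp
 qed
qed

lemma bsf_mult: assumes "bsf f" shows "bsf (\<lambda>z. c * f z)"
 using assms by (rule bsf_subset[where c = "\<bar>c\<bar>"]) (use assms in \<open>auto simp: abs_mult\<close>)

lemma bsf_shift: assumes "bsf f" shows "bsf (\<lambda>z. f (z - y))"
proof -
 obtain b R where *: "f \<in> borel_measurable borel" "\<And>z. \<bar>f z\<bar> \<le> b" "\<And>z. R < norm z \<Longrightarrow> f z = 0"
  using bsfE[OF assms] by metis
 have "f (z - y) = 0" if "R + norm y < norm z" for z
  using that norm_triangle_ineq2[of z y] by (intro *(3)) linarith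
 thus ?thesis unfolding bsf_def using * by auto
qed

lemma bprob_measurable[measurable_dest]: "bprob M \<Longrightarrow> (\<lambda>y. y) \<in> borel_measurable M"
 by (simp add: bprob_def)

lemma conv_measurable_fst:
 assumes "bprob M" "f \<in> borel_measurable borel"
 shows "(\<lambda>y. f (z - y)) \<in> borel_measurable M"
  and "(\<lambda>x. f (fst x - snd x)) \<in> borel_measurable (borel \<Otimes>\<^sub>M M)"
  and "(\<lambda>x. f (fst x - snd x)) \<in> borel_measurable (lborel \<Otimes>\<^sub>M M)"
proof -
 note m = bprob_measurable[OF assms(1)]
 show "(\<lambda>y. f (z - y)) \<in> borel_measurable M"
  by (rule measurable_compose[OF borel_measurable_diff[OF measurable_const m] assms(2)]) auto
 show "(\<lambda>x. f (fst x - snd x)) \<in> borel_measurable (borel \<Otimes>\<^sub>M M)"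
  by (rule measurable_compose[OF borel_measurable_diff[OF measurable_fst measurable_compose[OF measurable_snd m]] assms(2)])
 have "fst \<in> borel_measurable (lborel \<Otimes>\<^sub>M M)" using measurable_fst[of lborel M] by simp
 thus "(\<lambda>x. f (fst x - snd x)) \<in> borel_measurable (lborel \<Otimes>\<^sub>M M)"
  by (rule measurable_compose[OF borel_measurable_diff[OF _ measurable_compose[OF measurable_snd m]] assms(2)])
qed

lemma bprob_prob: "bprob M \<Longrightarrow> prob_space M"
 by (simp add: bprob_def)

lemma conv_integrable:
 assumes "bprob M" "bsf f" shows "integrable M (\<lambda>y. f (z - y))"
proof -
 interpret prob_space M using assms(1) by (rule bprob_prob)
 note assms[measurable]
 obtain b where b: "\<And>z. \<bar>f z\<bar> \<le> b" using assms(2) unfolding bsf_def by blast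
 have "(\<lambda>y. f (z - y)) \<in> borel_measurable M" using conv_measurable_fst(1)[OF assms(1), of f z] assms(2) by (simp add: bsf_def)
 thus ?thesis using b by (intro integrable_const_bound[where B = b]) auto
qed

lemma conv_bounds:
 assumes "bprob M" "bsf f" "\<And>z. f z \<le> b" shows "conv M f z \<le> b"
proof -
 interpret prob_space M using assms(1) by (rule bprob_prob)
 have "conv M f z \<le> (\<integral>y. b \<partial>M)" unfolding conv_def
  using conv_integrable[OF assms(1,2)] assms(3) by (intro integral_mono) auto
 thus ?thesis by (simp add: prob_space)
qed

lemma conv_nonneg: "(\<And>z. 0 \<le> f z) \<Longrightarrow> 0 \<le> conv M f z"
 unfolding conv_def by simp

lemma conv_measurable[measurable]:
 assumes "bprob M" "bsf f" shows "conv M f \<in> borel_measurable borel"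
proof -
 interpret prob_space M using assms(1) by (rule bprob_prob)
 note assms[measurable]
 have "(\<lambda>z. \<integral>y. f (z - y) \<partial>M) \<in> borel_measurable borel"
  using conv_measurable_fst(2)[OF assms(1), of f] assms
  by (intro borel_measurable_lebesgue_integral) (auto simp: case_prod_beta')
 thus ?thesis by (simp add: conv_def[abs_def])
qed

lemma conv_bsf:
 assumes "bprob M" "bsf f" shows "bsf (conv M f)"
proof -
 interpret prob_space M using assms(1) by (rule bprob_prob)
 obtain b R where *: "f \<in> borel_measurable borel" "\<And>z. \<bar>f z\<bar> \<le> b" "\<And>z. R < norm z \<Longrightarrow> f z = 0"
  using bsfE[OF assms(2)] by metis
 obtain R' where R': "AE y in M. norm y \<le> R'" using assms(1) unfolding bprob_def by blast
 have ab: "bsf (\<lambda>z. \<bar>f z\<bar>)" by (rule bsf_subset[OF assms(2), where c = 1]) (use * in auto)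
 have "\<bar>conv M f z\<bar> \<le> b" for z
 proof -
  have "\<bar>conv M f z\<bar> \<le> (\<integral>y. \<bar>f (z - y)\<bar> \<partial>M)" unfolding conv_def by (rule integral_abs_bound)
  also have "... \<le> (\<integral>y. b \<partial>M)" using * conv_integrable[OF assms(1) ab] by (intro integral_mono) auto
  finally show ?thesis by (simp add: prob_space)
 qed
 moreover have "conv M f z = 0" if "R + R' < norm z" for z
  unfolding conv_def
 proof (rule integral_eq_zero_AE)
  show "AE y in M. f (z - y) = 0"
   using R'
  proof eventually_elim
   fix y :: complex assume "norm y \<le> R'"
   thus "f (z - y) = 0" using that norm_triangle_ineq2[of z y] by (intro *(3)) linarith
  qed
 qed
 ultimately show ?thesis unfolding bsf_def using conv_measurable[OF assms] by blast
qed

lemma integral_shift: fixes f :: "complex \<Rightarrow> real" assumes "f \<in> borel_measurable borel"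
 shows "(LBINT z. f (z - y)) = integral\<^sup>L lborel f"
proof -
 have "integral\<^sup>L lborel f = integral\<^sup>L (distr lborel borel ((+) (-y))) f"
  using lborel_distr_plus[of "-y"] by simp
 also have "... = (LBINT z. f (z - y))"
  using assms by (subst integral_distr) (auto simp: algebra_simps)
 finally show ?thesis by simp
qed

lemma conv_fubini_integrable:
 assumes "bprob M" "bsf f" shows "integrable (lborel \<Otimes>\<^sub>M M) (\<lambda>(z, y). f (z - y))"
proof -
 interpret prob_space M using assms(1) by (rule bprob_prob)
 interpret pair_sigma_finite lborel M ..
 note assms[measurable]
 have ab: "bsf (\<lambda>z. \<bar>f z\<bar>)" by (rule bsf_subset[OF assms(2), where c = 1]) auto
 show ?thesis
 proof (rule Fubini_integrable)
  show "(\<lambda>(z, y). f (z - y)) \<in> borel_measurable (lborel \<Otimes>\<^sub>M M)"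
   using conv_measurable_fst(3)[OF assms(1), of f] assms by (auto simp: case_prod_beta')
  show "integrable lborel (\<lambda>x. \<integral>y. norm (case (x, y) of (z, y) \<Rightarrow> f (z - y)) \<partial>M)"
   using bsf_integrable[OF conv_bsf[OF assms(1) ab]] by (simp add: conv_def[abs_def])
  show "AE x in lborel. integrable M (\<lambda>y. case (x, y) of (z, y) \<Rightarrow> f (z - y))"
   using conv_integrable[OF assms] by simp
 qed
qed

lemma integral_conv:
 assumes "bprob M" "bsf f" shows "integral\<^sup>L lborel (conv M f) = integral\<^sup>L lborel f"
proof -
 interpret prob_space M using assms(1) by (rule bprob_prob)
 interpret pair_sigma_finite lborel M ..
 have "integral\<^sup>L lborel (conv M f) = (\<integral>z. \<integral>y. f (z - y) \<partial>M \<partial>lborel)" by (simp add: conv_def[abs_def])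
 also have "... = (\<integral>y. \<integral>z. f (z - y) \<partial>lborel \<partial>M)"
  using Fubini_integral[OF conv_fubini_integrable[OF assms]] by simp
 also have "... = (\<integral>y. integral\<^sup>L lborel f \<partial>M)" using assms(2) by (subst integral_shift) auto
 finally show ?thesis by (simp add: prob_space)
qed

lemma integral_le_conv:
 assumes "bprob M" "bsf f" "bsf g" "\<And>z. g z \<le> conv M f z"
 shows "integral\<^sup>L lborel g \<le> integral\<^sup>L lborel f"
proof -
 have "integral\<^sup>L lborel g \<le> integral\<^sup>L lborel (conv M f)"
  using assms by (intro integral_mono bsf_integrable conv_bsf) auto
 thus ?thesis using integral_conv[OF assms(1,2)] by simp
qed

lemma conv_commute:
 assumes "bprob M" "bprob N" "bsf f"
 shows "conv M (conv N f) = conv N (conv M f)"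
proof
 fix z
 interpret M: prob_space M using assms(1) by (rule bprob_prob)
 interpret N: prob_space N using assms(2) by (rule bprob_prob)
 interpret pair_sigma_finite M N ..
 interpret P: prob_space "M \<Otimes>\<^sub>M N" by (rule prob_space_pair) unfold_locales
 note assms[measurable]
 obtain b where b: "\<And>z. \<bar>f z\<bar> \<le> b" using assms(3) unfolding bsf_def by blast
 have "(\<lambda>x. f (z - fst x - snd x)) \<in> borel_measurable (M \<Otimes>\<^sub>M N)"
  using assms by (intro measurable_compose[OF borel_measurable_diff[OF borel_measurable_diff[OF measurable_const]]]
   measurable_compose[OF measurable_fst] measurable_compose[OF measurable_snd]) (auto simp: bsf_def bprob_def)
 hence "integrable (M \<Otimes>\<^sub>M N) (\<lambda>(x, y). f (z - x - y))"
  by (intro P.integrable_const_bound[where B = b]) (use b in \<open>auto simp: case_prod_beta'\<close>)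
 from Fubini_integral[OF this] show "conv M (conv N f) z = conv N (conv M f) z"
  unfolding conv_def by (simp add: algebra_simps)
qed

lemma conv_sum:
 assumes "bprob M" "finite I" "\<And>i. i \<in> I \<Longrightarrow> bsf (f i)"
 shows "conv M (\<lambda>z. \<Sum>i\<in>I. c i * f i z) = (\<lambda>z. \<Sum>i\<in>I. c i * conv M (f i) z)"
proof
 fix z
 show "conv M (\<lambda>z. \<Sum>i\<in>I. c i * f i z) z = (\<Sum>i\<in>I. c i * conv M (f i) z)"
  unfolding conv_def using conv_integrable[OF assms(1)] assms(3)
  by (subst Bochner_Integration.integral_sum) auto
qed

definition dens :: "(complex \<Rightarrow> real) \<Rightarrow> bool" where
 "dens f \<longleftrightarrow> bsf f \<and> (\<forall>z. 0 \<le> f z) \<and> integral\<^sup>L lborel f = 1"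

definition ent :: "(complex \<Rightarrow> real) \<Rightarrow> real" where
 "ent f = - (LBINT z. f z * ln (f z))"

lemma dens_conv: "bprob M \<Longrightarrow> dens f \<Longrightarrow> dens (conv M f)"
 by (auto simp: dens_def conv_bsf conv_nonneg integral_conv)

lemma xlnx_le: fixes x b :: real assumes "0 \<le> x" "x \<le> b" shows "\<bar>x * ln x\<bar> \<le> 1 + b * \<bar>ln b\<bar>"
proof (cases "x = 0")
 case False
 hence x: "0 < x" using assms by simp
 have "- (x * ln x) \<le> 1"
 proof -
  have "ln (1/x) \<le> 1/x - 1" using x by (intro ln_le_minus_one) auto
  hence "x * ln (1/x) \<le> x * (1/x - 1)" using x by (intro mult_left_mono) auto
  also have "... = 1 - x" using x by (simp add: field_simps)
  finally show ?thesis using x by (simp add: ln_div)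
 qed
 moreover have "x * ln x \<le> b * \<bar>ln b\<bar>"
 proof -
  have "ln x \<le> \<bar>ln b\<bar>" using x assms by (smt (verit) ln_le_cancel_iff)
  hence "x * ln x \<le> x * \<bar>ln b\<bar>" using x by (intro mult_left_mono) auto
  also have "... \<le> b * \<bar>ln b\<bar>" using assms by (intro mult_right_mono) auto
  finally show ?thesis .
 qed
 moreover have "0 \<le> b * \<bar>ln b\<bar>" using assms by simp
 ultimately show ?thesis by linarith
qed (use assms in auto)

lemma bsf_xlnx:
 assumes "bsf f" "\<And>z. 0 \<le> f z" shows "bsf (\<lambda>z. f z * ln (f z))"
proof -
 obtain b R where *: "f \<in> borel_measurable borel" "\<And>z. \<bar>f z\<bar> \<le> b" "\<And>z. R < norm z \<Longrightarrow> f z = 0"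
  using bsfE[OF assms(1)] by metis
 have "\<bar>f z * ln (f z)\<bar> \<le> 1 + b * \<bar>ln b\<bar>" for z
  using *(2)[of z] assms(2)[of z] by (intro xlnx_le) auto
 moreover have "(\<lambda>z. f z * ln (f z)) \<in> borel_measurable borel" using *(1) by measurable
 moreover have "f z * ln (f z) = 0" if "R < norm z" for z using *(3)[OF that] by simp
 ultimately show ?thesis unfolding bsf_def by blast
qed

text \<open>Jensen's inequality for \<open>x * ln x\<close>, applied for fixed \<open>z\<close> to
  the mean of \<open>f (z - y)\<close> over \<open>y\<close>. Integration in \<open>z\<close> then
  removes the mean, since \<open>conv\<close> preserves integrals.\<close>

lemma ent_conv_ge:
 assumes M: "bprob M" and f: "dens f" shows "ent f \<le> ent (conv M f)"
proof -
 have b: "bsf f" and nn: "\<And>z. 0 \<le> f z" using f by (auto simp: dens_def)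
 have "(LBINT z. conv M f z * ln (conv M f z)) \<le> (LBINT z. f z * ln (f z))"
 proof (rule integral_le_conv[OF M])
  fix z
  interpret prob_space M using M by (rule bprob_prob)
  let ?a = "conv M f z"
  show "?a * ln ?a \<le> conv M (\<lambda>z. f z * ln (f z)) z"
  proof (cases "?a = 0")
   case True
   have "integrable M (\<lambda>y. f (z - y))" using conv_integrable[OF M b] .
   hence "AE y in M. f (z - y) = 0"
    using True nn by (subst integral_nonneg_eq_0_iff_AE[symmetric]) (auto simp: conv_def)
   hence "conv M (\<lambda>z. f z * ln (f z)) z = 0" unfolding conv_def
    by (intro integral_eq_zero_AE) auto
   thus ?thesis using True by simp
  next
   case False
   hence a: "0 < ?a" using conv_nonneg[where f = f and M = M and z = z] nn by (simp add: less_le)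
   \<comment> \<open>The tangent line of \<open>x * ln x\<close> at \<open>?a\<close>; its mean over
     \<open>y\<close> is exactly \<open>?a * ln ?a\<close>.\<close>
   have pt: "v * ln ?a + v - ?a \<le> v * ln v" if "0 \<le> v" for v
   proof (cases "v = 0")
    case False
    hence v: "0 < v" using that by simp
    have "ln (?a / v) \<le> ?a / v - 1" using a v by (intro ln_le_minus_one) auto
    hence "v * ln (?a / v) \<le> v * (?a / v - 1)" using v by (intro mult_left_mono) auto
    moreover have "v * (?a / v - 1) = ?a - v" using v by (simp add: field_simps)
    moreover have "v * ln (?a / v) = v * ln ?a - v * ln v" using a v by (simp add: ln_div algebra_simps)
    ultimately show ?thesis by linarith
   qed (use a in auto)
   have "(\<integral>y. f (z - y) * ln ?a + f (z - y) - ?a \<partial>M) \<le> (\<integral>y. f (z - y) * ln (f (z - y)) \<partial>M)"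
    using conv_integrable[OF M b] conv_integrable[OF M bsf_xlnx[OF b nn]] pt nn
    by (intro integral_mono) auto
   moreover have "(\<integral>y. f (z - y) * ln ?a + f (z - y) - ?a \<partial>M) = ?a * ln ?a + ?a - ?a"
    using conv_integrable[OF M b] by (subst Bochner_Integration.integral_diff) (auto simp: conv_def prob_space)
   ultimately show ?thesis by (simp add: conv_def)
  qed
 qed (use b nn M in \<open>auto intro!: bsf_xlnx conv_bsf conv_nonneg\<close>)
 thus ?thesis by (simp add: ent_def)
qed

section \<open>The Jensen gap of a mixture and its decrease under smoothing\<close>

definition mixf :: "'a set \<Rightarrow> ('a \<Rightarrow> real) \<Rightarrow> ('a \<Rightarrow> complex \<Rightarrow> real) \<Rightarrow> complex \<Rightarrow> real" where
 "mixf I p f z = (\<Sum>i\<in>I. p i * f i z)"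

text \<open>The pointwise Jensen gap of \<open>x * ln x\<close>. For weights of sum 1 and
  probability densities, its integral (\<open>integral_jdiv\<close>) is the generalised
  Jensen-Shannon divergence of the components.\<close>

definition jdiv :: "'a set \<Rightarrow> ('a \<Rightarrow> real) \<Rightarrow> ('a \<Rightarrow> real) \<Rightarrow> real" where
 "jdiv I p v = (\<Sum>i\<in>I. p i * (v i * ln (v i))) - (\<Sum>i\<in>I. p i * v i) * ln (\<Sum>i\<in>I. p i * v i)"

text \<open>The gap is convex and homogeneous of degree 1 in \<open>v\<close>, so its tangent plane
  at \<open>a\<close> passes through the origin and the supporting inequality has no constant term.
  Being linear in \<open>v\<close>, the lower bound survives averaging.\<close>

lemma jdiv_tangent:
 assumes I: "finite I" and p: "\<And>i. i \<in> I \<Longrightarrow> 0 \<le> p i" and v: "\<And>i. i \<in> I \<Longrightarrow> 0 \<le> v i"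
  and a: "\<And>i. i \<in> I \<Longrightarrow> 0 \<le> a i" and z: "\<And>i. i \<in> I \<Longrightarrow> a i = 0 \<Longrightarrow> v i = 0"
  and A: "A = (\<Sum>i\<in>I. p i * a i)" "0 < A"
 shows "(\<Sum>i\<in>I. p i * (v i * (ln (a i) - ln A))) \<le> jdiv I p v"
proof -
 define V where "V = (\<Sum>i\<in>I. p i * v i)"
 have V0: "0 \<le> V" unfolding V_def using p v by (intro sum_nonneg) auto
 have "jdiv I p v - (\<Sum>i\<in>I. p i * (v i * (ln (a i) - ln A)))
   = (\<Sum>i\<in>I. p i * (v i * (ln (v i) - ln V - ln (a i) + ln A)))"
  unfolding jdiv_def V_def[symmetric]
  by (simp add: algebra_simps sum.distrib sum_subtractf V_def sum_distrib_right sum_distrib_left)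
 also have "... \<ge> (\<Sum>i\<in>I. p i * (v i - a i * (V / A)))"
 proof (rule sum_mono)
  fix i assume i: "i \<in> I"
  have "v i - a i * (V / A) \<le> v i * (ln (v i) - ln V - ln (a i) + ln A)" if "0 < p i"
  proof (cases "v i = 0")
   case True thus ?thesis using a[OF i] V0 A(2) by simp
  next
   case False
   hence vi: "0 < v i" and ai: "0 < a i" using v[OF i] a[OF i] z[OF i] by force+
   have "p i * v i \<le> V" unfolding V_def using p v I i by (intro member_le_sum) auto
   hence V: "0 < V" using vi that by (smt (verit) mult_pos_pos)
   have "ln (a i * V / (v i * A)) \<le> a i * V / (v i * A) - 1"
    using vi ai V A by (intro ln_le_minus_one) auto
   hence "v i * ln (a i * V / (v i * A)) \<le> v i * (a i * V / (v i * A) - 1)"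
    using vi by (intro mult_left_mono) auto
   moreover have "ln (a i * V / (v i * A)) = ln (a i) + ln V - ln (v i) - ln A"
    using vi ai V A by (simp add: ln_div ln_mult)
   moreover have "v i * (a i * V / (v i * A) - 1) = a i * (V / A) - v i"
    using vi A by (simp add: field_simps)
   ultimately have "v i * (ln (a i) + ln V - ln (v i) - ln A) \<le> a i * (V / A) - v i" by simp
   thus ?thesis by (simp add: algebra_simps)
  qed
  thus "p i * (v i - a i * (V / A)) \<le> p i * (v i * (ln (v i) - ln V - ln (a i) + ln A))"
   using p[OF i] by (cases "p i = 0") (auto intro!: mult_left_mono)
 qed
 also have "(\<Sum>i\<in>I. p i * (v i - a i * (V / A))) = V - A * (V / A)"
  unfolding A V_def[symmetric] sum_distrib_right[where r = "V / _"]
  by (simp add: V_def right_diff_distrib sum_subtractf mult.assoc)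
 finally show ?thesis using A(2) by simp
qed

lemma jdiv_nonneg:
 assumes "finite I" "\<And>i. i \<in> I \<Longrightarrow> 0 \<le> p i" "(\<Sum>i\<in>I. p i) = 1" "\<And>i. i \<in> I \<Longrightarrow> 0 \<le> v i"
 shows "0 \<le> jdiv I p v"
 using jdiv_tangent[where I = I and p = p and v = v and a = "\<lambda>_. 1" and A = 1] assms by simp

lemma integral_jdiv:
 assumes I: "finite I" and p: "\<And>i. i \<in> I \<Longrightarrow> 0 \<le> p i" and f: "\<And>i. i \<in> I \<Longrightarrow> bsf (f i)" "\<And>i z. i \<in> I \<Longrightarrow> 0 \<le> f i z"
 shows "bsf (\<lambda>z. jdiv I p (\<lambda>i. f i z))"
  and "(LBINT z. jdiv I p (\<lambda>i. f i z)) = ent (mixf I p f) - (\<Sum>i\<in>I. p i * ent (f i))"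
proof -
 have m: "bsf (mixf I p f)" unfolding mixf_def[abs_def] using I f by (intro bsf_sum bsf_mult)
 have m0: "0 \<le> mixf I p f z" for z unfolding mixf_def using p f by (intro sum_nonneg) auto
 define g where "g = (\<lambda>z. \<Sum>i\<in>I. p i * (f i z * ln (f i z)))"
 define h where "h = (\<lambda>z. mixf I p f z * ln (mixf I p f z))"
 have g: "bsf g" unfolding g_def using I f by (intro bsf_sum bsf_mult bsf_xlnx) auto
 have h: "bsf h" unfolding h_def using m m0 by (intro bsf_xlnx) auto
 have eq: "jdiv I p (\<lambda>i. f i z) = g z - h z" for z unfolding jdiv_def g_def h_def mixf_def ..
 have "bsf (\<lambda>z. \<Sum>i\<in>{True,False}. if i then g z else - 1 * h z)"
 proof (rule bsf_sum)
  fix i show "bsf (\<lambda>z. if i then g z else - 1 * h z)" using g bsf_mult[OF h, of "-1"] by (cases i) auto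
 qed simp
 thus "bsf (\<lambda>z. jdiv I p (\<lambda>i. f i z))" by (simp add: eq)
 have "(LBINT z. jdiv I p (\<lambda>i. f i z)) = integral\<^sup>L lborel g - integral\<^sup>L lborel h"
  unfolding eq by (intro Bochner_Integration.integral_diff bsf_integrable g h)
 also have "integral\<^sup>L lborel g = (\<Sum>i\<in>I. p i * (LBINT z. f i z * ln (f i z)))"
  unfolding g_def using I f by (subst Bochner_Integration.integral_sum) (auto intro!: bsf_integrable bsf_xlnx bsf_mult integrable_mult_right)
 finally show "(LBINT z. jdiv I p (\<lambda>i. f i z)) = ent (mixf I p f) - (\<Sum>i\<in>I. p i * ent (f i))"
  by (simp add: ent_def h_def sum_negf)
qed

text \<open>Data processing: smoothing all components by one kernel can only lower the integrated
  Jensen gap. In other words, the entropy gained by smoothing is a convex function of the density.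
  Submodularity and all later arguments with mixtures come from this inequality.\<close>

theorem ent_mix_conv:
 assumes M: "bprob M" and I: "finite I" and p: "\<And>i. i \<in> I \<Longrightarrow> 0 \<le> p i" and p1: "(\<Sum>i\<in>I. p i) = 1"
  and f: "\<And>i. i \<in> I \<Longrightarrow> bsf (f i)" "\<And>i z. i \<in> I \<Longrightarrow> 0 \<le> f i z"
 shows "(\<Sum>i\<in>I. p i * (ent (f i) - ent (conv M (f i)))) \<le> ent (mixf I p f) - ent (conv M (mixf I p f))"
proof -
 interpret prob_space M using M by (rule bprob_prob)
 let ?g = "\<lambda>i. conv M (f i)"
 have g: "bsf (?g i)" "0 \<le> ?g i z" if "i \<in> I" for i z
  using that f M by (auto intro: conv_bsf conv_nonneg)
 have "(LBINT z. jdiv I p (\<lambda>i. ?g i z)) \<le> (LBINT z. jdiv I p (\<lambda>i. f i z))"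
 proof (rule integral_le_conv[OF M])
  show "bsf (\<lambda>z. jdiv I p (\<lambda>i. f i z))" using I p f by (rule integral_jdiv)
  show "bsf (\<lambda>z. jdiv I p (\<lambda>i. ?g i z))" using I p g by (rule integral_jdiv)
  fix z
  show "jdiv I p (\<lambda>i. ?g i z) \<le> conv M (\<lambda>z. jdiv I p (\<lambda>i. f i z)) z"
  proof (cases "(\<Sum>i\<in>I. p i * ?g i z) = 0")
   case True
   hence "p i * ?g i z = 0" if "i \<in> I" for i
    using that I p g by (subst (asm) sum_nonneg_eq_0_iff) auto
   hence "(\<Sum>i\<in>I. p i * (?g i z * ln (?g i z))) = 0" by (intro sum.neutral) auto
   hence "jdiv I p (\<lambda>i. ?g i z) = 0" using True by (simp add: jdiv_def)
   moreover have "0 \<le> conv M (\<lambda>z. jdiv I p (\<lambda>i. f i z)) z"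
    using I p p1 f by (intro conv_nonneg jdiv_nonneg) auto
   ultimately show ?thesis by simp
  next
   case False
   define A where "A = (\<Sum>i\<in>I. p i * ?g i z)"
   have A: "0 < A" using False p g unfolding A_def by (metis (no_types, lifting) less_le mult_nonneg_nonneg sum_nonneg)
   have ae: "AE y in M. ?g i z = 0 \<longrightarrow> f i (z - y) = 0" if i: "i \<in> I" for i
   proof (cases "?g i z = 0")
    case True
    have "integrable M (\<lambda>y. f i (z - y))" using conv_integrable[OF M f(1)[OF i]] .
    hence "AE y in M. f i (z - y) = 0"
     using True f i by (subst integral_nonneg_eq_0_iff_AE[symmetric]) (auto simp: conv_def)
    thus ?thesis by auto
   qed auto
   \<comment> \<open>The tangent plane is taken at the smoothed values \<open>?g i z\<close>. Where
     such a value is 0, \<open>f i (z - y)\<close> vanishes for almost every \<open>y\<close>, as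
     \<open>jdiv_tangent\<close> demands.\<close>
   have "AE y in M. \<forall>i\<in>I. ?g i z = 0 \<longrightarrow> f i (z - y) = 0"
    using ae I by (intro AE_finite_allI) auto
   hence "AE y in M. (\<Sum>i\<in>I. p i * (f i (z - y) * (ln (?g i z) - ln A))) \<le> jdiv I p (\<lambda>i. f i (z - y))"
    by eventually_elim (rule jdiv_tangent[OF I p], use f g A in \<open>auto simp: A_def\<close>)
   hence "(\<integral>y. (\<Sum>i\<in>I. p i * (f i (z - y) * (ln (?g i z) - ln A))) \<partial>M) \<le> (\<integral>y. jdiv I p (\<lambda>i. f i (z - y)) \<partial>M)"
    using I f conv_integrable[OF M] conv_integrable[OF M integral_jdiv(1)[OF I p f]]
    by (intro integral_mono_AE) auto
   moreover have "(\<integral>y. (\<Sum>i\<in>I. p i * (f i (z - y) * (ln (?g i z) - ln A))) \<partial>M)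
     = (\<Sum>i\<in>I. p i * (?g i z * (ln (?g i z) - ln A)))"
    using I f conv_integrable[OF M] by (subst Bochner_Integration.integral_sum) (auto simp: conv_def)
   moreover have "... = jdiv I p (\<lambda>i. ?g i z)"
    unfolding jdiv_def A_def[symmetric] by (simp add: A_def algebra_simps sum_subtractf sum_distrib_left sum_distrib_right)
   ultimately show ?thesis by (simp add: conv_def)
  qed
 qed
 moreover have "conv M (mixf I p f) = mixf I p ?g"
  unfolding mixf_def[abs_def] using conv_sum[OF M I, of f p] f by simp
 ultimately show ?thesis
  using integral_jdiv(2)[of I p f, OF I p f] integral_jdiv(2)[of I p ?g, OF I p g]
  by (simp add: algebra_simps sum_subtractf)
qed

lemma ent_mix_ge:
 assumes I: "finite I" and p: "\<And>i. i \<in> I \<Longrightarrow> 0 \<le> p i" and p1: "(\<Sum>i\<in>I. p i) = 1"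
  and f: "\<And>i. i \<in> I \<Longrightarrow> bsf (f i)" "\<And>i z. i \<in> I \<Longrightarrow> 0 \<le> f i z"
 shows "(\<Sum>i\<in>I. p i * ent (f i)) \<le> ent (mixf I p f)"
proof -
 have "0 \<le> (LBINT z. jdiv I p (\<lambda>i. f i z))"
  using I p p1 f by (intro integral_nonneg_AE AE_I2 jdiv_nonneg) auto
 thus ?thesis using integral_jdiv(2)[of I p f, OF I p f] by simp
qed

section \<open>Planar Lebesgue measure under complex multiplication\<close>

lemma lborel_complex:
 "(lborel :: complex measure) = distr (lborel \<Otimes>\<^sub>M lborel) borel (\<lambda>x. Complex (fst x) (snd x))"
proof (rule lborel_eqI)
 have m[measurable]: "(\<lambda>x. Complex (fst x) (snd x)) \<in> borel_measurable (lborel \<Otimes>\<^sub>M lborel)"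
  unfolding complex_eq_cancel_iff2 Complex_eq by measurable
 fix l u :: complex assume le: "\<And>b. b \<in> Basis \<Longrightarrow> l \<bullet> b \<le> u \<bullet> b"
 have "Re l \<le> Re u" "Im l \<le> Im u" using le[of 1] le[of \<i>] by (auto simp: Basis_complex_def)
 have "(\<lambda>x. Complex (fst x) (snd x)) -` box l u \<inter> space (lborel \<Otimes>\<^sub>M lborel) = box (Re l) (Re u) \<times> box (Im l) (Im u)"
  by (auto simp: box_def Basis_complex_def space_pair_measure)
 hence "emeasure (distr (lborel \<Otimes>\<^sub>M lborel) borel (\<lambda>x. Complex (fst x) (snd x))) (box l u)
   = emeasure (lborel \<Otimes>\<^sub>M lborel) (box (Re l) (Re u) \<times> box (Im l) (Im u))"
  by (subst emeasure_distr) auto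
 also have "... = ennreal ((Re u - Re l) * (Im u - Im l))"
  using \<open>Re l \<le> Re u\<close> \<open>Im l \<le> Im u\<close>
  by (subst lborel.emeasure_pair_measure_Times) (auto simp: ennreal_mult)
 finally show "emeasure (distr (lborel \<Otimes>\<^sub>M lborel) borel (\<lambda>x. Complex (fst x) (snd x))) (box l u) = ennreal (\<Prod>b\<in>Basis. (u - l) \<bullet> b)"
  by (simp add: Basis_complex_def)
qed simp

lemma measurable_Complex[measurable]:
 "(\<lambda>x. Complex (f x) (g x)) \<in> borel_measurable M" if [measurable]: "f \<in> borel_measurable M" "g \<in> borel_measurable M"
 unfolding Complex_eq by measurable

lemma nn_integral_complex:
 assumes [measurable]: "f \<in> borel_measurable borel"
 shows "(\<integral>\<^sup>+z. f z \<partial>lborel) = (\<integral>\<^sup>+x. \<integral>\<^sup>+y. f (Complex x y) \<partial>lborel \<partial>lborel)"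
proof -
 have "(\<integral>\<^sup>+z. f z \<partial>lborel) = (\<integral>\<^sup>+x. f (Complex (fst x) (snd x)) \<partial>(lborel \<Otimes>\<^sub>M lborel))"
  by (subst lborel_complex, subst nn_integral_distr) auto
 also have "... = (\<integral>\<^sup>+x. \<integral>\<^sup>+y. f (Complex x y) \<partial>lborel \<partial>lborel)"
  by (subst lborel.nn_integral_fst[symmetric]) auto
 finally show ?thesis .
qed

text \<open>Multiplication by \<open>c\<close> is factored into affine substitutions in one real
  coordinate at a time, so Fubini and the one-dimensional rule give the Jacobian.\<close>

lemma nn_integral_complex_mult:
 fixes c :: complex
 assumes f: "f \<in> borel_measurable borel" and c: "c \<noteq> 0"
 shows "(\<integral>\<^sup>+z. f z \<partial>lborel) = ennreal ((norm c)^2) * (\<integral>\<^sup>+z. f (c * z) \<partial>lborel)"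
proof -
 have *: "(\<integral>\<^sup>+z. f z \<partial>lborel) = ennreal ((norm c)^2) * (\<integral>\<^sup>+z. f (c * z) \<partial>lborel)"
  if [measurable]: "f \<in> borel_measurable borel" and "Re c \<noteq> 0" for f and c :: complex
 proof -
  define a b where "a = Re c" "b = Im c"
  have a: "a \<noteq> 0" using that by (simp add: a_b_def)
  have n: "(norm c)^2 = a^2 + b^2" by (simp add: a_b_def cmod_power2)
  have cz: "c * Complex x y = Complex (a * x - b * y) (b * x + a * y)" for x y
   by (simp add: a_b_def complex_eq_iff)
  let ?n = "a^2 + b^2" and ?G = "\<lambda>x y. f (Complex (a * x - b * y) (b * x + a * y))"
  \<comment> \<open>The intermediate map changes only the second coordinate. Substituting
    \<open>a * x - b * y\<close> for \<open>x\<close> afterwards gives multiplication by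
    \<open>c\<close>, and the factors \<open>?n / a\<close> and \<open>a\<close> combine to
    \<open>?n\<close>.\<close>
  let ?F = "\<lambda>x y. f (Complex x ((b / a) * x + (?n / a) * y))"
  have R: "(\<integral>\<^sup>+z. f (c * z) \<partial>lborel) = (\<integral>\<^sup>+x. \<integral>\<^sup>+y. ?G x y \<partial>lborel \<partial>lborel)"
   by (subst nn_integral_complex) (auto simp: cz)
  have L: "(\<integral>\<^sup>+z. f z \<partial>lborel) = (\<integral>\<^sup>+x. \<integral>\<^sup>+y. f (Complex x y) \<partial>lborel \<partial>lborel)"
   by (rule nn_integral_complex) simp
  have n0: "0 < ?n" using a by (simp add: add_pos_nonneg)
  have "(\<integral>\<^sup>+y. f (Complex x y) \<partial>lborel) = ennreal \<bar>?n / a\<bar> * (\<integral>\<^sup>+y. ?F x y \<partial>lborel)" for x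
   using n0 a by (intro nn_integral_real_affine) auto
  hence "(\<integral>\<^sup>+z. f z \<partial>lborel) = ennreal \<bar>?n / a\<bar> * (\<integral>\<^sup>+x. \<integral>\<^sup>+y. ?F x y \<partial>lborel \<partial>lborel)"
   unfolding L by (simp add: nn_integral_cmult)
  also have "(\<integral>\<^sup>+x. \<integral>\<^sup>+y. ?F x y \<partial>lborel \<partial>lborel)
    = (\<integral>\<^sup>+y. \<integral>\<^sup>+x. ?F x y \<partial>lborel \<partial>lborel)"
   by (rule lborel_pair.Fubini'[symmetric]) (simp add: case_prod_beta')
  also have "... = (\<integral>\<^sup>+y. ennreal \<bar>a\<bar> * (\<integral>\<^sup>+x. ?G x y \<partial>lborel) \<partial>lborel)"
  proof (rule nn_integral_cong)
   fix y
   have "(\<integral>\<^sup>+x. ?F x y \<partial>lborel)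
     = ennreal \<bar>a\<bar> * (\<integral>\<^sup>+x. f (Complex (- b * y + a * x) ((b / a) * (- b * y + a * x) + (?n / a) * y)) \<partial>lborel)"
    using a by (intro nn_integral_real_affine) auto
   moreover have "(b / a) * (- b * y + a * x) + (?n / a) * y = b * x + a * y" for x
    using a by (simp add: field_simps power2_eq_square)
   ultimately show "(\<integral>\<^sup>+x. ?F x y \<partial>lborel)
     = ennreal \<bar>a\<bar> * (\<integral>\<^sup>+x. ?G x y \<partial>lborel)"
    by simp
  qed
  also have "... = ennreal \<bar>a\<bar> * (\<integral>\<^sup>+y. \<integral>\<^sup>+x. ?G x y \<partial>lborel \<partial>lborel)"
   by (rule nn_integral_cmult) measurable
  also have "(\<integral>\<^sup>+y. \<integral>\<^sup>+x. ?G x y \<partial>lborel \<partial>lborel) = (\<integral>\<^sup>+z. f (c * z) \<partial>lborel)"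
   unfolding R by (rule lborel_pair.Fubini') (simp add: case_prod_beta')
  finally have "(\<integral>\<^sup>+z. f z \<partial>lborel) = (ennreal \<bar>?n / a\<bar> * ennreal \<bar>a\<bar>) * (\<integral>\<^sup>+z. f (c * z) \<partial>lborel)"
   by (simp add: mult.assoc)
  also have "ennreal \<bar>?n / a\<bar> * ennreal \<bar>a\<bar> = ennreal ?n"
   using a n0 by (subst ennreal_mult[symmetric]) (auto simp: abs_mult[symmetric])
  finally show ?thesis by (simp add: n)
 qed
 show ?thesis
 proof (cases "Re c = 0")
  case True
  \<comment> \<open>If \<open>Re c = 0\<close>, the previous case applies to the two factors
    \<open>?d\<close> and \<open>c / ?d\<close>, whose real parts are nonzero.\<close>
  let ?d = "Complex 1 1"
  have d: "Re ?d \<noteq> 0" "Re (c / ?d) \<noteq> 0" using c True by (auto simp: Re_divide complex_eq_iff)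
  have "(\<integral>\<^sup>+z. f (?d * z) \<partial>lborel) = ennreal ((norm (c / ?d))^2) * (\<integral>\<^sup>+z. f (?d * (c / ?d * z)) \<partial>lborel)"
   using f d(2) by (intro *) auto
  thus ?thesis unfolding *[OF f d(1)]
   using d by (simp add: mult.assoc[symmetric] ennreal_mult[symmetric] norm_divide power_divide complex_eq_iff)
 qed (rule *[OF f])
qed

lemma lborel_complex_mult:
 fixes c :: complex assumes c: "c \<noteq> 0"
 shows "(lborel :: complex measure) = density (distr lborel borel ((*) c)) (\<lambda>_. ennreal ((norm c)^2))"
proof (rule measure_eqI)
 fix A :: "complex set" assume "A \<in> sets lborel"
 hence A[measurable]: "A \<in> sets borel" by simp
 have "emeasure lborel A = (\<integral>\<^sup>+z. indicator A z \<partial>lborel)" by simp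
 also have "... = ennreal ((norm c)^2) * (\<integral>\<^sup>+z. indicator A (c * z) \<partial>lborel)"
  by (rule nn_integral_complex_mult[OF _ c]) simp
 also have "(\<integral>\<^sup>+z. indicator A (c * z) \<partial>lborel) = (\<integral>\<^sup>+z. indicator A z \<partial>distr lborel borel ((*) c))"
  by (subst nn_integral_distr) auto
 also have "ennreal ((norm c)^2) * (\<integral>\<^sup>+z. indicator A z \<partial>distr lborel borel ((*) c))
   = emeasure (density (distr lborel borel ((*) c)) (\<lambda>_. ennreal ((norm c)^2))) A"
  by (subst emeasure_density) (auto simp: nn_integral_cmult)
 finally show "emeasure lborel A = emeasure (density (distr lborel borel ((*) c)) (\<lambda>_. ennreal ((norm c)^2))) A" .
qed simp

lemma integral_complex_mult:
 fixes c :: complex and f :: "complex \<Rightarrow> real"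
 assumes [measurable]: "f \<in> borel_measurable borel" and c: "c \<noteq> 0"
 shows "(LBINT z. f (c * z)) = integral\<^sup>L lborel f / (norm c)^2"
proof -
 have "integral\<^sup>L lborel f = (\<integral>z. (norm c)^2 * f z \<partial>distr lborel borel ((*) c))"
  by (subst lborel_complex_mult[OF c], subst integral_density) auto
 also have "... = (norm c)^2 * (LBINT z. f (c * z))"
  by (subst integral_distr) auto
 finally show ?thesis using c by simp
qed

text \<open>For \<open>c \<noteq> 0\<close>: if \<open>f\<close> is the density of \<open>Z\<close>,
  then \<open>scl c f\<close> is the density of \<open>c * Z\<close>.\<close>

definition scl :: "complex \<Rightarrow> (complex \<Rightarrow> real) \<Rightarrow> complex \<Rightarrow> real" where
 "scl c f z = f (z / c) / (norm c)^2"

lemma integral_scl: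
 fixes c :: complex and f :: "complex \<Rightarrow> real"
 assumes "f \<in> borel_measurable borel" "c \<noteq> 0"
 shows "(LBINT z. f (z / c)) = (norm c)^2 * integral\<^sup>L lborel f"
 using integral_complex_mult[of f "1/c"] assms by (simp add: norm_divide power_divide divide_simps mult.commute)

lemma bsf_scl: assumes "bsf f" "c \<noteq> 0" shows "bsf (scl c f)"
proof -
 obtain b R where *: "f \<in> borel_measurable borel" "\<And>z. \<bar>f z\<bar> \<le> b" "\<And>z. R < norm z \<Longrightarrow> f z = 0" "0 \<le> R"
  using bsfE[OF assms(1)] by metis
 have "scl c f \<in> borel_measurable borel" unfolding scl_def[abs_def] using *(1) by measurable
 moreover have "\<bar>scl c f z\<bar> \<le> b / (norm c)^2" for z
  using *(2)[of "z / c"] assms(2) by (simp add: scl_def divide_right_mono)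
 moreover have "scl c f z = 0" if "R * norm c < norm z" for z
  using that assms(2) *(3)[of "z / c"] by (simp add: scl_def norm_divide field_simps)
 ultimately show ?thesis unfolding bsf_def by blast
qed

lemma dens_scl: assumes "dens f" "c \<noteq> 0" shows "dens (scl c f)"
proof -
 have "(LBINT z. scl c f z) = 1"
  unfolding scl_def using assms integral_scl[of f c] by (simp add: dens_def bsf_def)
 thus ?thesis using assms by (auto simp: dens_def bsf_scl) (simp add: scl_def)
qed

lemma scl_nonzero:
 assumes "\<And>z. R < norm z \<Longrightarrow> f z = 0" "scl c f y \<noteq> 0"
 shows "norm y \<le> R * norm c"
proof (cases "c = 0")
 case False
 have "norm (y / c) \<le> R" using assms by (force simp: scl_def)
 thus ?thesis using False by (simp add: norm_divide field_simps)
qed (use assms(2) in \<open>simp add: scl_def\<close>)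

lemma scl_scl: "scl c (scl d f) = scl (c * d) f"
 by (auto simp: scl_def fun_eq_iff norm_mult power_mult_distrib mult.commute)

lemma scl_1: "scl 1 f = f" by (auto simp: scl_def)

lemma ent_scl: assumes "dens f" "c \<noteq> 0" shows "ent (scl c f) = ent f + 2 * ln (norm c)"
proof -
 have b: "bsf f" and nn: "\<And>z. 0 \<le> f z" and i: "integral\<^sup>L lborel f = 1" using assms by (auto simp: dens_def)
 let ?n = "(norm c)^2"
 let ?g = "\<lambda>z. (f z * ln (f z) - f z * ln ?n) / ?n"
 have "scl c f z * ln (scl c f z) = ?g (z / c)" for z
  using nn[of "z / c"] assms(2) by (cases "f (z / c) = 0") (auto simp: scl_def ln_div field_simps)
 hence "- ent (scl c f) = (LBINT z. ?g (z / c))" by (simp add: ent_def)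
 also have "... = ?n * integral\<^sup>L lborel ?g"
  using b assms(2) by (intro integral_scl) (auto simp: bsf_def)
 also have "integral\<^sup>L lborel ?g = (- ent f - ln ?n) / ?n"
  using bsf_integrable[OF b] bsf_integrable[OF bsf_xlnx[OF b nn]] i
  by (simp add: ent_def diff_divide_distrib)
 also have "ln ?n = 2 * ln (norm c)" using assms(2) by (simp add: ln_realpow)
 finally show ?thesis using assms(2) by simp
qed

lemma bprob_distr:
 assumes "bprob M" "g \<in> borel_measurable borel" "\<And>R. \<exists>R'. \<forall>y. norm y \<le> R \<longrightarrow> norm (g y) \<le> R'"
 shows "bprob (distr M borel g)"
  and "f \<in> borel_measurable borel \<Longrightarrow> conv (distr M borel g) f z = (\<integral>y. f (z - g y) \<partial>M)"
proof -
 interpret prob_space M using assms(1) by (rule bprob_prob)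
 have m[measurable]: "g \<in> borel_measurable M"
  using measurable_compose[OF bprob_measurable[OF assms(1)] assms(2)] .
 obtain R where R: "AE y in M. norm y \<le> R" using assms(1) unfolding bprob_def by blast
 obtain R' where R': "\<And>y. norm y \<le> R \<Longrightarrow> norm (g y) \<le> R'" using assms(3) by blast
 have "AE y in distr M borel g. norm y \<le> R'"
  using R R' by (subst AE_distr_iff) auto
 thus "bprob (distr M borel g)" unfolding bprob_def by (auto intro: prob_space_distr)
 show "conv (distr M borel g) f z = (\<integral>y. f (z - g y) \<partial>M)" if [measurable]: "f \<in> borel_measurable borel"
  unfolding conv_def by (subst integral_distr) auto
qed

lemma bprob_scale: "bprob M \<Longrightarrow> bprob (distr M borel ((*) c))"
proof (rule bprob_distr)
 show "\<exists>R'. \<forall>y. norm y \<le> R \<longrightarrow> norm (c * y) \<le> R'" for R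
  by (rule exI[of _ "norm c * R"]) (auto simp: norm_mult intro: mult_left_mono)
qed auto

lemma scl_conv:
 assumes "bprob M" "bsf f" "c \<noteq> 0"
 shows "scl c (conv M f) = conv (distr M borel ((*) c)) (scl c f)"
proof
 fix z
 have "conv (distr M borel ((*) c)) (scl c f) z = (\<integral>y. scl c f (z - c * y) \<partial>M)"
  using assms bsf_scl[OF assms(2,3)] bprob_scale[OF assms(1), of c]
  by (intro bprob_distr) (auto simp: bsf_def intro!: exI[of _ "norm c * _"] simp: norm_mult intro: mult_left_mono)
 also have "... = (\<integral>y. f (z / c - y) / (norm c)^2 \<partial>M)"
  using assms(3) by (simp add: scl_def diff_divide_distrib)
 also have "... = scl c (conv M f) z" by (simp add: scl_def conv_def)
 finally show "scl c (conv M f) z = conv (distr M borel ((*) c)) (scl c f) z" ..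
qed

lemma bprob_pmf: "finite (set_pmf \<beta>) \<Longrightarrow> bprob (measure_pmf \<beta>)"
 unfolding bprob_def
proof (intro conjI)
 assume fin: "finite (set_pmf \<beta>)"
 show "prob_space (measure_pmf \<beta>)" by (rule prob_space_measure_pmf)
 show "\<exists>R. AE y in measure_pmf \<beta>. norm y \<le> R"
  using fin by (intro exI[of _ "Max (norm ` set_pmf \<beta>)"]) (auto simp: AE_measure_pmf_iff)
qed simp

lemma conv_pmf:
 assumes "finite (set_pmf \<beta>)"
 shows "conv (measure_pmf \<beta>) f z = (\<Sum>y\<in>set_pmf \<beta>. pmf \<beta> y * f (z - y))"
 unfolding conv_def using assms by (subst integral_measure_pmf) auto

lemma conv_map_pmf: "conv (measure_pmf (map_pmf g \<beta>)) f z = (\<integral>y. f (z - g y) \<partial>measure_pmf \<beta>)"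
 unfolding conv_def by simp

lemma scl_conv_pmf: "c \<noteq> 0 \<Longrightarrow> scl c (conv (measure_pmf \<beta>) f) = conv (measure_pmf (map_pmf ((*) c) \<beta>)) (scl c f)"
 by (auto simp: fun_eq_iff conv_map_pmf scl_def diff_divide_distrib) (simp add: conv_def)

lemma conv_return_pmf: "conv (measure_pmf (return_pmf a)) f = (\<lambda>z. f (z - a))"
 by (auto simp: conv_def)

lemma conv_return0_pmf[simp]: "conv (measure_pmf (return_pmf 0)) f = f"
 by (auto simp: conv_return_pmf)

lemma ent_shift: assumes "bsf f" "\<And>z. 0 \<le> f z" shows "ent (\<lambda>z. f (z - a)) = ent f"
 unfolding ent_def using bsf_xlnx[OF assms] by (subst integral_shift[where f = "\<lambda>z. f z * ln (f z)"]) (auto simp: bsf_def)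

lemma conv_bind_pmf:
 assumes "finite (set_pmf P)" "\<And>i. i \<in> set_pmf P \<Longrightarrow> finite (set_pmf (\<beta> i))"
 shows "conv (measure_pmf (bind_pmf P \<beta>)) f = mixf (set_pmf P) (pmf P) (\<lambda>i. conv (measure_pmf (\<beta> i)) f)"
 using assms by (auto simp: fun_eq_iff conv_def mixf_def pmf_expectation_bind[where A = "set_pmf P"])

text \<open>Convolution with a finite law is a mixture of translates, and all translates have the
  same entropy and the same gain under smoothing by \<open>M\<close>. So \<open>ent_mix_conv\<close>
  says that extra randomness \<open>\<beta>\<close> makes further smoothing less profitable.\<close>

lemma ent_submod:
 assumes \<beta>: "finite (set_pmf \<beta>)" and M: "bprob M" and f: "dens f"
 shows "ent f - ent (conv M f) \<le> ent (conv \<beta> f) - ent (conv M (conv \<beta> f))"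
proof -
 have b: "bsf f" and nn: "\<And>z. 0 \<le> f z" using f by (auto simp: dens_def)
 let ?F = "\<lambda>y z. f (z - y)"
 have eq: "conv \<beta> f = mixf (set_pmf \<beta>) (pmf \<beta>) ?F"
  using \<beta> by (auto simp: fun_eq_iff mixf_def conv_pmf)
 have "conv M (?F y) = (\<lambda>z. conv M f (z - y))" for y
  by (auto simp: conv_def fun_eq_iff algebra_simps)
 hence "ent (conv M (?F y)) = ent (conv M f)" for y
  using ent_shift[OF conv_bsf[OF M b] conv_nonneg[OF nn]] by simp
 moreover have "ent (?F y) = ent f" for y using ent_shift[OF b nn] .
 moreover have "(\<Sum>y\<in>set_pmf \<beta>. pmf \<beta> y * (ent (?F y) - ent (conv M (?F y)))) \<le>
   ent (mixf (set_pmf \<beta>) (pmf \<beta>) ?F) - ent (conv M (mixf (set_pmf \<beta>) (pmf \<beta>) ?F))"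
  using \<beta> b nn by (intro ent_mix_conv[OF M]) (auto simp: sum_pmf_eq_1 intro: bsf_shift)
 ultimately show ?thesis using \<beta> by (simp add: eq sum_pmf_eq_1 flip: sum_distrib_right)
qed

text \<open>Nonnegativity of relative entropy, with a comparison function \<open>g\<close> of total
  mass at most \<open>c\<close> in place of a density. It bounds entropies from above by the support
  (\<open>ent_le_area\<close>) and by ball masses (\<open>ex_ln_bm_le\<close>).\<close>

lemma gibbs:
 assumes f: "dens f" and g: "bsf g" "\<And>z. 0 \<le> g z" "\<And>z. 0 < f z \<Longrightarrow> 0 < g z" and fg: "bsf (\<lambda>z. f z * ln (g z))"
  and c: "integral\<^sup>L lborel g \<le> c" "0 < c"
 shows "(LBINT z. f z * ln (g z)) \<le> - ent f + ln c"
proof -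
 have b: "bsf f" and nn: "\<And>z. 0 \<le> f z" and i: "integral\<^sup>L lborel f = 1" using f by (auto simp: dens_def)
 note I = bsf_integrable[OF b] bsf_integrable[OF g(1)] bsf_integrable[OF fg] bsf_integrable[OF bsf_xlnx[OF b nn]]
 have pt: "f z * ln (g z) - f z * ln (f z) - f z * ln c \<le> g z / c - f z" for z
 proof (cases "f z = 0")
  case False
  hence fz: "0 < f z" and gz: "0 < g z" using nn[of z] g(3)[of z] by auto
  have "ln (g z / (f z * c)) \<le> g z / (f z * c) - 1" using fz gz c by (intro ln_le_minus_one) auto
  hence "f z * ln (g z / (f z * c)) \<le> f z * (g z / (f z * c) - 1)" using fz by (intro mult_left_mono) auto
  moreover have "f z * (g z / (f z * c) - 1) = g z / c - f z" using fz c by (simp add: field_simps)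
  moreover have "ln (g z / (f z * c)) = ln (g z) - ln (f z) - ln c" using fz gz c by (simp add: ln_div ln_mult)
  ultimately have "f z * (ln (g z) - ln (f z) - ln c) \<le> g z / c - f z" by simp
  thus ?thesis by (simp add: algebra_simps)
 qed (use g(2)[of z] c in auto)
 have "(LBINT z. f z * ln (g z) - f z * ln (f z) - f z * ln c) \<le> (LBINT z. g z / c - f z)"
  by (rule integral_mono) (use I pt in auto)
 moreover have "(LBINT z. f z * ln (g z) - f z * ln (f z) - f z * ln c) = (LBINT z. f z * ln (g z)) + ent f - ln c"
  using I i by (simp add: ent_def)
 moreover have "(LBINT z. g z / c - f z) = integral\<^sup>L lborel g / c - 1" using I i by simp
 moreover have "integral\<^sup>L lborel g / c \<le> 1" using c by simp
 ultimately show ?thesis by linarith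
qed

lemma ent_le_area:
 assumes f: "dens f" and S: "\<And>z. r < norm z \<Longrightarrow> f z = 0" and r: "0 < r"
 shows "ent f \<le> ln (pi * r^2)"
proof -
 let ?g = "indicator (cball 0 r) :: complex \<Rightarrow> real"
 have b: "bsf f" and nn: "\<And>z. 0 \<le> f z" using f by (auto simp: dens_def)
 \<comment> \<open>Both \<open>ln 1\<close> and, by convention, \<open>ln 0\<close> are 0, so the
   cross term vanishes identically.\<close>
 have z: "(\<lambda>z. f z * ln (?g z)) = (\<lambda>_. 0)" by (auto simp: fun_eq_iff indicator_def)
 have "(LBINT z. f z * ln (?g z)) \<le> - ent f + ln (pi * r^2)"
 proof (rule gibbs[OF f])
  show "bsf ?g" unfolding bsf_def
  proof (intro conjI)
   show "\<exists>b. \<forall>z. \<bar>?g z\<bar> \<le> b" by (rule exI[of _ 1]) (auto simp: indicator_def)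
   show "\<exists>R. \<forall>z. R < norm z \<longrightarrow> ?g z = 0" by (rule exI[of _ r]) (auto simp: indicator_def)
  qed (rule borel_measurable_indicator, simp)
  show "0 < ?g z" if "0 < f z" for z
   using S[of z] that by (cases "norm z \<le> r") (auto simp: indicator_def)
  show "bsf (\<lambda>z. f z * ln (?g z))" unfolding z using bsf_sum[of "{}"] by simp
  show "integral\<^sup>L lborel ?g \<le> pi * r^2"
   using r content_cball[of r "0::complex"] by (simp add: unit_ball_vol_2)
 qed (use r in auto)
 thus ?thesis by (simp add: z)
qed

lemma ent_ge_sup:
 assumes f: "dens f" and b: "\<And>z. f z \<le> b" shows "- ln b \<le> ent f"
proof -
 have bs: "bsf f" and nn: "\<And>z. 0 \<le> f z" and i: "integral\<^sup>L lborel f = 1" using f by (auto simp: dens_def)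
 have "f z * ln (f z) \<le> f z * ln b" for z
  using nn[of z] b[of z] by (cases "f z = 0") (auto intro!: mult_left_mono)
 hence "(LBINT z. f z * ln (f z)) \<le> (LBINT z. f z * ln b)"
  using bsf_integrable[OF bs] bsf_integrable[OF bsf_xlnx[OF bs nn]] by (intro integral_mono) auto
 thus ?thesis using i by (simp add: ent_def)
qed

section \<open>Entropy added by a fair choice between two points\<close>

definition hp :: "complex \<Rightarrow> complex pmf" where
 "hp v = map_pmf (\<lambda>b. if b then v else 0) (bernoulli_pmf (1/2))"

lemma finite_hp[simp]: "finite (set_pmf (hp v))" by (simp add: hp_def)

lemma conv_hp: "conv (hp v) f z = (f z + f (z - v)) / 2"
 by (simp add: hp_def conv_map_pmf)

lemma map_hp: "map_pmf ((*) c) (hp v) = hp (c * v)"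
 by (simp add: hp_def map_pmf_comp if_distrib[of "(*) c"] cong: if_cong)

text \<open>Two independent fair choices of \<open>w\<close> give 0, \<open>w\<close> and
  \<open>2 * w\<close> with weights 1/4, 1/2, 1/4. This is also an even mixture of
  \<open>hp (2 * w)\<close> and the point \<open>w\<close>. Concavity bounds the added entropy below
  by half the gain at \<open>2 * w\<close>; submodularity bounds it above by twice the gain at
  \<open>w\<close>.\<close>

lemma ent_hp_double:
 assumes f: "dens f"
 shows "ent (conv (hp (2 * w)) f) - ent f \<le> 4 * (ent (conv (hp w) f) - ent f)"
proof -
 have b: "bsf f" and nn: "\<And>z. 0 \<le> f z" using f by (auto simp: dens_def)
 let ?J = "ent (conv (hp w) f) - ent f"
 define F where "F = (\<lambda>b. if b then conv (hp (2 * w)) f else (\<lambda>z. f (z - w)))"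
 have F: "bsf (F i)" "0 \<le> F i z" for i z
  unfolding F_def using b nn conv_bsf[OF bprob_pmf[OF finite_hp] b] by (auto intro: bsf_shift conv_nonneg)
 have "conv (hp w) (conv (hp w) f) = mixf UNIV (\<lambda>_. 1/2) F"
  by (auto simp: fun_eq_iff mixf_def F_def conv_hp UNIV_bool field_simps)
 moreover have "(\<Sum>i\<in>UNIV. 1/2 * ent (F i)) \<le> ent (mixf UNIV (\<lambda>_. 1/2) F)"
  using F by (intro ent_mix_ge) auto
 ultimately have "ent (conv (hp (2 * w)) f) / 2 + ent f / 2 \<le> ent (conv (hp w) (conv (hp w) f))"
  using ent_shift[OF b nn, of w] by (simp add: UNIV_bool F_def)
 moreover have "ent f - ent (conv (hp w) f) \<le> ent (conv (hp w) f) - ent (conv (hp w) (conv (hp w) f))"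
  by (rule ent_submod) (auto simp: f bprob_pmf)
 ultimately show ?thesis by (simp add: field_simps)
qed

definition usq :: "complex \<Rightarrow> real" where "usq = indicator (cbox 0 (Complex 1 1))"

lemma usq_cbox: "z \<in> cbox 0 (Complex 1 1) \<longleftrightarrow> 0 \<le> Re z \<and> Re z \<le> 1 \<and> 0 \<le> Im z \<and> Im z \<le> 1"
 by (auto simp: cbox_def Basis_complex_def)

lemma content_cbox_complex: "measure lborel (cbox a b) = (if Re a \<le> Re b \<and> Im a \<le> Im b then (Re b - Re a) * (Im b - Im a) else 0)" for a b :: complex
 by (subst measure_lborel_cbox_eq) (auto simp: Basis_complex_def)

lemma dens_usq: "dens usq"
proof -
 have "norm z \<le> 2" if "z \<in> cbox 0 (Complex 1 1)" for z
  using that cmod_le[of z] by (auto simp: usq_cbox)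
 hence "bsf usq" unfolding bsf_def usq_def
  by (intro conjI exI[of _ 1] exI[of _ 2]) (auto simp: indicator_def not_less[symmetric])
 moreover have "integral\<^sup>L lborel usq = 1" by (simp add: usq_def content_cbox_complex)
 ultimately show ?thesis by (auto simp: dens_def usq_def)
qed

lemma ent_usq: "ent usq = 0"
proof -
 have "(\<lambda>z. usq z * ln (usq z)) = (\<lambda>_. 0)" by (auto simp: usq_def indicator_def)
 thus ?thesis by (simp add: ent_def)
qed

lemma usq_overlap: "1 - 2 * norm w \<le> (LBINT z. usq z * usq (z - w))"
proof -
 define s t where "s = Re w" "t = Im w"
 let ?a = "Complex (max 0 s) (max 0 t)" and ?b = "Complex (min 1 (1 + s)) (min 1 (1 + t))"
 have "usq z * usq (z - w) = indicator (cbox ?a ?b) z" for z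
  by (auto simp: usq_def indicator_def usq_cbox cbox_def Basis_complex_def s_t_def)
 hence eq: "(LBINT z. usq z * usq (z - w)) = measure lborel (cbox ?a ?b)" by simp
 have st: "\<bar>s\<bar> \<le> norm w" "\<bar>t\<bar> \<le> norm w" using abs_Re_le_cmod abs_Im_le_cmod by (auto simp: s_t_def)
 show ?thesis
 proof (cases "\<bar>s\<bar> \<le> 1 \<and> \<bar>t\<bar> \<le> 1")
  case True
  hence "measure lborel (cbox ?a ?b) = (1 - \<bar>s\<bar>) * (1 - \<bar>t\<bar>)"
   by (auto simp: content_cbox_complex min_def max_def abs_if)
  moreover have "(1 - \<bar>s\<bar>) * (1 - \<bar>t\<bar>) = 1 - \<bar>s\<bar> - \<bar>t\<bar> + \<bar>s\<bar> * \<bar>t\<bar>" by (simp add: algebra_simps)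
  ultimately show ?thesis using eq st by (smt (verit) abs_ge_zero mult_nonneg_nonneg)
 next
  case False
  thus ?thesis using eq st measure_nonneg[of lborel "cbox ?a ?b"] by linarith
 qed
qed

text \<open>The averaged density takes only the values 0, 1/2 and 1, so its entropy is
  \<open>ln 2 / 2\<close> times the area covered by exactly one of the two squares, which is at most
  \<open>4 * norm w\<close>.\<close>

lemma ent_hp_usq: "ent (conv (hp w) usq) \<le> 2 * norm w"
proof -
 have "(\<lambda>z. - (conv (hp w) usq z * ln (conv (hp w) usq z))) = (\<lambda>z. ln 2 / 2 * (usq z + usq (z - w) - 2 * (usq z * usq (z - w))))"
  by (auto simp: conv_hp usq_def indicator_def ln_div fun_eq_iff)
 hence "ent (conv (hp w) usq) = (LBINT z. ln 2 / 2 * (usq z + usq (z - w) - 2 * (usq z * usq (z - w))))"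
  unfolding ent_def Bochner_Integration.integral_minus[symmetric] by (rule arg_cong)
 also have "... = ln 2 / 2 * (1 + 1 - 2 * (LBINT z. usq z * usq (z - w)))"
 proof -
  have b: "bsf usq" and i: "integral\<^sup>L lborel usq = 1" using dens_usq by (auto simp: dens_def)
  have p: "bsf (\<lambda>z. usq z * usq (z - w))"
   by (rule bsf_subset[OF b, where c = 1]) (use b in \<open>auto simp: bsf_def usq_def indicator_def\<close>)
  note I = bsf_integrable[OF b] bsf_integrable[OF bsf_shift[OF b, of w]] bsf_integrable[OF p]
  have "(LBINT z. usq (z - w)) = 1" using i integral_shift[of usq w] b by (simp add: bsf_def)
  thus ?thesis
   using I i by simp
 qed
 also have "... \<le> ln 2 / 2 * (4 * norm w)"
  using usq_overlap[of w] by (intro mult_left_mono) auto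
 also have "... \<le> 2 * norm w"
  using ln_2_less_1 by (simp add: mult_left_le)
 finally show ?thesis .
qed

lemma densD:
 assumes "dens f" shows "bsf f" "\<And>z. 0 \<le> f z" "f \<in> borel_measurable borel" "integral\<^sup>L lborel f = 1"
 using assms unfolding dens_def bsf_def by blast+

definition dm :: "(complex \<Rightarrow> real) \<Rightarrow> complex measure" where
 "dm f = density lborel (\<lambda>z. ennreal (f z))"

lemma sets_dm[simp, measurable_cong]: "sets (dm f) = sets borel" by (simp add: dm_def)

lemma space_dm[simp]: "space (dm f) = UNIV" by (simp add: dm_def)

lemma integral_dm:
 fixes g :: "complex \<Rightarrow> real"
 assumes "dens f" "g \<in> borel_measurable borel"
 shows "integral\<^sup>L (dm f) g = (LBINT z. f z * g z)"
 unfolding dm_def using assms by (subst integral_density) (auto simp: dens_def bsf_def)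

lemma prob_space_dm: assumes "dens f" shows "prob_space (dm f)"
proof
 have b: "bsf f" and nn: "\<And>z. 0 \<le> f z" and i: "integral\<^sup>L lborel f = 1" using assms by (auto simp: dens_def)
 have "emeasure (dm f) (space (dm f)) = (\<integral>\<^sup>+z. ennreal (f z) \<partial>lborel)"
  unfolding dm_def using b by (subst emeasure_density) (auto simp: bsf_def)
 also have "... = 1" using bsf_integrable[OF b] nn i by (subst nn_integral_eq_integral) auto
 finally show "emeasure (dm f) (space (dm f)) = 1" .
qed

lemma AE_dm_support:
 assumes "dens f" "\<And>z. R < norm z \<Longrightarrow> f z = 0" shows "AE y in dm f. norm y \<le> R"
 unfolding dm_def using assms by (subst AE_density) (auto simp: dens_def bsf_def not_less intro!: AE_I2 leI)

lemma bprob_dm: assumes "dens f" shows "bprob (dm f)"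
proof -
 obtain R where "\<And>z. R < norm z \<Longrightarrow> f z = 0" using assms by (auto simp: dens_def bsf_def)
 thus ?thesis using AE_dm_support[OF assms, of R] prob_space_dm[OF assms] unfolding bprob_def
  by (auto intro: measurable_ident_sets)
qed

lemma integral_reflect: fixes f :: "complex \<Rightarrow> real" assumes "f \<in> borel_measurable borel"
 shows "(LBINT y. f (z - y)) = integral\<^sup>L lborel f"
proof -
 have "(LBINT y. f (z - y)) = (LBINT y. (\<lambda>x. f (- (x - z))) y)" by simp
 also have "... = (LBINT x. f (- x))"
  using assms by (subst integral_shift[where f = "\<lambda>x. f (- x)"]) auto
 also have "... = integral\<^sup>L lborel f"
  using integral_complex_mult[OF assms, of "-1"] by simp
 finally show ?thesis .
qed

lemma conv_dm: assumes "dens f" "g \<in> borel_measurable borel"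
 shows "conv (dm f) g z = (LBINT y. f y * g (z - y))"
 unfolding conv_def using assms by (subst integral_dm) auto

lemma conv_dm_swap: assumes "dens f" "dens g" shows "conv (dm f) g = conv (dm g) f"
proof
 fix z
 have [measurable]: "f \<in> borel_measurable borel" "g \<in> borel_measurable borel" using assms by (auto simp: dens_def bsf_def)
 have "conv (dm g) f z = (LBINT y. (\<lambda>x. f x * g (z - x)) (z - y))"
  using assms by (subst conv_dm) (auto simp: mult.commute)
 also have "... = (LBINT y. f y * g (z - y))" by (rule integral_reflect) auto
 finally show "conv (dm f) g z = conv (dm g) f z" using assms by (subst conv_dm) auto
qed

lemma scl_conv_dm:
 assumes "dens f" "dens g" "c \<noteq> 0"
 shows "scl c (conv (dm f) g) = conv (dm (scl c f)) (scl c g)"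
proof
 fix z
 note [measurable] = densD(3)[OF assms(1)] densD(3)[OF assms(2)]
 have "conv (dm (scl c f)) (scl c g) z = (LBINT y. scl c f y * scl c g (z - y))"
  by (intro conv_dm dens_scl assms densD(3))
 also have "... = (LBINT y. (\<lambda>x. f x * g (z / c - x) / (norm c)^4) (y / c))"
  by (simp add: scl_def diff_divide_distrib power_add[symmetric])
 also have "... = (norm c)^2 * (LBINT x. f x * g (z / c - x) / (norm c)^4)"
  by (rule integral_scl) (use assms in auto)
 also have "... = scl c (conv (dm f) g) z"
  unfolding scl_def[of c "conv (dm f) g"] conv_dm[OF assms(1) densD(3)[OF assms(2)]]
  using assms(3) by (simp add: power4_eq_xxxx power2_eq_square)
 finally show "scl c (conv (dm f) g) z = conv (dm (scl c f)) (scl c g) z" ..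
qed

lemma conv_distr_dm:
 assumes "dens f" "dens g" "c \<noteq> 0"
 shows "conv (distr (dm f) borel ((*) c)) g = conv (dm (scl c f)) g"
proof -
 have g: "g = scl c (scl (1/c) g)" using assms(3) by (simp add: scl_scl scl_1)
 have d: "dens (scl (1/c) g)" using assms by (intro dens_scl) auto
 have "scl c (conv (dm f) (scl (1/c) g)) = conv (distr (dm f) borel ((*) c)) (scl c (scl (1/c) g))"
  using assms d by (intro scl_conv bprob_dm) (auto simp: dens_def)
 moreover have "scl c (conv (dm f) (scl (1/c) g)) = conv (dm (scl c f)) (scl c (scl (1/c) g))"
  by (rule scl_conv_dm[OF assms(1) d assms(3)])
 ultimately show ?thesis using g by simp
qed

section \<open>Random power series with uniform noise\<close>

lemma exists_power_series_law:
 fixes \<theta> :: complex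
 assumes Q: "prob_space Q" "sets Q = sets borel" "AE x in Q. norm x \<le> C" and \<theta>: "norm \<theta> < 1"
 obtains m :: "complex measure" where "bprob m" "sets m = sets borel"
  "\<And>f. f \<in> borel_measurable borel \<Longrightarrow> (\<integral>\<^sup>+z. f z \<partial>m) = (\<integral>\<^sup>+x. \<integral>\<^sup>+y. f (x + \<theta> * y) \<partial>m \<partial>Q)"
proof -
 let ?S = "stream_space Q"
 interpret S: prob_space ?S by (rule prob_space.prob_space_stream_space[OF Q(1)])
 \<comment> \<open>The truncation changes digits only on a null set, but makes the series converge
   with one bound for every stream.\<close>
 define b where "b x = (if norm x \<le> \<bar>C\<bar> then x else 0)" for x :: complex
 have [measurable]: "b \<in> borel_measurable borel" unfolding b_def[abs_def] by measurable
 have [measurable]: "b \<in> borel_measurable Q"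
  unfolding measurable_cong_sets[OF Q(2) refl] by (rule \<open>b \<in> borel_measurable borel\<close>)
 have bM: "norm (b x) \<le> \<bar>C\<bar>" for x by (auto simp: b_def)
 define X where "X \<omega> = (\<Sum>n. \<theta> ^ n * b (\<omega> !! n))" for \<omega>
 have geo: "summable (\<lambda>n. norm \<theta> ^ n * \<bar>C\<bar>)"
  using \<theta> by (intro summable_mult2 summable_geometric) auto
 have nb: "norm (\<theta> ^ n * b (\<omega> !! n)) \<le> norm \<theta> ^ n * \<bar>C\<bar>" for n \<omega>
  using bM by (auto simp: norm_mult norm_power intro!: mult_left_mono)
 have summ: "summable (\<lambda>n. \<theta> ^ n * b (\<omega> !! n))" for \<omega>
  by (rule summable_comparison_test'[OF geo nb])
 have X_bound: "norm (X \<omega>) \<le> (\<Sum>n. norm \<theta> ^ n * \<bar>C\<bar>)" for \<omega>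
  unfolding X_def by (rule norm_suminf_le[OF nb geo])
 have X_meas [measurable]: "X \<in> borel_measurable ?S"
  unfolding X_def
 proof (intro borel_measurable_suminf borel_measurable_times borel_measurable_const)
  fix n show "(\<lambda>\<omega>. b (\<omega> !! n)) \<in> borel_measurable ?S"
   by (rule measurable_compose[OF measurable_snth]) simp
 qed
 have X_Cons: "X (x ## \<omega>) = b x + \<theta> * X \<omega>" for x \<omega>
 proof -
  have "X (x ## \<omega>) = \<theta> ^ 0 * b ((x ## \<omega>) !! 0) + (\<Sum>n. \<theta> ^ Suc n * b ((x ## \<omega>) !! Suc n))"
   unfolding X_def using suminf_split_head[OF summ[of "x ## \<omega>"]] by simp
  also have "(\<Sum>n. \<theta> ^ Suc n * b ((x ## \<omega>) !! Suc n)) = \<theta> * X \<omega>"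
   unfolding X_def by (subst suminf_mult[OF summ, symmetric]) (simp add: mult_ac)
  finally show ?thesis by simp
 qed
 define m where "m = distr ?S borel X"
 show thesis
 proof (rule that)
  have "AE y in m. norm y \<le> (\<Sum>n. norm \<theta> ^ n * \<bar>C\<bar>)"
   unfolding m_def using X_bound by (subst AE_distr_iff) auto
  thus "bprob m" unfolding bprob_def
   by (auto simp: m_def intro!: S.prob_space_distr)
  show "sets m = sets borel" by (simp add: m_def)
  fix f :: "complex \<Rightarrow> ennreal" assume [measurable]: "f \<in> borel_measurable borel"
  have "(\<integral>\<^sup>+z. f z \<partial>m) = (\<integral>\<^sup>+\<omega>. f (X \<omega>) \<partial>?S)"
   unfolding m_def by (subst nn_integral_distr) auto
  also have "... = (\<integral>\<^sup>+x. (\<integral>\<^sup>+\<omega>. f (X (x ## \<omega>)) \<partial>?S) \<partial>Q)"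
   by (rule prob_space.nn_integral_stream_space[OF Q(1)]) simp
  also have "... = (\<integral>\<^sup>+x. \<integral>\<^sup>+y. f (x + \<theta> * y) \<partial>m \<partial>Q)"
  proof (rule nn_integral_cong_AE)
   show "AE x in Q. (\<integral>\<^sup>+\<omega>. f (X (x ## \<omega>)) \<partial>?S) = (\<integral>\<^sup>+y. f (x + \<theta> * y) \<partial>m)"
    using Q(3)
   proof eventually_elim
    fix x :: complex assume "norm x \<le> C"
    hence "b x = x" by (simp add: b_def)
    thus "(\<integral>\<^sup>+\<omega>. f (X (x ## \<omega>)) \<partial>?S) = (\<integral>\<^sup>+y. f (x + \<theta> * y) \<partial>m)"
     unfolding m_def by (subst nn_integral_distr) (auto simp: X_Cons)
   qed
  qed
  finally show "(\<integral>\<^sup>+z. f z \<partial>m) = (\<integral>\<^sup>+x. \<integral>\<^sup>+y. f (x + \<theta> * y) \<partial>m \<partial>Q)" .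
 qed
qed

text \<open>The random series whose terms have density \<open>\<kappa>\<close> (digit plus uniform
  noise) has an absolutely continuous law, because its first term already has. Its density
  \<open>\<zeta>\<close> inherits the fixed-point equation of the law.\<close>

lemma exists_refinable_density:
 fixes \<theta> :: complex
 assumes \<alpha>: "finite (set_pmf \<alpha>)" and \<theta>: "norm \<theta> < 1" "\<theta> \<noteq> 0"
 obtains \<zeta> where "dens \<zeta>" "\<zeta> = conv \<alpha> (conv (dm usq) (scl \<theta> \<zeta>))"
proof -
 define \<kappa> where "\<kappa> = conv \<alpha> usq"
 have \<kappa>: "dens \<kappa>" unfolding \<kappa>_def by (intro dens_conv dens_usq bprob_pmf \<alpha>)
 hence [measurable]: "\<kappa> \<in> borel_measurable borel" by (simp add: dens_def bsf_def)
 obtain C where C: "\<And>z. C < norm z \<Longrightarrow> \<kappa> z = 0" using \<kappa> by (auto simp: dens_def bsf_def)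
 obtain m where m: "bprob m" and ms[measurable_cong]: "sets m = sets borel"
  and eq: "\<And>f. f \<in> borel_measurable borel \<Longrightarrow> (\<integral>\<^sup>+z. f z \<partial>m) = (\<integral>\<^sup>+x. \<integral>\<^sup>+y. f (x + \<theta> * y) \<partial>m \<partial>dm \<kappa>)"
  using exists_power_series_law[OF prob_space_dm[OF \<kappa>] sets_dm AE_dm_support[OF \<kappa> C] \<theta>(1)] by metis
 interpret m: prob_space m using m by (rule bprob_prob)
 interpret K: prob_space "dm \<kappa>" by (rule prob_space_dm[OF \<kappa>])
 interpret mK: pair_sigma_finite m "dm \<kappa>" ..
 interpret ml: pair_sigma_finite m lborel ..
 define \<zeta> where "\<zeta> = conv (distr m borel ((*) \<theta>)) \<kappa>"
 have \<zeta>: "dens \<zeta>" unfolding \<zeta>_def by (intro dens_conv \<kappa> bprob_scale m)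
 hence [measurable]: "\<zeta> \<in> borel_measurable borel" by (simp add: dens_def bsf_def)
 have \<zeta>': "\<zeta> z = (\<integral>y. \<kappa> (z - \<theta> * y) \<partial>m)" for z
  unfolding \<zeta>_def conv_def by (subst integral_distr) auto
 have \<zeta>e: "ennreal (\<zeta> z) = (\<integral>\<^sup>+y. ennreal (\<kappa> (z - \<theta> * y)) \<partial>m)" for z
 proof -
  obtain b where b: "\<And>z. \<bar>\<kappa> z\<bar> \<le> b" using densD(1)[OF \<kappa>] unfolding bsf_def by blast
  have "integrable m (\<lambda>y. \<kappa> (z - \<theta> * y))" by (rule m.integrable_const_bound[where B = b]) (use b in auto)
  thus ?thesis unfolding \<zeta>' using \<kappa> by (subst nn_integral_eq_integral) (auto simp: dens_def)
 qed
 have "m = dm \<zeta>"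
 proof (rule measure_eqI)
  fix A assume "A \<in> sets m"
  hence A[measurable]: "A \<in> sets borel" by (simp add: ms)
  have "emeasure m A = (\<integral>\<^sup>+z. indicator A z \<partial>m)" by (simp add: ms)
  also have "... = (\<integral>\<^sup>+x. \<integral>\<^sup>+y. indicator A (x + \<theta> * y) \<partial>m \<partial>dm \<kappa>)" by (rule eq) simp
  also have "... = (\<integral>\<^sup>+y. \<integral>\<^sup>+x. indicator A (x + \<theta> * y) \<partial>dm \<kappa> \<partial>m)"
   by (rule mK.Fubini') (simp add: case_prod_beta')
  also have "... = (\<integral>\<^sup>+y. \<integral>\<^sup>+x. ennreal (\<kappa> x) * indicator A (x + \<theta> * y) \<partial>lborel \<partial>m)"
   unfolding dm_def by (subst nn_integral_density) auto
  also have "... = (\<integral>\<^sup>+y. \<integral>\<^sup>+x. ennreal (\<kappa> (x - \<theta> * y)) * indicator A x \<partial>lborel \<partial>m)"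
  proof (rule nn_integral_cong)
   fix y
   have "(\<integral>\<^sup>+x. ennreal (\<kappa> (x - \<theta> * y)) * indicator A x \<partial>lborel)
     = (\<integral>\<^sup>+x. ennreal (\<kappa> (x - \<theta> * y)) * indicator A x \<partial>distr lborel borel ((+) (\<theta> * y)))"
    by (simp add: lborel_distr_plus)
   also have "... = (\<integral>\<^sup>+x. ennreal (\<kappa> x) * indicator A (x + \<theta> * y) \<partial>lborel)"
    by (subst nn_integral_distr) (auto simp: add.commute)
   finally show "(\<integral>\<^sup>+x. ennreal (\<kappa> x) * indicator A (x + \<theta> * y) \<partial>lborel) = (\<integral>\<^sup>+x. ennreal (\<kappa> (x - \<theta> * y)) * indicator A x \<partial>lborel)" ..
  qed
  also have "... = (\<integral>\<^sup>+x. \<integral>\<^sup>+y. ennreal (\<kappa> (x - \<theta> * y)) * indicator A x \<partial>m \<partial>lborel)"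
   by (rule ml.Fubini'[symmetric]) (simp add: case_prod_beta')
  also have "... = (\<integral>\<^sup>+x. ennreal (\<zeta> x) * indicator A x \<partial>lborel)"
   by (simp add: \<zeta>e nn_integral_multc)
  also have "... = emeasure (dm \<zeta>) A" unfolding dm_def by (subst emeasure_density) auto
  finally show "emeasure m A = emeasure (dm \<zeta>) A" .
 qed (simp add: ms)
 hence "\<zeta> = conv (distr (dm \<zeta>) borel ((*) \<theta>)) \<kappa>" by (simp add: \<zeta>_def)
 also have "... = conv (dm (scl \<theta> \<zeta>)) \<kappa>" by (rule conv_distr_dm[OF \<zeta> \<kappa> \<theta>(2)])
 also have "... = conv \<alpha> (conv (dm (scl \<theta> \<zeta>)) usq)"
  unfolding \<kappa>_def using dens_usq \<zeta> \<theta> \<alpha> by (intro conv_commute bprob_dm bprob_pmf dens_scl) (auto simp: dens_def)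
 also have "conv (dm (scl \<theta> \<zeta>)) usq = conv (dm usq) (scl \<theta> \<zeta>)"
  using dens_usq \<zeta> \<theta> by (intro conv_dm_swap dens_scl)
 finally show thesis using \<zeta> that by blast
qed

text \<open>A larger index means less smoothing. Telescoping \<open>ent_mix_conv\<close> compares
  two stages without composing the kernels between them.\<close>

lemma ent_mix_chain:
 assumes M: "\<And>n. bprob (M n)" and I: "finite I" and p: "\<And>i. i \<in> I \<Longrightarrow> 0 \<le> p i" "(\<Sum>i\<in>I. p i) = 1"
  and f: "\<And>i n. i \<in> I \<Longrightarrow> dens (f i n)" "\<And>i n. i \<in> I \<Longrightarrow> f i n = conv (M n) (f i (Suc n))"
  and st: "s \<le> t"
 shows "(\<Sum>i\<in>I. p i * (ent (f i t) - ent (f i s))) \<le> ent (mixf I p (\<lambda>i. f i t)) - ent (mixf I p (\<lambda>i. f i s))"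
 using st
proof (induction t rule: dec_induct)
 case (step t)
 have "conv (M t) (mixf I p (\<lambda>i. f i (Suc t))) = mixf I p (\<lambda>i. f i t)"
  unfolding mixf_def[abs_def] using f(1) by (subst conv_sum[OF M I]) (auto simp: densD f(2)[symmetric] fun_eq_iff)
 moreover have "(\<Sum>i\<in>I. p i * (ent (f i (Suc t)) - ent (conv (M t) (f i (Suc t)))))
   \<le> ent (mixf I p (\<lambda>i. f i (Suc t))) - ent (conv (M t) (mixf I p (\<lambda>i. f i (Suc t))))"
  using p f(1) by (intro ent_mix_conv M I) (auto simp: densD)
 moreover have "(\<Sum>i\<in>I. p i * (ent (f i (Suc t)) - ent (conv (M t) (f i (Suc t))))) = (\<Sum>i\<in>I. p i * (ent (f i (Suc t)) - ent (f i t)))"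
  by (simp add: f(2)[symmetric])
 ultimately show ?case using step.IH by (simp add: algebra_simps sum.distrib sum_subtractf)
qed simp

lemma ent_submod_chain:
 assumes M: "\<And>n. bprob (M n)" and \<beta>: "finite (set_pmf \<beta>)"
  and g: "\<And>n. dens (g n)" "\<And>n. g n = conv (M n) (g (Suc n))" and st: "s \<le> t"
 shows "ent (g t) - ent (g s) \<le> ent (conv \<beta> (g t)) - ent (conv \<beta> (g s))"
 using st
proof (induction t rule: dec_induct)
 case (step t)
 have "conv (M t) (conv \<beta> (g (Suc t))) = conv \<beta> (g t)"
  using g(1) by (subst conv_commute[OF M bprob_pmf[OF \<beta>]]) (auto simp: densD g(2)[symmetric])
 moreover have "ent (g (Suc t)) - ent (conv (M t) (g (Suc t))) \<le> ent (conv \<beta> (g (Suc t))) - ent (conv (M t) (conv \<beta> (g (Suc t))))"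
  by (intro ent_submod M \<beta> g(1))
 moreover have "conv (M t) (g (Suc t)) = g t" using g(2)[of t] ..
 ultimately show ?case using step.IH by simp
qed simp

section \<open>Entropy of self-similar sums\<close>

locale ssys =
 fixes \<theta> :: complex and \<alpha> :: "complex pmf"
 assumes th0: "\<theta> \<noteq> 0" and th1: "norm \<theta> < 1" and fin: "finite (set_pmf \<alpha>)"
begin

text \<open>\<open>\<alpha>\<close> is the digit law. \<open>zeta\<close> is the density of \<open>\<Sum>n. \<theta> ^ n * (\<xi>\<^sub>n + U\<^sub>n)\<close> with \<open>\<xi>\<^sub>n\<close> of law \<open>\<alpha>\<close>
 and \<open>U\<^sub>n\<close> uniform on the unit square, and \<open>rho l\<close> that of the same sum without the first \<open>l\<close> of the \<open>U\<^sub>n\<close>.\<close>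

definition zeta where "zeta = (SOME \<zeta>. dens \<zeta> \<and> \<zeta> = conv \<alpha> (conv (dm usq) (scl \<theta> \<zeta>)))"

lemma zeta: "dens zeta" "zeta = conv \<alpha> (conv (dm usq) (scl \<theta> zeta))"
proof -
 obtain \<zeta> where "dens \<zeta>" "\<zeta> = conv \<alpha> (conv (dm usq) (scl \<theta> \<zeta>))"
  by (rule exists_refinable_density[OF fin th1 th0])
 hence "\<exists>\<zeta>. dens \<zeta> \<and> \<zeta> = conv \<alpha> (conv (dm usq) (scl \<theta> \<zeta>))"
  by (intro exI[of _ \<zeta>] conjI)
 from someI_ex[OF this] show "dens zeta" "zeta = conv \<alpha> (conv (dm usq) (scl \<theta> zeta))"
  unfolding zeta_def[symmetric] by (rule conjunct1, rule conjunct2)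
qed

text \<open>The transfer operator: if \<open>\<phi>\<close> is the density of \<open>Z\<close>, then
  \<open>P \<phi>\<close> is that of \<open>\<xi> + \<theta> * Z\<close> with an independent digit
  \<open>\<xi>\<close>.\<close>

definition P where "P \<phi> = conv \<alpha> (scl \<theta> \<phi>)"

definition rho where "rho l = (P ^^ l) zeta"

definition noise where "noise l = dm (scl (\<theta> ^ l) usq)"

lemma bprob_\<alpha>[simp]: "bprob (measure_pmf \<alpha>)" using fin by (rule bprob_pmf)

declare th0[simp]

lemma bprob_noise[simp]: "bprob (noise l)"
 unfolding noise_def by (intro bprob_dm dens_scl dens_usq) simp

lemma dens_P: "dens \<phi> \<Longrightarrow> dens (P \<phi>)"
 unfolding P_def by (intro dens_conv dens_scl th0) simp_all

lemma dens_rho[simp]: "dens (rho l)"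
 unfolding rho_def by (induction l) (auto simp: zeta(1) dens_P)

lemma rho_Suc: "rho (Suc l) = P (rho l)" by (simp add: rho_def)

lemma scl_noise:
 assumes "dens \<phi>" shows "scl \<theta> (conv (noise l) \<phi>) = conv (noise (Suc l)) (scl \<theta> \<phi>)"
 unfolding noise_def using assms th0
 by (subst scl_conv_dm) (auto simp: scl_scl intro: dens_scl dens_usq)

lemma rho_noise: "rho l = conv (noise l) (rho (Suc l))"
proof (induction l)
 case 0
 have "zeta = conv (dm usq) (conv \<alpha> (scl \<theta> zeta))"
  by (subst zeta(2), rule conv_commute) (auto intro!: bprob_dm dens_usq densD(1) dens_scl zeta(1) th0)
 thus ?case by (simp add: rho_def noise_def scl_1 P_def)
next
 case (Suc l)
 have "rho (Suc l) = conv \<alpha> (scl \<theta> (conv (noise l) (rho (Suc l))))"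
  unfolding Suc[symmetric] by (simp only: rho_Suc P_def)
 also have "... = conv \<alpha> (conv (noise (Suc l)) (scl \<theta> (rho (Suc l))))"
  by (simp add: scl_noise)
 also have "... = conv (noise (Suc l)) (conv \<alpha> (scl \<theta> (rho (Suc l))))"
  by (rule conv_commute) (auto intro!: densD(1) dens_scl th0)
 finally show ?case by (simp add: rho_Suc[of "Suc l"] P_def)
qed

definition h where "h l = ent (rho l)"
definition e where "e l = h l - h (Suc l)"

lemma e_nonneg: "0 \<le> e l"
 using ent_conv_ge[of "noise l" "rho (Suc l)"] rho_noise[of l] by (simp add: e_def h_def)

lemma h_antimono: "s \<le> t \<Longrightarrow> h t \<le> h s"
 by (induction t rule: dec_induct) (use e_nonneg in \<open>auto simp: e_def intro: order_trans\<close>)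

lemma scl_chain: "scl \<theta> (rho l) = conv (noise (Suc l)) (scl \<theta> (rho (Suc l)))"
 by (subst rho_noise, rule scl_noise) simp

lemma ent_scl_rho: "ent (scl c (rho l)) = h l + 2 * ln (norm c)" if "c \<noteq> 0"
 using that by (simp add: ent_scl h_def)

text \<open>Scaling by \<open>\<theta>\<close> turns noise of level \<open>l\<close> into noise of
  level \<open>l + 1\<close> and shifts all entropies equally. The convolution with
  \<open>\<alpha>\<close> that follows can only reduce what the noise contributes.\<close>

lemma e_Suc_le: "e (Suc l) \<le> e l"
proof -
 have "ent (scl \<theta> (rho (Suc l))) - ent (scl \<theta> (rho l)) \<le> ent (conv \<alpha> (scl \<theta> (rho (Suc l)))) - ent (conv \<alpha> (scl \<theta> (rho l)))"
  by (rule ent_submod_chain[where M = "\<lambda>n. noise (Suc n)" and g = "\<lambda>n. scl \<theta> (rho n)"])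
    (auto simp: fin th0 intro: dens_scl scl_chain)
 thus ?thesis
  by (simp add: ent_scl_rho th0 rho_Suc[symmetric] P_def[symmetric] e_def h_def)
qed

lemma e_antimono: "s \<le> t \<Longrightarrow> e t \<le> e s"
 by (rule decseqD[OF decseq_SucI]) (auto simp: e_Suc_le)

text \<open>The Jensen-Shannon divergence between \<open>rho l\<close> and its translate by
  \<open>v\<close>. It is small as long as the noise left in \<open>rho l\<close> hides a shift by
  \<open>v\<close> (\<open>js_le\<close>).\<close>

definition js where "js v l = ent (conv (hp v) (rho l)) - h l"

lemma js_mono: assumes "s \<le> t" shows "js v s \<le> js v t"
proof -
 have "ent (rho t) - ent (rho s) \<le> ent (conv (hp v) (rho t)) - ent (conv (hp v) (rho s))"
  by (rule ent_submod_chain[where M = noise]) (auto intro: rho_noise assms)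
 thus ?thesis by (simp add: js_def h_def)
qed

text \<open>One more digit carries the shift \<open>v\<close> to \<open>\<theta> * v\<close> and the
  window from \<open>s\<close> to \<open>t\<close> one level further. By submodularity the increment
  of \<open>js\<close> over the window falls at most by the decrease of the entropy loss over the
  window, an error that is small once \<open>e\<close> is nearly constant.\<close>

lemma js_descent1:
 assumes "s \<le> t"
 shows "js v t - js v s \<le> js (\<theta> * v) (Suc t) - js (\<theta> * v) (Suc s) + ((h s - h t) - (h (Suc s) - h (Suc t)))"
proof -
 define g where "g n = scl \<theta> (conv (hp v) (rho n))" for n
 have d: "dens (conv (hp v) (rho n))" for n by (intro dens_conv bprob_pmf) auto
 have g1: "dens (g n)" for n unfolding g_def by (intro dens_scl d th0)
 have g2: "g n = conv (noise (Suc n)) (g (Suc n))" for n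
 proof -
  have "conv (hp v) (rho n) = conv (noise n) (conv (hp v) (rho (Suc n)))"
   by (subst rho_noise, rule conv_commute) (auto intro!: bprob_pmf densD(1))
  thus ?thesis unfolding g_def by (simp add: scl_noise[OF d])
 qed
 have g3: "conv \<alpha> (g n) = conv (hp (\<theta> * v)) (rho (Suc n))" for n
 proof -
  have "g n = conv (hp (\<theta> * v)) (scl \<theta> (rho n))" unfolding g_def by (simp add: scl_conv_pmf th0 map_hp)
  hence "conv \<alpha> (g n) = conv (hp (\<theta> * v)) (conv \<alpha> (scl \<theta> (rho n)))"
   by (simp, subst conv_commute) (auto intro!: bprob_pmf densD(1) dens_scl)
  thus ?thesis by (simp add: rho_Suc P_def)
 qed
 have "ent (g t) - ent (g s) \<le> ent (conv \<alpha> (g t)) - ent (conv \<alpha> (g s))"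
  by (rule ent_submod_chain[where M = "\<lambda>n. noise (Suc n)"]) (auto simp: fin g1 assms intro: g2)
 thus ?thesis unfolding g3 by (simp add: g_def ent_scl d th0 js_def)
qed

lemma js_descent:
 assumes "s \<le> t"
 shows "js v t - js v s \<le> js (\<theta> ^ i * v) (t + i) - js (\<theta> ^ i * v) (s + i) + ((h s - h t) - (h (s + i) - h (t + i)))"
proof (induction i)
 case (Suc i)
 show ?case using Suc js_descent1[of "s + i" "t + i" "\<theta> ^ i * v"] assms by (simp add: mult.assoc)
qed simp

text \<open>The noise of level \<open>s\<close> alone already blurs the shift: by submodularity the
  other summand, of density \<open>rho (Suc s)\<close>, may be dropped, and rescaling leads to the
  unit square.\<close>

lemma js_le: "js w s \<le> 2 * norm w / norm \<theta> ^ s"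
proof -
 define \<phi> where "\<phi> = scl (\<theta> ^ s) usq"
 have \<phi>: "dens \<phi>" unfolding \<phi>_def by (intro dens_scl dens_usq) simp
 let ?M = "dm (rho (Suc s))"
 have M: "bprob ?M" by (rule bprob_dm) simp
 have r: "conv ?M \<phi> = rho s" using rho_noise[of s] conv_dm_swap[OF \<phi> dens_rho, of "Suc s"] by (simp add: noise_def \<phi>_def)
 have c: "conv ?M (conv (hp w) \<phi>) = conv (hp w) (rho s)"
  using \<phi> by (subst conv_commute[OF M]) (auto simp: r intro: bprob_pmf densD)
 have "ent \<phi> - ent (conv ?M \<phi>) \<le> ent (conv (hp w) \<phi>) - ent (conv ?M (conv (hp w) \<phi>))"
  by (rule ent_submod) (auto intro: M \<phi>)
 hence "js w s \<le> ent (conv (hp w) \<phi>) - ent \<phi>" by (simp add: js_def h_def r c)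
 also have "conv (hp w) \<phi> = scl (\<theta> ^ s) (conv (hp (w / \<theta> ^ s)) usq)"
  unfolding \<phi>_def by (simp add: scl_conv_pmf map_hp)
 also have "ent \<dots> - ent \<phi> = ent (conv (hp (w / \<theta> ^ s)) usq)"
  unfolding \<phi>_def using dens_conv[OF bprob_pmf[OF finite_hp] dens_usq] by (simp add: ent_scl dens_usq ent_usq)
 also have "... \<le> 2 * norm (w / \<theta> ^ s)" by (rule ent_hp_usq)
 finally show ?thesis by (simp add: norm_divide norm_power)
qed

lemma js_double: "js (2 * w) l \<le> 4 * js w l"
 using ent_hp_double[OF dens_rho, of w l] by (simp add: js_def h_def)

primrec X :: "nat \<Rightarrow> complex pmf" where
 "X 0 = return_pmf 0"
| "X (Suc k) = bind_pmf \<alpha> (\<lambda>x. map_pmf (\<lambda>y. x + \<theta> * y) (X k))"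

lemma finite_X[simp]: "finite (set_pmf (X k))"
 using fin by (induction k) auto

lemma bprob_X[simp]: "bprob (measure_pmf (X k))" by (rule bprob_pmf) simp

lemma conv_X_Suc: "conv (X (Suc k)) f = conv \<alpha> (conv (map_pmf ((*) \<theta>) (X k)) f)"
 using fin by (auto simp: fun_eq_iff conv_bind_pmf mixf_def conv_pmf conv_map_pmf diff_diff_eq)

lemma P_funpow: "(P ^^ k) \<phi> = conv (X k) (scl (\<theta> ^ k) \<phi>)"
proof (induction k)
 case 0 thus ?case by (simp add: scl_1)
next
 case (Suc k)
 thus ?case
  unfolding conv_X_Suc by (simp add: scl_conv_pmf scl_scl) (simp add: P_def scl_conv_pmf scl_scl)
qed

lemma rho_add: "rho (k + l) = conv (X k) (scl (\<theta> ^ k) (rho l))"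
 by (simp add: rho_def funpow_add P_funpow)

end

section \<open>Two-dimensional grids of fair choices\<close>

primrec convs :: "complex list \<Rightarrow> (complex \<Rightarrow> real) \<Rightarrow> complex \<Rightarrow> real" where
 "convs [] f = f"
| "convs (v # vs) f = conv (hp v) (convs vs f)"

lemma convs_append: "convs (xs @ ys) f = convs xs (convs ys f)"
 by (induction xs) auto

lemma dens_convs: "dens f \<Longrightarrow> dens (convs vs f)"
 by (induction vs) (auto intro!: dens_conv bprob_pmf)

lemma conv_convs: "bprob M \<Longrightarrow> dens f \<Longrightarrow> conv M (convs vs f) = convs vs (conv M f)"
proof (induction vs)
 case (Cons v vs)
 have "conv M (conv (hp v) (convs vs f)) = conv (hp v) (conv M (convs vs f))"
  by (rule conv_commute) (use Cons.prems in \<open>auto intro!: bprob_pmf densD(1) dens_convs\<close>)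
 thus ?case using Cons by simp
qed simp

lemma scl_convs: "c \<noteq> 0 \<Longrightarrow> scl c (convs vs f) = convs (map ((*) c) vs) (scl c f)"
 by (induction vs) (auto simp: scl_conv_pmf map_hp)

lemma convs_supp: "(\<And>z. R < norm z \<Longrightarrow> f z = 0) \<Longrightarrow> R + sum_list (map norm vs) < norm z \<Longrightarrow> convs vs f z = 0"
proof (induction vs arbitrary: z)
 case (Cons v vs)
 have "norm (z - v) \<ge> norm z - norm v" by (rule norm_triangle_ineq2)
 moreover have "0 \<le> norm v" by simp
 ultimately have "R + sum_list (map norm vs) < norm (z - v)" "R + sum_list (map norm vs) < norm z"
  using Cons.prems(2) by (simp_all del: norm_ge_zero)
 thus ?case using Cons.IH[of z] Cons.IH[of "z - v"] Cons.prems(1) by (simp add: conv_hp)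
qed simp

lemma ent_convs_step:
 assumes "dens f" "bprob M"
 shows "ent (conv M (convs vs f)) - ent (convs vs f) \<le> ent (conv M f) - ent f"
proof (induction vs)
 case (Cons v vs)
 have "ent (convs vs f) - ent (conv M (convs vs f)) \<le> ent (conv (hp v) (convs vs f)) - ent (conv M (conv (hp v) (convs vs f)))"
  by (rule ent_submod) (auto intro: dens_convs assms)
 thus ?case using Cons by simp
qed simp

lemma ent_convs_le:
 assumes "dens f"
 shows "ent (convs vs f) - ent f \<le> (\<Sum>v\<leftarrow>vs. ent (conv (hp v) f) - ent f)"
proof (induction vs)
 case (Cons v vs)
 thus ?case using ent_convs_step[OF assms bprob_pmf[OF finite_hp], of v vs] by simp
qed simp

text \<open>Binary expansion: independent fair choices of \<open>2 ^ j * v\<close> add up to a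
  uniformly distributed multiple of \<open>v\<close>.\<close>

lemma convs_powers:
 "convs (map (\<lambda>j. 2 ^ j * v) [0..<b]) f z = (\<Sum>c<(2::nat)^b. f (z - of_nat c * v)) / 2 ^ b"
proof (induction b arbitrary: f)
 case (Suc b)
 have 1: "(\<Sum>c<(2::nat)^Suc b. f (z - of_nat c * v)) = (\<Sum>c<(2::nat)^b. f (z - of_nat c * v)) + (\<Sum>c<(2::nat)^b. f (z - of_nat (c + 2^b) * v))"
  using sum.atLeastLessThan_concat[of 0 "2^b" "2^b+2^b" "\<lambda>c. f (z - of_nat c * v)"]
   sum.shift_bounds_nat_ivl[of "\<lambda>c. f (z - of_nat c * v)" 0 "2^b" "2^b"]
  by (simp add: atLeast0LessThan mult_2)
 have 2: "(\<Sum>c<(2::nat)^b. f (z - of_nat (c + 2^b) * v)) = (\<Sum>c<(2::nat)^b. f (z - of_nat c * v - 2^b * v))"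
  by (simp add: algebra_simps)
 have 3: "(\<Sum>c<(2::nat)^b. conv (hp (2^b * v)) f (z - of_nat c * v)) =
   ((\<Sum>c<(2::nat)^b. f (z - of_nat c * v)) + (\<Sum>c<(2::nat)^b. f (z - of_nat c * v - 2^b * v))) / 2"
  by (simp add: conv_hp sum.distrib flip: sum_divide_distrib)
 have 4: "convs (map (\<lambda>j. 2 ^ j * v) [0..<Suc b]) f z = (\<Sum>c<(2::nat)^b. conv (hp (2^b * v)) f (z - of_nat c * v)) / 2 ^ b"
  by (simp add: convs_append Suc)
 show ?case unfolding 4 3 1 2 by simp
qed simp

lemma card_nat_interval:
 fixes a r :: real assumes "0 \<le> r"
 shows "finite {c::nat. \<bar>a - real c\<bar> \<le> r}" "real (card {c::nat. \<bar>a - real c\<bar> \<le> r}) \<le> 2 * r + 1"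
proof -
 let ?S = "{c::nat. \<bar>a - real c\<bar> \<le> r}"
 have sub: "int ` ?S \<subseteq> {\<lceil>a - r\<rceil>..\<lfloor>a + r\<rfloor>}"
  by (auto simp: ceiling_le_iff le_floor_iff)
 hence "finite (int ` ?S)" by (rule finite_subset) simp
 thus fin: "finite ?S" by (rule finite_imageD) simp
 have "card ?S = card (int ` ?S)" by (rule card_image[symmetric]) simp
 also have "... \<le> card {\<lceil>a - r\<rceil>..\<lfloor>a + r\<rfloor>}" by (rule card_mono[OF _ sub]) simp
 finally have "real (card ?S) \<le> real (nat (\<lfloor>a + r\<rfloor> - \<lceil>a - r\<rceil> + 1))" by simp
 also have "... \<le> 2 * r + 1" using assms by linarith
 finally show "real (card ?S) \<le> 2 * r + 1" .
qed

text \<open>As \<open>\<theta>\<close> is not real, the imaginary part confines \<open>c'\<close> to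
  a short interval, and for given \<open>c'\<close> the real part confines \<open>c\<close>. The
  bound is independent of the grid size \<open>A\<close> and of \<open>v\<close>.\<close>

lemma card_lattice:
 fixes \<theta> v z :: complex
 assumes th: "\<theta> \<noteq> 0" "Im \<theta> \<noteq> 0" and v: "norm \<theta> \<le> norm v" and \<rho>: "0 \<le> \<rho>"
 shows "real (card {(c, c') \<in> {..<A} \<times> {..<A}. norm (z - of_nat c * v - of_nat c' * (\<theta> * v)) \<le> \<rho>})
  \<le> (2 * \<rho> / (norm \<theta> * \<bar>Im \<theta>\<bar>) + 1) * (2 * \<rho> / norm \<theta> + 1)"
proof -
 have v0: "v \<noteq> 0" using th v by auto
 define y where "y = z / v"
 define S' where "S' = {c'::nat. \<bar>Im y / Im \<theta> - real c'\<bar> \<le> \<rho> / (norm \<theta> * \<bar>Im \<theta>\<bar>)}"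
 define S where "S c' = {c::nat. \<bar>Re (y - of_nat c' * \<theta>) - real c\<bar> \<le> \<rho> / norm \<theta>}" for c' :: nat
 have fin: "finite S'" "finite (S c')" for c'
  unfolding S'_def S_def using \<rho> by (intro card_nat_interval; simp)+
 have "{(c, c') \<in> {..<A} \<times> {..<A}. norm (z - of_nat c * v - of_nat c' * (\<theta> * v)) \<le> \<rho>} \<subseteq> prod.swap ` (SIGMA c':S'. S c')"
 proof clarify
  fix c c' :: nat assume le: "norm (z - of_nat c * v - of_nat c' * (\<theta> * v)) \<le> \<rho>"
  have eq: "z - of_nat c * v - of_nat c' * (\<theta> * v) = v * (y - of_nat c' * \<theta> - of_nat c)"
   using v0 by (simp add: y_def algebra_simps)
  have "norm (y - of_nat c' * \<theta> - of_nat c) * norm v \<le> \<rho>"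
   using le unfolding eq norm_mult by (simp add: mult.commute)
  hence "norm (y - of_nat c' * \<theta> - of_nat c) \<le> \<rho> / norm v"
   using v0 by (simp add: pos_le_divide_eq)
  also have "... \<le> \<rho> / norm \<theta>" using v \<rho> th v0 by (intro divide_left_mono) auto
  finally have n: "norm (y - of_nat c' * \<theta> - of_nat c) \<le> \<rho> / norm \<theta>" .
  have "\<bar>Im y - real c' * Im \<theta>\<bar> \<le> \<rho> / norm \<theta>"
   using abs_Im_le_cmod[of "y - of_nat c' * \<theta> - of_nat c"] n by simp
  hence "\<bar>Im y - real c' * Im \<theta>\<bar> / \<bar>Im \<theta>\<bar> \<le> \<rho> / norm \<theta> / \<bar>Im \<theta>\<bar>"
   by (rule divide_right_mono) simp
  moreover have "\<bar>Im y - real c' * Im \<theta>\<bar> / \<bar>Im \<theta>\<bar> = \<bar>Im y / Im \<theta> - real c'\<bar>"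
   using th by (simp add: diff_divide_distrib flip: abs_divide)
  ultimately have "\<bar>Im y / Im \<theta> - real c'\<bar> \<le> \<rho> / norm \<theta> / \<bar>Im \<theta>\<bar>" by simp
  moreover have "\<bar>Re (y - of_nat c' * \<theta>) - real c\<bar> \<le> \<rho> / norm \<theta>"
   using abs_Re_le_cmod[of "y - of_nat c' * \<theta> - of_nat c"] n by simp
  ultimately have "(c', c) \<in> (SIGMA c':S'. S c')" by (simp add: S'_def S_def)
  thus "(c, c') \<in> prod.swap ` (SIGMA c':S'. S c')" by force
 qed
 hence "card {(c, c') \<in> {..<A} \<times> {..<A}. norm (z - of_nat c * v - of_nat c' * (\<theta> * v)) \<le> \<rho>} \<le> card (prod.swap ` (SIGMA c':S'. S c'))"
  using fin by (intro card_mono) auto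
 also have "... \<le> card (SIGMA c':S'. S c')" using fin by (intro card_image_le) auto
 also have "... = (\<Sum>c'\<in>S'. card (S c'))" using fin by simp
 finally have "real (card {(c, c') \<in> {..<A} \<times> {..<A}. norm (z - of_nat c * v - of_nat c' * (\<theta> * v)) \<le> \<rho>}) \<le> (\<Sum>c'\<in>S'. real (card (S c')))"
  by (simp only: of_nat_le_iff flip: of_nat_sum)
 also have "... \<le> (\<Sum>c'\<in>S'. 2 * (\<rho> / norm \<theta>) + 1)"
  unfolding S_def using \<rho> by (intro sum_mono card_nat_interval) auto
 also have "... = real (card S') * (2 * (\<rho> / norm \<theta>) + 1)" by simp
 also have "... \<le> (2 * (\<rho> / (norm \<theta> * \<bar>Im \<theta>\<bar>)) + 1) * (2 * (\<rho> / norm \<theta>) + 1)"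
  unfolding S'_def using \<rho> by (intro mult_right_mono card_nat_interval) auto
 finally show ?thesis by simp
qed

lemma ex_power2_between: fixes x :: real assumes "1 \<le> x" shows "\<exists>b. x \<le> 2 ^ b \<and> 2 ^ b \<le> 2 * x"
proof -
 define b where "b = (LEAST b. x \<le> 2 ^ b)"
 obtain b0 where "x < 2 ^ b0" using real_arch_pow[of 2 x] by auto
 hence 1: "x \<le> 2 ^ b" unfolding b_def by (intro LeastI[of "\<lambda>b. x \<le> 2 ^ b" b0]) simp
 have "2 ^ b \<le> 2 * x"
 proof (cases b)
  case (Suc c)
  hence "\<not> x \<le> 2 ^ c" unfolding b_def by (metis lessI not_less_Least)
  thus ?thesis using Suc by simp
 qed (use assms in simp)
 thus ?thesis using 1 by blast
qed

lemma conv_supp: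
 assumes "bprob M" "AE y in M. norm y \<le> R'" "\<And>z. R < norm z \<Longrightarrow> f z = 0" "R + R' < norm z"
 shows "conv M f z = 0"
 unfolding conv_def
proof (rule integral_eq_zero_AE)
 show "AE y in M. f (z - y) = 0"
  using assms(2)
 proof eventually_elim
  fix y :: complex assume "norm y \<le> R'"
  thus "f (z - y) = 0" using assms(4) norm_triangle_ineq2[of z y] by (intro assms(3)) linarith
 qed
qed

context ssys begin

lemma alpha_bound: "\<exists>A\<ge>0. \<forall>x\<in>set_pmf \<alpha>. norm x \<le> A"
 using fin by (intro exI[of _ "\<Sum>x\<in>set_pmf \<alpha>. norm x"]) (auto intro!: member_le_sum sum_nonneg)

lemma supp_P:
 assumes "\<And>x. x \<in> set_pmf \<alpha> \<Longrightarrow> norm x \<le> A" "A + norm \<theta> * R \<le> R" "\<And>z. R < norm z \<Longrightarrow> \<phi> z = 0" "R < norm z"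
 shows "P \<phi> z = 0"
 unfolding P_def
proof (rule conv_supp)
 show "AE y in measure_pmf \<alpha>. norm y \<le> A" using assms(1) by (auto simp: AE_measure_pmf_iff)
 show "scl \<theta> \<phi> z = 0" if "norm \<theta> * R < norm z" for z
  using that by (simp add: scl_def assms(3) norm_divide field_simps)
 show "norm \<theta> * R + A < norm z" using assms by simp
qed simp

lemma rho_supp: "\<exists>R>0. \<forall>l z. R < norm z \<longrightarrow> rho l z = 0"
proof -
 obtain A where A: "0 \<le> A" "\<And>x. x \<in> set_pmf \<alpha> \<Longrightarrow> norm x \<le> A" using alpha_bound by blast
 obtain R0 where R0: "\<And>z. R0 < norm z \<Longrightarrow> zeta z = 0" using densD(1)[OF zeta(1)] unfolding bsf_def by blast
 define R where "R = max 1 (max R0 (A / (1 - norm \<theta>)))"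
 have "A / (1 - norm \<theta>) \<le> R" by (simp add: R_def)
 hence R: "A + norm \<theta> * R \<le> R" using th1 by (simp add: field_simps)
 have "rho l z = 0" if "R < norm z" for l z
  using that
 proof (induction l arbitrary: z)
  case 0 thus ?case using R0 by (simp add: rho_def R_def)
 next
  case (Suc l) thus ?case unfolding rho_Suc by (intro supp_P[OF A(2) R])
 qed
 thus ?thesis by (intro exI[of _ R]) (auto simp: R_def)
qed

text \<open>The fair choices in this list together make a uniform choice from a \<open>2 ^ b\<close>
  by \<open>2 ^ b\<close> grid spanned by \<open>v\<close> and \<open>\<theta> * v\<close>
  (\<open>convs_gl\<close>). \<open>Lp\<close> superposes \<open>n\<close> such grids, each shrunk
  by \<open>\<theta> ^ q\<close> relative to the previous one.\<close>

definition gl where "gl b v = map (\<lambda>j. 2 ^ j * v) [0..<b] @ map (\<lambda>j. 2 ^ j * (\<theta> * v)) [0..<b]"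

primrec Lp :: "nat \<Rightarrow> nat \<Rightarrow> nat \<Rightarrow> complex \<Rightarrow> complex list" where
 "Lp b q 0 v = []"
| "Lp b q (Suc n) v = gl b v @ map ((*) (\<theta> ^ q)) (Lp b q n v)"

lemma convs_gl:
 "convs (gl b v) f z = (\<Sum>(c, c')\<in>{..<2^b} \<times> {..<2^b}. f (z - of_nat c * v - of_nat c' * (\<theta> * v))) / 4 ^ b"
proof -
 have "convs (gl b v) f z = (\<Sum>c<(2::nat)^b. (\<Sum>c'<(2::nat)^b. f (z - of_nat c * v - of_nat c' * (\<theta> * v))) / 2 ^ b) / 2 ^ b"
  unfolding gl_def convs_append convs_powers ..
 also have "... = (\<Sum>c<(2::nat)^b. \<Sum>c'<(2::nat)^b. f (z - of_nat c * v - of_nat c' * (\<theta> * v))) / (2 ^ b * 2 ^ b)"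
  by (simp flip: sum_divide_distrib)
 also have "(2::real) ^ b * 2 ^ b = 4 ^ b" by (simp flip: power_mult_distrib)
 finally show ?thesis by (simp add: sum.cartesian_product)
qed

lemma sum_norm_powers: "(\<Sum>j\<leftarrow>[0..<b]. norm (2 ^ j * v)) \<le> 2 ^ b * norm (v::complex)"
proof (induction b)
 case (Suc b)
 have "norm (2 ^ b * v) = 2 ^ b * norm v" by (simp add: norm_mult norm_power)
 hence "(\<Sum>j\<leftarrow>[0..<Suc b]. norm (2 ^ j * v)) = (\<Sum>j\<leftarrow>[0..<b]. norm (2 ^ j * v)) + 2 ^ b * norm v" by simp
 moreover have "2 ^ Suc b * norm v = 2 ^ b * norm v + 2 ^ b * norm v" by simp
 ultimately show ?case using Suc by linarith
qed simp

lemma sum_norm_gl: assumes "norm v \<le> 1" shows "sum_list (map norm (gl b v)) \<le> 2 * 2 ^ b"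
proof -
 have "sum_list (map norm (gl b v)) \<le> 2 ^ b * norm v + 2 ^ b * norm (\<theta> * v)"
  using sum_norm_powers[where b = b and v = v] sum_norm_powers[where b = b and v = "\<theta> * v"] by (simp add: gl_def comp_def)
 also have "norm (\<theta> * v) \<le> 1" using assms th1 by (simp add: norm_mult mult_le_one)
 hence "2 ^ b * norm v + 2 ^ b * norm (\<theta> * v) \<le> 2 ^ b * 1 + 2 ^ b * 1"
  using assms by (intro add_mono mult_left_mono) auto
 finally show ?thesis by simp
qed

lemma sum_norm_Lp: assumes "norm v \<le> 1" "norm \<theta> ^ q \<le> 1/2" shows "sum_list (map norm (Lp b q n v)) \<le> 4 * 2 ^ b"
proof (induction n)
 case (Suc n)
 have "sum_list (map norm (map ((*) (\<theta> ^ q)) (Lp b q n v))) = norm \<theta> ^ q * sum_list (map norm (Lp b q n v))"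
  by (simp add: comp_def norm_mult norm_power sum_list_const_mult)
 also have "... \<le> 1/2 * (4 * 2 ^ b)" using assms Suc by (intro mult_mono) (auto intro!: sum_list_nonneg)
 finally show ?case using sum_norm_gl[OF assms(1), of b] by simp
qed simp

text \<open>Each level averages \<open>4 ^ b\<close> translates of a function whose height has grown
  by \<open>1 / norm \<theta> ^ (2 * q)\<close> and whose support radius is at most
  \<open>8 + R\<close>. At most \<open>C\<close> of them meet at a point, and \<open>b\<close> is
  such that the two powers cancel. The cost \<open>C\<close> per level does not depend on
  \<open>q\<close>, which is decisive in \<open>js_gap\<close>.\<close>

lemma sup_grid:
 assumes th: "Im \<theta> \<noteq> 0" and v: "norm \<theta> \<le> norm v" "norm v \<le> 1"
  and q: "norm \<theta> ^ q \<le> 1/2" and b: "1 \<le> norm \<theta> ^ q * 2 ^ b" "norm \<theta> ^ q * 2 ^ b \<le> 2"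
  and B: "\<And>z. zeta z \<le> B" "0 \<le> B" and R: "\<And>z. R < norm z \<Longrightarrow> zeta z = 0" "0 \<le> R"
  and C: "C = (2 * (8 + R) / (norm \<theta> * \<bar>Im \<theta>\<bar>) + 1) * (2 * (8 + R) / norm \<theta> + 1)"
 shows "convs (Lp b q n v) (scl (\<theta> ^ (q * n)) zeta) z \<le> C ^ n * B"
  and "4 * 2 ^ b + R < norm z \<Longrightarrow> convs (Lp b q n v) (scl (\<theta> ^ (q * n)) zeta) z = 0"
proof (induction n arbitrary: z)
 case 0
 { case 1 thus ?case using B by (simp add: scl_1) next
  case 2 thus ?case using R by (simp add: scl_1) (smt (verit) zero_le_power) }
next
 case (Suc n)
 let ?\<psi> = "convs (Lp b q n v) (scl (\<theta> ^ (q * n)) zeta)"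
 have C0: "0 \<le> C" unfolding C using R by simp
 have eq: "convs (Lp b q (Suc n) v) (scl (\<theta> ^ (q * Suc n)) zeta) = convs (gl b v) (scl (\<theta> ^ q) ?\<psi>)"
  by (simp add: convs_append scl_convs scl_scl power_add)
 have tq: "0 < norm \<theta> ^ q" by simp
 have s0: "scl (\<theta> ^ q) ?\<psi> y = 0" if "norm \<theta> ^ q * (4 * 2 ^ b + R) < norm y" for y
 proof -
  have "4 * 2 ^ b + R < norm (y / \<theta> ^ q)"
   using that tq by (simp add: norm_divide norm_power pos_less_divide_eq mult.commute)
  thus ?thesis by (simp add: scl_def Suc.IH(2))
 qed
 have r: "norm \<theta> ^ q * (4 * 2 ^ b + R) \<le> 8 + R"
 proof -
  have "norm \<theta> ^ q * R \<le> 1 * R" using q R by (intro mult_right_mono) auto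
  thus ?thesis using b by (simp add: algebra_simps)
 qed
 { case 1
  let ?S = "{(c, c') \<in> {..<2^b} \<times> {..<2^b}. norm (z - of_nat c * v - of_nat c' * (\<theta> * v)) \<le> 8 + R}"
  let ?t = "norm \<theta> ^ q"
  have "(\<Sum>(c, c')\<in>{..<2^b} \<times> {..<2^b}. scl (\<theta> ^ q) ?\<psi> (z - of_nat c * v - of_nat c' * (\<theta> * v)))
    = (\<Sum>(c, c')\<in>?S. scl (\<theta> ^ q) ?\<psi> (z - of_nat c * v - of_nat c' * (\<theta> * v)))"
   using s0[OF order_le_less_trans[OF r]] by (intro sum.mono_neutral_right) (auto simp flip: not_less)
  also have "... \<le> (\<Sum>(c, c')\<in>?S. C ^ n * B / ?t^2)"
   by (intro sum_mono) (auto simp: scl_def norm_power intro!: divide_right_mono Suc.IH(1))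
  also have "... = real (card ?S) * (C ^ n * B / ?t^2)" by (simp add: case_prod_beta')
  also have "... \<le> C * (C ^ n * B / ?t^2)"
   unfolding C using th R C0 B by (intro mult_right_mono card_lattice v(1)) (auto simp: C[symmetric])
  finally have "convs (gl b v) (scl (\<theta> ^ q) ?\<psi>) z \<le> C * (C ^ n * B / ?t^2) / 4 ^ b"
   unfolding convs_gl by (rule divide_right_mono) simp
  also have "(4::real) ^ b = (2 ^ b)^2" by (simp add: power2_eq_square flip: power_mult_distrib)
  hence "C * (C ^ n * B / ?t^2) / 4 ^ b = C ^ Suc n * B / (?t * 2 ^ b)^2"
   by (simp add: power_mult_distrib)
  also have "... \<le> C ^ Suc n * B / 1"
   using b(1) C0 B by (intro divide_left_mono) (auto simp: one_le_power)
  finally show ?case unfolding eq by simp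
 next
  case 2
  show ?case unfolding eq
  proof (rule convs_supp[OF s0])
   have "norm \<theta> ^ q * (4 * 2 ^ b + R) \<le> 1/2 * (4 * 2 ^ b + R)"
    using q R by (intro mult_right_mono) (auto simp: add_nonneg_nonneg)
   thus "norm \<theta> ^ q * (4 * 2 ^ b + R) + sum_list (map norm (gl b v)) < norm z"
    using 2 sum_norm_gl[OF v(2), of b] R by simp
  qed }
qed

text \<open>The grid is spread so evenly that, by the supremum and area bounds, smoothing it by
  \<open>scl (\<theta> ^ s) zeta\<close> gains at most \<open>n * ln C\<close> plus a constant. By
  submodularity the same holds after convolution with \<open>X s\<close>, where this smoothing
  produces at least the entropy of \<open>rho s\<close>.\<close>

lemma ent_grid_ge:
 assumes th: "Im \<theta> \<noteq> 0" and v: "norm \<theta> \<le> norm v" "norm v \<le> 1"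
  and q: "norm \<theta> ^ q \<le> 1/2" and b: "1 \<le> norm \<theta> ^ q * 2 ^ b" "norm \<theta> ^ q * 2 ^ b \<le> 2"
  and B: "\<And>z. zeta z \<le> B" "0 < B" and R: "\<And>l z. R < norm z \<Longrightarrow> rho l z = 0" "0 < R"
  and C: "C = (2 * (8 + R) / (norm \<theta> * \<bar>Im \<theta>\<bar>) + 1) * (2 * (8 + R) / norm \<theta> + 1)"
 shows "h s - (ln B + ln (pi * (4 * 2 ^ b + 2 * R)^2)) - real n * ln C
  \<le> ent (convs (map ((*) (\<theta> ^ s)) (Lp b q n v)) (rho (s + q * n)))"
proof -
 let ?L = "Lp b q n v" and ?K = "q * n"
 let ?\<psi> = "convs ?L (rho ?K)"
 have d\<psi>: "dens ?\<psi>" by (rule dens_convs) simp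
 let ?\<phi> = "scl (\<theta> ^ s) ?\<psi>"
 have d\<phi>: "dens ?\<phi>" by (rule dens_scl[OF d\<psi>]) simp
 have C1: "1 \<le> C" unfolding C using R th by (intro mult_ge1_I) auto
 have z: "rho 0 = zeta" by (simp add: rho_def)
 have dz: "dens (scl (\<theta> ^ s) zeta)" by (rule dens_scl[OF zeta(1)]) simp
 have "?\<psi> z \<le> C ^ n * B" for z
 proof -
  have "?\<psi> = conv (X ?K) (convs ?L (scl (\<theta> ^ ?K) zeta))"
   using rho_add[of ?K 0] by (simp add: z conv_convs dens_scl zeta(1))
  moreover have "conv (X ?K) (convs ?L (scl (\<theta> ^ ?K) zeta)) z \<le> C ^ n * B"
   using R(1)[of _ 0] R(2) B
   by (intro conv_bounds sup_grid[OF th v q b _ _ _ _ C]) (auto intro!: densD(1) dens_convs dens_scl zeta(1) simp: z)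
  ultimately show ?thesis by simp
 qed
 hence "- ln (C ^ n * B) \<le> ent ?\<psi>" by (rule ent_ge_sup[OF d\<psi>])
 hence lo: "- (real n * ln C + ln B) + 2 * ln (norm (\<theta> ^ s)) \<le> ent ?\<phi>"
  using C1 B by (simp add: ent_scl d\<psi> ln_mult ln_realpow)
 let ?\<kappa> = "dm (scl (\<theta> ^ s) zeta)"
 have \<kappa>: "bprob ?\<kappa>" by (rule bprob_dm[OF dz])
 have up: "ent (conv ?\<kappa> ?\<phi>) \<le> ln (pi * (4 * 2 ^ b + 2 * R)^2) + 2 * ln (norm (\<theta> ^ s))"
 proof -
  have "conv ?\<kappa> ?\<phi> = scl (\<theta> ^ s) (conv (dm zeta) ?\<psi>)"
   by (rule scl_conv_dm[symmetric]) (auto simp: zeta(1) d\<psi>)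
  moreover have "ent (conv (dm zeta) ?\<psi>) \<le> ln (pi * (4 * 2 ^ b + 2 * R)^2)"
  proof (rule ent_le_area)
   show "dens (conv (dm zeta) ?\<psi>)" by (intro dens_conv bprob_dm zeta(1) d\<psi>)
   fix z :: complex assume "4 * 2 ^ b + 2 * R < norm z"
   thus "conv (dm zeta) ?\<psi> z = 0"
    using R(1)[of _ 0]
    by (intro conv_supp[where R = "R + 4 * 2 ^ b" and R' = R])
      (auto simp: z zeta(1) intro!: bprob_dm AE_dm_support convs_supp[OF R(1)] order_le_less_trans[OF add_left_mono[OF sum_norm_Lp[OF v(2) q]]])
  qed (use R in \<open>auto intro: add_pos_pos\<close>)
  ultimately show ?thesis by (simp add: ent_scl dens_conv bprob_dm zeta(1) d\<psi>)
 qed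
 have "ent ?\<phi> - ent (conv ?\<kappa> ?\<phi>) \<le> ent (conv (X s) ?\<phi>) - ent (conv ?\<kappa> (conv (X s) ?\<phi>))"
  by (rule ent_submod) (auto intro: \<kappa> d\<phi>)
 moreover have "h s \<le> ent (conv ?\<kappa> (conv (X s) ?\<phi>))"
 proof -
  have "conv ?\<kappa> (conv (X s) ?\<phi>) = conv (X s) (conv ?\<kappa> ?\<phi>)"
   by (rule conv_commute) (auto intro: \<kappa> densD(1)[OF d\<phi>])
  also have "conv ?\<kappa> ?\<phi> = conv (dm ?\<phi>) (scl (\<theta> ^ s) zeta)" by (rule conv_dm_swap[OF dz d\<phi>])
  also have "conv (X s) \<dots> = conv (dm ?\<phi>) (conv (X s) (scl (\<theta> ^ s) zeta))"
   by (rule conv_commute) (auto intro: bprob_dm d\<phi> densD(1)[OF dz])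
  also have "conv (X s) (scl (\<theta> ^ s) zeta) = rho s" using rho_add[of s 0] by (simp add: z)
  finally show ?thesis unfolding h_def by (simp add: ent_conv_ge bprob_dm d\<phi>)
 qed
 moreover have "convs (map ((*) (\<theta> ^ s)) ?L) (rho (s + ?K)) = conv (X s) ?\<phi>"
  by (simp add: rho_add scl_convs conv_convs dens_scl)
 ultimately show ?thesis using lo up by simp
qed

lemma js_nonneg: "0 \<le> js v l"
 unfolding js_def h_def by (simp add: ent_conv_ge bprob_pmf)

lemma js_power2: "js (2 ^ j * w) l \<le> 4 ^ j * js w l"
proof (induction j)
 case (Suc j)
 thus ?case using js_double[of "2 ^ j * w" l] by (simp add: mult.assoc)
qed simp

lemma sum_js_powers: "(\<Sum>j\<leftarrow>[0..<b]. js (2 ^ j * w) l) \<le> 4 ^ b * js w l"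
proof (induction b)
 case (Suc b)
 have "0 \<le> 4 ^ b * js w l" using js_nonneg[of w l] by simp
 moreover have "4 ^ Suc b * js w l = 4 * (4 ^ b * js w l)" by simp
 moreover have "(\<Sum>j\<leftarrow>[0..<Suc b]. js (2 ^ j * w) l) = (\<Sum>j\<leftarrow>[0..<b]. js (2 ^ j * w) l) + js (2 ^ b * w) l" by simp
 ultimately show ?case using Suc js_power2[of b w l] by linarith
qed (simp add: js_nonneg)

text \<open>Level \<open>i\<close> of the list consists of dyadic multiples of
  \<open>\<theta> ^ (q * i) * v\<close> and \<open>\<theta> ^ (q * i + 1) * v\<close>, hence two
  terms per level; the doublings cost the factor \<open>4 ^ b\<close>.\<close>

lemma sum_js_Lp:
 assumes "1 \<le> q" "\<And>m. m \<le> q * n \<Longrightarrow> js (\<theta> ^ (s + m) * v) T \<le> G m"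
 shows "(\<Sum>x\<leftarrow>Lp b q n v. js (\<theta> ^ s * x) T) \<le> 4 ^ b * (\<Sum>i<n. G (q * i) + G (q * i + 1))"
 using assms(2)
proof (induction n arbitrary: s G)
 case (Suc n)
 have "(\<Sum>x\<leftarrow>gl b v. js (\<theta> ^ s * x) T) \<le> 4 ^ b * js (\<theta> ^ s * v) T + 4 ^ b * js (\<theta> ^ (s + 1) * v) T"
  using sum_js_powers[where b = b and w = "\<theta> ^ s * v" and l = T] sum_js_powers[where b = b and w = "\<theta> ^ (s + 1) * v" and l = T]
  by (simp add: gl_def comp_def mult_ac)
 also have "... \<le> 4 ^ b * G 0 + 4 ^ b * G 1"
  using Suc.prems[of 0] Suc.prems[of 1] assms(1) by (intro add_mono mult_left_mono) auto
 finally have 1: "(\<Sum>x\<leftarrow>gl b v. js (\<theta> ^ s * x) T) \<le> 4 ^ b * (G 0 + G 1)" by (simp add: algebra_simps)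
 have "(\<Sum>x\<leftarrow>Lp b q n v. js (\<theta> ^ (s + q) * x) T) \<le> 4 ^ b * (\<Sum>i<n. G (q * i + q) + G (q * i + 1 + q))"
 proof (rule Suc.IH)
  fix m assume "m \<le> q * n"
  thus "js (\<theta> ^ (s + q + m) * v) T \<le> G (m + q)" using Suc.prems[of "m + q"] by (simp add: ac_simps)
 qed
 hence "(\<Sum>x\<leftarrow>map ((*) (\<theta> ^ q)) (Lp b q n v). js (\<theta> ^ s * x) T) \<le> 4 ^ b * (\<Sum>i<n. G (q * i + q) + G (q * i + 1 + q))"
  by (simp add: comp_def power_add mult_ac)
 moreover have "(\<Sum>i<Suc n. G (q * i) + G (q * i + 1)) = (G 0 + G 1) + (\<Sum>i<n. G (q * i + q) + G (q * i + 1 + q))"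
  by (subst sum.lessThan_Suc_shift) (simp add: algebra_simps)
 ultimately show ?case using 1 by (simp add: distrib_left)
qed simp

lemma h_diff_le: "s \<le> t \<Longrightarrow> h s - h t \<le> real (t - s) * e s"
proof (induction t rule: dec_induct)
 case (step t)
 have "h s - h (Suc t) = (h s - h t) + e t" by (simp add: e_def)
 also have "... \<le> real (t - s) * e s + e s" using step e_antimono[of s t] by auto
 finally show ?case using step by (simp add: Suc_diff_le algebra_simps)
qed simp

lemma h_diff_ge:
 assumes E: "\<And>l. E \<le> e l" and st: "s \<le> t" shows "real (t - s) * E \<le> h s - h t"
 using st
proof (induction t rule: dec_induct)
 case (step t)
 have "real (t - s) * E + E \<le> (h s - h t) + e t" using step E by (intro add_mono) auto
 also have "... = h s - h (Suc t)" by (simp add: e_def)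
 finally show ?case using step by (simp add: Suc_diff_le algebra_simps)
qed simp

text \<open>If fair choices at some scale were almost free, \<open>js_descent\<close> would make
  them almost free at all coarser scales of a long stretch, and \<open>n\<close> levels of grids
  would cost a bounded amount of entropy. By \<open>ent_grid_ge\<close> these grids restore all but
  \<open>n * ln C\<close> plus a constant of the entropy lost over \<open>q * n\<close> levels,
  which is at least \<open>q * n * E\<close>. For large \<open>q\<close> this is impossible.\<close>

lemma js_gap:
 assumes th: "Im \<theta> \<noteq> 0" and E: "0 < E" "\<And>l. E \<le> e l" "e \<longlonglongrightarrow> E"
 shows "\<exists>\<epsilon>>0. \<exists>r l0. \<forall>l\<ge>l0. \<forall>v. norm \<theta> ^ (l + 1) \<le> norm v \<longrightarrow> norm v \<le> norm \<theta> ^ l \<longrightarrow>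
      \<epsilon> \<le> js v (l + r) - js v (l - r)" (is "\<exists>\<epsilon>>0. \<exists>r l0. ?P \<epsilon> r l0")
proof (rule ccontr)
 assume neg: "\<not> ?thesis"
 obtain R where R: "0 < R" "\<And>l z. R < norm z \<Longrightarrow> rho l z = 0" using rho_supp by blast
 obtain B' where B': "\<And>z. \<bar>zeta z\<bar> \<le> B'" using densD(1)[OF zeta(1)] unfolding bsf_def by blast
 define B where "B = \<bar>B'\<bar> + 1"
 have B: "zeta z \<le> B" "0 < B" for z using B'[of z] by (auto simp: B_def)
 define C where "C = (2 * (8 + R) / (norm \<theta> * \<bar>Im \<theta>\<bar>) + 1) * (2 * (8 + R) / norm \<theta> + 1)"
 define u where "u = norm \<theta>"
 have u: "0 < u" "u < 1" using th1 by (auto simp: u_def)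
 \<comment> \<open>The order of choice matters: \<open>C\<close> is independent of \<open>q\<close>,
   so \<open>q\<close> can beat \<open>ln C\<close>. The constants \<open>b\<close>,
   \<open>C4\<close> and \<open>C5\<close> depend on \<open>q\<close>, and \<open>n\<close> comes
   last.\<close>
 obtain q where q: "1 \<le> q" "u ^ q \<le> 1/2" "ln C + 1 \<le> real q * E"
 proof -
  obtain q1 where q1: "u ^ q1 < 1/2" using real_arch_pow_inv[of "1/2" u] u by auto
  obtain q2 where q2: "(ln C + 1) / E < real q2" using reals_Archimedean2 by blast
  show thesis
  proof (rule that[of "max 1 (max q1 q2)"])
   have "u ^ (max 1 (max q1 q2)) \<le> u ^ q1" using u by (intro power_decreasing) auto
   thus "u ^ (max 1 (max q1 q2)) \<le> 1/2" using q1 by simp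
   have "ln C + 1 \<le> real q2 * E" using q2 E(1) by (simp add: pos_divide_less_eq)
   also have "real q2 * E \<le> real (max 1 (max q1 q2)) * E" using E(1) by (intro mult_right_mono) auto
   finally show "ln C + 1 \<le> real (max 1 (max q1 q2)) * E" .
  qed simp
 qed
 obtain b where b: "1 / u ^ q \<le> 2 ^ b" "2 ^ b \<le> 2 * (1 / u ^ q)"
 proof -
  have "0 < u ^ q" using u by simp
  hence "1 \<le> 1 / u ^ q" using q(2) by (simp add: pos_le_divide_eq)
  from ex_power2_between[OF this] show thesis using that by blast
 qed
 have b': "1 \<le> u ^ q * 2 ^ b" "u ^ q * 2 ^ b \<le> 2" using b u by (simp_all add: field_simps)
 define C5 where "C5 = ln B + ln (pi * (4 * 2 ^ b + 2 * R)^2)"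
 define C4 where "C4 = 4 ^ b * (4 / (1 - u) + 4)"
 obtain n where n: "C5 + C4 < real n" "1 \<le> n"
 proof -
  obtain n where "C5 + C4 < real n" using reals_Archimedean2 by blast
  thus thesis by (intro that[of "max 1 n"]) auto
 qed
 define K where "K = q * n"
 \<comment> \<open>Beyond \<open>l1\<close> the loss over a window of length \<open>2 * K\<close>
   exceeds \<open>2 * K * E\<close> by at most \<open>1 / n\<close>. This bounds the whole error of
   the descent, however many levels it passes.\<close>
 have "eventually (\<lambda>l. e l < E + 1 / real n / (2 * real K)) sequentially"
  using E(3) n q by (intro order_tendstoD) (auto simp: K_def)
 then obtain l1 where l1: "e l1 < E + 1 / real n / (2 * real K)" by (auto simp: eventually_sequentially)
 have l1': "2 * real K * (e l - E) \<le> 1 / real n" if "l1 \<le> l" for l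
 proof -
  have "2 * real K * (e l - E) \<le> 2 * real K * (1 / real n / (2 * real K))"
   using l1 e_antimono[OF that] by (intro mult_left_mono) auto
  also have "... = 1 / real n" using q n by (simp add: K_def)
  finally show ?thesis .
 qed
 have "\<not> ?P (1 / real n) K (l1 + 2 * K)"
 proof
  assume "?P (1 / real n) K (l1 + 2 * K)"
  moreover have "0 < 1 / real n" using n by simp
  ultimately show False using neg by blast
 qed
 then obtain l v where l: "l1 + 2 * K \<le> l" and v: "u ^ (l + 1) \<le> norm v" "norm v \<le> u ^ l"
  and small: "js v (l + K) - js v (l - K) < 1 / real n"
  unfolding u_def by (auto simp: not_le)
 define s where "s = l1 + K"
 define v0 where "v0 = v / \<theta> ^ l"
 have v0: "u \<le> norm v0" "norm v0 \<le> 1"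
  using v u by (auto simp: v0_def norm_divide norm_power u_def[symmetric] field_simps)
 \<comment> \<open>The window around level \<open>s + m\<close> reaches from below \<open>s\<close>
   to above \<open>s + K\<close> and contributes at most \<open>2 / n\<close>. What is present at
   level \<open>s\<close> is at most \<open>2 * u ^ m\<close>, because the shift has length at most
   \<open>u ^ (s + m)\<close>.\<close>
 have js: "js (\<theta> ^ (s + m) * v0) (s + K) \<le> 2 * u ^ m + 2 / real n" if m: "m \<le> K" for m
 proof -
  let ?w = "\<theta> ^ (s + m) * v0"
  define i where "i = l - (s + m)"
  have i: "s + m + i = l" using l m by (simp add: i_def s_def)
  hence w: "\<theta> ^ i * ?w = v" by (simp add: v0_def power_add[symmetric] add.commute mult.assoc[symmetric])
  have sm: "s + m - K + i = l - K" "s + m + K + i = l + K" using i by (auto simp: s_def)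
  have "js ?w (s + m + K) - js ?w (s + m - K) \<le> js v (l + K) - js v (l - K) +
    ((h (s + m - K) - h (s + m + K)) - (h (l - K) - h (l + K)))"
   using js_descent[of "s + m - K" "s + m + K" ?w i] unfolding sm w by simp
  moreover have "h (s + m - K) - h (s + m + K) \<le> 2 * real K * e (s + m - K)"
   using h_diff_le[of "s + m - K" "s + m + K"] by (simp add: s_def)
  moreover have "2 * real K * E \<le> h (l - K) - h (l + K)"
   using h_diff_ge[OF E(2), of "l - K" "l + K"] l by simp
  moreover have "2 * real K * (e (s + m - K) - E) \<le> 1 / real n" by (rule l1') (simp add: s_def)
  ultimately have "js ?w (s + m + K) - js ?w (s + m - K) \<le> 2 / real n"
   using small by (simp add: algebra_simps)
  moreover have "js ?w (s + K) \<le> js ?w (s + m + K)" by (rule js_mono) simp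
  moreover have "js ?w (s + m - K) \<le> js ?w s" using m by (intro js_mono) simp
  moreover have "js ?w s \<le> 2 * u ^ m"
  proof -
   have "js ?w s \<le> 2 * norm ?w / norm \<theta> ^ s" by (rule js_le)
   also have "... = 2 * (u ^ m * norm v0)" using u by (simp add: norm_mult norm_power u_def[symmetric] power_add)
   also have "... \<le> 2 * (u ^ m * 1)" using v0 u by (intro mult_left_mono) auto
   finally show ?thesis by simp
  qed
  ultimately show ?thesis by linarith
 qed
 let ?L = "Lp b q n v0"
 have "(\<Sum>x\<leftarrow>?L. js (\<theta> ^ s * x) (s + K)) \<le> 4 ^ b * (\<Sum>i<n. (2 * u ^ (q * i) + 2 / real n) + (2 * u ^ (q * i + 1) + 2 / real n))"
  by (rule sum_js_Lp[OF q(1)]) (use js in \<open>auto simp: K_def\<close>)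
 also have "... \<le> 4 ^ b * (\<Sum>i<n. 4 * u ^ i + 4 / real n)"
 proof (intro mult_left_mono sum_mono)
  fix i
  have "i \<le> q * i" using q(1) by simp
  hence "i \<le> q * i" "i \<le> q * i + 1" by linarith+
  hence "u ^ (q * i) \<le> u ^ i" "u ^ (q * i + 1) \<le> u ^ i" using u by (simp_all only: power_decreasing less_imp_le)
  thus "(2 * u ^ (q * i) + 2 / real n) + (2 * u ^ (q * i + 1) + 2 / real n) \<le> 4 * u ^ i + 4 / real n" by simp
 qed simp
 also have "(\<Sum>i<n. 4 * u ^ i + 4 / real n) = 4 * (\<Sum>i<n. u ^ i) + 4" using n by (simp add: sum.distrib sum_distrib_left)
 also have "4 ^ b * (4 * (\<Sum>i<n. u ^ i) + 4) \<le> C4"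
 proof -
  have "(\<Sum>i<n. u ^ i) \<le> 1 / (1 - u)"
  proof -
   have "(\<Sum>i<n. u ^ i) = (1 - u ^ n) / (1 - u)" using u by (simp add: sum_gp_strict)
   also have "... \<le> 1 / (1 - u)" using u by (intro divide_right_mono) auto
   finally show ?thesis .
  qed
  thus ?thesis unfolding C4_def by (intro mult_left_mono) auto
 qed
 finally have cost: "(\<Sum>x\<leftarrow>?L. js (\<theta> ^ s * x) (s + K)) \<le> C4" .
 have "h s - C5 - real n * ln C \<le> ent (convs (map ((*) (\<theta> ^ s)) ?L) (rho (s + K)))"
  unfolding C5_def K_def using v0 q b' B R
  by (intro ent_grid_ge[OF th _ _ _ _ _ _ _ _ _ C_def]) (auto simp: u_def)
 also have "... \<le> h (s + K) + (\<Sum>x\<leftarrow>?L. js (\<theta> ^ s * x) (s + K))"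
  using ent_convs_le[of "rho (s + K)" "map ((*) (\<theta> ^ s)) ?L"] by (simp add: comp_def js_def h_def)
 also have "... \<le> h (s + K) + C4" using cost by simp
 also have "h (s + K) \<le> h s - real K * E" using h_diff_ge[OF E(2), of s "s + K"] by simp
 finally have "real n * (real q * E) \<le> C5 + C4 + real n * ln C" by (simp add: K_def algebra_simps)
 moreover have "real n * (ln C + 1) \<le> real n * (real q * E)" using q by (intro mult_left_mono) auto
 ultimately show False using n by (simp add: algebra_simps)
qed

end

section \<open>Masses of balls\<close>

definition ex :: "complex pmf \<Rightarrow> (complex \<Rightarrow> real) \<Rightarrow> real" where
 "ex \<beta> f = (\<Sum>y\<in>set_pmf \<beta>. pmf \<beta> y * f y)"

definition bm :: "complex pmf \<Rightarrow> real \<Rightarrow> complex \<Rightarrow> real" where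
 "bm \<beta> r y = (\<Sum>w\<in>{w \<in> set_pmf \<beta>. norm (w - y) \<le> r}. pmf \<beta> w)"

lemma ex_mono: "(\<And>y. y \<in> set_pmf \<beta> \<Longrightarrow> f y \<le> g y) \<Longrightarrow> ex \<beta> f \<le> ex \<beta> g"
 unfolding ex_def by (intro sum_mono mult_left_mono) auto

lemma ex_const: "finite (set_pmf \<beta>) \<Longrightarrow> ex \<beta> (\<lambda>_. c) = c"
 unfolding ex_def by (simp add: sum_pmf_eq_1 flip: sum_distrib_right)

lemma ex_add: "ex \<beta> (\<lambda>y. f y + g y) = ex \<beta> f + ex \<beta> g"
 unfolding ex_def by (simp add: distrib_left sum.distrib)

lemma ex_diff: "ex \<beta> (\<lambda>y. f y - g y) = ex \<beta> f - ex \<beta> g"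
 unfolding ex_def by (simp add: right_diff_distrib sum_subtractf)

lemma ex_cmult: "ex \<beta> (\<lambda>y. c * f y) = c * ex \<beta> f"
 unfolding ex_def by (simp add: sum_distrib_left mult_ac)

lemma bm_nonneg: "0 \<le> bm \<beta> r y" unfolding bm_def by (intro sum_nonneg) auto

lemma bm_mono:
 assumes "finite (set_pmf \<beta>)" "r + norm (y - y') \<le> r'" shows "bm \<beta> r y \<le> bm \<beta> r' y'"
 unfolding bm_def
proof (rule sum_mono2)
 show "{w \<in> set_pmf \<beta>. norm (w - y) \<le> r} \<subseteq> {w \<in> set_pmf \<beta>. norm (w - y') \<le> r'}"
 proof clarify
  fix w assume "norm (w - y) \<le> r"
  moreover have "norm (w - y') \<le> norm (w - y) + norm (y - y')"
   using norm_triangle_ineq[of "w - y" "y - y'"] by simp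
  ultimately show "norm (w - y') \<le> r'" using assms(2) by linarith
 qed
qed (use assms in auto)

lemma pmf_le_bm: assumes "finite (set_pmf \<beta>)" "y \<in> set_pmf \<beta>" "0 \<le> r" shows "pmf \<beta> y \<le> bm \<beta> r y"
 unfolding bm_def using assms by (intro member_le_sum) auto

lemma bm_pos: "finite (set_pmf \<beta>) \<Longrightarrow> y \<in> set_pmf \<beta> \<Longrightarrow> 0 \<le> r \<Longrightarrow> 0 < bm \<beta> r y"
 using pmf_le_bm[of \<beta> y r] pmf_positive[of y \<beta>] by linarith

lemma bm_le_1: assumes "finite (set_pmf \<beta>)" shows "bm \<beta> r y \<le> 1"
proof -
 have "bm \<beta> r y \<le> (\<Sum>w\<in>set_pmf \<beta>. pmf \<beta> w)" unfolding bm_def using assms by (intro sum_mono2) auto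
 thus ?thesis using assms by (simp add: sum_pmf_eq_1)
qed

text \<open>Squares of side \<open>r / 2\<close>, so that two points of one cell are within distance
  \<open>r\<close> (\<open>cell_eq\<close>).\<close>

definition cell :: "real \<Rightarrow> complex \<Rightarrow> int \<times> int" where
 "cell r y = (\<lfloor>2 * Re y / r\<rfloor>, \<lfloor>2 * Im y / r\<rfloor>)"

lemma abs_diff_floor: "\<lfloor>a\<rfloor> = \<lfloor>b\<rfloor> \<Longrightarrow> \<bar>a - b\<bar> < (1::real)" by linarith

lemma cell_eq: assumes "0 < r" "cell r y = cell r y'" shows "norm (y - y') \<le> r"
proof -
 have "\<bar>2 * Re y / r - 2 * Re y' / r\<bar> < 1" "\<bar>2 * Im y / r - 2 * Im y' / r\<bar> < 1"
  using assms(2) unfolding cell_def by (auto intro: abs_diff_floor)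
 moreover have *: "\<bar>s - t\<bar> < r / 2" if "\<bar>2 * s / r - 2 * t / r\<bar> < 1" for s t :: real
 proof -
  have "2 * s / r - 2 * t / r = (2 / r) * (s - t)" by (simp add: algebra_simps diff_divide_distrib)
  hence "\<bar>2 * s / r - 2 * t / r\<bar> = 2 / r * \<bar>s - t\<bar>" by (simp only: abs_mult) (use assms(1) in simp)
  thus ?thesis using that assms(1) by (simp add: field_simps)
 qed
 ultimately have "\<bar>Re (y - y')\<bar> < r / 2" "\<bar>Im (y - y')\<bar> < r / 2" by simp_all
 thus ?thesis using cmod_le[of "y - y'"] by linarith
qed

lemma card_cells:
 assumes r: "0 < r" and K: "0 \<le> K" and A: "\<And>w. w \<in> A \<Longrightarrow> norm (w - y) \<le> K * r"
 shows "finite (cell r ` A)" "real (card (cell r ` A)) \<le> (4 * K + 2)^2"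
proof -
 define I where "I t = {\<lfloor>2 * t / r - 2 * K\<rfloor>..\<lfloor>2 * t / r + 2 * K\<rfloor>}" for t :: real
 have sub: "cell r ` A \<subseteq> I (Re y) \<times> I (Im y)"
 proof (rule image_subsetI)
  fix w assume w: "w \<in> A"
  have *: "\<lfloor>2 * s / r\<rfloor> \<in> I t" if "\<bar>s - t\<bar> \<le> K * r" for s t :: real
  proof -
   have "2 * s / r \<le> (2 * t + 2 * K * r) / r" "(2 * t - 2 * K * r) / r \<le> 2 * s / r"
    using that r by (auto simp: abs_le_iff intro!: divide_right_mono)
   hence "2 * s / r \<le> 2 * t / r + 2 * K" "2 * t / r - 2 * K \<le> 2 * s / r"
    using r by (simp_all add: add_divide_distrib diff_divide_distrib)
   thus ?thesis unfolding I_def by (auto intro: floor_mono)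
  qed
  have "\<bar>Re w - Re y\<bar> \<le> K * r" "\<bar>Im w - Im y\<bar> \<le> K * r"
   using A[OF w] abs_Re_le_cmod[of "w - y"] abs_Im_le_cmod[of "w - y"] by auto
  thus "cell r w \<in> I (Re y) \<times> I (Im y)" unfolding cell_def using * by blast
 qed
 have fin: "finite (I t)" for t by (simp add: I_def)
 have card: "real (card (I t)) \<le> 4 * K + 2" for t
  unfolding I_def using K by simp linarith
 show "finite (cell r ` A)" by (rule finite_subset[OF sub]) (use fin in auto)
 have "card (cell r ` A) \<le> card (I (Re y) \<times> I (Im y))" by (rule card_mono[OF _ sub]) (use fin in auto)
 hence "real (card (cell r ` A)) \<le> real (card (I (Re y))) * real (card (I (Im y)))"
  by (simp add: card_cartesian_product flip: of_nat_mult)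
 also have "... \<le> (4 * K + 2) * (4 * K + 2)" using card K by (intro mult_mono) auto
 finally show "real (card (cell r ` A)) \<le> (4 * K + 2)^2" by (simp add: power2_eq_square)
qed

text \<open>Points of one cell see each other at distance \<open>r\<close>, so a cell contributes at most \<open>1\<close> to the
 sum of \<open>pmf y / bm r y\<close>.\<close>

lemma ex_bm_ratio:
 assumes fin: "finite (set_pmf \<beta>)" and r: "0 < r" and K: "0 \<le> K"
 shows "ex \<beta> (\<lambda>y. bm \<beta> (K * r) y / bm \<beta> r y) \<le> (4 * K + 2)^2"
proof -
 let ?W = "set_pmf \<beta>"
 define A where "A y = {w \<in> ?W. norm (w - y) \<le> K * r}" for y
 have sym: "w \<in> A y \<longleftrightarrow> y \<in> A w" if "w \<in> ?W" "y \<in> ?W" for w y using that by (simp add: A_def norm_minus_commute)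
 have finA: "finite (A y)" for y using fin by (simp add: A_def)
 have "ex \<beta> (\<lambda>y. bm \<beta> (K * r) y / bm \<beta> r y) = (\<Sum>y\<in>?W. \<Sum>w\<in>?W. if w \<in> A y then pmf \<beta> y * (pmf \<beta> w / bm \<beta> r y) else 0)"
  unfolding ex_def
 proof (rule sum.cong[OF refl])
  fix y assume "y \<in> ?W"
  have "(\<Sum>w\<in>?W. if w \<in> A y then pmf \<beta> y * (pmf \<beta> w / bm \<beta> r y) else 0) = (\<Sum>w\<in>?W \<inter> A y. pmf \<beta> y * (pmf \<beta> w / bm \<beta> r y))"
   by (simp only: sum.inter_restrict[OF fin])
  also have "?W \<inter> A y = A y" by (auto simp: A_def)
  also have "(\<Sum>w\<in>A y. pmf \<beta> y * (pmf \<beta> w / bm \<beta> r y)) = pmf \<beta> y * ((\<Sum>w\<in>A y. pmf \<beta> w) / bm \<beta> r y)"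
   by (simp only: sum_distrib_left sum_divide_distrib)
  also have "(\<Sum>w\<in>A y. pmf \<beta> w) = bm \<beta> (K * r) y" by (simp only: A_def bm_def)
  finally show "pmf \<beta> y * (bm \<beta> (K * r) y / bm \<beta> r y) = (\<Sum>w\<in>?W. if w \<in> A y then pmf \<beta> y * (pmf \<beta> w / bm \<beta> r y) else 0)" ..
 qed
 also have "... = (\<Sum>w\<in>?W. \<Sum>y\<in>?W. if y \<in> A w then pmf \<beta> w * (pmf \<beta> y / bm \<beta> r y) else 0)"
  by (subst sum.swap) (intro sum.cong refl, auto simp: sym mult_ac)
 also have "... = (\<Sum>w\<in>?W. pmf \<beta> w * (\<Sum>y\<in>A w. pmf \<beta> y / bm \<beta> r y))"
 proof (rule sum.cong[OF refl])
  fix w assume "w \<in> ?W"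
  have "(\<Sum>y\<in>?W. if y \<in> A w then pmf \<beta> w * (pmf \<beta> y / bm \<beta> r y) else 0) = (\<Sum>y\<in>?W \<inter> A w. pmf \<beta> w * (pmf \<beta> y / bm \<beta> r y))"
   by (simp only: sum.inter_restrict[OF fin])
  also have "?W \<inter> A w = A w" by (auto simp: A_def)
  finally show "(\<Sum>y\<in>?W. if y \<in> A w then pmf \<beta> w * (pmf \<beta> y / bm \<beta> r y) else 0) = pmf \<beta> w * (\<Sum>y\<in>A w. pmf \<beta> y / bm \<beta> r y)"
   by (simp add: sum_distrib_left)
 qed
 also have "... \<le> (\<Sum>w\<in>?W. pmf \<beta> w * (4 * K + 2)^2)"
 proof (intro sum_mono mult_left_mono)
  fix w assume "w \<in> ?W"
  have "(\<Sum>y\<in>A w. pmf \<beta> y / bm \<beta> r y) = (\<Sum>c\<in>cell r ` A w. \<Sum>y\<in>{y \<in> A w. cell r y = c}. pmf \<beta> y / bm \<beta> r y)"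
   by (rule sum.image_gen[OF finA])
  also have "... \<le> (\<Sum>c\<in>cell r ` A w. 1)"
  proof (rule sum_mono)
   fix c assume "c \<in> cell r ` A w"
   let ?B = "{y \<in> A w. cell r y = c}"
   show "(\<Sum>y\<in>?B. pmf \<beta> y / bm \<beta> r y) \<le> 1"
   proof (cases "?B = {}")
    case False
    have finB: "finite ?B" using finA by simp
    have pos: "0 < (\<Sum>y\<in>?B. pmf \<beta> y)" using False finB
     by (intro sum_pos) (auto simp: A_def pmf_positive)
    have "(\<Sum>y\<in>?B. pmf \<beta> y / bm \<beta> r y) \<le> (\<Sum>y\<in>?B. pmf \<beta> y / (\<Sum>y\<in>?B. pmf \<beta> y))"
    proof (intro sum_mono divide_left_mono)
     fix y assume y: "y \<in> ?B"
     show le: "(\<Sum>y\<in>?B. pmf \<beta> y) \<le> bm \<beta> r y"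
      unfolding bm_def using fin y cell_eq[OF r] by (intro sum_mono2) (auto simp: A_def)
     show "0 < bm \<beta> r y * (\<Sum>y\<in>?B. pmf \<beta> y)" using pos le by (intro mult_pos_pos) auto
    qed simp
    also have "... = 1" using pos by (simp flip: sum_divide_distrib)
    finally show ?thesis .
   next
    case True thus ?thesis by (simp only: sum.empty)
   qed
  qed
  also have "... = real (card (cell r ` A w))" by simp
  also have "... \<le> (4 * K + 2)^2" by (rule card_cells[OF r K, where y = w]) (auto simp: A_def)
  finally show "(\<Sum>y\<in>A w. pmf \<beta> y / bm \<beta> r y) \<le> (4 * K + 2)^2" .
 qed simp
 also have "... = (4 * K + 2)^2" using ex_const[OF fin, of "(4 * K + 2)^2"] by (simp add: ex_def)
 finally show ?thesis .
qed

text \<open>Enlarging the radius by a fixed factor raises the mean log mass by a bounded amount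
  whatever the law, since the logarithm of a ratio is below the ratio and \<open>ex_bm_ratio\<close>
  applies.\<close>

lemma ex_ln_ratio_le:
 assumes fin: "finite (set_pmf \<beta>)" and r: "0 < r" and K: "0 < K"
 shows "ex \<beta> (\<lambda>y. ln (bm \<beta> (K * r) y)) \<le> ex \<beta> (\<lambda>y. ln (bm \<beta> r y)) + (4 * K + 2)^2"
proof -
 have "ex \<beta> (\<lambda>y. ln (bm \<beta> (K * r) y) - ln (bm \<beta> r y)) \<le> ex \<beta> (\<lambda>y. bm \<beta> (K * r) y / bm \<beta> r y)"
 proof (rule ex_mono)
  fix y assume y: "y \<in> set_pmf \<beta>"
  have p: "0 < bm \<beta> (K * r) y" "0 < bm \<beta> r y" using fin y r K by (auto intro!: bm_pos)
  hence "ln (bm \<beta> (K * r) y / bm \<beta> r y) \<le> bm \<beta> (K * r) y / bm \<beta> r y - 1" by (intro ln_le_minus_one) auto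
  thus "ln (bm \<beta> (K * r) y) - ln (bm \<beta> r y) \<le> bm \<beta> (K * r) y / bm \<beta> r y"
   using p by (simp add: ln_div)
 qed
 thus ?thesis using ex_bm_ratio[OF fin r, of K] K by (simp add: ex_diff)
qed

text \<open>Writing \<open>ln (1 / x) = 2 * ln (1 / sqrt x)\<close> gives the bound
  \<open>2 * (1 - x) / sqrt x\<close>, which the arithmetic-geometric mean inequality splits with
  weight \<open>A\<close>.\<close>

lemma ln_inverse_le:
 fixes x D A :: real
 assumes x: "0 < x" "x \<le> 1" and D: "0 < D" and A: "0 < A"
 shows "ln (1 / x) \<le> A * ((1 - x) / D) + (D / x) / A"
proof -
 define y where "y = sqrt x"
 have y: "0 < y" "y \<le> 1" "y^2 = x" using x by (auto simp: y_def)
 have "ln (1 / x) = 2 * ln (1 / y)" using y by (simp add: y(3)[symmetric] ln_div ln_realpow)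
 also have "... \<le> 2 * (1 / y - 1)" using y by (intro mult_left_mono ln_le_minus_one) auto
 also have "1 / y - 1 = (1 - y) / y" using y by (simp add: field_simps)
 also have "(1 - y) / y \<le> (1 - x) / y" using y by (intro divide_right_mono) (auto simp: power2_eq_square mult_left_le_one_le simp flip: y(3))
 also have "2 * ((1 - x) / y) \<le> A * ((1 - x) / D) + (D / x) / A"
 proof -
  define p q where "p = A * ((1 - x) / D)" and "q = (D / x) / A * (1 - x)"
  have "p * q = ((1 - x) / y)^2" using A D y x by (simp add: p_def q_def power_divide y(3)) (simp add: field_simps power2_eq_square)
  moreover have "0 \<le> p" "0 \<le> q" "0 \<le> (1 - x) / y" using A D x y by (auto simp: p_def q_def)
  moreover have "2 * sqrt (p * q) \<le> p + q" using calculation(2,3) arith_geo_mean_sqrt[of p q] by simp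
  moreover have "sqrt (((1 - x) / y)^2) = (1 - x) / y"
   using calculation(4) by (simp only: real_sqrt_abs abs_of_nonneg)
  ultimately have "2 * ((1 - x) / y) \<le> p + q" by (simp only:)
  moreover have "q \<le> (D / x) / A" unfolding q_def using A D x by (intro mult_left_le) auto
  ultimately show ?thesis by (simp add: p_def)
 qed
 finally show ?thesis by simp
qed

text \<open>A logarithmic drop of mass is traded for the linear drop that
  \<open>scale_mass_le\<close> can bound. The rest is a mean ratio of masses, bounded by
  \<open>ex_bm_ratio\<close> and made small by a large \<open>A\<close>.\<close>

lemma ex_ln_drop_le:
 assumes fin: "finite (set_pmf \<beta>)" and r: "0 < r2" "r2 \<le> r1" and A: "0 < A"
 shows "ex \<beta> (\<lambda>y. ln (bm \<beta> r1 y)) - ex \<beta> (\<lambda>y. ln (bm \<beta> r2 y))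
  \<le> A * ex \<beta> (\<lambda>y. (bm \<beta> r1 y - bm \<beta> r2 y) / bm \<beta> (2 * r1) y) + (8 * (r1 / r2) + 2)^2 / A"
proof -
 have "ex \<beta> (\<lambda>y. ln (bm \<beta> r1 y) - ln (bm \<beta> r2 y))
  \<le> ex \<beta> (\<lambda>y. A * ((bm \<beta> r1 y - bm \<beta> r2 y) / bm \<beta> (2 * r1) y) + (1 / A) * (bm \<beta> (2 * r1 / r2 * r2) y / bm \<beta> r2 y))"
 proof (rule ex_mono)
  fix y assume y: "y \<in> set_pmf \<beta>"
  have p: "0 < bm \<beta> r1 y" "0 < bm \<beta> r2 y" "0 < bm \<beta> (2 * r1) y" using fin y r by (auto intro!: bm_pos)
  have le: "bm \<beta> r2 y \<le> bm \<beta> r1 y" by (rule bm_mono[OF fin]) (use r in auto)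
  have "ln (1 / (bm \<beta> r2 y / bm \<beta> r1 y)) \<le> A * ((1 - bm \<beta> r2 y / bm \<beta> r1 y) / (bm \<beta> (2 * r1) y / bm \<beta> r1 y))
    + ((bm \<beta> (2 * r1) y / bm \<beta> r1 y) / (bm \<beta> r2 y / bm \<beta> r1 y)) / A"
   using p le A by (intro ln_inverse_le) auto
  also have "(1 - bm \<beta> r2 y / bm \<beta> r1 y) / (bm \<beta> (2 * r1) y / bm \<beta> r1 y) = (bm \<beta> r1 y - bm \<beta> r2 y) / bm \<beta> (2 * r1) y"
   using p by (simp add: field_simps)
  also have "(bm \<beta> (2 * r1) y / bm \<beta> r1 y) / (bm \<beta> r2 y / bm \<beta> r1 y) = bm \<beta> (2 * r1) y / bm \<beta> r2 y"
   using p by simp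
  finally show "ln (bm \<beta> r1 y) - ln (bm \<beta> r2 y) \<le> A * ((bm \<beta> r1 y - bm \<beta> r2 y) / bm \<beta> (2 * r1) y) + (1 / A) * (bm \<beta> (2 * r1 / r2 * r2) y / bm \<beta> r2 y)"
   using p r by (simp add: ln_div mult.commute)
 qed
 also have "... = A * ex \<beta> (\<lambda>y. (bm \<beta> r1 y - bm \<beta> r2 y) / bm \<beta> (2 * r1) y) + (1 / A) * ex \<beta> (\<lambda>y. bm \<beta> (2 * r1 / r2 * r2) y / bm \<beta> r2 y)"
  unfolding ex_add ex_cmult ..
 also have "... \<le> A * ex \<beta> (\<lambda>y. (bm \<beta> r1 y - bm \<beta> r2 y) / bm \<beta> (2 * r1) y) + (1 / A) * (4 * (2 * r1 / r2) + 2)^2"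
  using A r by (intro add_left_mono mult_left_mono ex_bm_ratio fin) auto
 finally show ?thesis by (simp add: ex_diff)
qed

definition bp :: "complex \<Rightarrow> complex \<Rightarrow> complex pmf" where
 "bp w w' = map_pmf (\<lambda>b. if b then w' else w) (bernoulli_pmf (1/2))"

lemma finite_bp[simp]: "finite (set_pmf (bp w w'))" by (simp add: bp_def)

lemma conv_bp: "conv (bp w w') f z = (f (z - w) + f (z - w')) / 2"
 by (simp add: bp_def conv_map_pmf)

lemma conv_bp_hp: "conv (bp w w') f = (\<lambda>z. conv (hp (w' - w)) f (z - w))"
 by (simp add: fun_eq_iff conv_bp conv_hp)

context ssys begin

text \<open>Splitting a symmetric part \<open>g\<close> of the product weights into pairs of points and leaving the
 rest on the diagonal writes \<open>X k\<close> as a mixture of two-point measures.\<close>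

lemma pair_entropy:
 fixes g :: "complex \<Rightarrow> complex \<Rightarrow> real"
 assumes g: "\<And>w w'. 0 \<le> g w w'" "\<And>w w'. g w w' = g w' w"
  and row: "\<And>w. w \<in> set_pmf (X k) \<Longrightarrow> (\<Sum>w'\<in>set_pmf (X k). g w w') \<le> pmf (X k) w"
  and st: "s \<le> t"
 shows "(\<Sum>w\<in>set_pmf (X k). \<Sum>w'\<in>set_pmf (X k). g w w' * (js ((w' - w) / \<theta> ^ k) t - js ((w' - w) / \<theta> ^ k) s))
  \<le> (h s - h t) - (h (k + s) - h (k + t))"
proof -
 let ?W = "set_pmf (X k)"
 define p where "p = pmf (X k)"
 define G where "G w w' = g w w' + (if w = w' then p w - (\<Sum>w'\<in>?W. g w w') else 0)" for w w'
 let ?G = "\<lambda>i. G (fst i) (snd i)" and ?v = "\<lambda>i. (snd i - fst i) / \<theta> ^ k"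
 define \<phi> where "\<phi> n = scl (\<theta> ^ k) (rho n)" for n
 define F where "F i n = conv (bp (fst i) (snd i)) (\<phi> n)" for i n
 have d\<phi>: "dens (\<phi> n)" for n unfolding \<phi>_def by (rule dens_scl) auto
 have n\<phi>: "\<phi> n = conv (noise (n + k)) (\<phi> (Suc n))" for n
  unfolding \<phi>_def
 proof (induction k)
  case 0 thus ?case using rho_noise[of n] by (simp add: scl_1)
 next
  case (Suc k)
  have "scl (\<theta> ^ Suc k) (rho n) = scl \<theta> (scl (\<theta> ^ k) (rho n))" by (simp add: scl_scl)
  also have "... = scl \<theta> (conv (noise (n + k)) (scl (\<theta> ^ k) (rho (Suc n))))" unfolding Suc ..
  also have "... = conv (noise (Suc (n + k))) (scl \<theta> (scl (\<theta> ^ k) (rho (Suc n))))"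
   by (intro scl_noise dens_scl) auto
  finally show ?case by (simp add: scl_scl)
 qed
 have rowG: "(\<Sum>w'\<in>?W. G w w') = p w" if "w \<in> ?W" for w
  using that by (simp add: G_def sum.distrib sum.delta')
 have G0: "0 \<le> G w w'" if "w \<in> ?W" for w w'
  using g row[OF that] by (auto simp: G_def p_def)
 have symG: "G w w' = G w' w" for w w' using g(2)[of w w'] by (auto simp: G_def)
 have rowF: "(\<Sum>i\<in>?W \<times> ?W. ?G i * c) = c" for c
 proof -
  have "(\<Sum>i\<in>?W \<times> ?W. ?G i) = (\<Sum>w\<in>?W. \<Sum>w'\<in>?W. G w w')"
   by (simp add: sum.cartesian_product case_prod_beta')
  also have "... = 1" by (simp add: rowG p_def sum_pmf_eq_1)
  finally show ?thesis by (simp flip: sum_distrib_right)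
 qed
 have mix: "mixf (?W \<times> ?W) ?G (\<lambda>i. F i n) = rho (k + n)" for n
 proof
  fix z
  let ?S = "\<Sum>w\<in>?W. \<Sum>w'\<in>?W. G w w' * \<phi> n (z - w) / 2"
  have "mixf (?W \<times> ?W) ?G (\<lambda>i. F i n) z
    = (\<Sum>w\<in>?W. \<Sum>w'\<in>?W. G w w' * \<phi> n (z - w) / 2 + G w w' * \<phi> n (z - w') / 2)"
   by (simp add: mixf_def F_def conv_bp sum.cartesian_product case_prod_beta' distrib_left add_divide_distrib)
  also have "... = ?S + (\<Sum>w\<in>?W. \<Sum>w'\<in>?W. G w w' * \<phi> n (z - w') / 2)"
   by (simp add: sum.distrib)
  also have "(\<Sum>w\<in>?W. \<Sum>w'\<in>?W. G w w' * \<phi> n (z - w') / 2) = ?S"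
   by (subst sum.swap) (simp add: symG)
  also have "?S + ?S
    = (\<Sum>w\<in>?W. (\<Sum>w'\<in>?W. G w w') * \<phi> n (z - w))"
   by (simp add: sum_distrib_right flip: sum.distrib)
  also have "... = conv (X k) (\<phi> n) z" by (simp add: conv_pmf rowG p_def)
  finally show "mixf (?W \<times> ?W) ?G (\<lambda>i. F i n) z = rho (k + n) z"
   by (simp add: rho_add \<phi>_def)
 qed
 have entF: "ent (F i n) = js (?v i) n + (h n + 2 * ln (norm (\<theta> ^ k)))" for i n
 proof -
  have d: "dens (conv (hp (snd i - fst i)) (\<phi> n))" by (intro dens_conv bprob_pmf d\<phi>) simp
  have "ent (F i n) = ent (conv (hp (snd i - fst i)) (\<phi> n))"
   unfolding F_def conv_bp_hp by (rule ent_shift) (use densD[OF d] in auto)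
  also have "conv (hp (snd i - fst i)) (\<phi> n) = scl (\<theta> ^ k) (conv (hp (?v i)) (rho n))"
   by (simp add: \<phi>_def scl_conv_pmf map_hp)
  also have "ent \<dots> = ent (conv (hp (?v i)) (rho n)) + 2 * ln (norm (\<theta> ^ k))"
   by (intro ent_scl dens_conv bprob_pmf) auto
  finally show ?thesis by (simp add: js_def)
 qed
 have "(\<Sum>i\<in>?W \<times> ?W. ?G i * (ent (F i t) - ent (F i s)))
  \<le> ent (mixf (?W \<times> ?W) ?G (\<lambda>i. F i t)) - ent (mixf (?W \<times> ?W) ?G (\<lambda>i. F i s))"
 proof (rule ent_mix_chain[where M = "\<lambda>n. noise (n + k)"])
  show "(\<Sum>i\<in>?W \<times> ?W. ?G i) = 1" using rowF[of 1] by simp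
  show "dens (F i n)" for i n unfolding F_def by (intro dens_conv bprob_pmf d\<phi>) simp
  show "F i n = conv (noise (n + k)) (F i (Suc n))" for i n
   unfolding F_def by (subst n\<phi>, rule conv_commute) (auto intro!: bprob_pmf densD(1)[OF d\<phi>])
 qed (use G0 st in auto)
 also have "... = h (k + t) - h (k + s)" unfolding mix by (simp add: h_def)
 finally have "(\<Sum>i\<in>?W \<times> ?W. ?G i * (js (?v i) t - js (?v i) s)
   + ?G i * (h t - h s)) \<le> h (k + t) - h (k + s)"
  unfolding entF by (simp add: algebra_simps)
 hence "(\<Sum>i\<in>?W \<times> ?W. ?G i * (js (?v i) t - js (?v i) s))
   \<le> (h s - h t) - (h (k + s) - h (k + t))"
  unfolding sum.distrib rowF by simp
 moreover have "js 0 n = 0" for n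
 proof -
  have "conv (hp 0) (rho n) = rho n" by (simp add: fun_eq_iff conv_hp)
  thus ?thesis by (simp add: js_def h_def)
 qed
 hence "G w w' * (js ((w' - w) / \<theta> ^ k) t - js ((w' - w) / \<theta> ^ k) s) = g w w' * (js ((w' - w) / \<theta> ^ k) t - js ((w' - w) / \<theta> ^ k) s)" for w w'
  by (cases "w = w'") (auto simp: G_def)
 ultimately show ?thesis by (simp add: sum.cartesian_product case_prod_beta')
qed

lemma scale_mass_le:
 assumes gap: "\<And>v. norm \<theta> ^ (j + 1) \<le> norm v \<Longrightarrow> norm v \<le> norm \<theta> ^ j \<Longrightarrow> \<epsilon> \<le> js v (j + r) - js v (j - r)" "0 < \<epsilon>"
  and E: "\<And>l. E \<le> e l"
 shows "ex (X k) (\<lambda>w. (bm (X k) (norm \<theta> ^ (k + j)) w - bm (X k) (norm \<theta> ^ (k + j + 1)) w) / bm (X k) (2 * norm \<theta> ^ (k + j)) w)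
  \<le> 4 * real r / \<epsilon> * (e (j - r) - E)"
proof -
 let ?W = "set_pmf (X k)"
 let ?d = "\<lambda>w w'. js ((w' - w) / \<theta> ^ k) (j + r) - js ((w' - w) / \<theta> ^ k) (j - r)"
 define p where "p = pmf (X k)"
 define r1 r2 where "r1 = norm \<theta> ^ (k + j)" and "r2 = norm \<theta> ^ (k + j + 1)"
 have rr: "0 < r2" "r2 \<le> r1" using th1 by (auto simp: r1_def r2_def mult_left_le_one_le)
 define N where "N w w' \<longleftrightarrow> r2 < norm (w - w') \<and> norm (w - w') \<le> r1" for w w' :: complex
 define S where "S = bm (X k) r1"
 have S: "0 < S w" if "w \<in> ?W" for w unfolding S_def using that rr by (intro bm_pos) auto
 have S0: "0 \<le> S w" for w unfolding S_def by (rule bm_nonneg)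
 define g where "g w w' = (if N w w' then p w * p w' / (S w + S w') else 0)" for w w'
 have g: "0 \<le> g w w'" "g w w' = g w' w" for w w'
  using S0 by (auto simp: g_def p_def N_def norm_minus_commute ac_simps)
 have near: "(\<Sum>w'\<in>?W. if N w w' then p w' else 0) = S w - bm (X k) r2 w" for w
 proof -
  have "S w = (\<Sum>w'\<in>?W. if norm (w' - w) \<le> r1 then p w' else 0)"
   unfolding S_def bm_def p_def by (simp add: sum.inter_filter)
  moreover have "bm (X k) r2 w = (\<Sum>w'\<in>?W. if norm (w' - w) \<le> r2 then p w' else 0)"
   unfolding bm_def p_def by (simp add: sum.inter_filter)
  ultimately show ?thesis
   unfolding sum_subtractf[symmetric] using rr
   by (simp add: sum_subtractf[symmetric]) (intro sum.cong, auto simp: N_def norm_minus_commute)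
 qed
 have row: "(\<Sum>w'\<in>?W. g w w') \<le> p w" if w: "w \<in> ?W" for w
 proof -
  have "(\<Sum>w'\<in>?W. g w w') \<le> (\<Sum>w'\<in>?W. p w / S w * (if N w w' then p w' else 0))"
  proof (rule sum_mono)
   fix w' assume "w' \<in> ?W"
   have "p w * p w' / (S w + S w') \<le> p w * p w' / S w"
    using S[OF w] S0[of w'] by (intro divide_left_mono) (auto simp: p_def intro!: mult_pos_pos add_pos_nonneg)
   thus "g w w' \<le> p w / S w * (if N w w' then p w' else 0)" by (simp add: g_def)
  qed
  also have "... = p w / S w * (S w - bm (X k) r2 w)" by (simp only: near flip: sum_distrib_left)
  also have "... \<le> p w / S w * S w"
   using S[OF w] bm_nonneg[of "X k" r2 w] by (intro mult_left_mono) (auto simp: p_def)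
  finally show ?thesis using S[OF w] by simp
 qed
 have "(\<Sum>w\<in>?W. \<Sum>w'\<in>?W. g w w' * ?d w w')
  \<le> (h (j - r) - h (j + r)) - (h (k + (j - r)) - h (k + (j + r)))"
  by (rule pair_entropy) (use g row in \<open>auto simp: p_def\<close>)
 also have "... \<le> real (j + r - (j - r)) * (e (j - r) - E)"
 proof -
  have le: "j - r \<le> j + r" "k + (j - r) \<le> k + (j + r)" by simp_all
  have eq: "k + (j + r) - (k + (j - r)) = j + r - (j - r)" by simp
  show ?thesis
   using h_diff_le[OF le(1)] h_diff_ge[OF E le(2)] unfolding eq right_diff_distrib by linarith
 qed
 also have "... \<le> (2 * real r) * (e (j - r) - E)" using E[of "j - r"] by (intro mult_right_mono) auto
 finally have 1: "(\<Sum>w\<in>?W. \<Sum>w'\<in>?W. g w w' * ?d w w')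
   \<le> 2 * real r * (e (j - r) - E)" .
 have 2: "\<epsilon> * (p w * (S w - bm (X k) r2 w) / bm (X k) (2 * r1) w) / 2
   \<le> (\<Sum>w'\<in>?W. g w w' * ?d w w')" if w: "w \<in> ?W" for w
 proof -
  let ?D = "bm (X k) (2 * r1) w"
  have D: "0 < ?D" using rr w by (intro bm_pos) auto
  have SD: "S w \<le> ?D" unfolding S_def using rr by (intro bm_mono) auto
  have "(\<Sum>w'\<in>?W. \<epsilon> * p w / (2 * ?D) * (if N w w' then p w' else 0))
   \<le> (\<Sum>w'\<in>?W. g w w' * ?d w w')"
  proof (rule sum_mono)
   fix w' assume w': "w' \<in> ?W"
   show "\<epsilon> * p w / (2 * ?D) * (if N w w' then p w' else 0) \<le> g w w' * ?d w w'"
   proof (cases "N w w'")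
    case True
    have nq: "norm ((w' - w) / \<theta> ^ k) = norm (w - w') / norm \<theta> ^ k" by (simp add: norm_divide norm_power norm_minus_commute)
    have "norm \<theta> ^ (j + 1) \<le> norm ((w' - w) / \<theta> ^ k)" "norm ((w' - w) / \<theta> ^ k) \<le> norm \<theta> ^ j"
     unfolding nq using True by (auto simp: N_def r1_def r2_def power_add field_simps)
    hence js: "\<epsilon> \<le> ?d w w'" by (rule gap(1))
    \<comment> \<open>The ball of radius \<open>r1\<close> about \<open>w'\<close> lies in the ball
      of radius \<open>2 * r1\<close> about \<open>w\<close>; hence the doubled ball in the
      denominator.\<close>
    have "S w' \<le> ?D" unfolding S_def using True by (intro bm_mono) (auto simp: N_def norm_minus_commute)
    hence "p w * p w' / (2 * ?D) \<le> g w w'"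
     using True SD S[OF w] S0[of w'] D by (auto simp: g_def p_def intro!: divide_left_mono mult_pos_pos add_pos_nonneg)
    hence "\<epsilon> * (p w * p w' / (2 * ?D)) \<le> ?d w w' * g w w'"
     using js gap(2) D by (intro mult_mono) (auto simp: p_def)
    thus ?thesis using True by (simp add: mult_ac)
   qed (simp add: g_def)
  qed
  thus ?thesis by (simp only: near flip: sum_distrib_left) (simp add: mult_ac)
 qed
 have "(\<Sum>w\<in>?W. \<epsilon> * (p w * (S w - bm (X k) r2 w) / bm (X k) (2 * r1) w) / 2)
   \<le> (\<Sum>w\<in>?W. \<Sum>w'\<in>?W. g w w' * ?d w w')"
  by (rule sum_mono) (rule 2)
 hence "\<epsilon> / 2 * ex (X k) (\<lambda>w. (S w - bm (X k) r2 w) / bm (X k) (2 * r1) w) \<le> 2 * real r * (e (j - r) - E)"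
  using 1 by (simp add: ex_def p_def sum_distrib_left sum_divide_distrib mult_ac)
 thus ?thesis using gap(2) by (simp add: S_def r1_def r2_def field_simps)
qed

text \<open>\<open>rho k\<close> smears each atom of \<open>X k\<close> over a disc of radius
  \<open>R * norm \<theta> ^ k\<close>, so near an atom it is at most its peak height times the mass
  of a ball around that atom. As \<open>h k \<le> h 0\<close>, the mean log mass at this radius is
  bounded below by about \<open>2 * k * ln (norm \<theta>)\<close>.\<close>

lemma ent_rho_ge_bm:
 assumes B: "\<And>z. zeta z \<le> B" "0 < B" and R: "\<And>z. R < norm z \<Longrightarrow> zeta z = 0" "0 < R"
 shows "- ex (X k) (\<lambda>y. ln (bm (X k) (2 * R * norm \<theta> ^ k) y)) \<le> h k + ln B - 2 * ln (norm (\<theta> ^ k))"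
proof -
 let ?W = "set_pmf (X k)"
 define p where "p = pmf (X k)"
 define \<phi> where "\<phi> = scl (\<theta> ^ k) zeta"
 define t where "t = norm \<theta> ^ k"
 define c where "c y = ln (B / t^2 * bm (X k) (2 * R * t) y)" for y
 have t: "0 < t" by (simp add: t_def)
 have d\<phi>: "dens \<phi>" unfolding \<phi>_def by (rule dens_scl[OF zeta(1)]) simp
 note \<phi>D = densD[OF d\<phi>]
 have rho: "rho k z = (\<Sum>w\<in>?W. p w * \<phi> (z - w))" for z
  using rho_add[of k 0] by (simp add: \<phi>_def rho_def[of 0] conv_pmf p_def)
 have \<phi>0: "norm y \<le> R * t" if "\<phi> y \<noteq> 0" for y
  using scl_nonzero[OF R(1) that[unfolded \<phi>_def]] by (simp add: t_def norm_power)
 have \<phi>B: "\<phi> y \<le> B / t^2" for y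
  unfolding \<phi>_def scl_def t_def norm_power using B by (intro divide_right_mono) auto
 have pt: "rho k z * ln (rho k z) \<le> (\<Sum>y\<in>?W. p y * c y * \<phi> (z - y))" for z
 proof -
  have "rho k z * ln (rho k z) = (\<Sum>y\<in>?W. p y * \<phi> (z - y) * ln (rho k z))"
   by (subst rho) (simp add: sum_distrib_right)
  also have "... \<le> (\<Sum>y\<in>?W. p y * c y * \<phi> (z - y))"
  proof (rule sum_mono)
   fix y assume y: "y \<in> ?W"
   show "p y * \<phi> (z - y) * ln (rho k z) \<le> p y * c y * \<phi> (z - y)"
   proof (cases "\<phi> (z - y) = 0")
    case False
    hence n: "norm (z - y) \<le> R * t" and pos: "0 < \<phi> (z - y)" using \<phi>0 \<phi>D(2)[of "z - y"] by auto
    have "p y * \<phi> (z - y) \<le> rho k z" unfolding rho using y \<phi>D(2) by (intro member_le_sum) (auto simp: p_def)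
    moreover have "0 < p y * \<phi> (z - y)" using pos y by (simp add: p_def pmf_positive)
    ultimately have r0: "0 < rho k z" by linarith
    have "rho k z \<le> (\<Sum>w\<in>?W. if norm (w - z) \<le> R * t then p w * (B / t^2) else 0)"
     unfolding rho
    proof (rule sum_mono)
     fix w
     show "p w * \<phi> (z - w) \<le> (if norm (w - z) \<le> R * t then p w * (B / t^2) else 0)"
     proof (cases "norm (w - z) \<le> R * t")
      case True
      have "p w * \<phi> (z - w) \<le> p w * (B / t^2)" using \<phi>B by (intro mult_left_mono) (auto simp: p_def)
      thus ?thesis using True by simp
     next
      case False
      hence "\<phi> (z - w) = 0" using \<phi>0[of "z - w"] by (metis norm_minus_commute)
      thus ?thesis using False by simp
     qed
    qed
    also have "... = B / t^2 * bm (X k) (R * t) z"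
     by (simp add: bm_def p_def sum.inter_filter[symmetric] sum_distrib_left mult.commute)
    also have "... \<le> B / t^2 * bm (X k) (2 * R * t) y"
     using B n by (intro mult_left_mono bm_mono) auto
    finally have "ln (rho k z) \<le> c y" unfolding c_def using r0 by simp
    hence "p y * \<phi> (z - y) * ln (rho k z) \<le> p y * \<phi> (z - y) * c y"
     using pos by (intro mult_left_mono) (auto simp: p_def)
    thus ?thesis by (simp add: mult_ac)
   qed simp
  qed
  finally show ?thesis .
 qed
 have "(LBINT z. rho k z * ln (rho k z)) \<le> (LBINT z. (\<Sum>y\<in>?W. p y * c y * \<phi> (z - y)))"
  using pt densD[OF dens_rho[of k]] \<phi>D
  by (intro integral_mono bsf_integrable bsf_xlnx Bochner_Integration.integrable_sum integrable_mult_right bsf_shift) auto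
 also have "... = (\<Sum>y\<in>?W. p y * c y * integral\<^sup>L lborel \<phi>)"
  using \<phi>D by (subst Bochner_Integration.integral_sum) (auto intro!: integrable_mult_right bsf_integrable bsf_shift simp: integral_shift)
 also have "... = ex (X k) c" using \<phi>D by (simp add: ex_def p_def)
 also have "... = ex (X k) (\<lambda>y. (ln B - 2 * ln (norm (\<theta> ^ k))) + ln (bm (X k) (2 * R * norm \<theta> ^ k) y))"
  unfolding ex_def
 proof (rule sum.cong[OF refl])
  fix y assume "y \<in> ?W"
  hence "0 < bm (X k) (2 * R * t) y" using R t by (intro bm_pos) auto
  hence "c y = (ln B - 2 * ln t) + ln (bm (X k) (2 * R * t) y)"
   unfolding c_def using B t by (simp add: ln_mult ln_div ln_realpow)
  thus "pmf (X k) y * c y = pmf (X k) y * ((ln B - 2 * ln (norm (\<theta> ^ k))) + ln (bm (X k) (2 * R * norm \<theta> ^ k) y))"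
   by (simp add: t_def norm_power)
 qed
 also have "... = ln B - 2 * ln (norm (\<theta> ^ k)) + ex (X k) (\<lambda>y. ln (bm (X k) (2 * R * norm \<theta> ^ k) y))"
  by (simp add: ex_add ex_const)
 finally show ?thesis by (simp add: h_def ent_def)
qed

section \<open>Separated digit sums and Shannon entropy\<close>

definition separated :: "nat \<Rightarrow> nat \<Rightarrow> bool" where
 "separated k M \<longleftrightarrow> (\<forall>x y. (\<forall>i<k. x i \<in> set_pmf \<alpha> \<and> y i \<in> set_pmf \<alpha>) \<longrightarrow> (\<exists>i<k. x i \<noteq> y i) \<longrightarrow>
   norm \<theta> ^ (M * k) < norm (\<Sum>i<k. \<theta> ^ i * (x i - y i)))"

lemma set_X: "y \<in> set_pmf (X k) \<Longrightarrow> \<exists>x. (\<forall>i<k. x i \<in> set_pmf \<alpha>) \<and> y = (\<Sum>i<k. \<theta> ^ i * x i)"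
proof (induction k arbitrary: y)
 case (Suc k)
 then obtain x0 y' where *: "x0 \<in> set_pmf \<alpha>" "y' \<in> set_pmf (X k)" "y = x0 + \<theta> * y'" by auto
 obtain x where x: "\<forall>i<k. x i \<in> set_pmf \<alpha>" "y' = (\<Sum>i<k. \<theta> ^ i * x i)" using Suc.IH[OF *(2)] by blast
 have "y = (\<Sum>i<Suc k. \<theta> ^ i * case_nat x0 x i)"
  unfolding sum.lessThan_Suc_shift by (simp add: * x sum_distrib_left mult_ac)
 moreover have "\<forall>i<Suc k. case_nat x0 x i \<in> set_pmf \<alpha>" using * x by (auto split: nat.split)
 ultimately show ?case by blast
qed simp

lemma separated_inj:
 assumes sep: "separated k M" and jk: "Suc j \<le> k"
 shows "inj_on (\<lambda>(x, y). x + \<theta> * y) (set_pmf \<alpha> \<times> set_pmf (X j))"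
proof (rule inj_onI, clarify)
 fix x y x' y'
 assume x: "x \<in> set_pmf \<alpha>" "x' \<in> set_pmf \<alpha>" and y: "y \<in> set_pmf (X j)" "y' \<in> set_pmf (X j)"
  and eq: "x + \<theta> * y = x' + \<theta> * y'"
 obtain s where s: "\<forall>i<j. s i \<in> set_pmf \<alpha>" "y = (\<Sum>i<j. \<theta> ^ i * s i)" using set_X[OF y(1)] by blast
 obtain s' where s': "\<forall>i<j. s' i \<in> set_pmf \<alpha>" "y' = (\<Sum>i<j. \<theta> ^ i * s' i)" using set_X[OF y(2)] by blast
 \<comment> \<open>Both sums are padded to length \<open>k\<close> by the common digit
   \<open>x\<close>, which leaves their difference unchanged.\<close>
 define u where "u i = (if i \<le> j then case_nat x s i else x)" for i
 define u' where "u' i = (if i \<le> j then case_nat x' s' i else x)" for i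
 have u: "\<forall>i<k. u i \<in> set_pmf \<alpha> \<and> u' i \<in> set_pmf \<alpha>"
  using x s s' by (auto simp: u_def u'_def split: nat.split)
 have "(\<Sum>i<k. \<theta> ^ i * (u i - u' i)) = (\<Sum>i<Suc j. \<theta> ^ i * (u i - u' i))"
  using jk by (intro sum.mono_neutral_right) (auto simp: u_def u'_def)
 also have "... = (x - x') + \<theta> * (y - y')"
  unfolding sum.lessThan_Suc_shift
  by (simp add: u_def u'_def s s' sum_distrib_left sum_subtractf right_diff_distrib mult_ac)
 also have "... = 0" using eq by (simp add: algebra_simps)
 finally have "(\<Sum>i<k. \<theta> ^ i * (u i - u' i)) = 0" .
 hence "\<not> norm \<theta> ^ (M * k) < norm (\<Sum>i<k. \<theta> ^ i * (u i - u' i))" by simp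
 hence *: "u i = u' i" if "i < k" for i using sep u that unfolding separated_def by blast
 have "x = x'" using *[of 0] jk by (simp add: u_def u'_def)
 moreover have "y = y'" unfolding s s'
 proof (rule sum.cong[OF refl])
  fix i assume "i \<in> {..<j}"
  thus "\<theta> ^ i * s i = \<theta> ^ i * s' i" using *[of "Suc i"] jk by (simp add: u_def u'_def)
 qed
 ultimately show "x = x' \<and> y = y'" by simp
qed

definition Hp :: "complex pmf \<Rightarrow> real" where "Hp \<beta> = - ex \<beta> (\<lambda>y. ln (pmf \<beta> y))"

text \<open>Separation makes adding a digit injective on the supports, so no probabilities merge and
  the entropies add up.\<close>

lemma Hp_X:
 assumes sep: "separated k M" and jk: "j \<le> k" shows "Hp (X j) = real j * Hp \<alpha>"
 using jk
proof (induction j)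
 case 0 thus ?case by (simp add: Hp_def ex_def)
next
 case (Suc j)
 let ?f = "\<lambda>(x, y). x + \<theta> * y" and ?P = "pair_pmf \<alpha> (X j)"
 have inj: "inj_on ?f (set_pmf ?P)" using separated_inj[OF sep Suc.prems] by simp
 have X: "X (Suc j) = map_pmf ?f ?P"
  by (simp add: pair_pmf_def map_bind_pmf map_pmf_def bind_assoc_pmf bind_return_pmf)
 have "ex (X (Suc j)) (\<lambda>y. ln (pmf (X (Suc j)) y)) = (\<Sum>z\<in>set_pmf ?P. pmf ?P z * ln (pmf ?P z))"
  unfolding X ex_def set_map_pmf sum.reindex[OF inj] comp_def
  by (intro sum.cong refl) (simp only: pmf_map_inj[OF inj])
 also have "... = (\<Sum>x\<in>set_pmf \<alpha>. \<Sum>y\<in>set_pmf (X j). pmf \<alpha> x * pmf (X j) y * (ln (pmf \<alpha> x) + ln (pmf (X j) y)))"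
  by (simp add: sum.cartesian_product pmf_pair case_prod_beta')
   (intro sum.cong refl, auto simp: pmf_pair ln_mult pmf_positive)
 also have "... = (\<Sum>x\<in>set_pmf \<alpha>. pmf \<alpha> x * ln (pmf \<alpha> x) + pmf \<alpha> x * ex (X j) (\<lambda>y. ln (pmf (X j) y)))"
 proof (rule sum.cong[OF refl])
  fix x
  have "(\<Sum>y\<in>set_pmf (X j). pmf \<alpha> x * pmf (X j) y * (ln (pmf \<alpha> x) + ln (pmf (X j) y)))
   = pmf \<alpha> x * ln (pmf \<alpha> x) * (\<Sum>y\<in>set_pmf (X j). pmf (X j) y) + pmf \<alpha> x * ex (X j) (\<lambda>y. ln (pmf (X j) y))"
   by (simp add: ex_def sum_distrib_left algebra_simps sum.distrib)
  thus "(\<Sum>y\<in>set_pmf (X j). pmf \<alpha> x * pmf (X j) y * (ln (pmf \<alpha> x) + ln (pmf (X j) y)))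
   = pmf \<alpha> x * ln (pmf \<alpha> x) + pmf \<alpha> x * ex (X j) (\<lambda>y. ln (pmf (X j) y))"
   by (simp add: sum_pmf_eq_1)
 qed
 also have "... = ex \<alpha> (\<lambda>x. ln (pmf \<alpha> x)) + ex (X j) (\<lambda>y. ln (pmf (X j) y))"
  by (simp add: sum.distrib ex_def[of \<alpha>] sum_pmf_eq_1 fin flip: sum_distrib_right)
 finally show ?case using Suc by (simp add: Hp_def algebra_simps)
qed

lemma bm_separated:
 assumes sep: "separated k M" and y: "y \<in> set_pmf (X k)"
 shows "bm (X k) (norm \<theta> ^ (M * k)) y = pmf (X k) y"
proof -
 have "w = y" if w: "w \<in> set_pmf (X k)" and le: "norm (w - y) \<le> norm \<theta> ^ (M * k)" for w
 proof (rule ccontr)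
  assume "w \<noteq> y"
  obtain s where s: "\<forall>i<k. s i \<in> set_pmf \<alpha>" "y = (\<Sum>i<k. \<theta> ^ i * s i)" using set_X[OF y] by blast
  obtain s' where s': "\<forall>i<k. s' i \<in> set_pmf \<alpha>" "w = (\<Sum>i<k. \<theta> ^ i * s' i)" using set_X[OF w] by blast
  have "\<exists>i<k. s' i \<noteq> s i"
  proof (rule ccontr)
   assume "\<not> (\<exists>i<k. s' i \<noteq> s i)"
   hence "w = y" unfolding s s' by (intro sum.cong) auto
   thus False using \<open>w \<noteq> y\<close> by simp
  qed
  hence "norm \<theta> ^ (M * k) < norm (\<Sum>i<k. \<theta> ^ i * (s' i - s i))"
   using sep s s' unfolding separated_def by blast
  thus False using le by (simp add: s s' right_diff_distrib sum_subtractf)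
 qed
 hence "{w \<in> set_pmf (X k). norm (w - y) \<le> norm \<theta> ^ (M * k)} = {y}" using y by auto
 thus ?thesis by (simp add: bm_def)
qed

text \<open>Suppose the limit is positive and follow the mean log mass \<open>f k l\<close> from
  radius \<open>u ^ k\<close> to \<open>u ^ (M * k)\<close>. It starts no lower than
  \<open>- 2 * k * L\<close> minus a constant and, under separation, ends at
  \<open>- k * Hp \<alpha>\<close>. But all steps except the first \<open>j0\<close> lose at most
  \<open>\<eta>\<close>, which is too little.\<close>

theorem e_tendsto_0:
 assumes th: "Im \<theta> \<noteq> 0" and H: "- 2 * ln (norm \<theta>) < Hp \<alpha>"
  and sep: "1 \<le> M" "\<And>k0. \<exists>k\<ge>k0. separated k M"
 shows "e \<longlonglongrightarrow> 0"
proof -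
 have "decseq e" by (rule decseq_SucI) (rule e_Suc_le)
 then obtain E where lim: "e \<longlonglongrightarrow> E" and le: "\<And>l. E \<le> e l"
  using decseq_convergent[of e 0] e_nonneg by metis
 have "0 \<le> E" using lim e_nonneg by (intro LIMSEQ_le_const) auto
 show ?thesis
 proof (cases "E = 0")
  case False
  hence E: "0 < E" using \<open>0 \<le> E\<close> by simp
  define u where "u = norm \<theta>"
  have u: "0 < u" "u < 1" using th1 by (auto simp: u_def)
  define L where "L = - ln u"
  obtain \<epsilon> r l0 where gap: "0 < \<epsilon>" "\<And>l v. l0 \<le> l \<Longrightarrow> norm \<theta> ^ (l + 1) \<le> norm v \<Longrightarrow> norm v \<le> norm \<theta> ^ l \<Longrightarrow>
    \<epsilon> \<le> js v (l + r) - js v (l - r)"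
   using js_gap[OF th E le lim] by blast
  \<comment> \<open>\<open>M * k\<close> steps of size \<open>\<eta>\<close> amount to half of the
    required loss \<open>k * (Hp \<alpha> - 2 * L)\<close>.\<close>
  define \<eta> where "\<eta> = (Hp \<alpha> - 2 * L) / (2 * real M)"
  have \<eta>: "0 < \<eta>" using H sep(1) by (auto simp: \<eta>_def L_def u_def)
  define C1 where "C1 = (4 * (1 / u) + 2)^2"
  define C2 where "C2 = (8 * (1 / u) + 2)^2"
  \<comment> \<open>Makes the second term of \<open>ex_ln_drop_le\<close> equal to
    \<open>\<eta> / 2\<close>. The choice of \<open>j1\<close> brings the first term below
    \<open>\<eta> / 2\<close> as well.\<close>
  define A where "A = 2 * C2 / \<eta>"
  have "0 < 4 * (1 / u) + 2" "0 < 8 * (1 / u) + 2" using u by (auto intro: add_pos_pos)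
  hence C: "0 < C1" "0 < C2" unfolding C1_def C2_def by (simp_all only: zero_less_power)
  hence A: "0 < A" using \<eta> by (simp add: A_def)
  have ev: "eventually (\<lambda>j. e j < E + \<eta> / (2 * A) / (4 * real r / \<epsilon> + 1)) sequentially"
  proof -
   have "0 < 4 * real r / \<epsilon> + 1" using gap(1) by (intro add_nonneg_pos) auto
   hence "E < E + \<eta> / (2 * A) / (4 * real r / \<epsilon> + 1)" using \<eta> A by simp
   thus ?thesis by (rule order_tendstoD(2)[OF lim])
  qed
  then obtain j1 where j1: "\<And>j. j1 \<le> j \<Longrightarrow> e j < E + \<eta> / (2 * A) / (4 * real r / \<epsilon> + 1)"
   by (auto simp: eventually_sequentially)
  define j0 where "j0 = l0 + (j1 + r)"
  define f where "f k l = ex (X k) (\<lambda>y. ln (bm (X k) (u ^ l) y))" for k l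
  have step1: "f k l - f k (Suc l) \<le> C1" for k l
   using ex_ln_ratio_le[OF finite_X[of k], of "u ^ Suc l" "1 / u"] u by (simp add: f_def C1_def)
  have step2: "f k (k + j) - f k (Suc (k + j)) \<le> \<eta>" if j: "j0 \<le> j" for k j
  proof -
   have "f k (k + j) - f k (Suc (k + j)) \<le> A * ex (X k) (\<lambda>w. (bm (X k) (u ^ (k + j)) w - bm (X k) (u ^ (k + j + 1)) w) / bm (X k) (2 * u ^ (k + j)) w)
     + (8 * (u ^ (k + j) / u ^ Suc (k + j)) + 2)^2 / A"
    using ex_ln_drop_le[OF finite_X[of k], of "u ^ Suc (k + j)" "u ^ (k + j)" A] u A by (simp add: f_def mult_left_le_one_le)
   also have "u ^ (k + j) / u ^ Suc (k + j) = 1 / u" using u by simp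
   also have "ex (X k) (\<lambda>w. (bm (X k) (u ^ (k + j)) w - bm (X k) (u ^ (k + j + 1)) w) / bm (X k) (2 * u ^ (k + j)) w)
     \<le> 4 * real r / \<epsilon> * (e (j - r) - E)"
    unfolding u_def using j by (intro scale_mass_le gap le) (auto simp: j0_def)
   also have "... \<le> \<eta> / (2 * A)"
   proof -
    have "e (j - r) - E \<le> \<eta> / (2 * A) / (4 * real r / \<epsilon> + 1)"
    proof -
     have "j1 \<le> j - r" using j unfolding j0_def by linarith
     from j1[OF this] show ?thesis by simp
    qed
    hence "4 * real r / \<epsilon> * (e (j - r) - E) \<le> (4 * real r / \<epsilon> + 1) * (\<eta> / (2 * A) / (4 * real r / \<epsilon> + 1))"
     using gap(1) le[of "j - r"] by (intro mult_mono) auto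
    also have "... = \<eta> / (2 * A)" using gap(1) by (simp add: add_nonneg_eq_0_iff)
    finally show ?thesis .
   qed
   finally have "f k (k + j) - f k (Suc (k + j)) \<le> A * (\<eta> / (2 * A)) + (8 * (1 / u) + 2)^2 / A"
    using A by (simp add: mult_left_mono)
   also have "(8 * (1 / u) + 2)^2 / A = \<eta> / 2" unfolding C2_def[symmetric] A_def using C \<eta> by simp
   also have "A * (\<eta> / (2 * A)) = \<eta> / 2" using A by simp
   finally show ?thesis by simp
  qed
  have sum: "f k k - f k (k + n) \<le> real (min n j0) * C1 + real n * \<eta>" for k n
  proof (induction n)
   case (Suc n)
   show ?case
   proof (cases "n < j0")
    case True
    hence "real (min (Suc n) j0) * C1 + real (Suc n) * \<eta> = real (min n j0) * C1 + real n * \<eta> + C1 + \<eta>" by (simp add: algebra_simps)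
    thus ?thesis using Suc step1[of k "k + n"] \<eta> by simp
   next
    case False
    thus ?thesis using Suc step2[of n k] by (simp add: algebra_simps)
   qed
  qed simp
  obtain R where R: "0 < R" "\<And>l z. R < norm z \<Longrightarrow> rho l z = 0" using rho_supp by blast
  obtain B' where B': "\<And>z. \<bar>zeta z\<bar> \<le> B'" using densD(1)[OF zeta(1)] unfolding bsf_def by blast
  define B where "B = \<bar>B'\<bar> + 1"
  have B: "zeta z \<le> B" "0 < B" for z using B'[of z] by (auto simp: B_def)
  define C3 where "C3 = h 0 + ln B + (4 * (2 * R) + 2)^2"
  have low: "- f k k \<le> C3 + 2 * real k * L" for k
  proof -
   have "- ex (X k) (\<lambda>y. ln (bm (X k) (2 * R * norm \<theta> ^ k) y)) \<le> h k + ln B - 2 * ln (norm (\<theta> ^ k))"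
    using R(2)[of _ 0] by (intro ent_rho_ge_bm B R(1)) (simp add: rho_def)
   moreover have "ex (X k) (\<lambda>y. ln (bm (X k) (2 * R * norm \<theta> ^ k) y)) \<le> f k k + (4 * (2 * R) + 2)^2"
    unfolding f_def u_def by (rule ex_ln_ratio_le) (use R in auto)
   moreover have "h k \<le> h 0" by (rule h_antimono) simp
   moreover have "ln (norm (\<theta> ^ k)) = - (real k * L)" using u by (simp add: norm_power L_def u_def ln_realpow)
   ultimately show ?thesis by (simp add: C3_def)
  qed
  define C4 where "C4 = C3 + real j0 * C1"
  obtain k0 where k0: "2 * C4 / (Hp \<alpha> - 2 * L) < real k0" using reals_Archimedean2 by blast
  obtain k where k: "k0 \<le> k" "separated k M" using sep(2) by blast
  have "f k (k + (M - 1) * k) = ex (X k) (\<lambda>y. ln (pmf (X k) y))"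
  proof -
   have "k + (M - 1) * k = M * k" using sep(1) by (cases M) auto
   thus ?thesis unfolding f_def ex_def u_def using bm_separated[OF k(2)] by simp
  qed
  hence "f k (k + (M - 1) * k) = - (real k * Hp \<alpha>)"
   using Hp_X[OF k(2), of k] by (simp add: Hp_def)
  moreover have "f k k - f k (k + (M - 1) * k) \<le> real j0 * C1 + real M * real k * \<eta>"
  proof -
   have "real (min ((M - 1) * k) j0) * C1 \<le> real j0 * C1" using C by (intro mult_right_mono) auto
   moreover have "real ((M - 1) * k) * \<eta> \<le> real M * real k * \<eta>"
    using \<eta> sep(1) by (intro mult_right_mono) (auto simp flip: of_nat_mult)
   ultimately show ?thesis using sum[of k "(M - 1) * k"] by linarith
  qed
  ultimately have "real k * Hp \<alpha> \<le> C4 + 2 * real k * L + real M * real k * \<eta>"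
   using low[of k] by (simp add: C4_def)
  also have "real M * real k * \<eta> = real k * (Hp \<alpha> - 2 * L) / 2" using sep(1) by (simp add: \<eta>_def)
  finally have "real k * (Hp \<alpha> - 2 * L) \<le> 2 * C4" by (simp add: field_simps)
  moreover have "0 < Hp \<alpha> - 2 * L" using H by (simp add: L_def u_def)
  hence "2 * C4 < real k0 * (Hp \<alpha> - 2 * L)" using k0 by (simp add: pos_divide_less_eq)
  moreover have "real k0 * (Hp \<alpha> - 2 * L) \<le> real k * (Hp \<alpha> - 2 * L)"
   using k(1) \<open>0 < Hp \<alpha> - 2 * L\<close> by (intro mult_right_mono) auto
  ultimately show ?thesis by linarith
 qed (use lim in simp)
qed

end

section \<open>Large deviations\<close>

text \<open>The tangent line of \<open>x powr (1 + t)\<close> at \<open>m\<close>, obtained from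
  Young's inequality.\<close>

lemma powr_tangent:
 fixes v m t :: real
 assumes "0 \<le> v" "0 < m" "0 < t"
 shows "m powr t * ((1 + t) * v - t * m) \<le> v powr (1 + t)"
proof -
 have "v * m powr t \<le> v powr (1 + t) / (1 + t) + (m powr t) powr ((1 + t) / t) / ((1 + t) / t)"
  using assms by (intro Youngs_inequality) (auto simp: field_simps)
 also have "(m powr t) powr ((1 + t) / t) = m * m powr t"
  using assms by (simp add: powr_powr powr_mult_base)
 finally have "(1 + t) * (v * m powr t) \<le> (1 + t) * (v powr (1 + t) / (1 + t) + m * m powr t / ((1 + t) / t))"
  using assms by (intro mult_left_mono) auto
 also have "... = v powr (1 + t) + t * (m * m powr t)"
  using assms by (simp add: distrib_left)
 finally show ?thesis by (simp add: algebra_simps)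
qed

text \<open>Jensen's inequality on the indices with nonzero \<open>v\<close>, whose weights have
  some total \<open>s\<close> instead of 1; the gain is a factor \<open>s powr t\<close>. For
  translates of a function of small support, \<open>S i\<close> will be the mass of a ball around
  the \<open>i\<close>-th centre.\<close>

lemma powr_sum_le:
 fixes v p :: "'a \<Rightarrow> real"
 assumes A: "finite A" and v: "\<And>i. i \<in> A \<Longrightarrow> 0 \<le> v i" and p: "\<And>i. i \<in> A \<Longrightarrow> 0 \<le> p i" and t: "0 < t"
  and s: "\<And>i. i \<in> A \<Longrightarrow> v i \<noteq> 0 \<Longrightarrow> (\<Sum>j\<in>{j \<in> A. v j \<noteq> 0}. p j) \<le> S i" and S: "\<And>i. i \<in> A \<Longrightarrow> 0 \<le> S i"
 shows "(\<Sum>i\<in>A. p i * v i) powr (1 + t) \<le> (\<Sum>i\<in>A. p i * (S i powr t * v i powr (1 + t)))"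
proof -
 define B where "B = {j \<in> A. v j \<noteq> 0}"
 define s where "s = (\<Sum>j\<in>B. p j)"
 define y where "y = (\<Sum>i\<in>A. p i * v i)"
 have B: "finite B" using A by (simp add: B_def)
 have y: "y = (\<Sum>i\<in>B. p i * v i)" unfolding y_def B_def using A by (intro sum.mono_neutral_right) auto
 have R: "(\<Sum>i\<in>A. p i * (S i powr t * v i powr (1 + t))) = (\<Sum>i\<in>B. p i * (S i powr t * v i powr (1 + t)))"
  unfolding B_def using A by (intro sum.mono_neutral_right) auto
 have nn: "0 \<le> (\<Sum>i\<in>A. p i * (S i powr t * v i powr (1 + t)))" using p by (intro sum_nonneg) auto
 show ?thesis
 proof (cases "y = 0")
  case False
  have "0 \<le> y" unfolding y_def using p v by (intro sum_nonneg) auto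
  hence y0: "0 < y" using False by simp
  have s0: "0 < s"
  proof (rule ccontr)
   assume "\<not> 0 < s"
   moreover have "0 \<le> s" unfolding s_def B_def using p by (intro sum_nonneg) auto
   ultimately have "s = 0" by simp
   hence "\<forall>j\<in>B. p j = 0" using p B unfolding s_def by (subst (asm) sum_nonneg_eq_0_iff) (auto simp: B_def)
   thus False using y0 y by simp
  qed
  define m where "m = y / s"
  have m: "0 < m" using y0 s0 by (simp add: m_def)
  have "s powr t * m powr t * y = s powr t * (m powr t * ((1 + t) * y - t * m * s))"
   using s0 by (simp add: m_def algebra_simps)
  also have "m powr t * ((1 + t) * y - t * m * s) = (\<Sum>i\<in>B. p i * (m powr t * ((1 + t) * v i - t * m)))"
   by (simp add: y s_def sum_distrib_left sum_distrib_right sum_subtractf algebra_simps)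
  also have "... \<le> (\<Sum>i\<in>B. p i * v i powr (1 + t))"
   using m t v p by (intro sum_mono mult_left_mono powr_tangent) (auto simp: B_def)
  also have "s powr t * (\<Sum>i\<in>B. p i * v i powr (1 + t)) = (\<Sum>i\<in>B. p i * (s powr t * v i powr (1 + t)))"
   by (simp add: sum_distrib_left mult_ac)
  also have "... \<le> (\<Sum>i\<in>B. p i * (S i powr t * v i powr (1 + t)))"
   using s0 t p assms(5) by (intro sum_mono mult_left_mono mult_right_mono powr_mono2) (auto simp: B_def s_def)
  finally have "s powr t * m powr t * y \<le> (\<Sum>i\<in>B. p i * (S i powr t * v i powr (1 + t)))"
   using s0 by (simp add: mult_left_mono)
  moreover have "s powr t * m powr t = y powr t" using s0 y0 by (simp add: m_def powr_divide)
  moreover have "y powr t * y = y powr (1 + t)" using y0 by (simp add: powr_mult_base mult.commute)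
  ultimately show ?thesis by (simp add: R y_def[symmetric])
 qed (use nn t in \<open>simp add: y_def[symmetric]\<close>)
qed

lemma exp_le_quadratic: fixes x :: real assumes "x \<le> 0" shows "exp x \<le> 1 + x + x^2"
proof -
 have "1 - x \<le> exp (- x)" using exp_ge_add_one_self[of "-x"] by simp
 hence "exp x * (1 - x) \<le> exp x * exp (- x)" by (intro mult_left_mono) auto
 also have "... = 1" by (simp flip: exp_add)
 also have "1 \<le> (1 + x + x^2) * (1 - x)"
 proof -
  have "(1 + x + x^2) * (1 - x) = 1 - x ^ 3" by (simp add: algebra_simps power2_eq_square power3_eq_cube)
  moreover have "x ^ 3 \<le> 0" using assms by (simp add: power3_eq_cube mult_nonneg_nonpos)
  ultimately show ?thesis by simp
 qed
 finally show ?thesis using assms by (simp add: mult_le_cancel_right)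
qed

lemma measure_cball_complex: "0 \<le> r \<Longrightarrow> measure lborel (cball (c::complex) r) = pi * r^2"
 using content_cball[of r c] by (simp add: unit_ball_vol_2)

lemma bm_indicator:
 assumes "finite (set_pmf \<beta>)"
 shows "bm \<beta> r z = (\<Sum>w\<in>set_pmf \<beta>. pmf \<beta> w * indicator (cball w r) z)"
 unfolding bm_def sum.inter_filter[OF assms]
 by (intro sum.cong) (auto simp: indicator_def dist_norm)

lemma bsf_indicator_cball: "bsf (indicator (cball w r))"
proof -
 have 1: "indicator (cball w r) z = (0::real)" if "norm w + r < norm z" for z
  using that norm_triangle_ineq2[of z w] by (auto simp: indicator_def dist_norm norm_minus_commute)
 have 2: "\<bar>indicator (cball w r) z\<bar> \<le> (1::real)" for z by (auto simp: indicator_def)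
 have 3: "(indicator (cball w r) :: complex \<Rightarrow> real) \<in> borel_measurable borel" by (rule borel_measurable_indicator) simp
 show ?thesis unfolding bsf_def using 1 2 3 by blast
qed

lemma bsf_bm: assumes "finite (set_pmf \<beta>)" shows "bsf (bm \<beta> r)"
proof -
 have "bm \<beta> r = (\<lambda>z. \<Sum>w\<in>set_pmf \<beta>. pmf \<beta> w * indicator (cball w r) z)"
  by (rule ext) (rule bm_indicator[OF assms])
 thus ?thesis using assms by (simp only:) (intro bsf_sum bsf_mult bsf_indicator_cball)
qed

lemma integral_bm:
 assumes "finite (set_pmf \<beta>)" "0 \<le> r" shows "integral\<^sup>L lborel (bm \<beta> r) = pi * r^2"
proof -
 have "integral\<^sup>L lborel (bm \<beta> r) = (\<Sum>w\<in>set_pmf \<beta>. pmf \<beta> w * (pi * r^2))"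
  unfolding ext[of "bm \<beta> r", OF bm_indicator[OF assms(1)]]
  using bsf_integrable[OF bsf_indicator_cball] assms
  by (subst Bochner_Integration.integral_sum) (auto simp: measure_cball_complex)
 thus ?thesis using assms by (simp add: sum_pmf_eq_1 flip: sum_distrib_right)
qed

lemma bsf_powr:
 assumes "bsf f" "\<And>z. 0 \<le> f z" "0 \<le> t" shows "bsf (\<lambda>z. f z powr (1 + t))"
proof -
 obtain b where b: "\<And>z. \<bar>f z\<bar> \<le> b" "f \<in> borel_measurable borel" using assms(1) unfolding bsf_def by blast
 show ?thesis
 proof (rule bsf_subset[OF assms(1), where c = "b powr t"])
  show "(\<lambda>z. f z powr (1 + t)) \<in> borel_measurable borel" using b(2) by measurable
  fix z
  have "f z powr (1 + t) = f z * f z powr t" using assms(2)[of z] by (simp add: powr_mult_base)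
  also have "... \<le> f z * b powr t" using assms b(1)[of z] by (intro mult_left_mono powr_mono2) auto
  finally show "\<bar>f z powr (1 + t)\<bar> \<le> b powr t * \<bar>f z\<bar>" using assms(2)[of z] by (simp add: mult.commute)
 qed
qed

context ssys begin

text \<open>Only the exponential rate matters: it bounds the logarithm of a ball mass below by a
  multiple of \<open>n\<close>, which controls the quadratic term in
  \<open>ex_powr_bm_small\<close>.\<close>

lemma pmf_X_ge:
 obtains a where "0 < a" "a \<le> 1" "\<And>n y. y \<in> set_pmf (X n) \<Longrightarrow> a ^ n \<le> pmf (X n) y"
proof -
 define a where "a = Min (pmf \<alpha> ` set_pmf \<alpha>)"
 have ne: "pmf \<alpha> ` set_pmf \<alpha> \<noteq> {}" by (simp add: set_pmf_not_empty)
 have a: "0 < a" "\<And>x. x \<in> set_pmf \<alpha> \<Longrightarrow> a \<le> pmf \<alpha> x"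
  unfolding a_def using fin ne by (auto simp: pmf_positive)
 obtain x where "x \<in> set_pmf \<alpha>" using set_pmf_not_empty by fast
 hence "a \<le> 1" using a(2)[of x] pmf_le_1[of \<alpha> x] by linarith
 moreover have "a ^ n \<le> pmf (X n) y" if "y \<in> set_pmf (X n)" for n y
  using that
 proof (induction n arbitrary: y)
  case (Suc n)
  let ?f = "\<lambda>(x, y). x + \<theta> * y" and ?P = "pair_pmf \<alpha> (X n)"
  have X: "X (Suc n) = map_pmf ?f ?P"
   by (simp add: pair_pmf_def map_bind_pmf map_pmf_def bind_assoc_pmf bind_return_pmf)
  then obtain z where z: "z \<in> set_pmf ?P" "y = ?f z" using Suc.prems by auto
  have "a ^ Suc n \<le> pmf \<alpha> (fst z) * pmf (X n) (snd z)"
   using a Suc.IH[of "snd z"] z(1) by (auto intro!: mult_mono)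
  also have "... = pmf ?P z" by (metis pmf_pair prod.collapse)
  also have "... \<le> pmf (X (Suc n)) y"
   unfolding X z(2) pmf_map by (simp add: pmf.rep_eq) (intro measure_pmf.finite_measure_mono, auto)
  finally show ?case .
 qed simp
 ultimately show thesis using that a(1) by blast
qed

text \<open>A converse to \<open>ent_rho_ge_bm\<close>: Gibbs' inequality for \<open>rho n\<close>
  against the ball mass of radius \<open>3 * R * norm \<theta> ^ n\<close> as a function of the
  centre, whose integral is the area of the disc. The radius 3 arises because a point of the bump of
  \<open>y\<close> is within \<open>R * norm \<theta> ^ n\<close> of \<open>y\<close>, and the ball
  about \<open>y\<close> has twice that radius.\<close>

lemma ex_ln_bm_le:
 assumes R: "\<And>z. R < norm z \<Longrightarrow> zeta z = 0" "0 < R"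
 shows "ex (X n) (\<lambda>y. ln (bm (X n) (2 * R * norm \<theta> ^ n) y)) \<le> - h n + ln (pi * (3 * R * norm \<theta> ^ n)^2)"
proof -
 let ?W = "set_pmf (X n)"
 define p where "p = pmf (X n)"
 define t where "t = norm \<theta> ^ n"
 have t: "0 < t" by (simp add: t_def)
 define \<phi> where "\<phi> = scl (\<theta> ^ n) zeta"
 have d\<phi>: "dens \<phi>" unfolding \<phi>_def by (rule dens_scl[OF zeta(1)]) simp
 note \<phi>D = densD[OF d\<phi>]
 define g where "g = bm (X n) (3 * R * t)"
 have rho: "rho n z = (\<Sum>w\<in>?W. p w * \<phi> (z - w))" for z
  using rho_add[of n 0] by (simp add: \<phi>_def rho_def[of 0] conv_pmf p_def)
 have \<phi>0: "norm y \<le> R * t" if "\<phi> y \<noteq> 0" for y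
  using scl_nonzero[OF R(1) that[unfolded \<phi>_def]] by (simp add: t_def norm_power)
 have g2: "bm (X n) (2 * R * t) y \<le> g z" if "\<phi> (z - y) \<noteq> 0" for y z
  unfolding g_def using \<phi>0[OF that] by (intro bm_mono) (auto simp: norm_minus_commute)
 have g3: "0 < bm (X n) (2 * R * t) y" if "y \<in> ?W" for y using that R t by (intro bm_pos) auto
 have ex_y: "\<exists>y\<in>?W. \<phi> (z - y) \<noteq> 0" if "rho n z \<noteq> 0" for z
 proof (rule ccontr)
  assume "\<not> ?thesis"
  hence "rho n z = 0" unfolding rho by (intro sum.neutral) auto
  thus False using that by simp
 qed
 have gpos: "0 < g z" if "rho n z \<noteq> 0" for z
  using ex_y[OF that] g2 g3 by (meson less_le_trans)
 define c where "c = (\<Sum>y\<in>?W. - ln (bm (X n) (2 * R * t) y))"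
 have lnb: "ln (bm (X n) (2 * R * t) y) \<le> 0" for y
  using bm_le_1[OF finite_X, of n "2 * R * t" y] bm_nonneg[of "X n" "2 * R * t" y] by (cases "bm (X n) (2 * R * t) y = 0") auto
 have lng: "\<bar>ln (g z)\<bar> \<le> c" if nz: "rho n z \<noteq> 0" for z
 proof -
  obtain y where y: "y \<in> ?W" "\<phi> (z - y) \<noteq> 0" using ex_y[OF nz] by blast
  have "ln (bm (X n) (2 * R * t) y) \<le> ln (g z)" using g2[OF y(2)] g3[OF y(1)] gpos[OF nz] by simp
  moreover have "- ln (bm (X n) (2 * R * t) y) \<le> c" unfolding c_def using y lnb by (intro member_le_sum) auto
  moreover have "ln (g z) \<le> 0" using gpos[OF nz] bm_le_1[OF finite_X] by (simp add: g_def)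
  ultimately show ?thesis by linarith
 qed
 have bg: "bsf g" unfolding g_def by (rule bsf_bm) simp
 have bfg: "bsf (\<lambda>z. rho n z * ln (g z))"
 proof (rule bsf_subset[OF densD(1)[OF dens_rho[of n]], where c = c])
  show "(\<lambda>z. rho n z * ln (g z)) \<in> borel_measurable borel"
   using densD(3)[OF dens_rho[of n]] bg by (auto simp: bsf_def)
  show "\<bar>rho n z * ln (g z)\<bar> \<le> c * \<bar>rho n z\<bar>" for z
   using lng[of z] by (cases "rho n z = 0") (auto simp: abs_mult mult.commute intro: mult_right_mono)
 qed
 have "(LBINT z. rho n z * ln (g z)) \<le> - ent (rho n) + ln (pi * (3 * R * t)^2)"
 proof (rule gibbs[OF dens_rho bg _ _ bfg])
  show "integral\<^sup>L lborel g \<le> pi * (3 * R * t)^2" unfolding g_def using R t by (subst integral_bm) auto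
 qed (use gpos R t in \<open>auto simp: g_def bm_nonneg\<close>)
 moreover have "ex (X n) (\<lambda>y. ln (bm (X n) (2 * R * t) y)) \<le> (LBINT z. rho n z * ln (g z))"
 proof -
  have "ex (X n) (\<lambda>y. ln (bm (X n) (2 * R * t) y)) = (LBINT z. (\<Sum>y\<in>?W. p y * ln (bm (X n) (2 * R * t) y) * \<phi> (z - y)))"
   using \<phi>D by (subst Bochner_Integration.integral_sum) (auto intro!: integrable_mult_right bsf_integrable bsf_shift simp: integral_shift ex_def p_def)
  also have "... \<le> (LBINT z. rho n z * ln (g z))"
  proof (rule integral_mono)
   show "integrable lborel (\<lambda>z. \<Sum>y\<in>?W. p y * ln (bm (X n) (2 * R * t) y) * \<phi> (z - y))"
    using \<phi>D by (intro Bochner_Integration.integrable_sum integrable_mult_right bsf_integrable bsf_shift)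
   show "integrable lborel (\<lambda>z. rho n z * ln (g z))" by (rule bsf_integrable[OF bfg])
   fix z
   have "(\<Sum>y\<in>?W. p y * ln (bm (X n) (2 * R * t) y) * \<phi> (z - y)) \<le> (\<Sum>y\<in>?W. p y * \<phi> (z - y) * ln (g z))"
   proof (rule sum_mono)
    fix y assume y: "y \<in> ?W"
    show "p y * ln (bm (X n) (2 * R * t) y) * \<phi> (z - y) \<le> p y * \<phi> (z - y) * ln (g z)"
    proof (cases "\<phi> (z - y) = 0")
     case False
     have "ln (bm (X n) (2 * R * t) y) \<le> ln (g z)" using g2[OF False] g3[OF y] by simp
     hence "p y * \<phi> (z - y) * ln (bm (X n) (2 * R * t) y) \<le> p y * \<phi> (z - y) * ln (g z)"
      using \<phi>D(2) by (intro mult_left_mono) (auto simp: p_def)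
     thus ?thesis by (simp add: mult_ac)
    qed simp
   qed
   also have "... = rho n z * ln (g z)" by (subst rho) (simp add: sum_distrib_right)
   finally show "(\<Sum>y\<in>?W. p y * ln (bm (X n) (2 * R * t) y) * \<phi> (z - y)) \<le> rho n z * ln (g z)" .
  qed
  finally show ?thesis .
 qed
 ultimately show ?thesis by (simp add: h_def t_def)
qed

text \<open>Rescaling by \<open>\<theta> ^ n\<close> multiplies the moment by
  \<open>(norm \<theta> ^ n) powr (- 2 * t)\<close>. The translates by \<open>X n\<close> overlap at
  a point only if their centres are within \<open>2 * R * norm \<theta> ^ n\<close>, so
  \<open>powr_sum_le\<close> yields the other factor.\<close>

lemma integral_conv_X_powr_le:
 assumes f: "bsf f" "\<And>z. 0 \<le> f z" and R: "\<And>z. R < norm z \<Longrightarrow> f z = 0" "0 \<le> R" and t: "0 < t"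
 shows "(LBINT z. conv (X n) (scl (\<theta> ^ n) f) z powr (1 + t))
  \<le> ex (X n) (\<lambda>y. bm (X n) (2 * R * norm \<theta> ^ n) y powr t) * (norm \<theta> ^ n) powr (- 2 * t) * (LBINT z. f z powr (1 + t))"
proof -
 let ?W = "set_pmf (X n)"
 define u where "u = norm \<theta> ^ n"
 have u: "0 < u" by (simp add: u_def)
 define \<phi> where "\<phi> = scl (\<theta> ^ n) f"
 have \<phi>: "bsf \<phi>" "\<And>z. 0 \<le> \<phi> z" unfolding \<phi>_def using f by (auto intro: bsf_scl) (simp add: scl_def)
 have \<phi>0: "norm y \<le> R * u" if "\<phi> y \<noteq> 0" for y
  using scl_nonzero[OF R(1) that[unfolded \<phi>_def]] by (simp add: u_def norm_power)
 define S where "S y = bm (X n) (2 * R * u) y" for y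
 have pt: "conv (X n) \<phi> z powr (1 + t) \<le> (\<Sum>y\<in>?W. pmf (X n) y * (S y powr t * \<phi> (z - y) powr (1 + t)))" for z
  unfolding conv_pmf[OF finite_X]
 proof (rule powr_sum_le)
  fix y assume "y \<in> ?W" "\<phi> (z - y) \<noteq> 0"
  show "(\<Sum>j\<in>{j \<in> ?W. \<phi> (z - j) \<noteq> 0}. pmf (X n) j) \<le> S y"
   unfolding S_def bm_def
  proof (rule sum_mono2)
   show "{j \<in> ?W. \<phi> (z - j) \<noteq> 0} \<subseteq> {w \<in> ?W. norm (w - y) \<le> 2 * R * u}"
   proof clarify
    fix j assume "\<phi> (z - j) \<noteq> 0"
    hence "norm (z - j) \<le> R * u" "norm (z - y) \<le> R * u" using \<phi>0 \<open>\<phi> (z - y) \<noteq> 0\<close> by auto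
    thus "norm (j - y) \<le> 2 * R * u" using norm_triangle_ineq4[of "z - y" "z - j"] by simp
   qed
  qed auto
 qed (use \<phi> t in \<open>auto simp: S_def bm_nonneg\<close>)
 have c: "bsf (\<lambda>z. conv (X n) \<phi> z powr (1 + t))" using \<phi> t by (intro bsf_powr conv_bsf conv_nonneg) auto
 have p: "bsf (\<lambda>z. \<phi> z powr (1 + t))" using \<phi> t by (intro bsf_powr) auto
 have "(LBINT z. conv (X n) \<phi> z powr (1 + t)) \<le> (LBINT z. (\<Sum>y\<in>?W. pmf (X n) y * S y powr t * \<phi> (z - y) powr (1 + t)))"
  using pt bsf_integrable[OF c] bsf_integrable[OF bsf_shift[OF p]]
  by (intro integral_mono) (auto simp: mult.assoc)
 also have "... = (\<Sum>y\<in>?W. pmf (X n) y * S y powr t * (LBINT z. \<phi> z powr (1 + t)))"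
  using bsf_integrable[OF bsf_shift[OF p]] integral_shift[of "\<lambda>z. \<phi> z powr (1 + t)"] p
  by (subst Bochner_Integration.integral_sum) (auto simp: bsf_def)
 also have "... = ex (X n) (\<lambda>y. S y powr t) * (LBINT z. \<phi> z powr (1 + t))"
  by (simp add: ex_def sum_distrib_right)
 also have "(LBINT z. \<phi> z powr (1 + t)) = u powr (- 2 * t) * (LBINT z. f z powr (1 + t))"
 proof -
  have "\<phi> z powr (1 + t) = (\<lambda>x. f x powr (1 + t) / (u^2) powr (1 + t)) (z / \<theta> ^ n)" for z
   using f u by (simp add: \<phi>_def scl_def u_def norm_power powr_divide)
  hence "(LBINT z. \<phi> z powr (1 + t)) = (LBINT z. (\<lambda>x. f x powr (1 + t) / (u^2) powr (1 + t)) (z / \<theta> ^ n))" by simp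
  also have "... = (norm (\<theta> ^ n))^2 * (LBINT x. f x powr (1 + t) / (u^2) powr (1 + t))"
   using f by (intro integral_scl) (auto simp: bsf_def)
  also have "... = u^2 / (u^2) powr (1 + t) * (LBINT x. f x powr (1 + t))" by (simp add: u_def norm_power)
  also have "u^2 / (u^2) powr (1 + t) = u powr (- 2 * t)"
  proof -
   have "u^2 = u powr 2" using u by simp
   thus ?thesis using u by (simp only: powr_powr powr_diff[symmetric]) (simp add: algebra_simps)
  qed
  finally show ?thesis .
 qed
 finally show ?thesis by (simp add: \<phi>_def S_def u_def mult.assoc)
qed

text \<open>For small \<open>t\<close>, \<open>x powr t\<close> is \<open>1 + t * ln x\<close> up to
  a quadratic error. Since \<open>e\<close> tends to 0, the mean log mass is at most
  \<open>2 * n * ln (norm \<theta>) + 2 * \<eta> * n\<close> for large \<open>n\<close>, and this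
  governs the mean of the power. The block length \<open>n\<close> is fixed before \<open>t\<close>,
  because the quadratic error grows with \<open>n\<close>.\<close>

lemma ex_powr_bm_small:
 assumes lim: "e \<longlonglongrightarrow> 0" and \<eta>: "0 < \<eta>" and R: "\<And>z. R < norm z \<Longrightarrow> zeta z = 0" "0 < R"
 shows "\<exists>n\<ge>1. \<exists>t>0. ex (X n) (\<lambda>y. bm (X n) (2 * R * norm \<theta> ^ n) y powr t) * (norm \<theta> ^ n) powr (- 2 * t) \<le> exp (3 * t * \<eta> * real n)"
proof -
 define u where "u = norm \<theta>"
 have u: "0 < u" "u < 1" using th1 by (auto simp: u_def)
 obtain a where a: "0 < a" "a \<le> 1" "\<And>n y. y \<in> set_pmf (X n) \<Longrightarrow> a ^ n \<le> pmf (X n) y"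
  using pmf_X_ge by blast
 define c where "c = - ln a"
 have c: "0 \<le> c" using a by (simp add: c_def)
 have "eventually (\<lambda>m. e m < \<eta>) sequentially" using lim \<eta> by (intro order_tendstoD) auto
 then obtain m0 where m0: "e m0 < \<eta>" by (auto simp: eventually_sequentially)
 define C8 where "C8 = ln (pi * (3 * R)^2) - h m0"
 obtain n0 where n0: "C8 / \<eta> < real n0" using reals_Archimedean2 by blast
 define n where "n = max 1 (max n0 m0)"
 have n: "1 \<le> n" "m0 \<le> n" "C8 \<le> real n * \<eta>"
 proof -
  have "C8 \<le> real n0 * \<eta>" using n0 \<eta> by (simp add: pos_divide_less_eq)
  also have "... \<le> real n * \<eta>" using \<eta> by (intro mult_right_mono) (auto simp: n_def)
  finally show "C8 \<le> real n * \<eta>" .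
 qed (auto simp: n_def)
 have hn: "- h n \<le> real n * \<eta> - h m0"
 proof -
  have "h m0 - h n \<le> real (n - m0) * e m0" using n by (intro h_diff_le)
  also have "... \<le> real n * \<eta>" using m0 e_nonneg[of m0] by (intro mult_mono) auto
  finally show ?thesis by simp
 qed
 define t where "t = \<eta> / (real n * c^2 + 1)"
 have nc: "0 < real n * c^2 + 1" by (intro add_nonneg_pos) auto
 have t: "0 < t" using \<eta> nc by (simp add: t_def)
 have tn: "t * (real n * c^2) \<le> \<eta>"
 proof -
  have "t * (real n * c^2) \<le> t * (real n * c^2 + 1)" using t by (intro mult_left_mono) auto
  also have "... = \<eta>" using nc by (simp add: t_def)
  finally show ?thesis .
 qed
 let ?S = "bm (X n) (2 * R * u ^ n)"
 have "ex (X n) (\<lambda>y. ?S y powr t) \<le> ex (X n) (\<lambda>y. (1 + t * ln (?S y)) + t^2 * (real n * c)^2)"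
 proof (rule ex_mono)
  fix y assume y: "y \<in> set_pmf (X n)"
  have S: "pmf (X n) y \<le> ?S y" using R u y by (intro pmf_le_bm) auto
  have S0: "0 < ?S y" using R u y by (intro bm_pos) auto
  have ln0: "ln (?S y) \<le> 0" using S0 bm_le_1[OF finite_X] by simp
  have "a ^ n \<le> ?S y" using a(3)[OF y] S by linarith
  hence "ln (a ^ n) \<le> ln (?S y)" using a(1) S0 by simp
  hence "- ln (?S y) \<le> real n * c" using a(1) by (simp add: ln_realpow c_def)
  hence "(- ln (?S y))^2 \<le> (real n * c)^2" using ln0 by (intro power_mono) auto
  hence sq: "t^2 * (ln (?S y))^2 \<le> t^2 * (real n * c)^2" by (intro mult_left_mono) auto
  have "?S y powr t = exp (t * ln (?S y))" using S0 by (simp add: powr_def)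
  also have "... \<le> 1 + t * ln (?S y) + (t * ln (?S y))^2"
   using t ln0 by (intro exp_le_quadratic) (simp add: mult_nonneg_nonpos)
  finally show "?S y powr t \<le> (1 + t * ln (?S y)) + t^2 * (real n * c)^2" using sq by (simp add: power_mult_distrib)
 qed
 also have "... = 1 + t * ex (X n) (\<lambda>y. ln (?S y)) + t^2 * (real n * c)^2"
  by (simp add: ex_add ex_cmult ex_const)
 also have "... \<le> exp (t * ex (X n) (\<lambda>y. ln (?S y)) + t^2 * (real n * c)^2)"
  using exp_ge_add_one_self[of "t * ex (X n) (\<lambda>y. ln (?S y)) + t^2 * (real n * c)^2"] by (simp only: add.assoc)
 also have "... \<le> exp (t * (2 * \<eta> * n + 2 * real n * ln u) + t * \<eta> * n)"
 proof -
  have "ex (X n) (\<lambda>y. ln (?S y)) \<le> - h n + ln (pi * (3 * R * u ^ n)^2)" unfolding u_def by (rule ex_ln_bm_le[OF R])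
  also have "ln (pi * (3 * R * u ^ n)^2) = ln (pi * (3 * R)^2) + 2 * real n * ln u"
   using R u by (simp add: power_mult_distrib ln_mult ln_realpow)
  also have "- h n + (ln (pi * (3 * R)^2) + 2 * real n * ln u) \<le> 2 * \<eta> * n + 2 * real n * ln u"
  proof -
   have "2 * \<eta> * n = 2 * (real n * \<eta>)" by simp
   thus ?thesis using hn n(3) unfolding C8_def by linarith
  qed
  finally have "t * ex (X n) (\<lambda>y. ln (?S y)) \<le> t * (2 * \<eta> * n + 2 * real n * ln u)" using t by (intro mult_left_mono) auto
  moreover have "t^2 * (real n * c)^2 \<le> t * \<eta> * n"
  proof -
   have "t^2 * (real n * c)^2 = t * n * (t * (real n * c^2))" by (simp add: power2_eq_square mult_ac)
   also have "... \<le> t * n * \<eta>" using t tn by (intro mult_left_mono) auto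
   finally show ?thesis by (simp add: mult_ac)
  qed
  ultimately show ?thesis by simp
 qed
 finally have 1: "ex (X n) (\<lambda>y. ?S y powr t) \<le> exp (t * (2 * \<eta> * n + 2 * real n * ln u) + t * \<eta> * n)" .
 have 2: "(u ^ n) powr (- 2 * t) = exp (- 2 * t * (real n * ln u))"
  using u by (simp add: powr_def ln_realpow)
 have "ex (X n) (\<lambda>y. ?S y powr t) * (u ^ n) powr (- 2 * t)
  \<le> exp (t * (2 * \<eta> * n + 2 * real n * ln u) + t * \<eta> * n) * exp (- 2 * t * (real n * ln u))"
  unfolding 2 by (rule mult_right_mono[OF 1]) simp
 also have "... = exp (3 * t * \<eta> * n)" by (simp add: algebra_simps flip: exp_add)
 finally show ?thesis using n t unfolding u_def by blast
qed

text \<open>Iterating over blocks of \<open>n\<close> digits, the moments grow at most like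
  \<open>exp (t * \<tau> / 2 * n * k)\<close>. Markov's inequality at a threshold exceeding the area
  scale by \<open>exp (\<tau> * n * k)\<close> leaves \<open>exp (- t * \<tau> / 2 * n * k)\<close>.
  The value \<open>\<tau> / 6\<close> below compensates the factor 3 in
  \<open>ex_powr_bm_small\<close>.\<close>

theorem large_deviation:
 assumes lim: "e \<longlonglongrightarrow> 0" and \<tau>: "0 < \<tau>" and r: "0 < r"
 shows "\<exists>n\<ge>1. \<exists>c>0. \<exists>C\<ge>0. \<forall>k. ex (X (n * k))
   (\<lambda>y. if (norm \<theta> ^ (n * k))\<^sup>2 * exp (\<tau> * real (n * k)) < bm (X (n * k)) (r * norm \<theta> ^ (n * k)) y then 1 else 0) \<le> C * exp (- c * real k)"
proof -
 define u where "u = norm \<theta>"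
 have u: "0 < u" "u < 1" using th1 by (auto simp: u_def)
 obtain A where A: "0 \<le> A" "\<And>x. x \<in> set_pmf \<alpha> \<Longrightarrow> norm x \<le> A" using alpha_bound by blast
 obtain R0 where R0: "0 < R0" "\<And>l z. R0 < norm z \<Longrightarrow> rho l z = 0" using rho_supp by blast
 define R where "R = max (2 * r) (max R0 (A / (1 - u)))"
 have R: "0 < R" "2 * r \<le> R" "R0 \<le> R" using r R0 by (auto simp: R_def)
 have "A / (1 - u) \<le> R" by (simp add: R_def)
 hence inv: "A + norm \<theta> * R \<le> R" using u by (simp add: u_def field_simps)
 have zR: "zeta z = 0" if "R < norm z" for z using R0(2)[of z 0] R that by (simp add: rho_def)
 have "0 < \<tau> / 6" using \<tau> by simp
 obtain n t where n: "1 \<le> n" and t: "0 < t"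
  and T: "ex (X n) (\<lambda>y. bm (X n) (2 * R * u ^ n) y powr t) * (u ^ n) powr (- 2 * t) \<le> exp (3 * t * (\<tau> / 6) * n)"
  using ex_powr_bm_small[OF lim \<open>0 < \<tau> / 6\<close> zR R(1)] unfolding u_def by blast
 \<comment> \<open>The normalised indicator of a disc, so that \<open>(P ^^ m) ch\<close> is a ball
   mass of \<open>X m\<close> divided by the area of the ball. The radius is \<open>2 * r\<close>
   because the ball of radius \<open>2 * r * u ^ m\<close> about any point close to \<open>y\<close>
   contains the ball of radius \<open>r * u ^ m\<close> about \<open>y\<close>.\<close>
 define ch :: "complex \<Rightarrow> real" where "ch z = 1 / (4 * pi * r^2) * indicator (cball 0 (2 * r)) z" for z
 have ch: "bsf ch" "\<And>z. 0 \<le> ch z" "\<And>z. R < norm z \<Longrightarrow> ch z = 0"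
 proof -
  show "bsf ch" unfolding ch_def[abs_def] by (rule bsf_mult[OF bsf_indicator_cball])
 qed (use R in \<open>auto simp: ch_def indicator_def\<close>)
 define f where "f m = (P ^^ m) ch" for m
 have f: "bsf (f m) \<and> (\<forall>z. 0 \<le> f m z) \<and> (\<forall>z. R < norm z \<longrightarrow> f m z = 0)" for m
 proof (induction m)
  case 0 thus ?case using ch by (auto simp: f_def)
 next
  case (Suc m)
  have "f (Suc m) = P (f m)" by (simp add: f_def)
  moreover have "bsf (P (f m))" unfolding P_def using Suc by (intro conv_bsf bsf_scl) auto
  moreover have "0 \<le> P (f m) z" for z unfolding P_def using Suc by (intro conv_nonneg) (auto simp: scl_def)
  moreover have "P (f m) z = 0" if "R < norm z" for z using Suc that by (intro supp_P[OF A(2) inv]) auto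
  ultimately show ?case by simp
 qed
 define M where "M k = (LBINT z. f (n * k) z powr (1 + t))" for k
 have Mnn: "0 \<le> M k" for k unfolding M_def by (intro integral_nonneg_AE) auto
 have M: "M k \<le> exp (3 * t * (\<tau> / 6) * n * k) * M 0" for k
 proof (induction k)
  case (Suc k)
  have "f (n * Suc k) = conv (X n) (scl (\<theta> ^ n) (f (n * k)))"
   unfolding f_def by (simp add: funpow_add P_funpow)
  hence "M (Suc k) \<le> (ex (X n) (\<lambda>y. bm (X n) (2 * R * norm \<theta> ^ n) y powr t) * (norm \<theta> ^ n) powr (- 2 * t)) * M k"
   unfolding M_def using f[of "n * k"] R t by (simp only:) (intro integral_conv_X_powr_le, auto)
  also have "... \<le> exp (3 * t * (\<tau> / 6) * n) * M k"
   using T Mnn unfolding u_def by (rule mult_right_mono)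
  also have "... \<le> exp (3 * t * (\<tau> / 6) * n) * (exp (3 * t * (\<tau> / 6) * n * k) * M 0)"
   using Suc by (intro mult_left_mono) auto
  also have "... = exp (3 * t * (\<tau> / 6) * n * real (Suc k)) * M 0"
   by (simp add: algebra_simps flip: exp_add)
  finally show ?case .
 qed simp
 have main: "ex (X (n * k)) (\<lambda>y. bm (X (n * k)) (r * u ^ (n * k)) y powr t) \<le> 4 * (4 * pi * r^2 * (u ^ (n * k))^2) powr t * M k" for k
 proof -
  define m where "m = n * k"
  define D where "D = 4 * pi * r^2 * (u ^ m)^2"
  have D: "0 < D" using r u by (simp add: D_def)
  let ?W = "set_pmf (X m)"
  let ?b = "bm (X m) (r * u ^ m)" and ?B = "\<lambda>y. cball y (r * u ^ m)" and ?B2 = "\<lambda>y. cball y (2 * r * u ^ m)"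
  let ?q = "\<lambda>y. pmf (X m) y * ((?b y / D) powr t / D)"
  have fz: "f m z = bm (X m) (2 * r * u ^ m) z / D" for z
  proof -
   have "f m z = (\<Sum>y\<in>?W. pmf (X m) y * scl (\<theta> ^ m) ch (z - y))"
    unfolding f_def P_funpow by (rule conv_pmf) simp
   also have "... = (\<Sum>y\<in>?W. pmf (X m) y * indicator (?B2 y) z / D)"
   proof (rule sum.cong[OF refl])
    fix y
    have "(norm ((z - y) / \<theta> ^ m) \<le> 2 * r) = (norm (z - y) \<le> 2 * r * u ^ m)"
     using u by (simp add: norm_divide norm_power u_def[symmetric] pos_divide_le_eq)
    hence "indicator (cball 0 (2 * r)) ((z - y) / \<theta> ^ m) = (indicator (?B2 y) z :: real)"
     by (simp add: indicator_def dist_norm norm_minus_commute)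
    thus "pmf (X m) y * scl (\<theta> ^ m) ch (z - y) = pmf (X m) y * indicator (?B2 y) z / D"
     by (simp add: scl_def ch_def D_def norm_power u_def)
   qed
   also have "... = bm (X m) (2 * r * u ^ m) z / D" by (simp only: bm_indicator[OF finite_X] sum_divide_distrib)
   finally show ?thesis .
  qed
  have pt: "(\<Sum>y\<in>?W. ?q y * indicator (?B y) z) \<le> f m z powr (1 + t)" for z
  proof -
   have "(\<Sum>y\<in>?W. ?q y * indicator (?B y) z)
     \<le> (\<Sum>y\<in>?W. pmf (X m) y * indicator (?B2 y) z / D * f m z powr t)"
   proof (rule sum_mono)
    fix y
    show "?q y * indicator (?B y) z
     \<le> pmf (X m) y * indicator (?B2 y) z / D * f m z powr t"
    proof (cases "z \<in> ?B y")
     case True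
     hence le: "norm (y - z) \<le> r * u ^ m" by (simp add: dist_norm)
     have "r * u ^ m \<le> 2 * r * u ^ m" using r u by simp
     hence z2: "z \<in> ?B2 y" using True by simp
     have "?b y \<le> bm (X m) (2 * r * u ^ m) z" using le by (intro bm_mono) auto
     hence "(?b y / D) powr t \<le> f m z powr t"
      unfolding fz using D t by (intro powr_mono2 divide_right_mono) (auto simp: bm_nonneg)
     hence "pmf (X m) y / D * (?b y / D) powr t \<le> pmf (X m) y / D * f m z powr t"
      using D by (intro mult_left_mono) auto
     thus ?thesis using True z2 by (simp add: mult_ac)
    next
     case False
     thus ?thesis using D by (simp add: indicator_def)
    qed
   qed
   also have "... = bm (X m) (2 * r * u ^ m) z / D * f m z powr t"
    by (simp only: bm_indicator[OF finite_X] sum_divide_distrib sum_distrib_right)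
   also have "... = f m z powr (1 + t)" using f[of m] by (simp add: fz[symmetric] powr_mult_base)
   finally show ?thesis .
  qed
  have "ex (X m) (\<lambda>y. ?b y powr t) / (4 * D powr t)
    = (\<Sum>y\<in>?W. ?q y * (pi * (r * u ^ m)^2))"
  proof -
   have "(pi * (r * u ^ m)^2) / D = 1 / 4" using r u by (simp add: D_def power_mult_distrib)
   hence *: "x / D * (pi * (r * u ^ m)^2) = x / 4" for x :: real
    by (metis mult.commute times_divide_eq_right times_divide_eq_left mult_1 divide_divide_eq_left)
   have "?q y * (pi * (r * u ^ m)^2) = pmf (X m) y * ?b y powr t / (4 * D powr t)" for y
    unfolding mult.assoc *[of "(?b y / D) powr t"] using D by (simp add: powr_divide bm_nonneg mult.commute)
   thus ?thesis by (simp add: ex_def sum_divide_distrib)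
  qed
  also have "... = (LBINT z. (\<Sum>y\<in>?W. ?q y * indicator (?B y) z))"
   using bsf_integrable[OF bsf_indicator_cball] r u
   by (subst Bochner_Integration.integral_sum) (auto simp: measure_cball_complex)
  also have "... \<le> (LBINT z. f m z powr (1 + t))"
   using pt f[of m] t by (intro integral_mono bsf_integrable bsf_sum bsf_mult bsf_indicator_cball bsf_powr) auto
  finally have "ex (X m) (\<lambda>y. ?b y powr t) / (4 * D powr t) \<le> M k" by (simp add: M_def m_def)
  moreover have "0 < 4 * D powr t" using D by simp
  ultimately have "ex (X m) (\<lambda>y. ?b y powr t) \<le> M k * (4 * D powr t)"
   by (simp only: pos_divide_le_eq)
  thus ?thesis unfolding m_def D_def by (simp only: mult_ac)
 qed
 define c where "c = t * \<tau> * n / 2"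
 define C where "C = 4 * (4 * pi * r^2) powr t * M 0"
 have "ex (X (n * k)) (\<lambda>y. if (u ^ (n * k))\<^sup>2 * exp (\<tau> * real (n * k)) < bm (X (n * k)) (r * u ^ (n * k)) y then 1 else 0) \<le> C * exp (- c * k)" for k
 proof -
  define m where "m = n * k"
  let ?b = "bm (X m) (r * u ^ m)"
  define \<kappa> where "\<kappa> = (u ^ m)^2 * exp (\<tau> * m)"
  have \<kappa>: "0 < \<kappa>" using u by (simp add: \<kappa>_def)
  have "ex (X m) (\<lambda>y. if \<kappa> < ?b y then 1 else 0) \<le> ex (X m) (\<lambda>y. 1 / \<kappa> powr t * ?b y powr t)"
  proof (rule ex_mono)
   fix y
   have "\<kappa> powr t \<le> ?b y powr t" if "\<kappa> < ?b y"
    using that \<kappa> t by (intro powr_mono2) auto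
   thus "(if \<kappa> < ?b y then 1 else 0) \<le> 1 / \<kappa> powr t * ?b y powr t"
    using \<kappa> by (auto simp: field_simps)
  qed
  also have "... = 1 / \<kappa> powr t * ex (X m) (\<lambda>y. ?b y powr t)" by (rule ex_cmult)
  also have "... \<le> 1 / \<kappa> powr t * (4 * (4 * pi * r^2 * (u ^ m)^2) powr t * M k)"
   using main[of k] \<kappa> by (intro mult_left_mono) (auto simp: m_def)
  also have "... \<le> 1 / \<kappa> powr t * (4 * (4 * pi * r^2 * (u ^ m)^2) powr t * (exp (3 * t * (\<tau> / 6) * n * k) * M 0))"
   using M[of k] \<kappa> by (intro mult_left_mono) auto
  also have "... = C * (((u ^ m)^2) powr t / \<kappa> powr t * exp (t * \<tau> * n * k / 2))"
   using u r by (simp add: C_def powr_mult mult_ac)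
  also have "((u ^ m)^2) powr t / \<kappa> powr t = exp (- (t * \<tau> * n * k))"
  proof -
   have "((u ^ m)^2) powr t / \<kappa> powr t = 1 / exp (\<tau> * m) powr t"
    using u by (simp add: \<kappa>_def powr_mult)
   also have "... = exp (- (t * \<tau> * n * k))"
    by (simp add: exp_powr_real exp_minus m_def mult_ac divide_inverse)
   finally show ?thesis .
  qed
  also have "exp (- (t * \<tau> * n * k)) * exp (t * \<tau> * n * k / 2) = exp (- c * k)"
   by (simp add: c_def field_simps flip: exp_add)
  finally show ?thesis by (simp add: m_def \<kappa>_def)
 qed
 moreover have "0 < c" using t \<tau> n by (simp add: c_def)
 moreover have "0 \<le> C" using Mnn by (simp add: C_def)
 ultimately show ?thesis using n unfolding u_def by blast
qed

end

section \<open>Sets of Hausdorff dimension zero\<close>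

text \<open>Zero Hausdorff measure for every positive exponent, in a form suited to unions: no bound
  on the diameters is imposed, because a small sum already forces every diameter to be
  small.\<close>

definition thin :: "'a::metric_space set \<Rightarrow> bool" where
 "thin S \<longleftrightarrow> (\<forall>s>0. \<forall>\<epsilon>>0. \<exists>U::nat \<Rightarrow> 'a set. S \<subseteq> (\<Union>n. U n) \<and> (\<forall>n. bounded (U n)) \<and>
   (\<Sum>n. ennreal (diameter (U n) powr s)) \<le> ennreal \<epsilon>)"

lemma diameter_le_dist:
 assumes "0 \<le> d" "\<And>x y. x \<in> S \<Longrightarrow> y \<in> S \<Longrightarrow> dist x y \<le> d" shows "diameter S \<le> d"
 unfolding diameter_def using assms by (auto intro!: cSUP_least)

lemma thin_subset: "thin T \<Longrightarrow> S \<subseteq> T \<Longrightarrow> thin S"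
 unfolding thin_def by (meson order_trans)

lemma thin_hausdorff_measure:
 assumes "thin S" "0 < s" shows "hausdorff_measure s S = 0"
proof -
 have "hausdorff_premeasure s \<delta> S \<le> ennreal \<epsilon>" if "0 < \<delta>" "0 < \<epsilon>" for \<delta> \<epsilon>
 proof -
  define \<epsilon>' where "\<epsilon>' = min \<epsilon> (\<delta> powr s)"
  have "0 < \<epsilon>'" using that by (simp add: \<epsilon>'_def)
  then obtain U :: "nat \<Rightarrow> 'a set" where U: "S \<subseteq> (\<Union>n. U n)" "\<And>n. bounded (U n)"
   "(\<Sum>n. ennreal (diameter (U n) powr s)) \<le> ennreal \<epsilon>'"
   using assms unfolding thin_def by blast
  have "diameter (U n) \<le> \<delta>" for n
  proof (rule ccontr)
   assume "\<not> diameter (U n) \<le> \<delta>"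
   hence lt: "\<delta> powr s < diameter (U n) powr s" using that assms(2) by (intro powr_less_mono2) auto
   have "ennreal (diameter (U n) powr s) = (\<Sum>i\<in>{n}. ennreal (diameter (U i) powr s))" by simp
   also have "... \<le> (\<Sum>n. ennreal (diameter (U n) powr s))" by (intro sum_le_suminf) auto
   also have "... \<le> ennreal \<epsilon>'" by (rule U)
   finally have "diameter (U n) powr s \<le> \<epsilon>'" using \<open>0 < \<epsilon>'\<close> by simp
   thus False using lt by (simp add: \<epsilon>'_def)
  qed
  hence "U \<in> hausdorff_covers \<delta> S" using U by (simp add: hausdorff_covers_def)
  hence "hausdorff_premeasure s \<delta> S \<le> (\<Sum>n. ennreal (diameter (U n) powr s))"
   unfolding hausdorff_premeasure_def by (rule INF_lower)
  also have "... \<le> ennreal \<epsilon>" using U(3) by (rule order_trans) (simp add: \<epsilon>'_def ennreal_leI)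
  finally show ?thesis .
 qed
 hence "hausdorff_premeasure s \<delta> S \<le> 0" if "0 < \<delta>" for \<delta>
  using that by (rule_tac ennreal_le_epsilon) auto
 hence "hausdorff_premeasure s \<delta> S = 0" if "0 < \<delta>" for \<delta> using that by simp
 thus ?thesis unfolding hausdorff_measure_def by (simp add: SUP_eq_const)
qed

lemma thin_hausdorff_dim: assumes "thin S" shows "hausdorff_dim S = 0"
proof -
 have "hausdorff_dim S \<le> ennreal s" if "0 < s" for s
  unfolding hausdorff_dim_def using thin_hausdorff_measure[OF assms that] that by (intro INF_lower) auto
 hence "hausdorff_dim S \<le> 0" by (rule_tac ennreal_le_epsilon) auto
 thus ?thesis by simp
qed

lemma thin_UN: assumes "\<And>i::nat. thin (S i)" shows "thin (\<Union>i. S i)"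
 unfolding thin_def
proof (intro allI impI)
 fix s \<epsilon> :: real assume s: "0 < s" and \<epsilon>: "0 < \<epsilon>"
 have "\<exists>U::nat \<Rightarrow> 'a set. S i \<subseteq> (\<Union>n. U n) \<and> (\<forall>n. bounded (U n)) \<and>
   (\<Sum>n. ennreal (diameter (U n) powr s)) \<le> ennreal (\<epsilon> * (1/2) ^ Suc i)" for i
  using assms[of i] s \<epsilon> unfolding thin_def by simp
 then obtain U :: "nat \<Rightarrow> nat \<Rightarrow> 'a set" where U: "\<And>i. S i \<subseteq> (\<Union>n. U i n)" "\<And>i n. bounded (U i n)"
   "\<And>i. (\<Sum>n. ennreal (diameter (U i n) powr s)) \<le> ennreal (\<epsilon> * (1/2) ^ Suc i)"
  by metis
 define V where "V n = U (fst (prod_decode n)) (snd (prod_decode n))" for n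
 have "(\<Sum>n. ennreal (diameter (V n) powr s)) = (\<Sum>i. \<Sum>n. ennreal (diameter (U i n) powr s))"
  unfolding V_def by (rule suminf_ennreal_2dimen[where f = "\<lambda>x. ennreal (diameter (U (fst x) (snd x)) powr s)"]) auto
 also have "... \<le> (\<Sum>i. ennreal (\<epsilon> * (1/2) ^ Suc i))"
  by (intro suminf_le U) auto
 also have "... = ennreal (\<Sum>i. \<epsilon> * (1/2) ^ Suc i)"
  using \<epsilon> by (intro suminf_ennreal2 summable_mult) (auto simp: summable_geometric)
 also have "(\<Sum>i. \<epsilon> * (1/2) ^ Suc i) = \<epsilon>"
  using sums_mult[OF power_half_series, of \<epsilon>] by (simp add: sums_iff)
 finally have "(\<Sum>n. ennreal (diameter (V n) powr s)) \<le> ennreal \<epsilon>" .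
 moreover have "(\<Union>i. S i) \<subseteq> (\<Union>n. V n)"
 proof
  fix x assume "x \<in> (\<Union>i. S i)"
  then obtain i n where "x \<in> U i n" using U(1) by blast
  hence "x \<in> V (prod_encode (i, n))" by (simp add: V_def)
  thus "x \<in> (\<Union>n. V n)" by blast
 qed
 moreover have "\<forall>n. bounded (V n)" using U(2) by (simp add: V_def)
 ultimately show "\<exists>V::nat \<Rightarrow> 'a set. (\<Union>i. S i) \<subseteq> (\<Union>n. V n) \<and> (\<forall>n. bounded (V n)) \<and>
   (\<Sum>n. ennreal (diameter (V n) powr s)) \<le> ennreal \<epsilon>" by blast
qed

lemma thin_empty: "thin {}"
 unfolding thin_def by (auto intro!: exI[of _ "\<lambda>_. {}"])

lemma thin_Un: assumes "thin S" "thin T" shows "thin (S \<union> T)"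
proof -
 have "thin (\<Union>i::nat. if i = 0 then S else T)" using assms by (intro thin_UN) auto
 moreover have "S \<union> T \<subseteq> (\<Union>i::nat. if i = 0 then S else T)" by (auto intro: exI[of _ 1])
 ultimately show ?thesis by (rule thin_subset)
qed

lemma thin_countable_UN: assumes "countable I" "\<And>i. i \<in> I \<Longrightarrow> thin (S i)" shows "thin (\<Union>i\<in>I. S i)"
proof (cases "I = {}")
 case False
 have "S ` I = range (\<lambda>n. S (from_nat_into I n))"
  unfolding range_from_nat_into[OF False assms(1), symmetric, THEN arg_cong[of _ _ "(`) S"]] image_image ..
 hence "(\<Union>i\<in>I. S i) = (\<Union>n. S (from_nat_into I n))" by simp
 moreover have "thin (\<Union>n. S (from_nat_into I n))"
  by (rule thin_UN) (rule assms(2)[OF from_nat_into[OF False]])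
 ultimately show ?thesis by simp
qed (simp add: thin_empty)

text \<open>The covering form of the Borel-Cantelli lemma: a point caught at arbitrarily late stages
  is caught by every tail of the family, and tails of a convergent series are small. The covers may
  depend on \<open>s\<close>.\<close>

lemma thin_limsup:
 assumes "\<And>s. 0 < s \<Longrightarrow> \<exists>C::nat \<Rightarrow> 'a::metric_space set. \<exists>d. summable (\<lambda>k. real (card (C k)) * d k powr s) \<and>
   (\<forall>k. finite (C k) \<and> 0 \<le> d k) \<and> (\<forall>x\<in>S. \<forall>k0. \<exists>k\<ge>k0. \<exists>c\<in>C k. dist c x \<le> d k)"
 shows "thin S"
 unfolding thin_def
proof (intro allI impI)
 fix s \<epsilon> :: real assume s: "0 < s" and \<epsilon>: "0 < \<epsilon>"
 obtain C :: "nat \<Rightarrow> 'a set" and d where sm: "summable (\<lambda>k. real (card (C k)) * d k powr s)"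
  and fin: "\<And>k. finite (C k)" and d: "\<And>k. 0 \<le> d k"
  and cov: "\<And>x k0. x \<in> S \<Longrightarrow> \<exists>k\<ge>k0. \<exists>c\<in>C k. dist c x \<le> d k"
  using assms[OF s] by metis
 let ?w = "\<lambda>k. 2 powr s * (real (card (C k)) * d k powr s)"
 have sm': "summable ?w" by (rule summable_mult[OF sm])
 obtain k0 where k0: "norm (\<Sum>k. ?w (k + k0)) < \<epsilon>"
  using suminf_exist_split[OF \<epsilon> sm'] by blast
 have "\<exists>f. C k = f ` {..<card (C k)}" for k
  using ex_bij_betw_nat_finite[OF fin[of k]] by (metis atLeast0LessThan bij_betw_imp_surj_on)
 then obtain f where f: "\<And>k. C k = f k ` {..<card (C k)}" by metis
 define U where "U k i = (if i < card (C (k + k0)) then cball (f (k + k0) i) (d (k + k0)) else {})" for k i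
 define V where "V n = U (fst (prod_decode n)) (snd (prod_decode n))" for n
 have diam: "ennreal (diameter (U k i) powr s) \<le> (if i < card (C (k + k0)) then ennreal ((2 * d (k + k0)) powr s) else 0)" for k i
 proof (cases "i < card (C (k + k0))")
  case True
  have "diameter (U k i) \<le> 2 * d (k + k0)"
  proof (rule diameter_le_dist)
   show "0 \<le> 2 * d (k + k0)" using d by simp
   fix x y assume "x \<in> U k i" "y \<in> U k i"
   hence "dist (f (k + k0) i) x \<le> d (k + k0)" "dist (f (k + k0) i) y \<le> d (k + k0)" using True by (auto simp: U_def)
   thus "dist x y \<le> 2 * d (k + k0)" using dist_triangle3[of x y "f (k + k0) i"] by linarith
  qed
  moreover have "0 \<le> diameter (U k i)" by (rule diameter_ge_0) (simp add: U_def)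
  ultimately show ?thesis using True s by (auto intro!: ennreal_leI powr_mono2)
 qed (simp add: U_def)
 have "(\<Sum>n. ennreal (diameter (V n) powr s)) = (\<Sum>k. \<Sum>i. ennreal (diameter (U k i) powr s))"
  unfolding V_def by (rule suminf_ennreal_2dimen[where f = "\<lambda>x. ennreal (diameter (U (fst x) (snd x)) powr s)"]) auto
 also have "... \<le> (\<Sum>k. ennreal (?w (k + k0)))"
 proof (intro suminf_le)
  fix k
  have "(\<Sum>i. ennreal (diameter (U k i) powr s)) \<le> (\<Sum>i. if i < card (C (k + k0)) then ennreal ((2 * d (k + k0)) powr s) else 0)"
   using diam by (intro suminf_le) auto
  also have "... = (\<Sum>i<card (C (k + k0)). ennreal ((2 * d (k + k0)) powr s))"
   by (subst suminf_finite[of "{..<card (C (k + k0))}"]) auto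
  also have "... = ennreal (?w (k + k0))"
   using d by (simp add: powr_mult ennreal_of_nat_eq_real_of_nat mult_ac flip: ennreal_mult)
  finally show "(\<Sum>i. ennreal (diameter (U k i) powr s)) \<le> ennreal (?w (k + k0))" .
 qed auto
 also have "... = ennreal (\<Sum>k. ?w (k + k0))"
  using summable_ignore_initial_segment[OF sm', of k0] by (intro suminf_ennreal2) auto
 also have "... \<le> ennreal \<epsilon>" using k0 by (intro ennreal_leI) auto
 finally have "(\<Sum>n. ennreal (diameter (V n) powr s)) \<le> ennreal \<epsilon>" .
 moreover have "S \<subseteq> (\<Union>n. V n)"
 proof
  fix x assume "x \<in> S"
  then obtain k c where k: "k0 \<le> k" "c \<in> C k" "dist c x \<le> d k" using cov by blast
  obtain i where i: "i < card (C k)" "c = f k i" using k(2) f[of k] by auto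
  have "x \<in> V (prod_encode (k - k0, i))" using k i by (simp add: V_def U_def)
  thus "x \<in> (\<Union>n. V n)" by blast
 qed
 moreover have "\<forall>n. bounded (V n)" by (simp add: V_def U_def)
 ultimately show "\<exists>V::nat \<Rightarrow> 'a set. S \<subseteq> (\<Union>n. V n) \<and> (\<forall>n. bounded (V n)) \<and>
   (\<Sum>n. ennreal (diameter (V n) powr s)) \<le> ennreal \<epsilon>" by blast
qed

text \<open>Distances in \<open>S\<close> are at most \<open>C\<close> times those of the images, so
  covers pull back with diameters enlarged at most by \<open>C\<close>.\<close>

lemma thin_preimage:
 fixes f :: "'a::metric_space \<Rightarrow> 'b::metric_space"
 assumes T: "thin T" and S: "f ` S \<subseteq> T" and L: "\<And>x y. x \<in> S \<Longrightarrow> y \<in> S \<Longrightarrow> dist x y \<le> C * dist (f x) (f y)" and C: "0 < C"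
 shows "thin S"
 unfolding thin_def
proof (intro allI impI)
 fix s \<epsilon> :: real assume s: "0 < s" and \<epsilon>: "0 < \<epsilon>"
 obtain U :: "nat \<Rightarrow> 'b set" where U: "T \<subseteq> (\<Union>n. U n)" "\<And>n. bounded (U n)"
   "(\<Sum>n. ennreal (diameter (U n) powr s)) \<le> ennreal (\<epsilon> / C powr s)"
  using T s \<epsilon> C unfolding thin_def by (metis divide_pos_pos powr_gt_zero less_irrefl)
 define V where "V n = {x \<in> S. f x \<in> U n}" for n
 have d: "dist x y \<le> C * diameter (U n)" if "x \<in> V n" "y \<in> V n" for x y n
 proof -
  have "dist x y \<le> C * dist (f x) (f y)" using that by (intro L) (auto simp: V_def)
  also have "... \<le> C * diameter (U n)" using that C U(2) by (intro mult_left_mono diameter_bounded_bound) (auto simp: V_def)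
  finally show ?thesis .
 qed
 have dU: "0 \<le> diameter (U n)" for n using U(2) by (rule diameter_ge_0)
 have b: "bounded (V n)" for n
  unfolding bounded_def
 proof (cases "V n = {}")
  case False
  then obtain x where "x \<in> V n" by blast
  thus "\<exists>x e. \<forall>y\<in>V n. dist x y \<le> e" using d by blast
 qed auto
 have "diameter (V n) \<le> C * diameter (U n)" for n
  using d C dU by (intro diameter_le_dist) auto
 hence "ennreal (diameter (V n) powr s) \<le> ennreal (C powr s) * ennreal (diameter (U n) powr s)" for n
  using s C dU[of n] diameter_ge_0[OF b[of n]]
  by (simp add: powr_mult[symmetric] flip: ennreal_mult) (intro ennreal_leI powr_mono2, auto)
 hence "(\<Sum>n. ennreal (diameter (V n) powr s)) \<le> (\<Sum>n. ennreal (C powr s) * ennreal (diameter (U n) powr s))"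
  by (intro suminf_le) auto
 also have "... = ennreal (C powr s) * (\<Sum>n. ennreal (diameter (U n) powr s))" by simp
 also have "... \<le> ennreal (C powr s) * ennreal (\<epsilon> / C powr s)" by (rule mult_left_mono[OF U(3)]) simp
 also have "... = ennreal \<epsilon>" using C \<epsilon> by (simp flip: ennreal_mult)
 finally have "(\<Sum>n. ennreal (diameter (V n) powr s)) \<le> ennreal \<epsilon>" .
 moreover have "S \<subseteq> (\<Union>n. V n)" using S U(1) by (fastforce simp: V_def)
 ultimately show "\<exists>V::nat \<Rightarrow> 'a set. S \<subseteq> (\<Union>n. V n) \<and> (\<forall>n. bounded (V n)) \<and>
   (\<Sum>n. ennreal (diameter (V n) powr s)) \<le> ennreal \<epsilon>" using b by blast
qed

section \<open>Near coincidences of digit sums\<close>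

text \<open>Divide successively by the Blaschke factors of the disc of radius \<open>R\<close>.\<close>

lemma poly_small_at_0:
 fixes p :: "complex poly" and zs :: "complex list"
 assumes R: "0 < r" "r < R" and \<tau>: "0 < \<tau>" "\<tau> \<le> 4 * R"
  and C: "\<And>w. norm w = R \<Longrightarrow> norm (poly p w) \<le> C"
  and small: "\<And>z. z \<in> set zs \<Longrightarrow> norm z \<le> r \<and> norm (poly p z) \<le> \<rho>" and \<rho>: "0 \<le> \<rho>"
  and sep: "sorted_wrt (\<lambda>z w. \<tau> \<le> norm (z - w)) zs"
 shows "norm (poly p 0) \<le> (r / R) ^ length zs * C + 2 * real (length zs) * \<rho> * (4 * R / \<tau>) ^ length zs"
 using C small \<rho> sep
proof (induction zs arbitrary: p C \<rho>)
 case Nil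
 have "norm (poly p 0) \<le> C"
 proof (rule maximum_modulus_frontier[of "poly p" "cball 0 R"])
  show "poly p holomorphic_on interior (cball 0 R)" by (intro holomorphic_intros)
  show "continuous_on (closure (cball 0 R)) (poly p)" by (intro continuous_intros)
 qed (use R Nil.prems in auto)
 thus ?case by simp
next
 case (Cons z zs)
 have z: "norm z \<le> r" "norm (poly p z) \<le> \<rho>" using Cons.prems(2) by auto
 define q where "q = synthetic_div p z"
 have q: "poly p w = (w - z) * poly q w + poly p z" for w
  using arg_cong[OF synthetic_div_correct'[of z p], of "\<lambda>p. poly p w"] by (simp add: q_def algebra_simps)
 \<comment> \<open>On the circle of radius \<open>R\<close> the factor
   \<open>(R^2 - cnj z * w) / R\<close> has the same modulus as \<open>w - z\<close>, so exchanging
   them keeps the boundary values bounded. At 0 the exchange yields the factor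
   \<open>norm z / R\<close>, hence a gain \<open>r / R\<close> per point.\<close>
 define g where "g = smult (1 / R) (q * [:R\<^sup>2, - cnj z:])"
 have g: "poly g w = poly q w * (R^2 - cnj z * w) / R" for w
  by (simp add: g_def algebra_simps diff_divide_distrib)
 have C1: "norm (poly g w) \<le> C + \<rho>" if w: "norm w = R" for w
 proof -
  have "complex_of_real (R^2) - cnj z * w = w * cnj (w - z)"
   using complex_norm_square[of w] w by (simp add: algebra_simps)
  hence "norm (complex_of_real (R^2) - cnj z * w) = R * norm (w - z)"
   using w by (simp only: norm_mult complex_mod_cnj)
  hence "norm (poly g w) = norm ((w - z) * poly q w)"
   using R by (simp add: g norm_mult norm_divide mult_ac)
  also have "(w - z) * poly q w = poly p w - poly p z" using q[of w] by simp
  also have "norm ... \<le> norm (poly p w) + norm (poly p z)" by (rule norm_triangle_ineq4)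
  also have "... \<le> C + \<rho>" using Cons.prems(1)[OF w] z by linarith
  finally show ?thesis .
 qed
 define \<kappa> where "\<kappa> = 4 * R / \<tau>"
 have \<kappa>: "1 \<le> \<kappa>" using \<tau> by (simp add: \<kappa>_def)
 have small': "norm w \<le> r \<and> norm (poly g w) \<le> \<rho> * \<kappa>" if w: "w \<in> set zs" for w
 proof
  show wr: "norm w \<le> r" using Cons.prems(2) w by simp
  have d: "\<tau> \<le> norm (w - z)" using Cons.prems(4) w by (simp add: norm_minus_commute)
  have "norm (poly q w) * norm (w - z) = norm (poly p w - poly p z)" using q[of w] by (simp add: mult.commute flip: norm_mult)
  also have "... \<le> norm (poly p w) + norm (poly p z)" by (rule norm_triangle_ineq4)
  also have "... \<le> 2 * \<rho>" using Cons.prems(2)[of w] w z by auto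
  finally have "norm (poly q w) * norm (w - z) \<le> 2 * \<rho>" .
  moreover have "norm (poly q w) * \<tau> \<le> norm (poly q w) * norm (w - z)" using d by (intro mult_left_mono) auto
  ultimately have nq: "norm (poly q w) \<le> 2 * \<rho> / \<tau>" using \<tau> by (simp add: pos_le_divide_eq)
  have "norm (complex_of_real (R^2) - cnj z * w) \<le> norm (complex_of_real (R^2)) + norm (cnj z * w)" by (rule norm_triangle_ineq4)
  also have "norm (cnj z * w) \<le> R * R" using z wr R by (auto simp: norm_mult intro!: mult_mono)
  also have "norm (complex_of_real (R^2)) + R * R = 2 * R^2" by (simp only: norm_of_real) (simp add: power2_eq_square)
  finally have "norm (poly g w) \<le> (2 * \<rho> / \<tau>) * (2 * R^2) / R"
   using nq R \<tau> \<open>0 \<le> \<rho>\<close> by (simp only: g norm_mult norm_divide norm_of_real) (intro divide_mono mult_mono, auto)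
  also have "... = \<rho> * \<kappa>" using R by (simp add: \<kappa>_def power2_eq_square)
  finally show "norm (poly g w) \<le> \<rho> * \<kappa>" .
 qed
 let ?m = "length zs"
 have IH: "norm (poly g 0) \<le> (r / R) ^ ?m * (C + \<rho>) + 2 * real ?m * (\<rho> * \<kappa>) * \<kappa> ^ ?m"
  unfolding \<kappa>_def
  using Cons.prems(3,4) \<tau> R by (intro Cons.IH C1 small'[unfolded \<kappa>_def]) auto
 have rR: "0 \<le> r / R" "r / R \<le> 1" using R by auto
 have "poly p 0 = - z * poly q 0 + poly p z" using q[of 0] by simp
 hence "norm (poly p 0) \<le> norm z * norm (poly q 0) + norm (poly p z)"
  by (metis norm_mult norm_minus_cancel norm_triangle_ineq)
 also have "norm z * norm (poly q 0) = (norm z / R) * norm (poly g 0)"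
  using R by (simp add: g norm_mult norm_divide norm_power power2_eq_square)
 also have "... \<le> (r / R) * ((r / R) ^ ?m * (C + \<rho>) + 2 * real ?m * (\<rho> * \<kappa>) * \<kappa> ^ ?m)"
  using z R IH by (intro mult_mono divide_right_mono) auto
 also have "... = (r / R) ^ Suc ?m * C + (r / R) ^ Suc ?m * \<rho> + (r / R) * (2 * real ?m * \<rho> * \<kappa> ^ Suc ?m)"
  by (simp add: algebra_simps)
 also have "... \<le> (r / R) ^ Suc ?m * C + \<rho> + 2 * real ?m * \<rho> * \<kappa> ^ Suc ?m"
 proof -
  have "(r / R) ^ Suc ?m * \<rho> \<le> 1 * \<rho>" using rR \<open>0 \<le> \<rho>\<close> by (intro mult_right_mono power_le_one) auto
  moreover have "(r / R) * (2 * real ?m * \<rho> * \<kappa> ^ Suc ?m) \<le> 1 * (2 * real ?m * \<rho> * \<kappa> ^ Suc ?m)"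
   using rR \<open>0 \<le> \<rho>\<close> \<kappa> by (intro mult_right_mono) auto
  ultimately show ?thesis by simp
 qed
 finally have "norm (poly p 0) \<le> (r / R) ^ Suc ?m * C + 2 * \<rho> + 2 * real ?m * \<rho> * \<kappa> ^ Suc ?m" using z by simp
 moreover have "2 * \<rho> \<le> 2 * \<rho> * \<kappa> ^ Suc ?m" using \<open>0 \<le> \<rho>\<close> one_le_power[OF \<kappa>, of "Suc ?m"] by (simp add: mult_left_le del: power_Suc)
   (metis mult_left_mono mult.right_neutral)
 moreover have "2 * real (Suc ?m) * \<rho> * \<kappa> ^ Suc ?m = 2 * \<rho> * \<kappa> ^ Suc ?m + 2 * real ?m * \<rho> * \<kappa> ^ Suc ?m"
  by (simp add: distrib_left distrib_right)
 ultimately have "norm (poly p 0) \<le> (r / R) ^ Suc ?m * C + 2 * real (Suc ?m) * \<rho> * \<kappa> ^ Suc ?m" by linarith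
 thus ?case by (simp only: \<kappa>_def length_Cons)
qed

section \<open>Covers of sublevel sets of polynomials\<close>

definition covered :: "nat \<Rightarrow> real \<Rightarrow> 'a::real_normed_vector set \<Rightarrow> bool" where
 "covered m \<delta> A \<longleftrightarrow> (\<exists>C. finite C \<and> card C \<le> m \<and> (\<forall>x\<in>A. \<exists>c\<in>C. norm (c - x) \<le> \<delta>))"

text \<open>A separated list of maximal length is a net, since an uncovered point could be added to
  it.\<close>

lemma finite_net:
 fixes A :: "'a::real_normed_vector set"
 assumes "\<not> (\<exists>zs. length zs = m \<and> set zs \<subseteq> A \<and> sorted_wrt (\<lambda>z w. \<tau> \<le> norm (z - w)) zs)"
 shows "covered m \<tau> A"
proof -
 let ?P = "\<lambda>n. \<exists>zs. length zs = n \<and> set zs \<subseteq> A \<and> sorted_wrt (\<lambda>z w. \<tau> \<le> norm (z - w)) zs"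
 have down: "?P n" if pm: "?P m'" "n \<le> m'" for n m'
 proof -
  obtain zs where "length zs = m'" "set zs \<subseteq> A" "sorted_wrt (\<lambda>z w. \<tau> \<le> norm (z - w)) zs" using pm(1) by blast
  thus ?thesis using pm(2)
   by (intro exI[of _ "take n zs"]) (auto intro: sorted_wrt_take dest: in_set_takeD)
 qed
 have lt: "n < m" if "?P n" for n using down[OF that, of m] assms by (meson not_less)
 have P0: "?P 0" by auto
 define n where "n = (GREATEST n. ?P n)"
 have n: "?P n" unfolding n_def by (rule GreatestI_nat[where P = ?P and b = m and k = 0, OF P0]) (use lt less_imp_le in blast)
 have max: "\<not> ?P (Suc n)"
 proof
  assume "?P (Suc n)"
  hence "Suc n \<le> n" unfolding n_def by (rule Greatest_le_nat[where P = ?P and b = m]) (use lt less_imp_le in blast)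
  thus False by simp
 qed
 obtain zs where zs: "length zs = n" "set zs \<subseteq> A" "sorted_wrt (\<lambda>z w. \<tau> \<le> norm (z - w)) zs" using n by blast
 have "\<exists>c\<in>set zs. norm (c - x) \<le> \<tau>" if x: "x \<in> A" for x
 proof (rule ccontr)
  assume "\<not> ?thesis"
  hence "sorted_wrt (\<lambda>z w. \<tau> \<le> norm (z - w)) (x # zs)" using zs by (auto simp: norm_minus_commute not_le)
  hence "?P (Suc n)" using zs x by (intro exI[of _ "x # zs"]) auto
  thus False using max by blast
 qed
 moreover have "card (set zs) \<le> m" using card_length[of zs] zs(1) lt[OF n] by simp
 ultimately show ?thesis unfolding covered_def by (intro exI[of _ "set zs"]) auto
qed

definition pl :: "nat \<Rightarrow> (nat \<Rightarrow> complex) \<Rightarrow> complex poly" where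
 "pl k c = (\<Sum>i<k. monom (c i) i)"

lemma poly_pl: "poly (pl k c) z = (\<Sum>i<k. c i * z ^ i)"
 by (simp add: pl_def poly_sum poly_monom)

text \<open>What counts is that \<open>m\<close> and \<open>K\<close> do not depend on the degree
  \<open>k\<close>. Coefficients from a finite set bound the polynomial uniformly on a circle of
  radius below 1 and keep its value at 0 above a fixed \<open>\<delta>\<close>. By
  \<open>poly_small_at_0\<close>, \<open>m\<close> separated points with small values would push
  that value below \<open>\<delta>\<close>.\<close>

lemma sublevel_net:
 fixes \<Delta> :: "complex set" and r :: real
 assumes \<Delta>: "finite \<Delta>" and r: "0 < r" "r < 1"
 shows "\<exists>m\<ge>1. \<exists>K>0. \<forall>k\<ge>1. \<forall>c. (\<forall>i<k. c i \<in> \<Delta>) \<longrightarrow> c 0 \<noteq> 0 \<longrightarrow> (\<forall>\<rho>. 0 < \<rho> \<longrightarrow> \<rho> \<le> 1 \<longrightarrow>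
  covered m (K * \<rho> powr (1 / real m)) {x. norm x \<le> r \<and> norm (poly (pl k c) x) \<le> \<rho>})"
proof (cases "\<Delta> \<subseteq> {0}")
 case True
 show ?thesis
 proof (rule exI[of _ 1], rule conjI, simp, rule exI[of _ 1], intro conjI allI impI)
  fix k :: nat and c :: "nat \<Rightarrow> complex" and \<rho> :: real
  assume "1 \<le> k" "\<forall>i<k. c i \<in> \<Delta>" "c 0 \<noteq> 0"
  hence False using True by force
  thus "covered 1 (1 * \<rho> powr (1 / real 1)) {x. norm x \<le> r \<and> norm (poly (pl k c) x) \<le> \<rho>}" ..
 qed auto
next
 case False
 define R where "R = (1 + r) / 2"
 have R: "r < R" "R < 1" "0 < R" using r by (auto simp: R_def)
 define D where "D = (\<Sum>d\<in>\<Delta>. norm d)"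
 have D: "norm d \<le> D" if "d \<in> \<Delta>" for d unfolding D_def using \<Delta> that by (intro member_le_sum) auto
 have D0: "0 \<le> D" unfolding D_def by (intro sum_nonneg) auto
 define \<delta> where "\<delta> = Min (norm ` (\<Delta> - {0}))"
 have \<delta>: "0 < \<delta>" "\<And>d. d \<in> \<Delta> \<Longrightarrow> d \<noteq> 0 \<Longrightarrow> \<delta> \<le> norm d"
 proof -
  have "\<Delta> - {0} \<noteq> {}" using False by blast
  thus "0 < \<delta>" unfolding \<delta>_def using \<Delta> by (subst Min_gr_iff) auto
 qed (use \<Delta> in \<open>auto simp: \<delta>_def\<close>)
 define B where "B = D / (1 - R)"
 have B0: "0 \<le> B" using D0 R by (simp add: B_def)
 obtain m0 where m0: "(r / R) ^ m0 < \<delta> / (2 * (B + 1))"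
  using real_arch_pow_inv[of "\<delta> / (2 * (B + 1))" "r / R"] \<delta> B0 R r by auto
 define m where "m = max 1 m0"
 have m: "1 \<le> m" by (simp add: m_def)
 have rm: "(r / R) ^ m * B \<le> \<delta> / 2"
 proof -
  have "(r / R) ^ m \<le> (r / R) ^ m0" using R r by (intro power_decreasing) (auto simp: m_def)
  hence "(r / R) ^ m * B \<le> \<delta> / (2 * (B + 1)) * B" using m0 B0 by (intro mult_right_mono) auto
  also have "... \<le> \<delta> / 2" using \<delta> B0 by (simp add: field_simps)
  finally show ?thesis .
 qed
 \<comment> \<open>Solves \<open>2 * m * \<rho> * (4 * R / \<tau>) ^ m = \<delta> / 4\<close> in the
   form \<open>\<tau> = K * \<rho> powr (1 / m)\<close>.\<close>
 define K where "K = 4 * R * (\<delta> / (8 * real m)) powr (- 1 / real m)"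
 have K: "0 < K" using R \<delta> m by (simp add: K_def)
 show ?thesis
 proof (intro exI[of _ m] exI[of _ K] conjI allI impI m K)
  fix k :: nat and c :: "nat \<Rightarrow> complex" and \<rho> :: real
  assume k: "1 \<le> k" and c: "\<forall>i<k. c i \<in> \<Delta>" and c0: "c 0 \<noteq> 0" and \<rho>: "0 < \<rho>" "\<rho> \<le> 1"
  let ?p = "pl k c"
  have p0: "\<delta> \<le> norm (poly ?p 0)"
  proof -
   have "poly ?p 0 = (\<Sum>i\<in>{0}. c i * 0 ^ i)"
    unfolding poly_pl using k by (intro sum.mono_neutral_right) auto
   thus ?thesis using \<delta>(2)[of "c 0"] c c0 k by simp
  qed
  have pB: "norm (poly ?p w) \<le> B" if "norm w = R" for w
  proof -
   have "norm (poly ?p w) \<le> (\<Sum>i<k. norm (c i * w ^ i))" unfolding poly_pl by (rule norm_sum)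
   also have "... \<le> (\<Sum>i<k. D * R ^ i)"
    using c D that R by (intro sum_mono) (auto simp: norm_mult norm_power intro!: mult_right_mono)
   also have "... = D * ((1 - R ^ k) / (1 - R))" using R by (simp add: sum_gp_strict flip: sum_distrib_left)
   also have "... \<le> D * (1 / (1 - R))" using D0 R by (intro mult_left_mono divide_right_mono) auto
   finally show ?thesis by (simp add: B_def)
  qed
  define A where "A = {x. norm x \<le> r \<and> norm (poly ?p x) \<le> \<rho>}"
  define \<tau> where "\<tau> = K * \<rho> powr (1 / real m)"
  have \<tau>: "0 < \<tau>" using K \<rho> by (simp add: \<tau>_def)
  have "covered m \<tau> A"
  proof (cases "\<tau> \<le> 4 * R")
   case False
   thus ?thesis using m r R unfolding covered_def by (intro exI[of _ "{0}"]) (auto simp: A_def)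
  next
   case True
   show ?thesis
   proof (rule finite_net, rule notI)
    assume "\<exists>zs. length zs = m \<and> set zs \<subseteq> A \<and> sorted_wrt (\<lambda>z w. \<tau> \<le> norm (z - w)) zs"
    then obtain zs where zs: "length zs = m" "set zs \<subseteq> A" "sorted_wrt (\<lambda>z w. \<tau> \<le> norm (z - w)) zs" by blast
    have "norm (poly ?p 0) \<le> (r / R) ^ m * B + 2 * real m * \<rho> * (4 * R / \<tau>) ^ m"
     using zs \<rho> \<tau> True by (intro poly_small_at_0[OF r(1) R(1) _ _ pB, of \<tau> zs \<rho>, unfolded zs(1)]) (auto simp: A_def)
    moreover have "2 * real m * \<rho> * (4 * R / \<tau>) ^ m = \<delta> / 4"
    proof -
     define b where "b = \<delta> / (8 * real m)"
     have b: "0 < b" using \<delta> m by (auto simp: b_def)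
     have "4 * R / \<tau> = (b / \<rho>) powr (1 / real m)"
      using b \<rho> R by (simp add: \<tau>_def K_def b_def[symmetric] powr_divide powr_minus_divide)
     hence "(4 * R / \<tau>) ^ m = b / \<rho>"
      using b \<rho> m by (simp add: powr_powr flip: powr_realpow')
     thus ?thesis using \<rho> m by (simp add: b_def)
    qed
    ultimately show False using rm p0 \<delta>(1) by linarith
   qed
  qed
  thus "covered m (K * \<rho> powr (1 / real m)) {x. norm x \<le> r \<and> norm (poly ?p x) \<le> \<rho>}"
   unfolding A_def \<tau>_def .
 qed
qed

definition near_coincidence :: "complex set \<Rightarrow> complex \<Rightarrow> nat \<Rightarrow> nat \<Rightarrow> bool" where
 "near_coincidence \<Delta> x M k \<longleftrightarrow> (\<exists>c. (\<forall>i<k. c i \<in> \<Delta>) \<and> (\<exists>i<k. c i \<noteq> 0) \<and> norm (\<Sum>i<k. c i * x ^ i) \<le> norm x ^ (M * k))"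

lemma factor_power:
 fixes c :: "nat \<Rightarrow> complex"
 assumes j: "j < k" and 0: "\<And>i. i < j \<Longrightarrow> c i = 0"
 shows "(\<Sum>i<k. c i * x ^ i) = x ^ j * (\<Sum>i<k. (if i + j < k then c (i + j) else 0) * x ^ i)"
proof -
 have "(\<Sum>i<k. (if i + j < k then c (i + j) else 0) * x ^ i) = (\<Sum>i<k - j. c (i + j) * x ^ i)"
  by (intro sum.mono_neutral_cong_right) auto
 hence "x ^ j * (\<Sum>i<k. (if i + j < k then c (i + j) else 0) * x ^ i) = (\<Sum>i = 0..<k - j. c (i + j) * x ^ (i + j))"
  by (simp add: sum_distrib_left power_add mult_ac atLeast0LessThan)
 also have "... = (\<Sum>i = 0 + j..<(k - j) + j. c i * x ^ i)"
  by (rule sum.shift_bounds_nat_ivl[symmetric])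
 also have "... = (\<Sum>i<k. c i * x ^ i)"
  using j 0 by (intro sum.mono_neutral_left) auto
 finally show ?thesis ..
qed

text \<open>At most \<open>card \<Delta> ^ k\<close> coefficient sequences contribute
  \<open>m\<close> balls each, of radius of order \<open>r powr (M' * k / m)\<close>. Since near
  coincidences are assumed for every \<open>M\<close>, \<open>M'\<close> can be chosen after the
  exponent \<open>s\<close> to make the sum converge.\<close>

lemma thin_nonseparated_disc:
 fixes \<Delta> :: "complex set"
 assumes \<Delta>: "finite \<Delta>" "0 \<in> \<Delta>" and r: "0 < r" "r < 1"
 shows "thin {x. 0 < norm x \<and> norm x \<le> r \<and> (\<forall>M\<ge>1. \<forall>k0. \<exists>k\<ge>k0. near_coincidence \<Delta> x M k)}" (is "thin ?T")
proof (rule thin_limsup)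
 fix s :: real assume s: "0 < s"
 from sublevel_net[OF \<Delta>(1) r] obtain m K where m: "1 \<le> m" and K: "0 < K" and net: "\<forall>k\<ge>1. \<forall>c. (\<forall>i<k. c i \<in> \<Delta>) \<longrightarrow> c 0 \<noteq> 0 \<longrightarrow>
   (\<forall>\<rho>. 0 < \<rho> \<longrightarrow> \<rho> \<le> 1 \<longrightarrow> covered m (K * \<rho> powr (1 / real m)) {x. norm x \<le> r \<and> norm (poly (pl k c) x) \<le> \<rho>})"
  by (elim exE conjE)
 define q where "q = r powr (s / real m)"
 have q: "0 < q" "q < 1" using r s m by (auto simp: q_def powr01_less_one)
 have cardD: "0 < card \<Delta>" using \<Delta> by (auto simp: card_gt_0_iff)
 obtain M' where M': "q ^ M' < 1 / (2 * real (card \<Delta>))"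
  using real_arch_pow_inv[of "1 / (2 * real (card \<Delta>))" q] q cardD by auto
 \<comment> \<open>The extra unit pays for dividing by \<open>x ^ j\<close>, where
   \<open>j < k\<close> is the first index with a nonzero coefficient.\<close>
 define M where "M = Suc M'"
 define \<rho> where "\<rho> k = r ^ (M' * k)" for k
 have \<rho>: "0 < \<rho> k" "\<rho> k \<le> 1" for k using r by (auto simp: \<rho>_def power_le_one)
 define F where "F k = {c \<in> PiE {..<k} (\<lambda>_. \<Delta>). c 0 \<noteq> 0}" for k :: nat
 have finPi: "finite (PiE {..<k} (\<lambda>_. \<Delta>))" for k :: nat using \<Delta> by (intro finite_PiE) auto
 have finF: "finite (F k)" for k :: nat by (rule finite_subset[OF _ finPi[of k]]) (auto simp: F_def)
 have cardF: "card (F k) \<le> card \<Delta> ^ k" for k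
 proof -
  have "card (F k) \<le> card (PiE {..<k} (\<lambda>_. \<Delta>))" using finPi by (intro card_mono) (auto simp: F_def)
  thus ?thesis by (simp add: card_PiE)
 qed
 define N where "N k c = (SOME C. finite C \<and> card C \<le> m \<and>
   (\<forall>x\<in>{x. norm x \<le> r \<and> norm (poly (pl k c) x) \<le> \<rho> k}. \<exists>z\<in>C. norm (z - x) \<le> K * \<rho> k powr (1 / real m)))" for k c
 have N: "finite (N k c) \<and> card (N k c) \<le> m \<and>
   (\<forall>x\<in>{x. norm x \<le> r \<and> norm (poly (pl k c) x) \<le> \<rho> k}. \<exists>z\<in>N k c. norm (z - x) \<le> K * \<rho> k powr (1 / real m))"
  if "1 \<le> k" "c \<in> F k" for k c
  unfolding N_def
  by (rule someI_ex, fold covered_def) (use that \<rho> in \<open>auto simp: F_def intro!: net[rule_format]\<close>)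
 define C where "C k = (if 1 \<le> k then \<Union>c\<in>F k. N k c else {})" for k
 define d where "d k = K * \<rho> k powr (1 / real m)" for k
 have d0: "0 \<le> d k" for k using K by (simp add: d_def)
 have finC: "finite (C k)" for k using finF N by (auto simp: C_def)
 have cardC: "real (card (C k)) \<le> real m * real (card \<Delta>) ^ k" for k
 proof (cases "1 \<le> k")
  case True
  have "card (C k) \<le> (\<Sum>c\<in>F k. card (N k c))" using True finF by (simp add: C_def card_UN_le)
  also have "... \<le> (\<Sum>c\<in>F k. m)" using N True by (intro sum_mono) auto
  also have "... \<le> m * card \<Delta> ^ k" using cardF[of k] by simp
  finally show ?thesis by (metis of_nat_le_iff of_nat_mult of_nat_power)
 qed (simp add: C_def)
 have "summable (\<lambda>k. real (card (C k)) * d k powr s)"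
 proof (rule summable_comparison_test')
  show "summable (\<lambda>k. real m * K powr s * (1 / 2) ^ k)" by (intro summable_mult summable_geometric) auto
  fix k :: nat
  have "\<rho> k powr (s / real m) = (q ^ M') ^ k"
  proof -
   have "\<rho> k powr (s / real m) = (r powr real (M' * k)) powr (s / real m)" using r by (simp only: \<rho>_def powr_realpow)
   also have "... = (r powr (s / real m)) powr real (M' * k)" by (simp add: powr_powr mult.commute)
   also have "... = (q ^ M') ^ k" using q by (simp add: q_def[symmetric] powr_realpow power_mult del: of_nat_mult)
   finally show ?thesis .
  qed
  hence "d k powr s = K powr s * (q ^ M') ^ k"
   using K \<rho>[of k] by (simp add: d_def powr_mult powr_powr)
  hence "real (card (C k)) * d k powr s \<le> (real m * real (card \<Delta>) ^ k) * (K powr s * (q ^ M') ^ k)"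
   using cardC[of k] q by (simp add: mult_right_mono)
  also have "... = real m * K powr s * (real (card \<Delta>) * q ^ M') ^ k" by (simp add: power_mult_distrib)
  also have "... \<le> real m * K powr s * (1 / 2) ^ k"
  proof (intro mult_left_mono power_mono)
   show "real (card \<Delta>) * q ^ M' \<le> 1 / 2" using M' cardD by (simp add: field_simps)
  qed (use q in auto)
  finally show "norm (real (card (C k)) * d k powr s) \<le> real m * K powr s * (1 / 2) ^ k" by simp
 qed
 moreover have "\<exists>k\<ge>k0. \<exists>z\<in>C k. dist z x \<le> d k"
  if x: "x \<in> ?T" for x k0
 proof -
  have xr: "0 < norm x" "norm x \<le> r" using x by auto
  have "1 \<le> M" by (simp add: M_def)
  then obtain k where k: "k0 \<le> k" "near_coincidence \<Delta> x M k" using x by blast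
  then obtain c where c: "\<forall>i<k. c i \<in> \<Delta>" "\<exists>i<k. c i \<noteq> 0" "norm (\<Sum>i<k. c i * x ^ i) \<le> norm x ^ (M * k)"
   unfolding near_coincidence_def by blast
  define j where "j = (LEAST i. c i \<noteq> 0)"
  obtain i where i: "i < k" "c i \<noteq> 0" using c(2) by blast
  have "j \<le> i" unfolding j_def using i(2) by (rule Least_le)
  hence j: "j < k" "c j \<noteq> 0" using i(1) LeastI[of "\<lambda>i. c i \<noteq> 0", OF i(2)] unfolding j_def by simp_all
  have j3: "c i = 0" if "i < j" for i using not_less_Least[of i "\<lambda>i. c i \<noteq> 0"] that unfolding j_def by blast
  define c' where "c' = restrict (\<lambda>i. if i + j < k then c (i + j) else 0) {..<k}"
  have k1: "1 \<le> k" using j by simp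
  have cF: "c' \<in> F k" using c(1) j \<Delta>(2) k1 by (auto simp: F_def c'_def)
  have "norm x ^ j * norm (poly (pl k c') x) \<le> norm x ^ (M * k)"
  proof -
   have "(\<Sum>i<k. c i * x ^ i) = x ^ j * (\<Sum>i<k. (if i + j < k then c (i + j) else 0) * x ^ i)"
    by (rule factor_power[OF j(1) j3])
   also have "... = x ^ j * poly (pl k c') x" unfolding poly_pl c'_def by simp
   finally have "norm (\<Sum>i<k. c i * x ^ i) = norm x ^ j * norm (poly (pl k c') x)" by (simp only: norm_mult norm_power)
   thus ?thesis using c(3) by simp
  qed
  also have "M * k = j + (M * k - j)" using j by (simp add: M_def)
  also have "norm x ^ (j + (M * k - j)) = norm x ^ j * norm x ^ (M * k - j)" by (rule power_add)
  finally have "norm (poly (pl k c') x) \<le> norm x ^ (M * k - j)" using xr by simp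
  also have "... \<le> norm x ^ (M' * k)" using xr r j by (intro power_decreasing) (auto simp: M_def)
  also have "... \<le> \<rho> k" unfolding \<rho>_def using xr by (intro power_mono) auto
  finally have le: "norm (poly (pl k c') x) \<le> \<rho> k" .
  obtain z where "z \<in> N k c'" "norm (z - x) \<le> K * \<rho> k powr (1 / real m)"
   using N[OF k1 cF] xr le by blast
  thus ?thesis using k k1 cF by (intro exI[of _ k]) (auto simp: C_def d_def dist_norm)
 qed
 ultimately show "\<exists>C d. summable (\<lambda>k. real (card (C k)) * d k powr s) \<and> (\<forall>k. finite (C k) \<and> 0 \<le> d k) \<and>
   (\<forall>x\<in>?T. \<forall>k0. \<exists>k\<ge>k0. \<exists>c\<in>C k. dist c x \<le> d k)"
  using finC d0 by blast
qed

theorem thin_nonseparated: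
 fixes \<Delta> :: "complex set"
 assumes \<Delta>: "finite \<Delta>" "0 \<in> \<Delta>"
 shows "\<exists>E. thin E \<and> (\<forall>x. x \<notin> E \<longrightarrow> 0 < norm x \<longrightarrow> norm x < 1 \<longrightarrow>
  (\<exists>M\<ge>1. \<exists>k0. \<forall>k\<ge>k0. \<not> near_coincidence \<Delta> x M k))"
proof -
 define S where "S r = {x. 0 < norm x \<and> norm x \<le> r \<and> (\<forall>M\<ge>1. \<forall>k0. \<exists>k\<ge>k0. near_coincidence \<Delta> x M k)}" for r :: real
 have "thin (S (1 - 1 / real (n + 2)))" for n
  unfolding S_def by (intro thin_nonseparated_disc \<Delta>) (auto simp: field_simps)
 hence "thin (\<Union>n. S (1 - 1 / real (n + 2)))" by (rule thin_UN)
 moreover have "\<exists>M\<ge>1. \<exists>k0. \<forall>k\<ge>k0. \<not> near_coincidence \<Delta> x M k"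
  if x: "x \<notin> (\<Union>n. S (1 - 1 / real (n + 2)))" "0 < norm x" "norm x < 1" for x
 proof -
  obtain n where n: "1 / (1 - norm x) < real n" using reals_Archimedean2 by blast
  have "1 < real n * (1 - norm x)" using n x(3) by (simp add: pos_divide_less_eq)
  also have "... \<le> real (n + 2) * (1 - norm x)" using x(3) by (intro mult_right_mono) auto
  finally have "norm x \<le> 1 - 1 / real (n + 2)" by (simp add: field_simps)
  moreover have "x \<notin> S (1 - 1 / real (n + 2))" using x(1) by blast
  ultimately show ?thesis using x(2) unfolding S_def by blast
 qed
 ultimately show ?thesis by blast
qed

section \<open>The Erdos--Kahane argument\<close>

definition dZ :: "real \<Rightarrow> real" where "dZ x = \<bar>x - of_int (round x)\<bar>"

lemma dZ_le_half: "dZ x \<le> 1 / 2"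
 unfolding dZ_def by (metis abs_minus_commute of_int_round_abs_le)

text \<open>Three-term recurrence \<open>x\<^sub>2 = t x\<^sub>1 - q x\<^sub>0\<close> for \<open>x\<^sub>k = Re (u w\<^sup>k)\<close>, where \<open>t = 2 Re w\<close> and \<open>q = |w|\<^sup>2\<close>;
 \<open>t\<close> and \<open>q\<close> are recovered from four consecutive terms by Cramer's rule.\<close>

definition ekD :: "real \<Rightarrow> real \<Rightarrow> real \<Rightarrow> real" where "ekD a b c = b * b - a * c"
definition ekT :: "real \<Rightarrow> real \<Rightarrow> real \<Rightarrow> real \<Rightarrow> real" where "ekT a b c d = (b * c - a * d) / ekD a b c"
definition ekQ :: "real \<Rightarrow> real \<Rightarrow> real \<Rightarrow> real \<Rightarrow> real" where "ekQ a b c d = (c * c - b * d) / ekD a b c"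
definition ekF :: "real \<Rightarrow> real \<Rightarrow> real \<Rightarrow> real \<Rightarrow> real" where "ekF a b c d = ekT a b c d * d - ekQ a b c d * c"

lemma Re_rec: "Re (u * w * w) = 2 * Re w * Re (u * w) - (norm w)^2 * Re u"
 unfolding cmod_power2 by (simp add: power2_eq_square algebra_simps)

lemma ekD_Re: "ekD (Re u) (Re (u * w)) (Re (u * w * w)) = (norm u)^2 * (Im w)^2"
 unfolding cmod_power2 by (simp add: ekD_def power2_eq_square algebra_simps)

lemma ekN1_Re: "Re (u * w) * Re (u * w * w) - Re u * Re (u * w * w * w) = 2 * Re w * ekD (Re u) (Re (u * w)) (Re (u * w * w))"
 by (simp add: ekD_def power2_eq_square algebra_simps)

lemma ekN2_Re: "Re (u * w * w) * Re (u * w * w) - Re (u * w) * Re (u * w * w * w) = (norm w)^2 * ekD (Re u) (Re (u * w)) (Re (u * w * w))"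
 unfolding cmod_power2 by (simp add: ekD_def power2_eq_square algebra_simps)

lemma prod_perturb:
 fixes x y :: real
 assumes "\<bar>X - x\<bar> \<le> \<delta>" "\<bar>Y - y\<bar> \<le> \<delta>" "\<delta> \<le> 1 / 2" "\<bar>x\<bar> \<le> A" "\<bar>y\<bar> \<le> A" "1 \<le> A"
 shows "\<bar>X * Y - x * y\<bar> \<le> 3 * A * \<delta>"
proof -
 have \<delta>: "0 \<le> \<delta>" using assms(1) by linarith
 have "\<bar>X * Y - x * y\<bar> = \<bar>(X - x) * (Y - y) + (X - x) * y + x * (Y - y)\<bar>" by (simp add: algebra_simps)
 also have "... \<le> \<bar>X - x\<bar> * \<bar>Y - y\<bar> + \<bar>X - x\<bar> * \<bar>y\<bar> + \<bar>x\<bar> * \<bar>Y - y\<bar>"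
  unfolding abs_mult[symmetric] by linarith
 also have "... \<le> \<delta> * A + \<delta> * A + A * \<delta>"
  using assms \<delta> by (intro add_mono mult_mono) auto
 finally show ?thesis by (simp add: algebra_simps)
qed

text \<open>At the exact values both numerators are multiples of \<open>ekD\<close>
  (\<open>ekN1_Re\<close>, \<open>ekN2_Re\<close>), and \<open>ekD\<close> is at least
  \<open>(norm u)^2 / B^2\<close>. The bound \<open>6 * B ^ 5 \<le> norm u\<close> keeps half of
  this after the perturbation, so the quotients err by order \<open>1 / norm u\<close>. In
  \<open>ekF\<close> they multiply terms of order \<open>norm u\<close>, which leaves an error bound
  free of \<open>u\<close>.\<close>

lemma ek_perturb:
 fixes u w :: complex
 assumes B: "1 \<le> B" "norm w \<le> B" "1 / B \<le> \<bar>Im w\<bar>" and A: "6 * B ^ 5 \<le> norm u" and \<delta>: "\<delta> \<le> 1 / 2"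
  and x: "\<bar>X0 - Re u\<bar> \<le> \<delta>" "\<bar>X1 - Re (u * w)\<bar> \<le> \<delta>" "\<bar>X2 - Re (u * w * w)\<bar> \<le> \<delta>" "\<bar>X3 - Re (u * w * w * w)\<bar> \<le> \<delta>"
 shows "\<bar>ekT X0 X1 X2 X3 - 2 * Re w\<bar> \<le> 36 * B ^ 7 * \<delta> / norm u"
  and "\<bar>ekQ X0 X1 X2 X3 - (norm w)^2\<bar> \<le> 36 * B ^ 7 * \<delta> / norm u"
  and "\<bar>ekF X0 X1 X2 X3 - Re (u * w * w * w * w)\<bar> \<le> 147 * B ^ 10 * \<delta>"
proof -
 define n where "n = norm u"
 define A where "A = n * B ^ 3"
 have B0: "0 < B" using B by simp
 have \<delta>0: "0 \<le> \<delta>" using x(1) by linarith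
 have "6 * B ^ 5 \<ge> 6 * 1" using B by (intro mult_left_mono one_le_power) auto
 hence n: "6 \<le> n" using A by (simp add: n_def)
 have A1: "1 \<le> A" using mult_mono[of 1 n 1 "B ^ 3"] n one_le_power[OF B(1), of 3] by (simp add: A_def)
 have le: "norm (u * w ^ k) \<le> A" if "k \<le> 3" for k
 proof -
  have "norm (u * w ^ k) \<le> n * B ^ k" using B by (simp add: norm_mult norm_power n_def mult_left_mono power_mono)
  also have "... \<le> A" unfolding A_def using B that n by (intro mult_left_mono power_increasing) auto
  finally show ?thesis .
 qed
 have b: "\<bar>Re u\<bar> \<le> A" "\<bar>Re (u * w)\<bar> \<le> A" "\<bar>Re (u * w * w)\<bar> \<le> A" "\<bar>Re (u * w * w * w)\<bar> \<le> A"
  using le[of 0] le[of 1] le[of 2] le[of 3] abs_Re_le_cmod[of u] abs_Re_le_cmod[of "u * w"] abs_Re_le_cmod[of "u * w * w"]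
   abs_Re_le_cmod[of "u * w * w * w"] by (simp_all add: power2_eq_square power3_eq_cube mult.assoc)
 define x0 x1 x2 x3 where xs: "x0 = Re u" "x1 = Re (u * w)" "x2 = Re (u * w * w)" "x3 = Re (u * w * w * w)"
 define t q where tq: "t = 2 * Re w" "q = (norm w)^2"
 define D D' where "D = ekD X0 X1 X2" and "D' = ekD x0 x1 x2"
 note b = b[folded xs] and x = x[folded xs]
 have D: "\<bar>D - D'\<bar> \<le> 6 * A * \<delta>"
  using prod_perturb[OF x(2) x(2) \<delta> b(2) b(2) A1] prod_perturb[OF x(1) x(3) \<delta> b(1) b(3) A1]
  by (simp add: D_def D'_def ekD_def)
 have N1: "\<bar>(X1 * X2 - X0 * X3) - (x1 * x2 - x0 * x3)\<bar> \<le> 6 * A * \<delta>"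
  using prod_perturb[OF x(2) x(3) \<delta> b(2) b(3) A1] prod_perturb[OF x(1) x(4) \<delta> b(1) b(4) A1] by simp
 have N2: "\<bar>(X2 * X2 - X1 * X3) - (x2 * x2 - x1 * x3)\<bar> \<le> 6 * A * \<delta>"
  using prod_perturb[OF x(3) x(3) \<delta> b(3) b(3) A1] prod_perturb[OF x(2) x(4) \<delta> b(2) b(4) A1] by simp
 have D'eq: "D' = n^2 * (Im w)^2" unfolding D'_def xs n_def by (rule ekD_Re)
 have t: "\<bar>t\<bar> \<le> 2 * B" using abs_Re_le_cmod[of w] B by (simp add: tq)
 have q: "0 \<le> q" "q \<le> B^2" using B by (auto simp: tq intro!: power_mono)
 have Dlow: "n^2 / B^2 / 2 \<le> D"
 proof -
  have "(1 / B)^2 \<le> \<bar>Im w\<bar>\<^sup>2" using B B0 by (intro power_mono) auto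
  hence "n^2 * (1 / B)^2 \<le> D'" unfolding D'eq by (intro mult_left_mono) auto
  moreover have "6 * A * \<delta> \<le> n^2 / B^2 / 2"
  proof -
   have "6 * A * \<delta> \<le> 6 * A * (1 / 2)" using \<delta> A1 by (intro mult_left_mono) auto
   also have "... = 6 * B ^ 5 * n / B^2 / 2" using B0 by (simp add: A_def field_simps eval_nat_numeral)
   also have "... \<le> n * n / B^2 / 2" using A n B0 by (intro divide_right_mono mult_right_mono) (auto simp: n_def)
   finally show ?thesis by (simp add: power2_eq_square)
  qed
  ultimately show ?thesis using D by (simp add: power_divide)
 qed
 have Dpos: "0 < n^2 / B^2 / 2" using n B0 by auto
 have main: "\<bar>N / D - c\<bar> \<le> 36 * B ^ 7 * \<delta> / n"
  if N: "\<bar>N - c * D'\<bar> \<le> 6 * A * \<delta>" and c: "\<bar>c\<bar> \<le> 2 * B^2" for N c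
 proof -
  have "\<bar>c * D' - c * D\<bar> = \<bar>c\<bar> * \<bar>D - D'\<bar>" by (simp add: abs_minus_commute flip: abs_mult right_diff_distrib)
  also have "... \<le> (2 * B^2) * (6 * A * \<delta>)" using D c by (intro mult_mono) auto
  finally have "\<bar>N - c * D\<bar> \<le> 6 * A * \<delta> + 2 * B^2 * (6 * A * \<delta>)" using N by linarith
  also have "... \<le> B^2 * (6 * A * \<delta>) + 2 * B^2 * (6 * A * \<delta>)"
   using mult_right_mono[of 1 "B^2" "6 * A * \<delta>"] one_le_power[OF B(1), of 2] A1 \<delta>0 by (simp add: mult_ac)
  finally have e: "\<bar>N - c * D\<bar> \<le> 18 * A * B^2 * \<delta>" by (simp add: algebra_simps)
  have "N / D - c = (N - c * D) / D" using Dlow Dpos by (simp add: field_simps)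
  hence "\<bar>N / D - c\<bar> = \<bar>N - c * D\<bar> / D" using Dlow Dpos by simp
  also have "... \<le> (18 * A * B^2 * \<delta>) / (n^2 / B^2 / 2)" using e Dlow Dpos A1 \<delta>0 by (intro frac_le) auto
  also have "... = 36 * B ^ 7 * \<delta> / n" using n B0 by (simp add: A_def field_simps eval_nat_numeral)
  finally show ?thesis .
 qed
 have N1': "x1 * x2 - x0 * x3 = t * D'" unfolding tq D'_def xs by (rule ekN1_Re)
 have N2': "x2 * x2 - x1 * x3 = q * D'" unfolding tq D'_def xs by (rule ekN2_Re)
 have BB: "B \<le> B^2" using B mult_left_mono[of 1 B B] by (simp add: power2_eq_square)
 have T: "\<bar>ekT X0 X1 X2 X3 - t\<bar> \<le> 36 * B ^ 7 * \<delta> / n"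
  using N1 N1' t BB unfolding ekT_def D_def[symmetric] by (intro main) auto
 have Q: "\<bar>ekQ X0 X1 X2 X3 - q\<bar> \<le> 36 * B ^ 7 * \<delta> / n"
  using N2 N2' q unfolding ekQ_def D_def[symmetric] by (intro main) auto
 show "\<bar>ekT X0 X1 X2 X3 - 2 * Re w\<bar> \<le> 36 * B ^ 7 * \<delta> / norm u" using T by (simp add: tq n_def)
 show "\<bar>ekQ X0 X1 X2 X3 - (norm w)^2\<bar> \<le> 36 * B ^ 7 * \<delta> / norm u" using Q by (simp add: tq n_def)
 have x4: "Re (u * w * w * w * w) = t * x3 - q * x2" using Re_rec[of "u * w * w" w] by (simp add: xs tq)
 define T' Q' where "T' = ekT X0 X1 X2 X3" and "Q' = ekQ X0 X1 X2 X3"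
 have X: "\<bar>X2\<bar> \<le> 2 * A" "\<bar>X3\<bar> \<le> 2 * A" using x b \<delta> A1 by linarith+
 have tri: "\<bar>a + b - c - d\<bar> \<le> \<bar>a\<bar> + \<bar>b\<bar> + \<bar>c\<bar> + \<bar>d\<bar>" for a b c d :: real by linarith
 have "ekF X0 X1 X2 X3 - (t * x3 - q * x2) = (T' - t) * X3 + t * (X3 - x3) - (Q' - q) * X2 - q * (X2 - x2)"
  by (simp add: ekF_def T'_def Q'_def algebra_simps)
 hence "\<bar>ekF X0 X1 X2 X3 - (t * x3 - q * x2)\<bar> \<le> \<bar>T' - t\<bar> * \<bar>X3\<bar> + \<bar>t\<bar> * \<bar>X3 - x3\<bar> + \<bar>Q' - q\<bar> * \<bar>X2\<bar> + \<bar>q\<bar> * \<bar>X2 - x2\<bar>"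
  using tri[of "(T' - t) * X3" "t * (X3 - x3)" "(Q' - q) * X2" "q * (X2 - x2)"] by (simp only: abs_mult)
 also have "... \<le> (36 * B ^ 7 * \<delta> / n) * (2 * A) + (2 * B) * \<delta> + (36 * B ^ 7 * \<delta> / n) * (2 * A) + B^2 * \<delta>"
 proof (intro add_mono mult_mono)
  have nn: "0 \<le> 36 * B ^ 7 * \<delta> / n" using B0 n \<delta>0 by simp
  show "0 \<le> 36 * B ^ 7 * \<delta> / n" "0 \<le> 36 * B ^ 7 * \<delta> / n" by (rule nn)+
  show "\<bar>T' - t\<bar> \<le> 36 * B ^ 7 * \<delta> / n" "\<bar>Q' - q\<bar> \<le> 36 * B ^ 7 * \<delta> / n" using T Q by (simp_all only: T'_def Q'_def)
  show "\<bar>q\<bar> \<le> B^2" using q by simp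
 qed (use X x t B0 in simp_all)
 also have "... = 144 * B ^ 10 * \<delta> + 2 * (B * \<delta>) + B^2 * \<delta>" using n by (simp add: A_def field_simps eval_nat_numeral)
 also have "... \<le> 144 * B ^ 10 * \<delta> + 2 * (B ^ 10 * \<delta>) + B ^ 10 * \<delta>"
  using B \<delta>0 power_increasing[of 2 10 B] power_increasing[of 1 10 B] by (intro add_mono mult_left_mono mult_right_mono) auto
 finally show "\<bar>ekF X0 X1 X2 X3 - Re (u * w * w * w * w)\<bar> \<le> 147 * B ^ 10 * \<delta>" unfolding x4 by (simp add: mult_ac)
qed

text \<open>Sequences with few nonzero entries are counted through the generating function in \<open>y\<close>.\<close>

lemma card_sparse_codes:
 fixes L C n :: nat and y b :: real
 assumes y: "0 < y" "y \<le> 1"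
 shows "real (card {c \<in> PiE {..n} (\<lambda>k. if k < 4 then {-int L..int L} else {-int C..int C}). real (card {k\<in>{4..n}. c k \<noteq> 0}) \<le> b})
   \<le> (2 * real L + 1) ^ 4 * (1 + 2 * real C * y) ^ n * (1 / y) powr b"
proof -
 define S :: "nat \<Rightarrow> int set" where "S k = (if k < 4 then {-int L..int L} else {-int C..int C})" for k
 define v where "v k c = (if k < 4 \<or> c = 0 then 1 else y)" for k :: nat and c :: int
 let ?P = "PiE {..n} S"
 let ?G = "{c \<in> ?P. real (card {k\<in>{4..n}. c k \<noteq> 0}) \<le> b}"
 have finP: "finite ?P" by (intro finite_PiE) (auto simp: S_def)
 have v0: "0 \<le> v k c" for k c using y by (simp add: v_def)
 have w: "(\<Prod>k\<le>n. v k (c k)) = y ^ card {k\<in>{4..n}. c k \<noteq> 0}" for c :: "nat \<Rightarrow> int"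
 proof -
  have "(\<Prod>k\<le>n. v k (c k)) = (\<Prod>k\<in>{k\<in>{4..n}. c k \<noteq> 0}. y)"
   by (intro prod.mono_neutral_cong_right) (auto simp: v_def)
  thus ?thesis by simp
 qed
 have "real (card ?G) * y powr b = (\<Sum>c\<in>?G. y powr b)" by simp
 also have "... \<le> (\<Sum>c\<in>?G. \<Prod>k\<le>n. v k (c k))"
  unfolding w using y by (intro sum_mono) (auto simp: powr_realpow[symmetric] intro!: powr_mono')
 also have "... \<le> (\<Sum>c\<in>?P. \<Prod>k\<le>n. v k (c k))"
  using finP v0 by (intro sum_mono2) (auto intro!: prod_nonneg)
 also have "... = (\<Prod>k\<le>n. \<Sum>c\<in>S k. v k c)"
  by (rule prod_sum_PiE[symmetric]) (auto simp: S_def)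
 also have "... \<le> (\<Prod>k\<le>n. if k < 4 then 2 * real L + 1 else 1 + 2 * real C * y)"
 proof (intro prod_mono conjI)
  fix k
  show "0 \<le> (\<Sum>c\<in>S k. v k c)" using v0 by (intro sum_nonneg) auto
  show "(\<Sum>c\<in>S k. v k c) \<le> (if k < 4 then 2 * real L + 1 else 1 + 2 * real C * y)"
  proof (cases "k < 4")
   case False
   have "(\<Sum>c\<in>S k. v k c) = v k 0 + (\<Sum>c\<in>S k - {0}. v k c)"
    using False by (intro sum.remove) (auto simp: S_def)
   also have "(\<Sum>c\<in>S k - {0}. v k c) = (\<Sum>c\<in>S k - {0}. y)" using False by (intro sum.cong) (auto simp: v_def)
   also have "... = real (2 * C) * y" using False by (simp add: S_def card_Diff_singleton)
   finally show ?thesis using False by (simp add: v_def)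
  qed (auto simp: S_def v_def)
 qed
 also have "... = (\<Prod>k\<in>{..n} \<inter> {..<4}. 2 * real L + 1) * (\<Prod>k\<in>{..n} \<inter> - {..<4}. 1 + 2 * real C * y)"
  by (subst prod.If_cases) (simp_all add: lessThan_def)
 also have "... \<le> (2 * real L + 1) ^ 4 * (1 + 2 * real C * y) ^ n"
 proof (intro mult_mono)
  have "card ({..n} \<inter> {..<4::nat}) \<le> card {..<4::nat}" by (intro card_mono) auto
  thus "(\<Prod>k\<in>{..n} \<inter> {..<4}. 2 * real L + 1) \<le> (2 * real L + 1) ^ 4"
   by (simp del: power_numeral) (intro power_increasing, auto)
  have "{..n} \<inter> - {..<4::nat} \<subseteq> {1..n}" by auto
  hence "card ({..n} \<inter> - {..<4::nat}) \<le> card {1..n}" by (intro card_mono) auto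
  thus "(\<Prod>k\<in>{..n} \<inter> - {..<4}. 1 + 2 * real C * y) \<le> (1 + 2 * real C * y) ^ n"
   using y by (simp) (intro power_increasing, auto)
 qed (use y in \<open>auto intro!: prod_nonneg\<close>)
 finally have "real (card ?G) * y powr b \<le> (2 * real L + 1) ^ 4 * (1 + 2 * real C * y) ^ n" .
 hence "real (card ?G) \<le> (2 * real L + 1) ^ 4 * (1 + 2 * real C * y) ^ n * (1 / y) powr b"
  using y by (simp add: powr_divide pos_le_divide_eq)
 thus ?thesis unfolding S_def .
qed

text \<open>The nearest integers obey the recurrence up to an error proportional to
  \<open>\<delta>\<close>. The choice \<open>\<delta> = 1 / 2\<close> leaves boundedly many values
  for the next integer, a small \<open>\<delta>\<close> exactly one.\<close>

lemma ek_code: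
 fixes u w :: complex
 assumes B: "1 \<le> B" "norm w \<le> B" "1 / B \<le> \<bar>Im w\<bar>" "1 \<le> norm w" and A: "6 * B ^ 5 \<le> norm u"
  and \<delta>: "\<delta> \<le> 1 / 2" "\<And>i. i \<le> 4 \<Longrightarrow> dZ (Re (u * w ^ (k + i))) \<le> \<delta>"
 defines "K \<equiv> (\<lambda>k. real_of_int (round (Re (u * w ^ k))))"
 shows "\<bar>ekT (K k) (K (k + 1)) (K (k + 2)) (K (k + 3)) - 2 * Re w\<bar> \<le> 36 * B ^ 7 * \<delta> / norm (u * w ^ k)"
  and "\<bar>ekQ (K k) (K (k + 1)) (K (k + 2)) (K (k + 3)) - (norm w)^2\<bar> \<le> 36 * B ^ 7 * \<delta> / norm (u * w ^ k)"
  and "\<bar>K (k + 4) - ekF (K k) (K (k + 1)) (K (k + 2)) (K (k + 3))\<bar> \<le> (1 + 147 * B ^ 10) * \<delta>"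
proof -
 let ?v = "u * w ^ k"
 have A': "6 * B ^ 5 \<le> norm ?v"
  using A mult_mono[OF A one_le_power[OF B(4), of k]] B(1) by (simp add: norm_mult norm_power)
 have e: "?v * w = u * w ^ (k + 1)" "u * w ^ (k + 1) * w = u * w ^ (k + 2)" "u * w ^ (k + 2) * w = u * w ^ (k + 3)"
  "u * w ^ (k + 3) * w = u * w ^ (k + 4)"
  by (simp_all add: power_add eval_nat_numeral mult_ac)
 have x: "\<bar>K (k + i) - Re (u * w ^ (k + i))\<bar> \<le> \<delta>" if "i \<le> 4" for i
  using \<delta>(2)[OF that] by (simp add: dZ_def K_def abs_minus_commute)
 have x0: "\<bar>K k - Re ?v\<bar> \<le> \<delta>" using x[of 0] by simp
 note P = ek_perturb[OF B(1-3) A' \<delta>(1), unfolded e, OF x0 x[of 1] x[of 2] x[of 3]]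
 show "\<bar>ekT (K k) (K (k + 1)) (K (k + 2)) (K (k + 3)) - 2 * Re w\<bar> \<le> 36 * B ^ 7 * \<delta> / norm ?v"
  by (rule P(1)) simp_all
 show "\<bar>ekQ (K k) (K (k + 1)) (K (k + 2)) (K (k + 3)) - (norm w)^2\<bar> \<le> 36 * B ^ 7 * \<delta> / norm ?v"
  by (rule P(2)) simp_all
 have "\<bar>ekF (K k) (K (k + 1)) (K (k + 2)) (K (k + 3)) - Re (u * w ^ (k + 4))\<bar> \<le> 147 * B ^ 10 * \<delta>"
  by (rule P(3)) simp_all
 thus "\<bar>K (k + 4) - ekF (K k) (K (k + 1)) (K (k + 2)) (K (k + 3))\<bar> \<le> (1 + 147 * B ^ 10) * \<delta>"
  using x[of 4] by (simp add: distrib_right)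
qed

definition far_count :: "real \<Rightarrow> complex \<Rightarrow> complex \<Rightarrow> nat \<Rightarrow> nat" where
 "far_count \<kappa> w u n = card {k. k \<le> n \<and> \<kappa> \<le> dZ (Re (u * w ^ k))}"

text \<open>The lower bound on \<open>norm u\<close> keeps the recurrence nondegenerate. The upper
  bound limits the number of possible starting integers to a small exponential rate. Uniformity in
  \<open>u\<close> is needed because \<open>u\<close> will be a frequency.\<close>

definition escapes :: "real \<Rightarrow> real \<Rightarrow> real \<Rightarrow> nat \<Rightarrow> complex \<Rightarrow> bool" where
 "escapes \<kappa> U \<epsilon> n0 w \<longleftrightarrow> (\<forall>n\<ge>n0. \<forall>u. U \<le> norm u \<longrightarrow> norm u \<le> exp (\<epsilon> * real n) \<longrightarrow> \<epsilon> * real n < real (far_count \<kappa> w u n))"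

text \<open>If \<open>w\<close> does not escape, then for arbitrarily large \<open>n\<close> the
  integers nearest to \<open>Re (u * w ^ k)\<close> are predicted by their four predecessors except
  at few \<open>k\<close>. The corrections form a sparse code; there are few such codes, and each
  determines \<open>w\<close> up to order \<open>1 / r ^ n\<close> through the last four integers.
  Fixing the sign \<open>s\<close> of the imaginary part makes \<open>w\<close> recoverable from
  \<open>Re w\<close> and \<open>norm w\<close>.\<close>

lemma thin_ek_region:
 fixes B r s :: real
 assumes r: "1 < r" and B: "1 \<le> B" and s: "\<bar>s\<bar> = 1"
 shows "thin {w. r \<le> norm w \<and> norm w \<le> B \<and> 1 / B \<le> s * Im w \<and>
  (\<forall>\<epsilon>>0. \<forall>n0. \<not> escapes (1 / (4 * (1 + 147 * B ^ 10))) (6 * B ^ 5) \<epsilon> n0 w)}"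
  (is "thin ?T")
proof (rule thin_limsup)
 fix \<sigma> :: real assume \<sigma>: "0 < \<sigma>"
 define G where "G = 1 + 147 * B ^ 10"
 have G: "1 \<le> G" using B by (simp add: G_def)
 define C where "C = nat \<lceil>G\<rceil>"
 have C: "1 \<le> real C" "G \<le> real C" using G unfolding C_def by linarith+
 define \<kappa> where "\<kappa> = 1 / (4 * G)"
 have \<kappa>: "0 < \<kappa>" "\<kappa> \<le> 1 / 2" "G * \<kappa> = 1 / 4" using G by (auto simp: \<kappa>_def field_simps)
 define l where "l = ln r"
 have l: "0 < l" using r by (simp add: l_def)
 \<comment> \<open>A quarter of the rate \<open>\<sigma> * l\<close> is granted to
   \<open>1 + 2 * C * y\<close>. Another quarter goes to \<open>\<epsilon>\<close>, shared by the
   four starting integers (\<open>4 * \<epsilon>\<close>) and the at most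
   \<open>5 * \<epsilon> * n\<close> nonzero corrections (\<open>5 * \<epsilon> * lY\<close>). The
   remaining half is the decay of the covering sum.\<close>
 define y where "y = min (1 / 2) ((exp (\<sigma> * l / 4) - 1) / (2 * real C))"
 have y: "0 < y" "y < 1" "1 + 2 * real C * y \<le> exp (\<sigma> * l / 4)"
 proof -
  have "0 < (exp (\<sigma> * l / 4) - 1) / (2 * real C)" using \<sigma> l C by simp
  thus "0 < y" by (simp add: y_def)
  have "y \<le> (exp (\<sigma> * l / 4) - 1) / (2 * real C)" by (simp add: y_def)
  thus "1 + 2 * real C * y \<le> exp (\<sigma> * l / 4)" using C by (simp add: field_simps)
 qed (simp add: y_def)
 define lY where "lY = ln (1 / y)"
 have lY: "0 < lY" using y by (simp add: lY_def ln_div)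
 define \<epsilon> where "\<epsilon> = (\<sigma> * l / 4) / (4 + 5 * lY)"
 have \<epsilon>: "0 < \<epsilon>" "4 * \<epsilon> + 5 * \<epsilon> * lY = \<sigma> * l / 4"
 proof -
  show "0 < \<epsilon>" using \<sigma> l lY by (auto simp: \<epsilon>_def intro!: divide_pos_pos)
  have "4 * \<epsilon> + 5 * \<epsilon> * lY = \<epsilon> * (4 + 5 * lY)" by (simp add: algebra_simps)
  also have "... = \<sigma> * l / 4" using lY unfolding \<epsilon>_def by (metis add_pos_pos mult_pos_pos nonzero_eq_divide_eq order_less_irrefl zero_less_numeral)
  finally show "4 * \<epsilon> + 5 * \<epsilon> * lY = \<sigma> * l / 4" .
 qed
 define K where "K w u k = round (Re (u * w ^ k))" for w u :: complex and k :: nat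
 define rl where "rl n = {(w, u). r \<le> norm w \<and> norm w \<le> B \<and> 1 / B \<le> s * Im w \<and> 6 * B ^ 5 \<le> norm u \<and> norm u \<le> exp (\<epsilon> * n) \<and>
   real (far_count \<kappa> w u n) \<le> \<epsilon> * n}" for n :: nat
 define Kr where "Kr n wu = restrict (K (fst wu) (snd wu)) {..n}" for n :: nat and wu
 define nx where "nx f k = round (ekF (f (k - 4)) (f (k - 3)) (f (k - 2)) (f (k - 1)))"
  for f :: "nat \<Rightarrow> int" and k :: nat
 define code where "code n f = restrict (\<lambda>k. if k < 4 then f k else f k - nx f k) {..n}" for n :: nat and f :: "nat \<Rightarrow> int"
 define L where "L n = nat \<lceil>exp (\<epsilon> * n) * B ^ 3 + 1\<rceil>" for n :: nat
 define cs where "cs n = {c \<in> PiE {..n} (\<lambda>k. if k < 4 then {-int (L n)..int (L n)} else {-int C..int C}).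
   real (card {k\<in>{4..n}. c k \<noteq> 0}) \<le> 5 * \<epsilon> * n}" for n :: nat
 have im: "1 / B \<le> \<bar>Im w\<bar>" if "1 / B \<le> s * Im w" for w
  using that s by (metis abs_ge_self abs_mult mult_1 order_trans)
 have cfin: "finite (cs n)" for n unfolding cs_def by (rule finite_subset[of _ "PiE {..n} (\<lambda>k. if k < 4 then {-int (L n)..int (L n)} else {-int C..int C})"])
  (auto intro!: finite_PiE)
 have code: "code n (Kr n (w, u)) \<in> cs n" if rl: "(w, u) \<in> rl n" for n w u
 proof -
  from rl have w: "r \<le> norm w" "norm w \<le> B" "1 / B \<le> s * Im w" "6 * B ^ 5 \<le> norm u" "norm u \<le> exp (\<epsilon> * n)"
   and cd: "real (far_count \<kappa> w u n) \<le> \<epsilon> * n" unfolding rl_def by auto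
  have w1: "1 \<le> norm w" using w r by linarith
  let ?c = "code n (Kr n (w, u))"
  have c_lo: "?c k = K w u k" if "k < 4" "k \<le> n" for k using that by (simp add: code_def Kr_def)
  have lo: "\<bar>real_of_int (K w u k)\<bar> \<le> real (L n)" if "k < 4" for k
  proof -
   have "\<bar>Re (u * w ^ k)\<bar> \<le> norm (u * w ^ k)" by (rule abs_Re_le_cmod)
   also have "... \<le> exp (\<epsilon> * n) * B ^ 3"
    using w w1 that power_mono[of "norm w" B k] power_increasing[of k 3 B] B
    by (auto simp: norm_mult norm_power intro!: mult_mono)
   finally have "\<bar>Re (u * w ^ k)\<bar> \<le> exp (\<epsilon> * n) * B ^ 3" .
   moreover have "\<bar>Re (u * w ^ k) - real_of_int (K w u k)\<bar> \<le> 1 / 2" using dZ_le_half by (simp add: dZ_def K_def)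
   ultimately have "\<bar>real_of_int (K w u k)\<bar> \<le> exp (\<epsilon> * n) * B ^ 3 + 1" by linarith
   also have "... \<le> real (L n)" unfolding L_def by linarith
   finally show ?thesis .
  qed
  let ?F = "\<lambda>k. ekF (K w u (k - 4)) (K w u (k - 4 + 1)) (K w u (k - 4 + 2)) (K w u (k - 4 + 3))"
  have hi: "?c k = K w u k - round (?F k)" if "\<not> k < 4" "k \<le> n" for k
  proof -
   have e: "k - 4 + 1 = k - 3" "k - 4 + 2 = k - 2" "k - 4 + 3 = k - 1" using that by auto
   have le: "k - i \<le> n" for i using that by simp
   show ?thesis unfolding e using that le[of 1] le[of 2] le[of 3] le[of 4] by (simp add: code_def Kr_def nx_def)
  qed
  have bd: "\<bar>real_of_int (K w u k) - ?F k\<bar> \<le> G * \<delta>"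
   if "\<not> k < 4" "\<delta> \<le> 1 / 2" "\<And>i. i \<le> 4 \<Longrightarrow> dZ (Re (u * w ^ (k - 4 + i))) \<le> \<delta>" for k \<delta>
  proof -
   have "k - 4 + 4 = k" using that by simp
   thus ?thesis using ek_code(3)[OF B w(2) im[OF w(3)] w1 w(4) that(2,3)] by (simp add: K_def G_def)
  qed
  have hiC: "\<bar>?c k\<bar> \<le> int C" if k: "\<not> k < 4" "k \<le> n" for k
  proof -
   have "\<bar>real_of_int (?c k)\<bar> \<le> G * (1 / 2) + 1 / 2"
    using bd[OF k(1) order_refl dZ_le_half] of_int_round_abs_le[of "?F k"] unfolding hi[OF k] of_int_diff by linarith
   also have "... \<le> real C" using C G by linarith
   finally show ?thesis by linarith
  qed
  \<comment> \<open>If all five terms from \<open>k - 4\<close> to \<open>k\<close> were within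
    \<open>\<kappa>\<close> of the integers, then \<open>G * \<kappa> = 1 / 4\<close> would force
    the rounded prediction to be right. This is where the factor 5 comes from.\<close>
  have hi0: "\<exists>i\<le>4. \<kappa> \<le> dZ (Re (u * w ^ (k - 4 + i)))" if k: "\<not> k < 4" "k \<le> n" "?c k \<noteq> 0" for k
  proof (rule ccontr)
   assume "\<not> ?thesis"
   hence le: "dZ (Re (u * w ^ (k - 4 + i))) \<le> \<kappa>" if "i \<le> 4" for i using that by force
   have "\<bar>real_of_int (K w u k) - ?F k\<bar> \<le> 1 / 4"
    using bd[OF k(1) \<kappa>(2) le] \<kappa>(3) by simp
   hence "round (?F k) = K w u k"
    by (intro round_unique') linarith
   thus False using hi[OF k(1,2)] k(3) by simp
  qed
  have "card {k\<in>{4..n}. ?c k \<noteq> 0} \<le> card (\<Union>i\<le>4. (\<lambda>k. k + (4 - i)) ` {k. k \<le> n \<and> \<kappa> \<le> dZ (Re (u * w ^ k))})"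
  proof (intro card_mono subsetI)
   fix k assume k: "k \<in> {k\<in>{4..n}. ?c k \<noteq> 0}"
   then obtain i where i: "i \<le> 4" "\<kappa> \<le> dZ (Re (u * w ^ (k - 4 + i)))" using hi0[of k] by auto
   hence "k = (k - 4 + i) + (4 - i)" "k - 4 + i \<le> n" using k by auto
   thus "k \<in> (\<Union>i\<le>4. (\<lambda>k. k + (4 - i)) ` {k. k \<le> n \<and> \<kappa> \<le> dZ (Re (u * w ^ k))})"
    using i by (intro UN_I[of i] image_eqI[of _ _ "k - 4 + i"]) auto
  qed auto
  also have "... \<le> (\<Sum>i\<le>4::nat. card ((\<lambda>k. k + (4 - i)) ` {k. k \<le> n \<and> \<kappa> \<le> dZ (Re (u * w ^ k))}))"
   by (rule card_UN_le) auto
  also have "... \<le> (\<Sum>i\<le>4::nat. card {k. k \<le> n \<and> \<kappa> \<le> dZ (Re (u * w ^ k))})"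
   by (intro sum_mono card_image_le) auto
  also have "... = 5 * far_count \<kappa> w u n" by (simp add: far_count_def)
  finally have "real (card {k\<in>{4..n}. ?c k \<noteq> 0}) \<le> 5 * real (far_count \<kappa> w u n)"
   by linarith
  hence n5: "real (card {k\<in>{4..n}. ?c k \<noteq> 0}) \<le> 5 * \<epsilon> * n" using cd by linarith
  have "?c \<in> PiE {..n} (\<lambda>k. if k < 4 then {-int (L n)..int (L n)} else {-int C..int C})"
  proof (rule PiE_I)
   fix k assume k: "k \<in> {..n}"
   show "?c k \<in> (if k < 4 then {-int (L n)..int (L n)} else {-int C..int C})"
   proof (cases "k < 4")
    case True
    have "\<bar>K w u k\<bar> \<le> int (L n)" using lo[OF True] by linarith
    thus ?thesis using True c_lo[OF True] k by auto
   qed (use hiC[of k] k in auto)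
  qed (simp add: code_def)
  thus ?thesis using n5 by (simp add: cs_def)
 qed
 have inj: "inj_on (code n) (Kr n ` rl n)" for n
 proof (rule inj_onI)
  fix f g assume fg: "f \<in> Kr n ` rl n" "g \<in> Kr n ` rl n" and eq: "code n f = code n g"
  have ext: "f \<in> extensional {..n}" "g \<in> extensional {..n}" using fg by (auto simp: Kr_def)
  have "k \<le> n \<longrightarrow> f k = g k" for k
  proof (induction k rule: less_induct)
   case (less k)
   show ?case
   proof
    assume k: "k \<le> n"
    have e: "(if k < 4 then f k else f k - nx f k) = (if k < 4 then g k else g k - nx g k)"
     using fun_cong[OF eq, of k] k by (simp add: code_def)
    show "f k = g k"
    proof (cases "k < 4")
     case False
     hence "f (k - i) = g (k - i)" if "0 < i" "i \<le> 4" for i using less.IH[of "k - i"] k that by simp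
     hence "nx f k = nx g k" by (simp add: nx_def)
     thus ?thesis using e False by simp
    qed (use e in simp)
   qed
  qed
  thus "f = g" using ext by (intro extensionalityI[of f "{..n}"]) auto
 qed
 have cimg: "code n ` (Kr n ` rl n) \<subseteq> cs n" for n using code by (auto simp: image_subset_iff)
 have Kfin: "finite (Kr n ` rl n)" for n
  using finite_subset[OF cimg cfin] inj by (rule finite_imageD)
 have Kcard: "card (Kr n ` rl n) \<le> card (cs n)" for n
  using card_mono[OF cfin cimg] card_image[OF inj] by simp
 define d where "d n = 9 * B ^ 4 * r ^ 3 / r ^ n" for n :: nat
 have d0: "0 < d n" for n using B r by (simp add: d_def)
 have close: "dist w w' \<le> d n" if n: "3 \<le> n" and rl: "(w, u) \<in> rl n" "(w', u') \<in> rl n" and eq: "Kr n (w, u) = Kr n (w', u')" for n w u w' u'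
 proof -
  define e where "e = 3 * B^2 * r ^ 3 / r ^ n"
  have e0: "0 < e" using B r by (simp add: e_def)
  let ?k = "n - 3"
  define T Q where "T = ekT (K w u ?k) (K w u (?k + 1)) (K w u (?k + 2)) (K w u (?k + 3))"
   and "Q = ekQ (K w u ?k) (K w u (?k + 1)) (K w u (?k + 2)) (K w u (?k + 3))"
  have Keq: "K w u k = K w' u' k" if "k \<le> n" for k using fun_cong[OF eq, of k] that by (simp add: Kr_def)
  have TQ: "\<bar>T - 2 * Re v\<bar> \<le> e \<and> \<bar>Q - (norm v)^2\<bar> \<le> e"
   if v: "(v, u'') \<in> rl n" and K'': "\<And>k. k \<le> n \<Longrightarrow> K w u k = K v u'' k" for v u''
  proof -
   from v have v: "r \<le> norm v" "norm v \<le> B" "1 / B \<le> s * Im v" "6 * B ^ 5 \<le> norm u''" unfolding rl_def by auto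
   have v1: "1 \<le> norm v" using v r by linarith
   have "6 * B ^ 5 * r ^ ?k \<le> norm (u'' * v ^ ?k)"
    using v B r by (auto simp: norm_mult norm_power intro!: mult_mono power_mono)
   hence "36 * B ^ 7 * (1 / 2) / norm (u'' * v ^ ?k) \<le> 36 * B ^ 7 * (1 / 2) / (6 * B ^ 5 * r ^ ?k)"
    using B r by (intro frac_le) auto
   also have "... = e" using B r n by (simp add: e_def power_diff field_simps eval_nat_numeral)
   finally have le: "36 * B ^ 7 * (1 / 2) / norm (u'' * v ^ ?k) \<le> e" .
   have "K w u (?k + i) = K v u'' (?k + i)" if "i \<le> 3" for i using K''[of "?k + i"] n that by simp
   note Kv = this[of 0, simplified] this[of 1, simplified] this[of 2, simplified] this[of 3, simplified]
   have T': "T = ekT (K v u'' ?k) (K v u'' (?k + 1)) (K v u'' (?k + 2)) (K v u'' (?k + 3))"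
    and Q': "Q = ekQ (K v u'' ?k) (K v u'' (?k + 1)) (K v u'' (?k + 2)) (K v u'' (?k + 3))"
    unfolding T_def Q_def by (simp_all add: Kv)
   have "\<bar>T - 2 * Re v\<bar> \<le> 36 * B ^ 7 * (1 / 2) / norm (u'' * v ^ ?k)"
    unfolding T' K_def by (rule ek_code(1)[OF B v(2) im[OF v(3)] v1 v(4) order_refl dZ_le_half])
   moreover have "\<bar>Q - (norm v)^2\<bar> \<le> 36 * B ^ 7 * (1 / 2) / norm (u'' * v ^ ?k)"
    unfolding Q' K_def by (rule ek_code(2)[OF B v(2) im[OF v(3)] v1 v(4) order_refl dZ_le_half])
   ultimately show ?thesis using le by linarith
  qed
  have R: "\<bar>Re w - Re w'\<bar> \<le> e" and q: "\<bar>(norm w)\<^sup>2 - (norm w')^2\<bar> \<le> 2 * e"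
   using TQ[OF rl(1) refl] TQ[OF rl(2) Keq] by linarith+
  from rl have w: "norm w \<le> B" "1 / B \<le> s * Im w" "norm w' \<le> B" "1 / B \<le> s * Im w'" unfolding rl_def by auto
  have Rs: "\<bar>Re w + Re w'\<bar> \<le> 2 * B" using abs_Re_le_cmod[of w] abs_Re_le_cmod[of w'] w by linarith
  have Is: "2 / B \<le> \<bar>Im w + Im w'\<bar>"
  proof -
   have "2 / B \<le> s * (Im w + Im w')" using w by (simp add: distrib_left)
   also have "... \<le> \<bar>Im w + Im w'\<bar>" using s by (metis abs_ge_self abs_mult mult_1)
   finally show ?thesis .
  qed
  \<comment> \<open>The imaginary parts have the same sign and modulus at least
    \<open>1 / B\<close>, so the difference of their squares can be divided by their sum.\<close>
  have "(Im w - Im w') * (Im w + Im w') = ((norm w)^2 - (norm w')^2) - (Re w - Re w') * (Re w + Re w')"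
   unfolding cmod_power2 by (simp add: power2_eq_square algebra_simps)
  hence "\<bar>Im w - Im w'\<bar> * \<bar>Im w + Im w'\<bar> \<le> \<bar>(norm w)\<^sup>2 - (norm w')^2\<bar> + \<bar>Re w - Re w'\<bar> * \<bar>Re w + Re w'\<bar>"
   unfolding abs_mult[symmetric] by linarith
  also have "... \<le> 2 * e + e * (2 * B)" using R q Rs e0 by (intro add_mono mult_mono) auto
  finally have "\<bar>Im w - Im w'\<bar> * (2 / B) \<le> 2 * e + e * (2 * B)"
   using mult_left_mono[OF Is, of "\<bar>Im w - Im w'\<bar>"] by linarith
  hence I: "\<bar>Im w - Im w'\<bar> \<le> B * e + B^2 * e" using B by (simp add: field_simps power2_eq_square)
  have "dist w w' \<le> \<bar>Re w - Re w'\<bar> + \<bar>Im w - Im w'\<bar>" unfolding dist_norm using cmod_le[of "w - w'"] by simp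
  also have "... \<le> e + B * e + B^2 * e" using R I by linarith
  also have "... \<le> B^2 * e + B^2 * e + B^2 * e"
   using e0 B one_le_power[OF B, of 2] power_increasing[of 1 2 B] mult_right_mono[of 1 "B^2" e]
   by (intro add_mono mult_right_mono) simp_all
  also have "... = d n" by (simp add: d_def e_def power2_eq_square eval_nat_numeral)
  finally show ?thesis .
 qed
 define pt where "pt n f = fst (SOME wu. wu \<in> rl n \<and> Kr n wu = f)" for n f
 define Cn where "Cn n = (if 3 \<le> n then pt n ` Kr n ` rl n else {})" for n :: nat
 have "summable (\<lambda>n. real (card (Cn n)) * d n powr \<sigma>)"
 proof (rule summable_comparison_test')
  show "summable (\<lambda>n. (7 * B ^ 3) ^ 4 * (9 * B ^ 4 * r ^ 3) powr \<sigma> * exp (- \<sigma> * l / 2) ^ n)"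
   using \<sigma> l by (intro summable_mult summable_geometric) auto
  fix n :: nat
  have "card (Cn n) \<le> card (cs n)"
   using Kcard[of n] card_image_le[OF Kfin[of n], of "pt n"] by (auto simp: Cn_def)
  hence "real (card (Cn n)) \<le> (2 * real (L n) + 1) ^ 4 * (1 + 2 * real C * y) ^ n * (1 / y) powr (5 * \<epsilon> * n)"
   using card_sparse_codes[OF y(1) less_imp_le[OF y(2)], of n "L n" C "5 * \<epsilon> * n"] unfolding cs_def by linarith
  also have "... \<le> (7 * B ^ 3 * exp (\<epsilon> * n)) ^ 4 * exp (\<sigma> * l / 4) ^ n * exp (5 * \<epsilon> * lY * real n)"
  proof (intro mult_mono power_mono)
   define z where "z = exp (\<epsilon> * n) * B ^ 3"
   have "1 \<le> z" using mult_mono[of 1 "exp (\<epsilon> * n)" 1 "B ^ 3"] \<epsilon> one_le_power[OF B, of 3] by (simp add: z_def)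
   hence "2 * real (nat \<lceil>z + 1\<rceil>) + 1 \<le> 7 * z" by linarith
   thus "2 * real (L n) + 1 \<le> 7 * B ^ 3 * exp (\<epsilon> * n)" by (simp add: L_def z_def mult_ac)
   show "(1 / y) powr (5 * \<epsilon> * n) \<le> exp (5 * \<epsilon> * lY * real n)" using y by (simp add: powr_def lY_def mult_ac)
  qed (use y B in auto)
  also have "... = (7 * B ^ 3) ^ 4 * (exp (4 * (\<epsilon> * n)) * exp (\<sigma> * l / 4 * real n) * exp (5 * \<epsilon> * lY * real n))"
   by (simp add: power_mult_distrib exp_of_nat_mult[symmetric] mult_ac flip: exp_of_nat2_mult)
  also have "exp (4 * (\<epsilon> * n)) * exp (\<sigma> * l / 4 * real n) * exp (5 * \<epsilon> * lY * real n) = exp (\<sigma> * l / 2 * real n)"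
  proof -
   have "4 * (\<epsilon> * n) + \<sigma> * l / 4 * real n + 5 * \<epsilon> * lY * real n = (4 * \<epsilon> + 5 * \<epsilon> * lY) * n + \<sigma> * l / 4 * real n"
    by (simp add: algebra_simps)
   thus ?thesis by (simp only: \<epsilon>(2) exp_add[symmetric]) (simp add: algebra_simps)
  qed
  finally have c: "real (card (Cn n)) \<le> (7 * B ^ 3) ^ 4 * exp (\<sigma> * l / 2 * real n)" .
  have "r ^ n = exp (l * n)" using r by (simp add: l_def exp_of_nat2_mult)
  hence "d n powr \<sigma> = (9 * B ^ 4 * r ^ 3) powr \<sigma> * exp (- \<sigma> * l * n)"
   using B r by (simp add: d_def powr_divide powr_def[of "exp _"] exp_minus field_simps)
  hence "real (card (Cn n)) * d n powr \<sigma> \<le> ((7 * B ^ 3) ^ 4 * exp (\<sigma> * l / 2 * real n)) * ((9 * B ^ 4 * r ^ 3) powr \<sigma> * exp (- \<sigma> * l * n))"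
   using c by (simp add: mult_right_mono)
  also have "... = (7 * B ^ 3) ^ 4 * (9 * B ^ 4 * r ^ 3) powr \<sigma> * (exp (\<sigma> * l / 2 * real n) * exp (- \<sigma> * l * n))"
   by (simp only: mult_ac)
  also have "exp (\<sigma> * l / 2 * real n) * exp (- \<sigma> * l * n) = exp (- \<sigma> * l / 2 * real n)"
   by (simp add: exp_add[symmetric] del: exp_add)
  also have "... = exp (- \<sigma> * l / 2) ^ n" by (simp only: exp_of_nat2_mult)
  finally show "norm (real (card (Cn n)) * d n powr \<sigma>) \<le> (7 * B ^ 3) ^ 4 * (9 * B ^ 4 * r ^ 3) powr \<sigma> * exp (- \<sigma> * l / 2) ^ n" by simp
 qed
 moreover have "\<forall>n. finite (Cn n) \<and> 0 \<le> d n" using Kfin d0 by (auto simp: Cn_def less_imp_le)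
 moreover have "\<forall>x\<in>?T. \<forall>k0. \<exists>k\<ge>k0. \<exists>c\<in>Cn k. dist c x \<le> d k"
 proof (intro ballI allI)
  fix w k0 assume w: "w \<in> ?T"
  hence "\<not> escapes \<kappa> (6 * B ^ 5) \<epsilon> (max k0 3) w"
   using \<epsilon>(1) unfolding \<kappa>_def G_def by blast
  then obtain n u where n: "max k0 3 \<le> n" and u: "6 * B ^ 5 \<le> norm u" "norm u \<le> exp (\<epsilon> * n)"
   "real (far_count \<kappa> w u n) \<le> \<epsilon> * n" unfolding escapes_def by (auto simp: not_less)
  have rl: "(w, u) \<in> rl n" using w u unfolding rl_def by simp
  define wu where "wu = (SOME wu. wu \<in> rl n \<and> Kr n wu = Kr n (w, u))"
  have "wu \<in> rl n \<and> Kr n wu = Kr n (w, u)" unfolding wu_def by (rule someI[of _ "(w, u)"]) (use rl in simp)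
  hence "dist (fst wu) w \<le> d n" using n rl by (intro close[of n _ "snd wu" _ u]) auto
  moreover have "fst wu \<in> Cn n" using n rl by (auto simp: Cn_def pt_def wu_def)
  ultimately show "\<exists>k\<ge>k0. \<exists>c\<in>Cn k. dist c w \<le> d k" using n by (intro exI[of _ n]) auto
 qed
 ultimately show "\<exists>C d. summable (\<lambda>k. real (card (C k)) * d k powr \<sigma>) \<and> (\<forall>k. finite (C k) \<and> 0 \<le> d k) \<and>
   (\<forall>x\<in>?T. \<forall>k0. \<exists>k\<ge>k0. \<exists>c\<in>C k. dist c x \<le> d k)"
  by (intro exI[of _ Cn] exI[of _ d] conjI)
qed

text \<open>\<open>x ^ N - y ^ N\<close> is \<open>x - y\<close> times a sum that equals
  \<open>N * c ^ (N - 1)\<close> at \<open>x = y = c\<close> and so stays away from 0 near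
  \<open>c\<close>. Passing to reciprocals only increases distances inside the unit disc.\<close>

lemma inverse_power_local:
 fixes c :: complex
 assumes c: "c \<noteq> 0" and N: "1 \<le> N"
 shows "\<exists>\<delta>>0. \<exists>C>0. \<forall>x y. dist c x < \<delta> \<longrightarrow> dist c y < \<delta> \<longrightarrow> 0 < norm x \<longrightarrow> norm x < 1 \<longrightarrow> 0 < norm y \<longrightarrow> norm y < 1 \<longrightarrow>
  dist x y \<le> C * dist (inverse (x ^ N)) (inverse (y ^ N))"
proof -
 define g where "g p = (\<Sum>i<N. snd p ^ (N - Suc i) * fst p ^ i)" for p :: "complex \<times> complex"
 define h where "h = norm (g (c, c)) / 2"
 have "g (c, c) = of_nat N * c ^ (N - 1)" by (simp add: g_def flip: power_add)
 hence h: "0 < h" using c N by (simp add: h_def norm_mult norm_power)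
 have "isCont (\<lambda>p. norm (g p)) (c, c)" unfolding g_def by (intro continuous_intros)
 hence "eventually (\<lambda>p. h < norm (g p)) (at (c, c))"
  using h unfolding isCont_def by (intro order_tendstoD(1)) (auto simp: h_def)
 then obtain d where d: "0 < d" "\<And>p. p \<noteq> (c, c) \<Longrightarrow> dist p (c, c) < d \<Longrightarrow> h < norm (g p)"
  unfolding eventually_at by blast
 have d': "h < norm (g p)" if "dist p (c, c) < d" for p using d(2)[OF _ that] h by (cases "p = (c, c)") (auto simp: h_def)
 show ?thesis
 proof (rule exI[of _ "d / 2"], rule conjI, use d in simp, rule exI[of _ "1 / h"], rule conjI, use h in simp, intro allI impI)
  fix x y assume xy: "dist c x < d / 2" "dist c y < d / 2" "0 < norm x" "norm x < 1" "0 < norm y" "norm y < 1"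
  have "dist (x, y) (c, c) \<le> dist x c + dist y c"
   unfolding dist_prod_def by (simp add: sqrt_sum_squares_le_sum)
  hence gh: "h < norm (g (x, y))" using xy by (intro d') (simp add: dist_commute)
  have "x ^ N - y ^ N = (x - y) * g (x, y)" unfolding g_def by (simp add: power_diff_sumr2)
  hence 1: "h * dist x y \<le> norm (x ^ N - y ^ N)"
   using mult_right_mono[OF less_imp_le[OF gh], of "dist x y"] by (simp add: norm_mult dist_norm mult.commute)
  have "inverse (x ^ N) - inverse (y ^ N) = (y ^ N - x ^ N) / (x ^ N * y ^ N)"
   using xy by (simp add: field_simps)
  hence "dist (inverse (x ^ N)) (inverse (y ^ N)) = norm (x ^ N - y ^ N) / (norm x ^ N * norm y ^ N)"
   by (simp add: dist_norm norm_divide norm_mult norm_power norm_minus_commute)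
  moreover have "norm (x ^ N - y ^ N) \<le> norm (x ^ N - y ^ N) / (norm x ^ N * norm y ^ N)"
  proof -
   have "norm x ^ N * norm y ^ N \<le> 1" using xy by (intro mult_le_one power_le_one) auto
   hence "norm (x ^ N - y ^ N) / 1 \<le> norm (x ^ N - y ^ N) / (norm x ^ N * norm y ^ N)"
    using xy by (intro divide_left_mono) auto
   thus ?thesis by simp
  qed
  ultimately have "h * dist x y \<le> dist (inverse (x ^ N)) (inverse (y ^ N))" using 1 by linarith
  thus "dist x y \<le> 1 / h * dist (inverse (x ^ N)) (inverse (y ^ N))"
   using h by (simp add: pos_le_divide_eq mult.commute)
 qed
qed

lemma thin_inverse_power:
 fixes W :: "complex set"
 assumes W: "thin W" and N: "1 \<le> N"
 shows "thin {x. 0 < norm x \<and> norm x < 1 \<and> inverse (x ^ N) \<in> W}" (is "thin ?S")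
proof -
 define P where "P c \<delta> C \<longleftrightarrow> (\<forall>x y. dist c x < \<delta> \<longrightarrow> dist c y < \<delta> \<longrightarrow> 0 < norm x \<longrightarrow> norm x < 1 \<longrightarrow> 0 < norm y \<longrightarrow> norm y < 1 \<longrightarrow>
  dist x y \<le> C * dist (inverse (x ^ N)) (inverse (y ^ N)))" for c :: complex and \<delta> C :: real
 have "\<exists>\<delta>>0. \<exists>C>0. P c \<delta> C" if "c \<noteq> 0" for c
  unfolding P_def by (rule inverse_power_local[OF that N])
 then obtain \<delta> C where \<delta>: "\<And>c. c \<noteq> 0 \<Longrightarrow> 0 < \<delta> c \<and> 0 < C c \<and> P c (\<delta> c) (C c)" by metis
 define F where "F = (\<lambda>c. ball c (\<delta> c)) ` (- {0})"
 obtain F' where F': "F' \<subseteq> F" "countable F'" "\<Union>F' = \<Union>F"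
  using Lindelof[of F] by (auto simp: F_def)
 have "thin (\<Union>V\<in>F'. V \<inter> ?S)"
 proof (rule thin_countable_UN[OF F'(2)])
  fix V assume "V \<in> F'"
  then obtain c where c: "c \<noteq> 0" "V = ball c (\<delta> c)" using F' by (auto simp: F_def)
  show "thin (V \<inter> ?S)"
   by (rule thin_preimage[OF W, of "\<lambda>x. inverse (x ^ N)" _ "C c"]) (use \<delta>[OF c(1)] c(2) in \<open>auto simp: P_def\<close>)
 qed
 moreover have "?S \<subseteq> (\<Union>V\<in>F'. V \<inter> ?S)"
 proof
  fix x assume x: "x \<in> ?S"
  hence "x \<noteq> 0" by auto
  hence "x \<in> \<Union>F" unfolding F_def using \<delta>[of x] by (intro UnionI[of "ball x (\<delta> x)"]) auto
  thus "x \<in> (\<Union>V\<in>F'. V \<inter> ?S)" using F' x by blast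
 qed
 ultimately show ?thesis by (rule thin_subset)
qed

text \<open>The regions of \<open>thin_ek_region\<close> exhaust the non-real \<open>w\<close>
  outside the closed unit disc by countably many pieces. Countably many exponents are included, so
  that one set serves every \<open>N\<close>.\<close>

theorem thin_erdos_kahane:
 "\<exists>E. thin E \<and> (\<forall>x N. x \<notin> E \<longrightarrow> 0 < norm x \<longrightarrow> norm x < 1 \<longrightarrow> 1 \<le> N \<longrightarrow> Im (x ^ N) \<noteq> 0 \<longrightarrow>
  (\<exists>\<kappa>>0. \<exists>U>0. \<exists>\<epsilon>>0. \<exists>n0. escapes \<kappa> U \<epsilon> n0 (inverse (x ^ N))))"
proof -
 define T where "T B r s = {w. r \<le> norm w \<and> norm w \<le> B \<and> 1 / B \<le> s * Im w \<and>
  (\<forall>\<epsilon>>0. \<forall>n0. \<not> escapes (1 / (4 * (1 + 147 * B ^ 10))) (6 * B ^ 5) \<epsilon> n0 w)}" for B r s :: real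
 define W where "W = (\<Union>j::nat. T (real j + 1) (1 + 1 / (real j + 1)) 1 \<union> T (real j + 1) (1 + 1 / (real j + 1)) (-1))"
 have "thin W" unfolding W_def
  by (intro thin_UN thin_Un) (unfold T_def, (rule thin_ek_region; simp)+)
 define E where "E = (\<Union>N. {x. 0 < norm x \<and> norm x < 1 \<and> inverse (x ^ Suc N) \<in> W})"
 have "thin E" unfolding E_def by (intro thin_UN thin_inverse_power \<open>thin W\<close>) simp
 moreover have "\<exists>\<kappa>>0. \<exists>U>0. \<exists>\<epsilon>>0. \<exists>n0. escapes \<kappa> U \<epsilon> n0 (inverse (x ^ N))"
  if x: "x \<notin> E" "0 < norm x" "norm x < 1" "1 \<le> N" "Im (x ^ N) \<noteq> 0" for x N
 proof -
  define w where "w = inverse (x ^ N)"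
  have "w \<notin> W" using x(1-4) unfolding E_def w_def by (cases N) auto
  have "norm x ^ N < 1" using x by (simp add: power_less_one_iff)
  hence w1: "1 < norm w" using x by (simp add: w_def norm_inverse norm_power one_less_inverse)
  have imw: "Im w \<noteq> 0" using x(2,5) by (simp add: w_def)
  obtain j :: nat where j: "max (norm w) (max (1 / \<bar>Im w\<bar>) (1 / (norm w - 1))) < real j" using reals_Archimedean2 by blast
  define B where "B = real j + 1"
  have j': "norm w < real j" "1 / \<bar>Im w\<bar> < real j" "1 / (norm w - 1) < real j" using j by auto
  have B: "1 \<le> B" "norm w \<le> B" "1 / \<bar>Im w\<bar> \<le> B" "1 / (norm w - 1) \<le> B" using j' by (auto simp: B_def)
  have "1 / B \<le> \<bar>Im w\<bar>" using B imw by (simp add: field_simps)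
  moreover have "1 + 1 / B \<le> norm w" using B w1 by (simp add: field_simps)
  moreover obtain s :: real where s: "s = 1 \<or> s = -1" "s * Im w = \<bar>Im w\<bar>"
   by (cases "0 \<le> Im w") (use that[of 1] that[of "-1"] in auto)
  moreover have "w \<notin> T B (1 + 1 / B) s" using \<open>w \<notin> W\<close> s(1) unfolding W_def B_def by blast
  ultimately have nT: "\<not> (\<forall>\<epsilon>>0. \<forall>n0. \<not> escapes (1 / (4 * (1 + 147 * B ^ 10))) (6 * B ^ 5) \<epsilon> n0 w)"
   using B(2) unfolding T_def by simp
  then obtain \<epsilon> n0 where "0 < \<epsilon>" "escapes (1 / (4 * (1 + 147 * B ^ 10))) (6 * B ^ 5) \<epsilon> n0 w" by blast
  moreover have "0 < 1 / (4 * (1 + 147 * B ^ 10))" "0 < 6 * B ^ 5" using B(1) by (auto intro!: add_pos_nonneg)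
  ultimately show ?thesis unfolding w_def by blast
 qed
 ultimately show ?thesis by (intro exI[of _ E] conjI allI impI)
qed

section \<open>Gaussian mixtures\<close>

lemma integral_Re_Im_mult:
 fixes f g :: "real \<Rightarrow> real"
 assumes f: "integrable lborel f" and g: "integrable lborel g"
 shows "integrable lborel (\<lambda>z. f (Re z) * g (Im z))"
  and "(LBINT z. f (Re z) * g (Im z)) = integral\<^sup>L lborel f * integral\<^sup>L lborel g"
proof -
 have [measurable]: "f \<in> borel_measurable borel" "g \<in> borel_measurable borel" using f g by auto
 have i: "integrable (lborel \<Otimes>\<^sub>M lborel) (\<lambda>(x, y). f x * g y)"
 proof (rule lborel_pair.Fubini_integrable)
  show "integrable lborel (\<lambda>x. \<integral>y. norm (case (x, y) of (x, y) \<Rightarrow> f x * g y) \<partial>lborel)"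
   using f by (simp add: abs_mult)
 qed (use g in auto)
 have c: "(\<lambda>x. Complex (fst x) (snd x)) \<in> measurable (lborel \<Otimes>\<^sub>M lborel) borel" by measurable
 have m: "(\<lambda>z. f (Re z) * g (Im z)) \<in> borel_measurable borel" by measurable
 show "integrable lborel (\<lambda>z. f (Re z) * g (Im z))"
  by (subst lborel_complex, subst integrable_distr_eq[OF c m]) (use i in \<open>simp add: case_prod_beta'\<close>)
 have "(LBINT z. f (Re z) * g (Im z)) = (\<integral>p. f (fst p) * g (snd p) \<partial>(lborel \<Otimes>\<^sub>M lborel))"
  by (subst lborel_complex, subst integral_distr[OF c m]) simp
 also have "... = (\<integral>x. \<integral>y. f x * g y \<partial>lborel \<partial>lborel)"
  using lborel_pair.integral_fst'[OF i] by (simp add: case_prod_beta')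
 finally show "(LBINT z. f (Re z) * g (Im z)) = integral\<^sup>L lborel f * integral\<^sup>L lborel g" by simp
qed

definition gau :: "real \<Rightarrow> complex \<Rightarrow> real" where
 "gau v z = exp (- (norm z)\<^sup>2 / (2 * v)) / (2 * pi * v)"

lemma gau_measurable[measurable]: "gau v \<in> borel_measurable borel" unfolding gau_def by measurable

lemma gau_pos: "0 < v \<Longrightarrow> 0 < gau v z" by (simp add: gau_def)

lemma gau_le: "0 < v \<Longrightarrow> gau v z \<le> 1 / (2 * pi * v)"
 unfolding gau_def by (intro divide_right_mono) (auto simp: divide_nonneg_pos)

lemma gau_1: "gau 1 z = std_normal_density (Re z) * std_normal_density (Im z)"
 by (simp add: gau_def std_normal_density_def cmod_power2 add_divide_distrib exp_add[symmetric] diff_divide_distrib real_sqrt_mult_self)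

lemma gau_scl: "c \<noteq> 0 \<Longrightarrow> scl c (gau v) = gau ((norm c)^2 * v)"
 by (auto simp: fun_eq_iff scl_def gau_def norm_divide power_divide field_simps)

lemma gau_integral: assumes v: "0 < v" shows "integrable lborel (gau v)" "integral\<^sup>L lborel (gau v) = 1"
proof -
 have 1: "integrable lborel (gau 1)" "integral\<^sup>L lborel (gau 1) = 1"
  using integral_Re_Im_mult[of std_normal_density std_normal_density] by (simp_all add: gau_1[abs_def])
 define c where "c = complex_of_real (sqrt v)"
 have c: "c \<noteq> 0" "(norm c)^2 = v" using v by (auto simp: c_def)
 have g: "gau v = scl c (gau 1)" using gau_scl[OF c(1), of 1] c by simp
 show 2: "integral\<^sup>L lborel (gau v) = 1"
  unfolding g scl_def using integral_scl[of "gau 1" c] c 1 v by simp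
 show "integrable lborel (gau v)" by (rule ccontr) (use 2 in \<open>simp add: not_integrable_integral_eq\<close>)
qed

lemma integrable_shift:
 fixes f :: "complex \<Rightarrow> real" assumes "integrable lborel f" shows "integrable lborel (\<lambda>z. f (z - y))"
proof -
 have [measurable]: "f \<in> borel_measurable borel" using assms by auto
 have "integrable (distr lborel borel ((+) (-y))) f" using assms by (simp add: lborel_distr_plus)
 thus ?thesis by (subst (asm) integrable_distr_eq) auto
qed

lemma gau_shift_integral:
 assumes v: "0 < v" shows "integrable lborel (\<lambda>z. gau v (z - x))" "(LBINT z. gau v (z - x)) = 1"
 using integrable_shift gau_integral[OF v] integral_shift[of "gau v"] by auto

text \<open>Completing the square splits off a factor that depends on the centres alone, so the
  integral over \<open>z\<close> in \<open>gau_conv\<close> is immediate.\<close>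

lemma gau_mult:
 assumes v: "0 < v" and w: "0 < w"
 shows "gau v (z - x) * gau w (z - y) = gau (v + w) (x - y) * gau (v * w / (v + w)) (z - (of_real w * x + of_real v * y) / of_real (v + w))"
proof -
 have vw: "0 < v + w" using v w by simp
 have q: "a^2 / v + b^2 / w = (b - a)^2 / (v + w) + ((w * a + v * b) / (v + w))^2 * (v + w) / (v * w)" for a b :: real
 proof -
  have "(b - a)^2 / (v + w) + ((w * a + v * b) / (v + w))^2 * (v + w) / (v * w)
    = ((b - a)^2 * (v * w) + (w * a + v * b)^2) / ((v + w) * (v * w))"
  proof -
   have g: "(X / (v + w))^2 * (v + w) / (v * w) = X^2 / ((v + w) * (v * w))" for X
    using vw by (simp add: power_divide power2_eq_square)
   show ?thesis unfolding g using v w by (simp add: add_divide_distrib)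
  qed
  also have "(b - a)^2 * (v * w) + (w * a + v * b)^2 = (v + w) * (a^2 * w + b^2 * v)"
   by (simp add: power2_eq_square algebra_simps)
  also have "... / ((v + w) * (v * w)) = a^2 / v + b^2 / w" using v w vw by (simp add: add_divide_distrib)
  finally show ?thesis ..
 qed
 define a b where "a = z - x" and "b = z - y"
 have 1: "x - y = b - a" by (simp add: a_def b_def)
 have vwc: "complex_of_real v + complex_of_real w \<noteq> 0" using vw by (metis less_irrefl of_real_add of_real_eq_0_iff)
 have 2: "z - (of_real w * x + of_real v * y) / of_real (v + w) = (of_real w * a + of_real v * b) / of_real (v + w)"
  using vwc by (simp add: a_def b_def field_simps)
 have "(norm a)^2 / v + (norm b)^2 / w = ((Re a)^2 / v + (Re b)^2 / w) + ((Im a)^2 / v + (Im b)^2 / w)"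
  by (simp add: cmod_power2 add_divide_distrib)
 also have "... = (norm (b - a))^2 / (v + w) + (norm ((of_real w * a + of_real v * b) / of_real (v + w)))^2 * (v + w) / (v * w)"
  unfolding q by (simp add: cmod_power2 add_divide_distrib distrib_right flip: of_real_add)
 finally have e: "(norm a)^2 / v + (norm b)^2 / w = (norm (b - a))^2 / (v + w) + (norm ((of_real w * a + of_real v * b) / of_real (v + w)))^2 * (v + w) / (v * w)" .
 have L: "exp (- p / (2 * v)) / (2 * pi * v) * (exp (- q / (2 * w)) / (2 * pi * w)) = exp (- (p / v + q / w) / 2) / (4 * pi^2 * (v * w))" for p q
 proof -
  have "- (p / v + q / w) / 2 = - p / (2 * v) + - q / (2 * w)" by (simp add: add_divide_distrib diff_divide_distrib mult.commute)
  thus ?thesis by (simp only: exp_add) (simp add: power2_eq_square)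
 qed
 have R: "exp (- p / (2 * (v + w))) / (2 * pi * (v + w)) * (exp (- q / (2 * (v * w / (v + w)))) / (2 * pi * (v * w / (v + w))))
   = exp (- (p / (v + w) + q * (v + w) / (v * w)) / 2) / (4 * pi^2 * (v * w))" for p q
 proof -
  have "- (p / (v + w) + q * (v + w) / (v * w)) / 2 = - p / (2 * (v + w)) + - q / (2 * (v * w / (v + w)))"
   using v w vw by (simp add: add_divide_distrib diff_divide_distrib mult.commute)
  thus ?thesis using vw by (simp only: exp_add) (simp add: power2_eq_square)
 qed
 have "gau v a * gau w b = gau (v + w) (b - a) * gau (v * w / (v + w)) ((of_real w * a + of_real v * b) / of_real (v + w))"
  unfolding gau_def L R e ..
 thus ?thesis unfolding 1 2 by (simp only: a_def[symmetric] b_def[symmetric])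
qed

lemma gau_conv:
 assumes v: "0 < v" and w: "0 < w"
 shows "integrable lborel (\<lambda>z. gau v (z - x) * gau w (z - y))" "(LBINT z. gau v (z - x) * gau w (z - y)) = gau (v + w) (x - y)"
proof -
 have "0 < v * w / (v + w)" using v w by simp
 thus "integrable lborel (\<lambda>z. gau v (z - x) * gau w (z - y))" "(LBINT z. gau v (z - x) * gau w (z - y)) = gau (v + w) (x - y)"
  unfolding gau_mult[OF v w] using gau_shift_integral by auto
qed

lemma std_normal_cos_sin:
 shows "integrable lborel (\<lambda>x. std_normal_density x * cos (t * x))" "(LBINT x. std_normal_density x * cos (t * x)) = exp (- t\<^sup>2 / 2)"
  and "integrable lborel (\<lambda>x. std_normal_density x * sin (t * x))" "(LBINT x. std_normal_density x * sin (t * x)) = 0"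
proof -
 show 1: "integrable lborel (\<lambda>x. std_normal_density x * cos (t * x))"
  by (rule Bochner_Integration.integrable_bound[OF integrable_normal_density[of 1 0]]) (auto simp: abs_mult mult_left_le)
 show 2: "integrable lborel (\<lambda>x. std_normal_density x * sin (t * x))"
  by (rule Bochner_Integration.integrable_bound[OF integrable_normal_density[of 1 0]]) (auto simp: abs_mult mult_left_le)
 have i: "integrable std_normal_distribution (\<lambda>x. iexp (t * x))"
  by (rule prob_space.integrable_iexp[OF prob_space_normal_density]) auto
 have c: "complex_of_real (exp (- (t^2) / 2)) = (CLINT x|std_normal_distribution. iexp (t * x))"
  using fun_cong[OF char_std_normal_distribution, of t] by (simp add: char_def)
 have "exp (- (t^2) / 2) = (\<integral>x. cos (t * x) \<partial>std_normal_distribution)"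
  using arg_cong[OF c, of Re] integral_Re[OF i] by (simp add: Re_exp)
 also have "... = (LBINT x. std_normal_density x * cos (t * x))" by (subst integral_density) auto
 finally show "(LBINT x. std_normal_density x * cos (t * x)) = exp (- t\<^sup>2 / 2)" by simp
 have "0 = (\<integral>x. sin (t * x) \<partial>std_normal_distribution)"
  using arg_cong[OF c, of Im] integral_Im[OF i] by (simp add: Im_exp)
 also have "... = (LBINT x. std_normal_density x * sin (t * x))" by (subst integral_density) auto
 finally show "(LBINT x. std_normal_density x * sin (t * x)) = 0" by simp
qed

lemma gau_fourier_1:
 shows "integrable lborel (\<lambda>\<xi>. gau 1 \<xi> * cos (Re (cnj \<xi> * x)))" "(LBINT \<xi>. gau 1 \<xi> * cos (Re (cnj \<xi> * x))) = exp (- (norm x)\<^sup>2 / 2)"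
proof -
 let ?C = "\<lambda>t x. std_normal_density x * cos (t * x)" and ?S = "\<lambda>t x. std_normal_density x * sin (t * x)"
 have e: "gau 1 \<xi> * cos (Re (cnj \<xi> * x)) = ?C (Re x) (Re \<xi>) * ?C (Im x) (Im \<xi>) - ?S (Re x) (Re \<xi>) * ?S (Im x) (Im \<xi>)" for \<xi>
  by (simp add: gau_1 cos_add algebra_simps)
 note I = integral_Re_Im_mult[OF std_normal_cos_sin(1) std_normal_cos_sin(1)] integral_Re_Im_mult[OF std_normal_cos_sin(3) std_normal_cos_sin(3)]
 show "integrable lborel (\<lambda>\<xi>. gau 1 \<xi> * cos (Re (cnj \<xi> * x)))" unfolding e using I by simp
 show "(LBINT \<xi>. gau 1 \<xi> * cos (Re (cnj \<xi> * x))) = exp (- (norm x)\<^sup>2 / 2)"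
  unfolding e using I by (simp add: std_normal_cos_sin cmod_power2 exp_add[symmetric] add_divide_distrib)
qed

lemma gau_fourier:
 assumes v: "0 < v"
 shows "integrable lborel (\<lambda>\<xi>. exp (- v * (norm \<xi>)^2 / 2) * cos (Re (cnj \<xi> * x)))"
  and "(LBINT \<xi>. exp (- v * (norm \<xi>)^2 / 2) * cos (Re (cnj \<xi> * x))) = (2 * pi)^2 * gau v x"
proof -
 define c where "c = complex_of_real (sqrt v)"
 have c: "c \<noteq> 0" "(norm c)^2 = v" using v by (auto simp: c_def)
 have cc: "c * c = of_real v" using v by (simp add: c_def flip: of_real_mult)
 let ?F = "\<lambda>\<xi>. gau 1 \<xi> * cos (Re (cnj \<xi> * (x / c)))"
 have e: "exp (- v * (norm \<xi>)^2 / 2) * cos (Re (cnj \<xi> * x)) = 2 * pi * ?F (c * \<xi>)" for \<xi>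
  using c v by (simp add: gau_def norm_mult power_mult_distrib c_def)
 have m: "?F \<in> borel_measurable borel"
  by (intro borel_measurable_times gau_measurable borel_measurable_continuous_onI continuous_intros)
 have I: "(LBINT \<xi>. ?F (c * \<xi>)) = exp (- (norm (x / c))\<^sup>2 / 2) / v"
  unfolding integral_complex_mult[OF m c(1)] gau_fourier_1(2)[of "x / c"] c(2) ..
 show "(LBINT \<xi>. exp (- v * (norm \<xi>)^2 / 2) * cos (Re (cnj \<xi> * x))) = (2 * pi)^2 * gau v x"
  unfolding e integral_mult_right_zero I norm_divide power_divide c(2) using v by (simp add: gau_def power2_eq_square)
 have "integrable lborel (\<lambda>\<xi>. ?F (c * \<xi>))"
  by (rule ccontr) (use I v in \<open>simp add: not_integrable_integral_eq\<close>)
 thus "integrable lborel (\<lambda>\<xi>. exp (- v * (norm \<xi>)^2 / 2) * cos (Re (cnj \<xi> * x)))"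
  unfolding e by simp
qed

lemma norm_sum_cis_sq:
 fixes a t :: "'j \<Rightarrow> real"
 shows "(norm (\<Sum>j\<in>J. of_real (a j) * cis (t j)))^2 = (\<Sum>j\<in>J. \<Sum>k\<in>J. a j * a k * cos (t j - t k))"
proof -
 have "(norm (\<Sum>j\<in>J. of_real (a j) * cis (t j)))^2 = (\<Sum>j\<in>J. a j * cos (t j))^2 + (\<Sum>j\<in>J. a j * sin (t j))^2"
  by (simp add: cmod_power2)
 also have "... = (\<Sum>j\<in>J. \<Sum>k\<in>J. a j * a k * cos (t j - t k))"
  by (simp add: power2_eq_square sum_product sum.distrib[symmetric] cos_diff algebra_simps)
 finally show ?thesis .
qed

text \<open>\<open>T\<close> is the Fourier transform of \<open>D\<close>. Both square integrals
  expand into the same finite double sum, one side evaluated by \<open>gau_conv\<close> and the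
  other by \<open>gau_fourier\<close>.\<close>

lemma gau_plancherel:
 fixes c v :: "'j \<Rightarrow> real" and x :: "'j \<Rightarrow> complex"
 assumes J: "finite J" and v: "\<And>j. j \<in> J \<Longrightarrow> 0 < v j"
 defines "D \<equiv> (\<lambda>z. \<Sum>j\<in>J. c j * gau (v j) (z - x j))"
  and "T \<equiv> (\<lambda>\<xi>. \<Sum>j\<in>J. of_real (c j * exp (- v j * (norm \<xi>)^2 / 2)) * cis (Re (cnj \<xi> * x j)))"
 shows "integrable lborel (\<lambda>z. (D z)^2)" "integrable lborel (\<lambda>\<xi>. (norm (T \<xi>))^2)"
  "(LBINT \<xi>. (norm (T \<xi>))^2) = (2 * pi)^2 * (LBINT z. (D z)^2)"
proof -
 have D: "(D z)^2 = (\<Sum>j\<in>J. \<Sum>k\<in>J. c j * c k * (gau (v j) (z - x j) * gau (v k) (z - x k)))" for z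
  by (simp add: D_def power2_eq_square sum_product mult_ac)
 have T: "(norm (T \<xi>))^2 = (\<Sum>j\<in>J. \<Sum>k\<in>J. c j * c k * (exp (- (v j + v k) * (norm \<xi>)^2 / 2) * cos (Re (cnj \<xi> * (x j - x k)))))" for \<xi>
  unfolding T_def norm_sum_cis_sq
  by (intro sum.cong refl) (simp add: exp_add[symmetric] right_diff_distrib left_diff_distrib add_divide_distrib distrib_right mult_ac)
 have vv: "0 < v j + v k" if "j \<in> J" "k \<in> J" for j k using v that by (simp add: add_pos_pos)
 show "integrable lborel (\<lambda>z. (D z)^2)" unfolding D using v gau_conv(1) by auto
 show "integrable lborel (\<lambda>\<xi>. (norm (T \<xi>))^2)" unfolding T
  by (intro Bochner_Integration.integrable_sum integrable_mult_right gau_fourier(1) vv)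
 have "(LBINT z. (D z)^2) = (\<Sum>j\<in>J. \<Sum>k\<in>J. c j * c k * gau (v j + v k) (x j - x k))"
  unfolding D using v gau_conv by (simp add: Bochner_Integration.integral_sum)
 moreover have "(LBINT \<xi>. (norm (T \<xi>))^2) = (\<Sum>j\<in>J. \<Sum>k\<in>J. c j * c k * ((2 * pi)^2 * gau (v j + v k) (x j - x k)))"
 proof -
  let ?E = "\<lambda>j k \<xi>. c j * c k * (exp (- (v j + v k) * (norm \<xi>)^2 / 2) * cos (Re (cnj \<xi> * (x j - x k))))"
  have i: "integrable lborel (?E j k)" if "j \<in> J" "k \<in> J" for j k
   by (intro integrable_mult_right gau_fourier(1) vv that)
  have I: "(LBINT \<xi>. ?E j k \<xi>) = c j * c k * ((2 * pi)^2 * gau (v j + v k) (x j - x k))" if "j \<in> J" "k \<in> J" for j k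
   by (simp only: integral_mult_right_zero gau_fourier(2)[OF vv[OF that]])
  have "(LBINT \<xi>. (norm (T \<xi>))^2) = (\<Sum>j\<in>J. \<integral>\<xi>. (\<Sum>k\<in>J. ?E j k \<xi>) \<partial>lborel)"
   unfolding T by (rule Bochner_Integration.integral_sum) (intro Bochner_Integration.integrable_sum i)
  also have "... = (\<Sum>j\<in>J. \<Sum>k\<in>J. \<integral>\<xi>. ?E j k \<xi> \<partial>lborel)"
   by (intro sum.cong refl Bochner_Integration.integral_sum i)
  also have "... = (\<Sum>j\<in>J. \<Sum>k\<in>J. c j * c k * ((2 * pi)^2 * gau (v j + v k) (x j - x k)))"
   by (intro sum.cong refl I)
  finally show ?thesis .
 qed
 ultimately show "(LBINT \<xi>. (norm (T \<xi>))^2) = (2 * pi)^2 * (LBINT z. (D z)^2)"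
  by (simp add: sum_distrib_left mult_ac)
qed

text \<open>A quadratic factor is absorbed by doubling the variance, because
  \<open>y \<le> exp y\<close>. This controls the mass far from the centres.\<close>

lemma gau_second_moment: assumes "0 < v" shows "(norm z)^2 * gau v z \<le> 8 * v * gau (2 * v) z"
proof -
 define y where "y = (norm z)^2 / (4 * v)"
 have y: "(norm z)^2 = 4 * v * y" using assms by (simp add: y_def)
 have "y \<le> exp y" using exp_ge_add_one_self[of y] by linarith
 hence "y * exp (- (2 * y)) \<le> exp y * exp (- (2 * y))" by (intro mult_right_mono) auto
 also have "... = exp (- y)" by (simp add: exp_add[symmetric] del: exp_add)
 finally have "4 * v * (y * exp (- (2 * y))) \<le> 4 * v * exp (- y)" using assms by simp
 thus ?thesis unfolding gau_def y using assms by (simp add: field_simps)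
qed

lemma integrable_indicator_cball: "integrable lborel (indicator (cball c s) :: complex \<Rightarrow> real)"
 by (rule integrable_real_indicator[OF _ emeasure_lborel_cball_finite]) simp

text \<open>Replacing a Gaussian by an average of a wider one over a disc introduces indicators of
  discs, through which \<open>gau_sum_le\<close> brings in ball masses. The variance
  \<open>4 * s^2\<close> fits the estimate
  \<open>(norm (x - u))^2 \<le> 4 * (norm x)^2 + 2 * s^2\<close> on the disc.\<close>

lemma gau_le_disc_average:
 assumes s: "0 < s"
 shows "gau (s^2) x \<le> 2 / s^2 * (LBINT u. indicator (cball 0 s) u * gau (4 * s^2) (x - u))"
  and "integrable lborel (\<lambda>u. indicator (cball 0 s) u * gau (4 * s^2) (x - u))"
proof -
 let ?g = "\<lambda>u. indicator (cball 0 s) u * gau (4 * s^2) (x - u)"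
 define k where "k = exp (- 1 / 4) / 4 * gau (s^2) x"
 show i: "integrable lborel ?g"
 proof (rule Bochner_Integration.integrable_bound)
  show "integrable lborel (\<lambda>u::complex. 1 / (2 * pi * (4 * s^2)) * indicator (cball 0 s) u :: real)"
   by (intro integrable_mult_right integrable_indicator_cball)
  show "AE u in lborel. norm (?g u) \<le> norm (1 / (2 * pi * (4 * s^2)) * indicator (cball 0 s) u :: real)"
   using gau_le[of "4 * s^2"] gau_pos[of "4 * s^2"] s by (intro AE_I2) (auto simp: indicator_def abs_of_pos)
 qed (intro borel_measurable_times borel_measurable_indicator measurable_compose[OF _ gau_measurable]; simp)
 have "k * indicator (cball 0 s) u \<le> ?g u" for u
 proof (cases "u \<in> cball 0 s")
  case True
  hence u: "(norm u)^2 \<le> s^2" using s by (intro power_mono) auto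
  have "norm (x - u) \<le> norm x + norm u" by (rule norm_triangle_ineq4)
  hence "(norm (x - u))^2 \<le> (norm x + norm u)^2" by (intro power_mono) auto
  also have "... \<le> 2 * (norm x)^2 + 2 * (norm u)^2"
   using sum_squares_bound[of "norm x" "norm u"] by (simp add: power2_sum)
  also have "... \<le> 4 * (norm x)^2 + 2 * s^2" using u zero_le_power2[of "norm x"] by linarith
  finally have "(norm (x - u))^2 / (8 * s^2) \<le> (4 * (norm x)^2 + 2 * s^2) / (8 * s^2)" using s by (intro divide_right_mono) auto
  also have "... = (norm x)^2 / (2 * s^2) + 1 / 4" using s by (simp add: field_simps)
  finally have "exp (- 1 / 4) * exp (- (norm x)\<^sup>2 / (2 * s^2)) \<le> exp (- (norm (x - u))\<^sup>2 / (8 * s^2))"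
   by (simp add: exp_add[symmetric])
  hence "exp (- 1 / 4) * exp (- (norm x)\<^sup>2 / (2 * s^2)) / (8 * pi * s^2) \<le> exp (- (norm (x - u))\<^sup>2 / (8 * s^2)) / (8 * pi * s^2)"
   by (intro divide_right_mono) auto
  thus ?thesis using True by (simp add: k_def gau_def)
 qed auto
 hence "(\<integral>u. k * indicator (cball 0 s) u \<partial>(lborel :: complex measure)) \<le> (LBINT u. ?g u)"
  by (intro integral_mono i integrable_mult_right integrable_indicator_cball) auto
 moreover have "measure lborel (cball (0::complex) s) = pi * s^2"
  using s by (simp add: content_cball unit_ball_vol_2)
 ultimately have "k * (pi * s^2) \<le> (LBINT u. ?g u)" by simp
 moreover have "gau (s^2) x \<le> 2 / s^2 * (k * (pi * s^2))"
 proof -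
  have "exp (1 / 4) \<le> 1 + 1 / 4 + (1 / 4 :: real)^2" by (rule exp_bound) auto
  hence "exp (1 / 4) \<le> (3 / 2 :: real)" by (simp add: power2_eq_square)
  hence "1 \<le> exp (- 1 / 4) * (3 / 2 :: real)" using exp_minus_inverse[of "1 / 4 :: real"] by (simp add: exp_minus field_simps)
  also have "... \<le> exp (- 1 / 4) * (pi / 2)" using pi_gt3 by (intro mult_left_mono) auto
  finally have "1 * gau (s^2) x \<le> exp (- 1 / 4) * (pi / 2) * gau (s^2) x"
   using gau_pos[of "s^2" x] s by (intro mult_right_mono) auto
  also have "... = 2 / s^2 * (k * (pi * s^2))" using s by (simp add: k_def)
  finally show ?thesis by simp
 qed
 moreover have "2 / s^2 * (k * (pi * s^2)) \<le> 2 / s^2 * (LBINT u. ?g u)"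
  using calculation(1) by (intro mult_left_mono) auto
 ultimately show "gau (s^2) x \<le> 2 / s^2 * (LBINT u. ?g u)" by linarith
qed

lemma gau_sum_le:
 assumes s: "0 < s" and Y: "finite Y" and A: "\<And>y. y \<in> Y \<Longrightarrow> 0 \<le> A y"
  and K: "\<And>u. (\<Sum>y\<in>{y \<in> Y. norm (y - u) \<le> s}. A y) \<le> K"
 shows "(\<Sum>y\<in>Y. A y * gau (s^2) (z - y)) \<le> 2 * K / s^2"
proof -
 let ?I = "\<lambda>y u. indicator (cball 0 s) (u - y) * gau (4 * s^2) (z - u)"
 have eq: "(LBINT u. indicator (cball 0 s) u * gau (4 * s^2) ((z - y) - u)) = (LBINT u. ?I y u)" for y
 proof -
  let ?f = "\<lambda>u::complex. indicator (cball 0 s) u * gau (4 * s^2) ((z - y) - u)"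
  have "?f \<in> borel_measurable borel"
   by (intro borel_measurable_times borel_measurable_indicator measurable_compose[OF _ gau_measurable]) auto
  from integral_shift[OF this, of y] have "(LBINT u. ?f (u - y)) = integral\<^sup>L lborel ?f" .
  moreover have "?f (u - y) = ?I y u" for u by simp
  ultimately show ?thesis by simp
 qed
 have i: "integrable lborel (?I y)" for y
  using integrable_shift[OF gau_le_disc_average(2)[OF s, of "z - y"], of y] by simp
 have g: "integrable lborel (\<lambda>u. gau (4 * s^2) (z - u))" "(LBINT u. gau (4 * s^2) (z - u)) = 1"
 proof -
  have sym: "gau (4 * s^2) (z - u) = gau (4 * s^2) (u - z)" for u by (simp add: gau_def norm_minus_commute)
  show "integrable lborel (\<lambda>u. gau (4 * s^2) (z - u))" "(LBINT u. gau (4 * s^2) (z - u)) = 1"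
   unfolding sym using s by (simp_all add: gau_shift_integral)
 qed
 have "(\<Sum>y\<in>Y. A y * gau (s^2) (z - y)) \<le> (\<Sum>y\<in>Y. A y * (2 / s^2 * (LBINT u. ?I y u)))"
  using A gau_le_disc_average(1)[OF s, of "z - _", unfolded eq] by (intro sum_mono mult_left_mono) simp_all
 also have "... = 2 / s^2 * (\<Sum>y\<in>Y. A y * (LBINT u. ?I y u))" by (simp add: sum_distrib_left mult_ac)
 also have "(\<Sum>y\<in>Y. A y * (LBINT u. ?I y u)) = (LBINT u. (\<Sum>y\<in>Y. A y * ?I y u))"
  using i by (simp add: Bochner_Integration.integral_sum)
 also have "... \<le> (LBINT u. K * gau (4 * s^2) (z - u))"
 proof (intro integral_mono)
  fix u
  have "(\<Sum>y\<in>Y. A y * ?I y u) = (\<Sum>y\<in>Y. A y * indicator (cball 0 s) (u - y)) * gau (4 * s^2) (z - u)"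
   by (simp add: sum_distrib_right mult_ac)
  also have "(\<Sum>y\<in>Y. A y * indicator (cball 0 s) (u - y)) = (\<Sum>y\<in>{y \<in> Y. norm (y - u) \<le> s}. A y)"
   using Y by (intro sum.mono_neutral_cong_right) (auto simp: norm_minus_commute indicator_def)
  also have "... * gau (4 * s^2) (z - u) \<le> K * gau (4 * s^2) (z - u)"
   using K gau_pos[of "4 * s^2"] s by (intro mult_right_mono) (auto intro: less_imp_le)
  finally show "(\<Sum>y\<in>Y. A y * ?I y u) \<le> K * gau (4 * s^2) (z - u)" .
 qed (use i g in auto)
 also have "... = K" using g by simp
 finally show ?thesis using s by (simp add: mult_left_mono divide_right_mono)
qed

section \<open>Fourier decay\<close>

definition ch :: "complex pmf \<Rightarrow> complex \<Rightarrow> complex" where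
 "ch \<beta> \<xi> = (\<Sum>y\<in>set_pmf \<beta>. of_real (pmf \<beta> y) * cis (Re (cnj \<xi> * y)))"

text \<open>The Fourier transform of \<open>P (gau 1) - gau 1\<close> for digit law
  \<open>\<mu>\<close> and ratio \<open>lam\<close>; it vanishes at 0.\<close>

definition chP :: "complex pmf \<Rightarrow> complex \<Rightarrow> complex \<Rightarrow> complex" where
 "chP \<mu> lam \<zeta> = ch \<mu> \<zeta> * of_real (exp (- (norm lam)\<^sup>2 * (norm \<zeta>)^2 / 2)) - of_real (exp (- (norm \<zeta>)\<^sup>2 / 2))"

lemma sum_pmf_1: "finite (set_pmf \<beta>) \<Longrightarrow> (\<Sum>y\<in>set_pmf \<beta>. pmf \<beta> y) = 1"
 using sum_pmf_eq_1[of "set_pmf \<beta>" \<beta>] by simp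

lemma scl_conv_finite:
 assumes "finite (set_pmf \<mu>)" "c \<noteq> 0"
 shows "scl c (conv \<mu> f) z = (\<Sum>d\<in>set_pmf \<mu>. pmf \<mu> d * scl c f (z - c * d))"
 using assms by (simp add: scl_def conv_pmf diff_divide_distrib sum_divide_distrib)

text \<open>\<open>A\<close> provides small ball masses and \<open>B\<close> Fourier decay. Atoms of
  \<open>A\<close> with too heavy a ball are discarded at the price of their probability. For the
  others the transform is dominated by \<open>sqrt S\<close> times that of \<open>F\<close>, the
  remaining part of \<open>A\<close> smoothed at scale \<open>s\<close>, whose supremum is of order
  \<open>K / s^2\<close>; Plancherel turns this into an L2 bound. The step to L1 uses the ball of
  radius \<open>R\<close>, with Gaussian second moments outside it.\<close>

lemma L1_conv_gau_diff_le:
 fixes A B \<mu> :: "complex pmf" and c lam :: complex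
 assumes fin: "finite (set_pmf A)" "finite (set_pmf B)" "finite (set_pmf \<mu>)"
  and c: "c \<noteq> 0" "norm c \<le> 1" and lam: "lam \<noteq> 0" "norm lam \<le> 1"
  and S: "0 \<le> S" "\<And>\<xi>. (norm (ch B \<xi>))^2 * (norm (chP \<mu> lam (cnj c * \<xi>)))^2 \<le> S * exp (- (norm lam * norm c * norm \<xi>)\<^sup>2 / 2)"
  and R: "\<And>y b d. y \<in> set_pmf A \<Longrightarrow> b \<in> set_pmf B \<Longrightarrow> d \<in> set_pmf \<mu> \<Longrightarrow> norm y + norm b + norm d + 1 \<le> R"
  and s: "s = norm lam * norm c / sqrt 2" and K: "0 \<le> K" and t: "0 < t"
 defines "D \<equiv> (\<lambda>z. conv A (conv B (scl c (conv \<mu> (scl lam (gau 1))))) z - conv A (conv B (scl c (gau 1))) z)"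
 shows "integrable lborel D"
  and "(LBINT z. \<bar>D z\<bar>) \<le> 2 * ex A (\<lambda>y. if K < bm A (2 * s) y then 1 else 0)
   + (t * (pi * R^2) + S * (2 * K / s^2) / t) / 2 + 16 * (norm c)^2"
proof -
 define Y where "Y = {y \<in> set_pmf A. bm A (2 * s) y \<le> K}"
 have Y: "finite Y" "Y \<subseteq> set_pmf A" using fin by (auto simp: Y_def)
 define w where "w = (norm lam * norm c)^2"
 have w0: "0 < w" using c lam by (simp add: w_def)
 have s0: "0 < s" and s2: "s^2 = w / 2" using c lam by (auto simp: s w_def power_divide)
 define JJ where "JJ X = X \<times> set_pmf B \<times> set_pmf \<mu> \<times> (UNIV :: bool set)" for X :: "complex set"
 define a where "a = (\<lambda>(y, b, d, k). pmf A y * (pmf B b * (pmf \<mu> d * (if k then 1 else - 1))))"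
 define x where "x = (\<lambda>(y, b, d, k). y + b + (if k then c * d else 0))"
 define v where "v = (\<lambda>(y::complex, b::complex, d::complex, k). if k then w else (norm c)\<^sup>2)"
 have finJ: "finite (JJ X)" if "finite X" for X using that fin by (simp add: JJ_def)
 have v0: "0 < v j" for j using w0 c by (auto simp: v_def split: prod.split)
 have sumJJ: "(\<Sum>j\<in>JJ X. f j) = (\<Sum>y\<in>X. \<Sum>b\<in>set_pmf B. \<Sum>d\<in>set_pmf \<mu>. f (y, b, d, True) + f (y, b, d, False))"
  for X and f :: "_ \<Rightarrow> 'z::comm_monoid_add"
  unfolding JJ_def by (simp add: sum.cartesian_product' UNIV_bool add.commute)
 define E where "E X z = (\<Sum>j\<in>JJ X. a j * gau (v j) (z - x j))" for X z
 have DE: "D z = E (set_pmf A) z" for z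
 proof -
  have g1: "scl c (scl lam (gau 1)) = gau w" unfolding scl_scl using c lam by (simp add: gau_scl w_def norm_mult mult.commute)
  have g2: "scl c (gau 1) = gau ((norm c)^2)" using c by (simp add: gau_scl)
  have "conv A (conv B (scl c (gau 1))) z = (\<Sum>y\<in>set_pmf A. \<Sum>b\<in>set_pmf B. pmf A y * (pmf B b * (1 * gau ((norm c)^2) (z - y - b))))"
   using fin by (simp add: conv_pmf g2 sum_distrib_left)
  also have "... = (\<Sum>y\<in>set_pmf A. \<Sum>b\<in>set_pmf B. \<Sum>d\<in>set_pmf \<mu>. pmf A y * (pmf B b * (pmf \<mu> d * gau ((norm c)^2) (z - y - b))))"
   unfolding sum_pmf_1[OF fin(3), symmetric] by (simp add: sum_distrib_left sum_distrib_right)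
  finally have 2: "conv A (conv B (scl c (gau 1))) z = \<dots>" .
  have 1: "conv A (conv B (scl c (conv \<mu> (scl lam (gau 1))))) z
    = (\<Sum>y\<in>set_pmf A. \<Sum>b\<in>set_pmf B. \<Sum>d\<in>set_pmf \<mu>. pmf A y * (pmf B b * (pmf \<mu> d * gau w (z - y - b - c * d))))"
   using fin c by (simp add: conv_pmf scl_conv_finite g1 sum_distrib_left)
  show ?thesis unfolding D_def 1 2 E_def sumJJ
   by (simp add: a_def x_def v_def sum_subtractf diff_diff_eq[symmetric] mult.assoc)
 qed
 have iE: "integrable lborel (E X)" for X
  unfolding E_def using v0 by (intro Bochner_Integration.integrable_sum integrable_mult_right gau_shift_integral(1))
 have DE': "D = E (set_pmf A)" by (rule ext) (rule DE)
 show "integrable lborel D" unfolding DE' by (rule iE)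
 have split: "E (set_pmf A) z = E Y z + E (set_pmf A - Y) z" for z
  unfolding E_def sumJJ using fin Y by (simp add: sum.subset_diff add.commute)
 have suma: "(\<Sum>j\<in>JJ X. \<bar>a j\<bar>) = 2 * (\<Sum>y\<in>X. pmf A y)" for X
 proof -
  have "(\<Sum>j\<in>JJ X. \<bar>a j\<bar>) = (\<Sum>y\<in>X. \<Sum>b\<in>set_pmf B. \<Sum>d\<in>set_pmf \<mu>. 2 * (pmf A y * (pmf B b * pmf \<mu> d)))"
   unfolding sumJJ by (simp add: a_def abs_mult)
  also have "... = 2 * (\<Sum>y\<in>X. pmf A y)"
   by (simp add: sum_distrib_left[symmetric] sum_pmf_1 fin)
  finally show ?thesis .
 qed
 have bad: "(LBINT z. \<bar>E (set_pmf A - Y) z\<bar>) \<le> 2 * ex A (\<lambda>y. if K < bm A (2 * s) y then 1 else 0)"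
 proof -
  have "(LBINT z. \<bar>E (set_pmf A - Y) z\<bar>) \<le> (LBINT z. (\<Sum>j\<in>JJ (set_pmf A - Y). \<bar>a j\<bar> * gau (v j) (z - x j)))"
  proof (intro integral_mono integrable_abs iE Bochner_Integration.integrable_sum integrable_mult_right gau_shift_integral(1) v0)
   fix z
   have "\<bar>E (set_pmf A - Y) z\<bar> \<le> (\<Sum>j\<in>JJ (set_pmf A - Y). \<bar>a j * gau (v j) (z - x j)\<bar>)" unfolding E_def by (rule sum_abs)
   thus "\<bar>E (set_pmf A - Y) z\<bar> \<le> (\<Sum>j\<in>JJ (set_pmf A - Y). \<bar>a j\<bar> * gau (v j) (z - x j))"
    using gau_pos[OF v0] by (simp add: abs_mult abs_of_pos)
  qed
  also have "... = (\<Sum>j\<in>JJ (set_pmf A - Y). \<bar>a j\<bar>)"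
   using gau_shift_integral[OF v0] by (subst Bochner_Integration.integral_sum) auto
  also have "... = 2 * (\<Sum>y\<in>set_pmf A - Y. pmf A y)" by (rule suma)
  also have "(\<Sum>y\<in>set_pmf A - Y. pmf A y) = ex A (\<lambda>y. if K < bm A (2 * s) y then 1 else 0)"
   unfolding ex_def using fin by (intro sum.mono_neutral_cong_left) (auto simp: Y_def)
  finally show ?thesis .
 qed
 \<comment> \<open>The variance is \<open>w / 2\<close> because the Gaussian factor in the
   hypothesis on \<open>S\<close> is the square of the transform of
   \<open>gau (w / 2)\<close>.\<close>
 define F where "F z = (\<Sum>y\<in>Y. pmf A y * gau (w / 2) (z - y))" for z
 define Gh where "Gh \<xi> = (\<Sum>y\<in>Y. of_real (pmf A y) * cis (Re (cnj \<xi> * y)))" for \<xi>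
 define T where "T \<xi> = (\<Sum>j\<in>JJ Y. of_real (a j * exp (- v j * (norm \<xi>)^2 / 2)) * cis (Re (cnj \<xi> * x j)))" for \<xi>
 define T' where "T' \<xi> = (\<Sum>y\<in>Y. of_real (pmf A y * exp (- (w / 2) * (norm \<xi>)^2 / 2)) * cis (Re (cnj \<xi> * y)))" for \<xi>
 have T: "T \<xi> = Gh \<xi> * ch B \<xi> * chP \<mu> lam (cnj c * \<xi>)" for \<xi>
 proof -
  have ci: "cis (Re (cnj \<xi> * (p + q))) = cis (Re (cnj \<xi> * p)) * cis (Re (cnj \<xi> * q))" for p q
   by (simp add: cis_mult distrib_left)
  have alg: "of_real (p * (q * (r * 1)) * e1) * (Yc * Bc * Dc) + of_real (p * (q * (r * - 1)) * e2) * (Yc * Bc)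
    = (of_real p * Yc) * ((of_real q * Bc) * (of_real r * Dc * of_real e1 - of_real r * of_real e2))"
   for p q r e1 e2 :: real and Yc Bc Dc :: complex by (simp add: algebra_simps)
  let ?u = "\<lambda>d. of_real (pmf \<mu> d) * cis (Re (cnj \<xi> * (c * d))) * of_real (exp (- w * (norm \<xi>)^2 / 2)) - of_real (pmf \<mu> d) * of_real (exp (- (norm c)\<^sup>2 * (norm \<xi>)^2 / 2))"
  have u: "(\<Sum>d\<in>set_pmf \<mu>. ?u d) = chP \<mu> lam (cnj c * \<xi>)"
  proof -
   have "(\<Sum>d\<in>set_pmf \<mu>. complex_of_real (pmf \<mu> d)) = 1" using sum_pmf_1[OF fin(3)] by (simp flip: of_real_sum)
   moreover have "- w * (norm \<xi>)^2 / 2 = - (norm lam)\<^sup>2 * (norm (cnj c * \<xi>))^2 / 2" "- (norm c)\<^sup>2 * (norm \<xi>)^2 / 2 = - (norm (cnj c * \<xi>))\<^sup>2 / 2"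
    by (simp_all add: w_def norm_mult power_mult_distrib)
   moreover have "cnj (cnj c * \<xi>) * d = cnj \<xi> * (c * d)" for d by simp
   ultimately show ?thesis
    unfolding chP_def ch_def by (simp only: sum_subtractf sum_distrib_right[symmetric] mult_1)
  qed
  have "T \<xi> = (\<Sum>y\<in>Y. \<Sum>b\<in>set_pmf B. \<Sum>d\<in>set_pmf \<mu>. (of_real (pmf A y) * cis (Re (cnj \<xi> * y))) * ((of_real (pmf B b) * cis (Re (cnj \<xi> * b))) * ?u d))"
   unfolding T_def sumJJ
   by (intro sum.cong refl) (simp only: a_def x_def v_def prod.case if_True if_False add_0_right ci alg)
  also have "... = Gh \<xi> * (ch B \<xi> * (\<Sum>d\<in>set_pmf \<mu>. ?u d))"
   by (simp only: sum_distrib_left[symmetric] sum_distrib_right[symmetric] Gh_def ch_def)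
  finally show ?thesis unfolding u by (simp only: mult.assoc)
 qed
 have T': "T' \<xi> = of_real (exp (- (w / 2) * (norm \<xi>)^2 / 2)) * Gh \<xi>" for \<xi>
  unfolding T'_def Gh_def sum_distrib_left by (intro sum.cong refl) (simp add: mult_ac)
 have TT': "(norm (T \<xi>))^2 \<le> S * (norm (T' \<xi>))^2" for \<xi>
 proof -
  have "(norm (T \<xi>))^2 = (norm (Gh \<xi>))^2 * ((norm (ch B \<xi>))^2 * (norm (chP \<mu> lam (cnj c * \<xi>)))^2)"
   by (simp add: T norm_mult power_mult_distrib)
  also have "... \<le> (norm (Gh \<xi>))^2 * (S * exp (- (norm lam * norm c * norm \<xi>)\<^sup>2 / 2))"
   using S(2) by (intro mult_left_mono) auto
  also have "exp (- (norm lam * norm c * norm \<xi>)\<^sup>2 / 2) = (exp (- (w / 2) * (norm \<xi>)^2 / 2))^2"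
   by (simp add: w_def power_mult_distrib flip: exp_double)
  finally show ?thesis by (simp add: T' norm_mult power_mult_distrib mult_ac)
 qed
 note PE = gau_plancherel[where v = v and c = a and x = x, OF finJ[OF Y(1)] v0, folded E_def T_def]
 have w2: "0 < w / 2" using w0 by simp
 note PF = gau_plancherel[where v = "\<lambda>_. w / 2" and c = "pmf A" and x = "\<lambda>y. y", OF Y(1) w2, folded F_def T'_def]
 have E2: "(LBINT z. (E Y z)^2) \<le> S * (2 * K / s^2)"
 proof -
  have "(2 * pi)^2 * (LBINT z. (E Y z)^2) = (LBINT \<xi>. (norm (T \<xi>))^2)" using PE(3) by simp
  also have "... \<le> (LBINT \<xi>. S * (norm (T' \<xi>))^2)"
   using TT' by (intro integral_mono integrable_mult_right PE(2) PF(2)) auto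
  also have "... = (2 * pi)^2 * (S * (LBINT z. (F z)^2))" using PF(3) by simp
  finally have "(LBINT z. (E Y z)^2) \<le> S * (LBINT z. (F z)^2)" by (simp add: mult_le_cancel_left)
  also have "(LBINT z. (F z)^2) \<le> 2 * K / s^2"
  proof -
   have F0: "0 \<le> F z" for z unfolding F_def using gau_pos[OF w2] by (intro sum_nonneg mult_nonneg_nonneg) (auto intro: less_imp_le)
   have FK: "F z \<le> 2 * K / s^2" for z
    unfolding F_def s2[symmetric]
   proof (rule gau_sum_le[OF s0 Y(1)])
    fix u
    show "(\<Sum>y\<in>{y \<in> Y. norm (y - u) \<le> s}. pmf A y) \<le> K"
    proof (cases "{y \<in> Y. norm (y - u) \<le> s} = {}")
     case False
     then obtain y0 where y0: "y0 \<in> Y" "norm (y0 - u) \<le> s" by blast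
     have "(\<Sum>y\<in>{y \<in> Y. norm (y - u) \<le> s}. pmf A y) \<le> bm A (2 * s) y0"
      unfolding bm_def
     proof (intro sum_mono2)
      show "{y \<in> Y. norm (y - u) \<le> s} \<subseteq> {w \<in> set_pmf A. norm (w - y0) \<le> 2 * s}"
      proof clarify
       fix y assume "y \<in> Y" "norm (y - u) \<le> s"
       thus "y \<in> set_pmf A \<and> norm (y - y0) \<le> 2 * s"
        using y0 Y norm_triangle_ineq4[of "y - u" "y0 - u"] by auto
      qed
     qed (use fin in auto)
     also have "... \<le> K" using y0 by (simp add: Y_def)
     finally show ?thesis .
    next
     case True
     show ?thesis unfolding True using K by simp
    qed
   qed simp
   have iF: "integrable lborel F" unfolding F_def using w2 by (intro Bochner_Integration.integrable_sum integrable_mult_right gau_shift_integral(1))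
   have "(LBINT z. (F z)^2) \<le> (LBINT z. 2 * K / s^2 * F z)"
   proof (intro integral_mono PF(1) integrable_mult_right iF)
    show "(F z)^2 \<le> 2 * K / s^2 * F z" for z
     unfolding power2_eq_square[of "F z"] by (intro mult_right_mono FK F0)
   qed
   also have "... = 2 * K / s^2 * (LBINT z. F z)" by simp
   also have "(LBINT z. F z) = (\<Sum>y\<in>Y. pmf A y)"
    unfolding F_def using gau_shift_integral[OF w2] by (subst Bochner_Integration.integral_sum) auto
   also have "2 * K / s^2 * (\<Sum>y\<in>Y. pmf A y) \<le> 2 * K / s^2 * (\<Sum>y\<in>set_pmf A. pmf A y)"
    using K Y fin by (intro mult_left_mono sum_mono2) auto
   finally show ?thesis using sum_pmf_1[OF fin(1)] by simp
  qed
  finally show ?thesis using S(1) by (simp add: mult_left_mono)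
 qed
 have good: "(LBINT z. \<bar>E Y z\<bar>) \<le> (t * (pi * R^2) + S * (2 * K / s^2) / t) / 2 + 16 * (norm c)^2"
 proof -
  have ycd: "norm (c * d) \<le> norm d" for d using c by (simp add: norm_mult mult_left_le_one_le)
  have R0: "0 < R"
  proof -
   obtain y b d where "y \<in> set_pmf A" "b \<in> set_pmf B" "d \<in> set_pmf \<mu>" using set_pmf_not_empty by (metis all_not_in_conv)
   from R[OF this] show ?thesis using norm_ge_zero[of y] norm_ge_zero[of b] norm_ge_zero[of d] by linarith
  qed
  have xR: "norm (x j) + 1 \<le> R" if j: "j \<in> JJ Y" for j
  proof -
   obtain y b d k where j': "j = (y, b, d, k)" by (cases j) auto
   have "norm (x j) \<le> norm y + norm b + norm (if k then c * d else 0)"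
    unfolding x_def j' by (simp only: prod.case) (intro norm_triangle_le add_mono norm_triangle_ineq order_refl)
   also have "norm (if k then c * d else 0) \<le> norm d" using ycd by simp
   finally show ?thesis using R[of y b d] j Y unfolding j' JJ_def by auto
  qed
  let ?tail = "\<lambda>z. \<Sum>j\<in>JJ Y. \<bar>a j\<bar> * (8 * v j * gau (2 * v j) (z - x j))"
  have v2: "0 < 2 * v j" for j using v0[of j] by simp
  have pt: "\<bar>E Y z\<bar> \<le> (t * indicator (cball 0 R) z + (E Y z)^2 / t) / 2 + ?tail z" for z
  proof (cases "z \<in> cball 0 R")
   case True
   \<comment> \<open>A weighted form of the step from L2 to L1 on a bounded set; the free weight
     \<open>t\<close> is balanced in \<open>L1_decay\<close>.\<close>
   have "2 * (t * \<bar>E Y z\<bar>) \<le> t^2 + (E Y z)^2" using sum_squares_bound[of t "\<bar>E Y z\<bar>"] by simp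
   hence "\<bar>E Y z\<bar> \<le> (t + (E Y z)^2 / t) / 2" using t by (simp add: field_simps power2_eq_square)
   moreover have "0 \<le> ?tail z" using gau_pos[OF v2] v0 by (intro sum_nonneg mult_nonneg_nonneg) (auto intro: less_imp_le)
   moreover have "t * indicator (cball 0 R) z = t" using True by simp
   ultimately show ?thesis by (simp only: add_increasing2)
  next
   case False
   have "\<bar>E Y z\<bar> \<le> (\<Sum>j\<in>JJ Y. \<bar>a j * gau (v j) (z - x j)\<bar>)" unfolding E_def by (rule sum_abs)
   also have "... \<le> ?tail z"
   proof (rule sum_mono)
    fix j assume j: "j \<in> JJ Y"
    have "1 \<le> norm (z - x j)" using False xR[OF j] norm_triangle_ineq2[of z "x j"] by simp
    hence "1 * gau (v j) (z - x j) \<le> (norm (z - x j))^2 * gau (v j) (z - x j)"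
     by (intro mult_right_mono one_le_power less_imp_le[OF gau_pos[OF v0]])
    also have "... \<le> 8 * v j * gau (2 * v j) (z - x j)" by (rule gau_second_moment[OF v0])
    finally show "\<bar>a j * gau (v j) (z - x j)\<bar> \<le> \<bar>a j\<bar> * (8 * v j * gau (2 * v j) (z - x j))"
     using gau_pos[OF v0] by (simp add: abs_mult abs_of_pos mult_left_mono)
   qed
   finally have "\<bar>E Y z\<bar> \<le> ?tail z" .
   moreover have "0 \<le> (t * indicator (cball 0 R) z + (E Y z)^2 / t) / 2" using t by simp
   ultimately show ?thesis by (simp only: add_increasing)
  qed
  have itail: "integrable lborel ?tail"
   using gau_shift_integral(1)[OF v2] by (intro Bochner_Integration.integrable_sum integrable_mult_right)
  have "(LBINT z. \<bar>E Y z\<bar>) \<le> (LBINT z. (t * indicator (cball 0 R) z + (E Y z)^2 / t) / 2 + ?tail z)"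
   using pt by (intro integral_mono integrable_abs iE Bochner_Integration.integrable_add integrable_divide integrable_mult_right
     integrable_indicator_cball PE(1) itail) auto
  also have "... = (t * measure lborel (cball 0 R :: complex set) + (LBINT z. (E Y z)^2) / t) / 2 + (LBINT z. ?tail z)"
   using integrable_indicator_cball[of 0 R] PE(1) itail by simp
  also have "measure lborel (cball 0 R :: complex set) = pi * R^2" using R0 by (simp add: content_cball unit_ball_vol_2)
  also have "(LBINT z. ?tail z) = (\<Sum>j\<in>JJ Y. \<bar>a j\<bar> * (8 * v j))"
   using gau_shift_integral[OF v2] by (subst Bochner_Integration.integral_sum) auto
  also have "... \<le> (\<Sum>j\<in>JJ Y. \<bar>a j\<bar> * (8 * (norm c)^2))"
  proof (intro sum_mono mult_left_mono)
   fix j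
   have "w \<le> (norm c)^2" unfolding w_def using lam by (intro power_mono) (auto simp: mult_left_le_one_le)
   thus "v j \<le> (norm c)^2" by (auto simp: v_def split: prod.split)
  qed auto
  also have "... = (\<Sum>j\<in>JJ Y. \<bar>a j\<bar>) * (8 * (norm c)^2)" by (simp add: sum_distrib_right)
  also have "... \<le> 2 * (8 * (norm c)^2)"
  proof (intro mult_right_mono)
   have "(\<Sum>y\<in>Y. pmf A y) \<le> (\<Sum>y\<in>set_pmf A. pmf A y)" using Y fin by (intro sum_mono2) auto
   thus "(\<Sum>j\<in>JJ Y. \<bar>a j\<bar>) \<le> 2" unfolding suma using sum_pmf_1[OF fin(1)] by simp
  qed simp
  finally have "(LBINT z. \<bar>E Y z\<bar>) \<le> (t * (pi * R^2) + (LBINT z. (E Y z)^2) / t) / 2 + 16 * (norm c)^2" by simp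
  moreover have "(LBINT z. (E Y z)^2) / t \<le> S * (2 * K / s^2) / t" using E2 t by (intro divide_right_mono) auto
  moreover have "p \<le> (q + r1) / 2 + 16 * u \<Longrightarrow> r1 \<le> r2 \<Longrightarrow> p \<le> (q + r2) / 2 + 16 * u" for p q r1 r2 u :: real
   by (simp add: field_simps)
  ultimately show ?thesis by blast
 qed
 have "(LBINT z. \<bar>D z\<bar>) \<le> (LBINT z. \<bar>E Y z\<bar> + \<bar>E (set_pmf A - Y) z\<bar>)"
  unfolding DE split by (intro integral_mono integrable_abs Bochner_Integration.integrable_add iE abs_triangle_ineq)
 also have "... = (LBINT z. \<bar>E Y z\<bar>) + (LBINT z. \<bar>E (set_pmf A - Y) z\<bar>)"
  by (intro Bochner_Integration.integral_add integrable_abs iE)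
 finally show "(LBINT z. \<bar>D z\<bar>) \<le> 2 * ex A (\<lambda>y. if K < bm A (2 * s) y then 1 else 0)
   + (t * (pi * R^2) + S * (2 * K / s^2) / t) / 2 + 16 * (norm c)^2"
 proof (rule order_trans)
  have "p + r \<le> 2 * r' + q + 16 * u" if "r \<le> 2 * r'" "p \<le> q + 16 * u" for p q r r' u :: real using that by linarith
  from this[OF bad good] show "(LBINT z. \<bar>E Y z\<bar>) + (LBINT z. \<bar>E (set_pmf A - Y) z\<bar>) \<le> 2 * ex A (\<lambda>y. if K < bm A (2 * s) y then 1 else 0)
   + (t * (pi * R^2) + S * (2 * K / s^2) / t) / 2 + 16 * (norm c)^2" .
 qed
qed

lemma ch_expectation:
 assumes "finite (set_pmf \<beta>)" shows "ch \<beta> \<xi> = measure_pmf.expectation \<beta> (\<lambda>y. cis (Re (cnj \<xi> * y)))"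
 unfolding ch_def by (subst integral_measure_pmf[OF assms]) (auto simp: scaleR_conv_of_real)

lemma norm_ch_le_1: assumes "finite (set_pmf \<beta>)" shows "norm (ch \<beta> \<xi>) \<le> 1"
proof -
 have "norm (ch \<beta> \<xi>) \<le> (\<Sum>y\<in>set_pmf \<beta>. norm (of_real (pmf \<beta> y) * cis (Re (cnj \<xi> * y))))"
  unfolding ch_def by (rule norm_sum)
 also have "... = 1" using sum_pmf_1[OF assms] by (simp add: norm_mult)
 finally show ?thesis .
qed

lemma (in ssys) ch_X_Suc: "ch (X (Suc k)) \<xi> = ch \<alpha> \<xi> * ch (X k) (cnj \<theta> * \<xi>)"
proof -
 have "ch (X (Suc k)) \<xi> = (\<Sum>x\<in>set_pmf \<alpha>. pmf \<alpha> x *\<^sub>R measure_pmf.expectation (map_pmf (\<lambda>y. x + \<theta> * y) (X k)) (\<lambda>y. cis (Re (cnj \<xi> * y))))"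
  unfolding ch_expectation[OF finite_X] by (simp, subst pmf_expectation_bind[OF fin]) auto
 also have "... = (\<Sum>x\<in>set_pmf \<alpha>. of_real (pmf \<alpha> x) * cis (Re (cnj \<xi> * x)) * ch (X k) (cnj \<theta> * \<xi>))"
 proof (intro sum.cong refl)
  fix x
  have c: "cis (Re (cnj \<xi> * (x + \<theta> * y))) = cis (Re (cnj \<xi> * x)) * cis (Re (cnj (cnj \<theta> * \<xi>) * y))" for y
  proof -
   have "Re (cnj \<xi> * (x + \<theta> * y)) = Re (cnj \<xi> * x) + Re (cnj (cnj \<theta> * \<xi>) * y)"
    by (simp add: distrib_left mult_ac)
   thus ?thesis by (simp only: cis_mult)
  qed
  show "pmf \<alpha> x *\<^sub>R measure_pmf.expectation (map_pmf (\<lambda>y. x + \<theta> * y) (X k)) (\<lambda>y. cis (Re (cnj \<xi> * y)))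
    = of_real (pmf \<alpha> x) * cis (Re (cnj \<xi> * x)) * ch (X k) (cnj \<theta> * \<xi>)"
   unfolding integral_map_pmf c ch_expectation[OF finite_X] integral_mult_right_zero scaleR_conv_of_real by (simp only: mult.assoc)
 qed
 finally show ?thesis by (simp only: ch_def[of \<alpha>] sum_distrib_right)
qed

lemma cos_le_of_dZ:
 assumes "0 < \<kappa>" "\<kappa> \<le> dZ x" shows "cos (2 * pi * x) \<le> cos (2 * pi * \<kappa>)"
proof -
 define f where "f = x - of_int (round x)"
 have f: "\<bar>f\<bar> = dZ x" by (simp add: f_def dZ_def)
 have "2 * pi * x = 2 * pi * f + 2 * pi * of_int (round x)" by (simp add: f_def algebra_simps)
 hence "cos (2 * pi * x) = cos (2 * pi * f)" by (simp only: cos_add sin_int_2pin cos_int_2pin mult_1_right mult_zero_right diff_zero)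
 also have "... = cos (2 * pi * \<bar>f\<bar>)" by (cases "0 \<le> f") auto
 also have "... \<le> cos (2 * pi * \<kappa>)"
  using assms dZ_le_half[of x] f by (intro cos_monotone_0_pi_le) (auto simp: field_simps)
 finally show ?thesis .
qed

text \<open>If the phases of \<open>d1\<close> and \<open>d2\<close> differ by an amount away from
  the multiples of \<open>2 * pi\<close>, these two terms cannot align and lose a definite amount.
  The other digits contribute at most their total probability.\<close>

lemma ch_contraction:
 assumes fin: "finite (set_pmf \<mu>)" and d: "d1 \<in> set_pmf \<mu>" "d2 \<in> set_pmf \<mu>" "d1 \<noteq> d2" and \<kappa>: "0 < \<kappa>"
 shows "\<exists>q. 0 < q \<and> q < 1 \<and> (\<forall>\<xi>. \<kappa> \<le> dZ (Re (cnj \<xi> * (d1 - d2)) / (2 * pi)) \<longrightarrow> norm (ch \<mu> \<xi>) \<le> q)"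
proof (cases "\<kappa> \<le> 1 / 2")
 case False
 hence "\<not> \<kappa> \<le> dZ x" for x using dZ_le_half[of x] by linarith
 thus ?thesis by (intro exI[of _ "1 / 2"]) auto
next
 case True
 define p1 p2 where p: "p1 = pmf \<mu> d1" "p2 = pmf \<mu> d2"
 have pp: "0 < p1" "0 < p2" using d by (auto simp: p pmf_positive)
 define Q where "Q = sqrt ((p1 + p2)^2 - 2 * p1 * p2 * (1 - cos (2 * pi * \<kappa>)))"
 have c1: "cos (2 * pi * \<kappa>) < 1"
  using cos_monotone_0_pi[of 0 "2 * pi * \<kappa>"] \<kappa> True by simp
 have "Q < sqrt ((p1 + p2)^2)" unfolding Q_def using pp c1 by (intro real_sqrt_less_mono) auto
 hence Q: "Q < p1 + p2" using pp by simp
 define q where "q = max (1 / 2) (Q + (1 - p1 - p2))"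
 have bound: "norm (ch \<mu> \<xi>) \<le> q" if x: "\<kappa> \<le> dZ (Re (cnj \<xi> * (d1 - d2)) / (2 * pi))" for \<xi>
 proof -
  let ?c = "\<lambda>y. complex_of_real (pmf \<mu> y) * cis (Re (cnj \<xi> * y))"
  define \<Delta> where "\<Delta> = Re (cnj \<xi> * (d1 - d2))"
  have \<Delta>: "Re (cnj \<xi> * d1) - Re (cnj \<xi> * d2) = \<Delta>" by (simp add: \<Delta>_def algebra_simps)
  have "cos \<Delta> = cos (2 * pi * (\<Delta> / (2 * pi)))" by simp
  also have "... \<le> cos (2 * pi * \<kappa>)" using x \<kappa> unfolding \<Delta>_def by (intro cos_le_of_dZ)
  finally have cosle: "cos \<Delta> \<le> cos (2 * pi * \<kappa>)" .
  have "(norm (\<Sum>y\<in>{d1, d2}. ?c y))^2 = (\<Sum>j\<in>{d1, d2}. \<Sum>k\<in>{d1, d2}. pmf \<mu> j * pmf \<mu> k * cos (Re (cnj \<xi> * j) - Re (cnj \<xi> * k)))"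
   by (rule norm_sum_cis_sq)
  also have "... = p1^2 + p2^2 + 2 * p1 * p2 * cos \<Delta>"
  proof -
   have "cos (Re (cnj \<xi> * d2) - Re (cnj \<xi> * d1)) = cos \<Delta>" using \<Delta> by (metis cos_minus minus_diff_eq)
   thus ?thesis using d(3) \<Delta> by (simp only: sum.insert finite.intros insert_iff empty_iff simp_thms sum.empty) (simp add: p power2_eq_square)
  qed
  also have "... \<le> p1^2 + p2^2 + 2 * p1 * p2 * cos (2 * pi * \<kappa>)" using cosle pp by simp
  also have "... = (p1 + p2)^2 - 2 * p1 * p2 * (1 - cos (2 * pi * \<kappa>))" by (simp add: power2_eq_square algebra_simps)
  finally have "norm (\<Sum>y\<in>{d1, d2}. ?c y) \<le> Q" unfolding Q_def by (rule real_le_rsqrt)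
  moreover have "norm (\<Sum>y\<in>set_pmf \<mu> - {d1, d2}. ?c y) \<le> 1 - p1 - p2"
  proof -
   have "norm (\<Sum>y\<in>set_pmf \<mu> - {d1, d2}. ?c y) \<le> (\<Sum>y\<in>set_pmf \<mu> - {d1, d2}. norm (?c y))" by (rule norm_sum)
   also have "... = (\<Sum>y\<in>set_pmf \<mu>. pmf \<mu> y) - (\<Sum>y\<in>{d1, d2}. pmf \<mu> y)"
    using fin d by (subst sum_diff[symmetric]) (auto simp: norm_mult)
   also have "... = 1 - p1 - p2" using d(3) sum_pmf_1[OF fin] by (simp add: p)
   finally show ?thesis .
  qed
  moreover have che: "ch \<mu> \<xi> = (\<Sum>y\<in>set_pmf \<mu> - {d1, d2}. ?c y) + (\<Sum>y\<in>{d1, d2}. ?c y)"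
   unfolding ch_def using fin d by (intro sum.subset_diff) auto
  ultimately have "norm (ch \<mu> \<xi>) \<le> Q + (1 - p1 - p2)"
   using norm_triangle_ineq[of "\<Sum>y\<in>set_pmf \<mu> - {d1, d2}. ?c y" "\<Sum>y\<in>{d1, d2}. ?c y"] unfolding che by linarith
  thus ?thesis by (simp add: q_def)
 qed
 show ?thesis using bound Q by (intro exI[of _ q]) (auto simp: q_def)
qed

context ssys
begin

lemma ch_X_le_power:
 assumes q: "0 < q" "q < 1" "\<And>\<xi>. g \<xi> \<Longrightarrow> norm (ch \<alpha> \<xi>) \<le> q"
 shows "norm (ch (X m) \<xi>) \<le> q ^ card {k. k < m \<and> g (cnj \<theta> ^ k * \<xi>)}"
proof (induction m arbitrary: \<xi>)
 case 0
 show ?case using norm_ch_le_1[OF finite_X[of 0], of \<xi>] by simp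
next
 case (Suc m)
 let ?S = "\<lambda>m \<xi>. {k. k < m \<and> g (cnj \<theta> ^ k * \<xi>)}"
 have "?S (Suc m) \<xi> = (if g \<xi> then {0} else {}) \<union> Suc ` ?S m (cnj \<theta> * \<xi>)"
 proof (intro set_eqI)
  fix k show "k \<in> ?S (Suc m) \<xi> \<longleftrightarrow> k \<in> (if g \<xi> then {0} else {}) \<union> Suc ` ?S m (cnj \<theta> * \<xi>)"
   by (cases k) (auto simp: mult_ac)
 qed
 hence card: "card (?S (Suc m) \<xi>) = (if g \<xi> then 1 else 0) + card (?S m (cnj \<theta> * \<xi>))"
  by (simp only:) (subst card_Un_disjoint, auto simp: card_image)
 have "norm (ch (X (Suc m)) \<xi>) = norm (ch \<alpha> \<xi>) * norm (ch (X m) (cnj \<theta> * \<xi>))" by (simp only: ch_X_Suc norm_mult)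
 also have "... \<le> q ^ (if g \<xi> then 1 else 0) * q ^ card (?S m (cnj \<theta> * \<xi>))"
  using q norm_ch_le_1[OF fin, of \<xi>] Suc.IH by (intro mult_mono) auto
 also have "... = q ^ card (?S (Suc m) \<xi>)" unfolding card by (simp add: power_add)
 finally show ?case .
qed

text \<open>Read backwards from index \<open>n\<close>, the phase differences of the factors of
  \<open>ch (X m) \<xi>\<close>, in units of \<open>2 * pi\<close>, are
  \<open>Re (u * inverse \<theta> ^ j)\<close> with \<open>u\<close> proportional to
  \<open>\<theta> ^ n * cnj \<xi>\<close>. So \<open>far_count\<close> counts factors that
  contract.\<close>

lemma ch_X_decay:
 assumes d: "d1 \<in> set_pmf \<alpha>" "d2 \<in> set_pmf \<alpha>" "d1 \<noteq> d2" and \<kappa>: "0 < \<kappa>" and \<epsilon>: "0 < \<epsilon>"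
  and ek: "escapes \<kappa> U \<epsilon> n0 (inverse \<theta>)"
 shows "\<exists>q. 0 < q \<and> q < 1 \<and> (\<forall>n m \<xi>. n0 \<le> n \<longrightarrow> n < m \<longrightarrow>
   U \<le> norm \<theta> ^ n * norm \<xi> * (norm (d1 - d2) / (2 * pi)) \<longrightarrow> norm \<theta> ^ n * norm \<xi> * (norm (d1 - d2) / (2 * pi)) \<le> exp (\<epsilon> * real n) \<longrightarrow>
   norm (ch (X m) \<xi>) \<le> q powr (\<epsilon> * real n))"
proof -
 obtain q where q: "0 < q" "q < 1" "\<And>\<xi>. \<kappa> \<le> dZ (Re (cnj \<xi> * (d1 - d2)) / (2 * pi)) \<Longrightarrow> norm (ch \<alpha> \<xi>) \<le> q"
  using ch_contraction[OF fin d \<kappa>] by blast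
 have "norm (ch (X m) \<xi>) \<le> q powr (\<epsilon> * n)"
  if n: "n0 \<le> n" "n < m" "U \<le> norm \<theta> ^ n * norm \<xi> * (norm (d1 - d2) / (2 * pi))"
   "norm \<theta> ^ n * norm \<xi> * (norm (d1 - d2) / (2 * pi)) \<le> exp (\<epsilon> * n)" for n m \<xi>
 proof -
  define u where "u = \<theta> ^ n * cnj \<xi> * (d1 - d2) / of_real (2 * pi)"
  have nu: "norm u = norm \<theta> ^ n * norm \<xi> * (norm (d1 - d2) / (2 * pi))"
   by (simp add: u_def norm_mult norm_divide norm_power)
  let ?S = "{k. k < m \<and> \<kappa> \<le> dZ (Re (cnj (cnj \<theta> ^ k * \<xi>) * (d1 - d2)) / (2 * pi))}"
  have e: "Re (u * inverse \<theta> ^ j) = Re (cnj (cnj \<theta> ^ (n - j) * \<xi>) * (d1 - d2)) / (2 * pi)" if "j \<le> n" for j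
  proof -
   have "u * inverse \<theta> ^ j = (cnj (cnj \<theta> ^ (n - j) * \<xi>) * (d1 - d2)) / of_real (2 * pi)"
    using that by (simp add: u_def power_diff field_simps)
   thus ?thesis by (simp only: Re_divide_of_real)
  qed
  have "far_count \<kappa> (inverse \<theta>) u n \<le> card ?S"
   unfolding far_count_def
  proof (rule card_inj_on_le[where f = "\<lambda>k. n - k"])
   show "inj_on (\<lambda>k. n - k) {k. k \<le> n \<and> \<kappa> \<le> dZ (Re (u * inverse \<theta> ^ k))}" by (auto simp: inj_on_def)
   show "(\<lambda>k. n - k) ` {k. k \<le> n \<and> \<kappa> \<le> dZ (Re (u * inverse \<theta> ^ k))} \<subseteq> ?S"
    using n(2) e by (auto simp del: complex_cnj_mult complex_cnj_power)
  qed simp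
  hence c: "\<epsilon> * n \<le> real (card ?S)" using ek[unfolded escapes_def, rule_format, OF n(1), of u] n(3,4) unfolding nu by linarith
  have "norm (ch (X m) \<xi>) \<le> q ^ card ?S" by (rule ch_X_le_power[where g = "\<lambda>\<xi>. \<kappa> \<le> dZ (Re (cnj \<xi> * (d1 - d2)) / (2 * pi))", OF q])
  also have "... = q powr real (card ?S)" using q by (simp add: powr_realpow)
  also have "... \<le> q powr (\<epsilon> * n)" using c q by (intro powr_mono') auto
  finally show ?thesis .
 qed
 thus ?thesis using q by blast
qed

end

lemma norm_chP_le_2:
 assumes fin: "finite (set_pmf \<mu>)" and l: "norm lam \<le> 1"
 shows "norm (chP \<mu> lam \<zeta>) \<le> 2 * exp (- (norm lam)\<^sup>2 * (norm \<zeta>)^2 / 2)"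
proof -
 have "norm (chP \<mu> lam \<zeta>) \<le> norm (ch \<mu> \<zeta>) * exp (- (norm lam)\<^sup>2 * (norm \<zeta>)^2 / 2) + exp (- (norm \<zeta>)\<^sup>2 / 2)"
  unfolding chP_def by (rule order_trans[OF norm_triangle_ineq4]) (simp add: norm_mult)
 also have "... \<le> 1 * exp (- (norm lam)\<^sup>2 * (norm \<zeta>)^2 / 2) + exp (- (norm lam)\<^sup>2 * (norm \<zeta>)^2 / 2)"
 proof (intro add_mono mult_right_mono norm_ch_le_1 fin)
  have "(norm lam)^2 * (norm \<zeta>)^2 \<le> 1 * (norm \<zeta>)^2" using l by (intro mult_right_mono) (auto simp: power_le_one)
  thus "exp (- (norm \<zeta>)\<^sup>2 / 2) \<le> exp (- (norm lam)\<^sup>2 * (norm \<zeta>)^2 / 2)" by simp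
 qed simp
 finally show ?thesis by simp
qed

lemma norm_cis_minus_1_le: "norm (cis t - 1) \<le> \<bar>t\<bar>"
proof -
 have "(norm (cis t - 1))^2 = (cos t - 1)^2 + (sin t)^2" by (simp add: cmod_power2)
 also have "... = 2 - 2 * cos t" using sin_cos_squared_add[of t] by (simp add: power2_diff algebra_simps)
 also have "... = (2 * sin (t / 2))^2" using cos_double_sin[of "t / 2"] by (simp add: power_mult_distrib)
 finally have "(norm (cis t - 1))^2 = (2 * sin (t / 2))^2" .
 hence "norm (cis t - 1) = \<bar>2 * sin (t / 2)\<bar>" by (metis abs_norm_cancel power2_eq_iff_nonneg power2_abs abs_ge_zero norm_ge_zero)
 also have "... \<le> \<bar>t\<bar>" using abs_sin_x_le_abs_x[of "t / 2"] by simp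
 finally show ?thesis .
qed

lemma norm_chP_le_lin:
 assumes fin: "finite (set_pmf \<mu>)" and l: "norm lam \<le> 1" and M: "\<And>d. d \<in> set_pmf \<mu> \<Longrightarrow> norm d \<le> M"
 shows "norm (chP \<mu> lam \<zeta>) \<le> exp (- (norm lam)\<^sup>2 * (norm \<zeta>)^2 / 2) * (M * norm \<zeta> + (norm \<zeta>)^2 / 2)"
proof -
 define E where "E = exp (- (norm lam)\<^sup>2 * (norm \<zeta>)^2 / 2)"
 define r where "r = (1 - (norm lam)^2) * (norm \<zeta>)^2 / 2"
 have 1: "norm (ch \<mu> \<zeta> - 1) \<le> M * norm \<zeta>"
 proof -
  have "ch \<mu> \<zeta> - 1 = (\<Sum>y\<in>set_pmf \<mu>. of_real (pmf \<mu> y) * (cis (Re (cnj \<zeta> * y)) - 1))"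
  proof -
   have "(\<Sum>y\<in>set_pmf \<mu>. complex_of_real (pmf \<mu> y)) = 1" using sum_pmf_1[OF fin] by (simp flip: of_real_sum)
   thus ?thesis by (simp only: right_diff_distrib sum_subtractf ch_def mult_1_right)
  qed
  hence "norm (ch \<mu> \<zeta> - 1) \<le> (\<Sum>y\<in>set_pmf \<mu>. norm (of_real (pmf \<mu> y) * (cis (Re (cnj \<zeta> * y)) - 1)))" by (simp only: norm_sum)
  also have "... \<le> (\<Sum>y\<in>set_pmf \<mu>. pmf \<mu> y * (M * norm \<zeta>))"
  proof (intro sum_mono)
   fix y assume y: "y \<in> set_pmf \<mu>"
   have "norm (cis (Re (cnj \<zeta> * y)) - 1) \<le> \<bar>Re (cnj \<zeta> * y)\<bar>" by (rule norm_cis_minus_1_le)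
   also have "... \<le> norm (cnj \<zeta> * y)" by (rule abs_Re_le_cmod)
   also have "... \<le> M * norm \<zeta>" using mult_left_mono[OF M[OF y], of "norm \<zeta>"] by (simp add: norm_mult mult.commute)
   finally show "norm (of_real (pmf \<mu> y) * (cis (Re (cnj \<zeta> * y)) - 1)) \<le> pmf \<mu> y * (M * norm \<zeta>)"
    by (simp only: norm_mult norm_of_real) (simp add: mult_left_mono)
  qed
  also have "... = M * norm \<zeta>" using sum_pmf_1[OF fin] by (simp flip: sum_distrib_right)
  finally show ?thesis .
 qed
 have Er: "exp (- (norm \<zeta>)\<^sup>2 / 2) = E * exp (- r)"
  unfolding E_def r_def exp_add[symmetric] by (rule arg_cong[of _ _ exp]) (simp add: field_simps)
 have 2: "\<bar>1 - exp (- r)\<bar> \<le> (norm \<zeta>)^2 / 2"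
 proof -
  have "0 \<le> r" unfolding r_def using l by (auto simp: power_le_one)
  hence "\<bar>1 - exp (- r)\<bar> = 1 - exp (- r)" by simp
  also have "... \<le> r" using exp_ge_add_one_self[of "- r"] by linarith
  also have "... \<le> (norm \<zeta>)^2 / 2" unfolding r_def by (intro divide_right_mono mult_left_le_one_le) (use l in \<open>auto simp: power_le_one\<close>)
  finally show ?thesis .
 qed
 have "chP \<mu> lam \<zeta> = of_real E * (ch \<mu> \<zeta> - 1) + of_real (E * (1 - exp (- r)))"
  unfolding chP_def Er E_def[symmetric] by (simp add: algebra_simps)
 hence "norm (chP \<mu> lam \<zeta>) \<le> norm (of_real E * (ch \<mu> \<zeta> - 1)) + norm (complex_of_real (E * (1 - exp (- r))))"
  by (simp only: norm_triangle_ineq)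
 also have "... = E * norm (ch \<mu> \<zeta> - 1) + E * \<bar>1 - exp (- r)\<bar>"
  by (simp only: norm_mult norm_of_real abs_mult) (simp add: E_def)
 also have "... \<le> E * (M * norm \<zeta>) + E * ((norm \<zeta>)^2 / 2)"
  using 1 2 by (intro add_mono mult_left_mono) (auto simp: E_def)
 finally show ?thesis unfolding E_def[symmetric] by (simp only: distrib_left)
qed

text \<open>Let \<open>z = norm \<theta> ^ m * norm \<xi>\<close>. For
  \<open>z \<le> exp (- \<eta> * m)\<close> the factor \<open>chP\<close> is small, as it vanishes
  at 0; for \<open>z \<ge> exp (\<eta> * m)\<close> the Gaussian is small; in between
  \<open>ch (X m)\<close> decays because \<open>inverse \<theta>\<close> escapes. The square of
  \<open>chP\<close> carries two Gaussian factors \<open>g\<close>, one of which is kept for the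
  conclusion.\<close>

theorem (in ssys) fourier_decay:
 assumes lam: "lam \<noteq> 0" "norm lam \<le> 1"
  and d: "d1 \<in> set_pmf \<alpha>" "d2 \<in> set_pmf \<alpha>" "d1 \<noteq> d2" and \<kappa>: "0 < \<kappa>" and U: "0 < U" and \<epsilon>: "0 < \<epsilon>"
  and ek: "escapes \<kappa> U \<epsilon> n0 (inverse \<theta>)"
 shows "\<exists>C\<ge>0. \<exists>c>0. \<forall>m \<xi>. (norm (ch (X m) \<xi>))^2 * (norm (chP \<alpha> lam (cnj (\<theta> ^ m) * \<xi>)))^2
  \<le> C * exp (- c * real m) * exp (- (norm lam * norm (\<theta> ^ m) * norm \<xi>)\<^sup>2 / 2)"
proof -
 obtain q where q: "0 < q" "q < 1" and dec: "\<And>n m \<xi>. n0 \<le> n \<Longrightarrow> n < m \<Longrightarrow>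
   U \<le> norm \<theta> ^ n * norm \<xi> * (norm (d1 - d2) / (2 * pi)) \<Longrightarrow> norm \<theta> ^ n * norm \<xi> * (norm (d1 - d2) / (2 * pi)) \<le> exp (\<epsilon> * n) \<Longrightarrow>
   norm (ch (X m) \<xi>) \<le> q powr (\<epsilon> * n)"
  using ch_X_decay[OF d \<kappa> \<epsilon> ek] by blast
 obtain M where M: "0 \<le> M" "\<And>d. d \<in> set_pmf \<alpha> \<Longrightarrow> norm d \<le> M" using alpha_bound by blast
 define a where "a = norm (d1 - d2) / (2 * pi)"
 have a: "0 < a" using d by (simp add: a_def)
 define L where "L = - ln (norm \<theta>)"
 have L: "0 < L" using th1 by (simp add: L_def)
 define l where "l = norm lam"
 have l: "0 < l" "l \<le> 1" using lam by (auto simp: l_def)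
 \<comment> \<open>\<open>8 * \<eta> \<le> L\<close> keeps the shift \<open>j\<close> chosen below
   within \<open>m / 2\<close>, and \<open>12 * \<eta> \<le> \<epsilon>\<close> keeps the shifted
   frequency below \<open>exp (\<epsilon> * n)\<close>.\<close>
 define \<eta> where "\<eta> = min (\<epsilon> / 12) (L / 8)"
 have \<eta>: "0 < \<eta>" "12 * \<eta> \<le> \<epsilon>" "8 * \<eta> \<le> L" using \<epsilon> L by (auto simp: \<eta>_def)
 define m0 where "m0 = nat \<lceil>max 4 (max (2 * real n0) (max (ln (U / a) / \<eta>) ((ln a + L) / (3 * \<eta>))))\<rceil>"
 have m0: "4 \<le> real m" "2 * real n0 \<le> real m" "ln (U / a) \<le> \<eta> * m" "ln a + L \<le> 3 * \<eta> * m" if "m0 \<le> m" for m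
 proof -
  have "max 4 (max (2 * real n0) (max (ln (U / a) / \<eta>) ((ln a + L) / (3 * \<eta>)))) \<le> real m0" unfolding m0_def by linarith
  also have "... \<le> real m" using that by simp
  finally have *: "4 \<le> real m" "2 * real n0 \<le> real m" "ln (U / a) / \<eta> \<le> real m" "(ln a + L) / (3 * \<eta>) \<le> real m" by auto
  show "4 \<le> real m" "2 * real n0 \<le> real m" by (fact *)+
  show "ln (U / a) \<le> \<eta> * m" "ln a + L \<le> 3 * \<eta> * m"
   using *(3,4) \<eta> by (simp_all add: divide_le_eq mult.commute)
 qed
 define c where "c = min (2 * \<eta>) (- \<epsilon> * ln q)"
 have c: "0 < c" "c \<le> 2 * \<eta>" "c \<le> - \<epsilon> * ln q" using \<eta> \<epsilon> q by (auto simp: c_def mult_less_0_iff)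
 define C where "C = (M + 1)^2 + 8 / l^2 + 4 * exp (c * m0)"
 have C0: "0 \<le> C" using l by (simp add: C_def)
 have main: "(norm (ch (X m) \<xi>))^2 * (norm (chP \<alpha> lam (cnj (\<theta> ^ m) * \<xi>)))^2
   \<le> C * exp (- c * m) * exp (- (norm lam * norm (\<theta> ^ m) * norm \<xi>)\<^sup>2 / 2)" for m \<xi>
 proof -
  define z where "z = norm \<theta> ^ m * norm \<xi>"
  have z0: "0 \<le> z" by (simp add: z_def)
  have nz: "norm (cnj (\<theta> ^ m) * \<xi>) = z" by (simp add: z_def norm_mult norm_power)
  define P where "P = norm (chP \<alpha> lam (cnj (\<theta> ^ m) * \<xi>))"
  define H where "H = norm (ch (X m) \<xi>)"
  define g where "g = exp (- l\<^sup>2 * z^2 / 2)"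
  have g: "0 < g" "g \<le> 1" by (auto simp: g_def)
  have ge: "g = exp (- (norm lam * norm (\<theta> ^ m) * norm \<xi>)\<^sup>2 / 2)"
   by (simp add: g_def l_def z_def norm_power power_mult_distrib mult_ac)
  have P0: "0 \<le> P" and H: "0 \<le> H" "H \<le> 1" using norm_ch_le_1[OF finite_X] by (auto simp: P_def H_def)
  have P2: "P \<le> 2 * g" using norm_chP_le_2[OF fin lam(2), of "cnj (\<theta> ^ m) * \<xi>"] unfolding nz by (simp add: P_def g_def l_def)
  have Pl: "P \<le> g * (M * z + z^2 / 2)"
   using norm_chP_le_lin[OF fin lam(2) M(2), of "cnj (\<theta> ^ m) * \<xi>"] unfolding nz by (simp add: P_def g_def l_def)
  have gg: "g * g \<le> g" using g by (simp add: mult_left_le)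
  have P4: "P^2 \<le> 4 * (g * g)" using power_mono[OF P2 P0, of 2] by (simp add: power2_eq_square)
  have H2: "H^2 \<le> 1" using H by (simp add: power_le_one)
  have e0: "0 \<le> exp (- c * m)" by simp
  have le_exp: "x * exp (- (2 * \<eta>) * m) \<le> x * exp (- c * m)" if "0 \<le> x" for x
   using that c(2) by (intro mult_left_mono) (auto intro!: mult_right_mono)
  have "H^2 * P^2 \<le> C * exp (- c * m) * g"
  proof (cases "z \<le> exp (- \<eta> * m)")
   case True
   have "exp (- \<eta> * m) \<le> 1" using \<eta> by simp
   hence "z \<le> 1" using True by linarith
   hence "z^2 / 2 \<le> z" using z0 mult_left_le[of z z] by (simp add: power2_eq_square)
   hence "g * (M * z + z^2 / 2) \<le> g * ((M + 1) * z)" using g by (intro mult_left_mono) (auto simp: algebra_simps)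
   hence "P \<le> g * ((M + 1) * z)" using Pl by linarith
   hence "P^2 \<le> (g * ((M + 1) * z))^2" using P0 by (intro power_mono)
   also have "... = (g * g) * ((M + 1)^2 * z^2)" by (simp add: power2_eq_square algebra_simps)
   also have "... \<le> g * ((M + 1)^2 * exp (- (2 * \<eta>) * m))"
   proof (intro mult_mono gg order_refl)
    have "z^2 \<le> (exp (- \<eta> * m))^2" using True z0 by (intro power_mono)
    thus "z^2 \<le> exp (- (2 * \<eta>) * m)" by (simp flip: exp_double) (simp add: mult.assoc)
   qed (use g in auto)
   also have "... \<le> g * ((M + 1)^2 * exp (- c * m))" using g by (intro mult_left_mono le_exp) auto
   also have "... \<le> g * (C * exp (- c * m))"
    using g l by (intro mult_left_mono mult_right_mono) (auto simp: C_def)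
   finally have "P^2 \<le> g * (C * exp (- c * m))" .
   thus ?thesis using mult_mono[OF H2, of "P^2" "g * (C * exp (- c * m))"] by (simp add: mult_ac)
  next
   case False
   hence zl: "exp (- \<eta> * m) \<le> z" by simp
   show ?thesis
   proof (cases "exp (\<eta> * m) \<le> z")
    case True
    have zpos: "0 < z" using True less_le_trans[OF exp_gt_zero] by blast
    define x where "x = l^2 * z^2 / 2"
    have x: "0 < x" using l zpos by (simp add: x_def)
    have "x * exp (- x) \<le> 1"
    proof -
     have "x \<le> exp x" using exp_ge_add_one_self[of x] by linarith
     hence "x * exp (- x) \<le> exp x * exp (- x)" by (intro mult_right_mono) auto
     thus ?thesis by (simp add: exp_minus)
    qed
    hence "g \<le> 1 / x" using x by (simp add: g_def x_def[symmetric] pos_le_divide_eq mult.commute)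
    also have "... = 2 / l^2 * (1 / z^2)" by (simp add: x_def)
    also have "... \<le> 2 / l^2 * exp (- (2 * \<eta>) * m)"
    proof (intro mult_left_mono)
     have "(exp (\<eta> * m))^2 \<le> z^2" using True by (intro power_mono) auto
     hence "exp (2 * \<eta> * m) \<le> z^2" by (simp flip: exp_double add: mult.assoc)
     hence "1 / z^2 \<le> 1 / exp (2 * \<eta> * m)" by (intro divide_left_mono) (use zpos in auto)
     thus "1 / z^2 \<le> exp (- (2 * \<eta>) * m)" by (simp add: exp_minus inverse_eq_divide)
    qed simp
    also have "... \<le> 2 / l^2 * exp (- c * m)" by (intro le_exp) simp
    finally have gz: "g \<le> 2 / l^2 * exp (- c * m)" .
    have "P^2 \<le> 4 * (g * (2 / l^2 * exp (- c * m)))" using P4 mult_left_mono[OF gz, of g] g by linarith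
    also have "... = g * ((8 / l^2) * exp (- c * m))" by simp
    also have "... \<le> g * (C * exp (- c * m))"
     using g l by (intro mult_left_mono mult_right_mono) (auto simp: C_def)
    finally have "P^2 \<le> g * (C * exp (- c * m))" .
    thus ?thesis using mult_mono[OF H2, of "P^2" "g * (C * exp (- c * m))"] by (simp add: mult_ac)
   next
    case zu: False
    have "H^2 \<le> exp (c * m0) * exp (- c * m)"
    proof (cases "m0 \<le> m")
     case False
     hence "c * m \<le> c * m0" using c by simp
     hence "1 \<le> exp (c * m0 + - c * m)" by simp
     thus ?thesis using H2 unfolding exp_add by linarith
    next
     case True
     note m = m0[OF True]
     \<comment> \<open>Stopping \<open>j\<close> digits before \<open>m\<close> enlarges the
       frequency by \<open>exp (L * j)\<close>, which lifts it above \<open>U\<close> even if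
       \<open>z\<close> is only \<open>exp (- \<eta> * m)\<close>.\<close>
     define j where "j = nat \<lceil>2 * \<eta> * m / L\<rceil>"
     have "0 < 2 * \<eta> * m / L" using \<eta> L m by simp
     hence j: "2 * \<eta> * m / L \<le> real j" "real j \<le> 2 * \<eta> * m / L + 1" "0 < j" unfolding j_def by linarith+
     have "2 * \<eta> * m / L \<le> real m / 4"
      using \<eta>(3) L mult_right_mono[OF \<eta>(3), of "real m"] by (simp add: field_simps)
     hence j2: "real j \<le> real m / 2" using j m by linarith
     define n where "n = m - j"
     have n: "real n = real m - real j" "n < m" using j2 j(3) m(1) by (auto simp: n_def of_nat_diff)
     have n2: "real m / 2 \<le> real n" using n j2 by simp
     have n0n: "n0 \<le> n" using n2 m(2) by linarith
     have th: "norm \<theta> = exp (- L)" by (simp add: L_def)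
     have "norm \<theta> ^ n * norm \<xi> * a = a * (exp (L * real j) * z)"
     proof -
      have "norm \<theta> ^ n = exp (L * real j) * norm \<theta> ^ m"
       unfolding th exp_of_nat2_mult[symmetric] exp_add[symmetric] n(1) by (simp add: algebra_simps)
      thus ?thesis by (simp add: z_def)
     qed
     note nu = this
     have lo: "U \<le> norm \<theta> ^ n * norm \<xi> * a"
     proof -
      have "exp (\<eta> * m) = exp (2 * \<eta> * m) * exp (- \<eta> * m)" by (simp flip: exp_add)
      also have "... \<le> exp (L * real j) * z"
       using zl j(1) L by (intro mult_mono) (auto simp: pos_divide_le_eq mult.commute)
      finally have "a * exp (\<eta> * m) \<le> a * (exp (L * real j) * z)" using a by simp
      moreover have "U / a \<le> exp (\<eta> * m)"
       using m(3) a U by (metis divide_pos_pos exp_le_cancel_iff exp_ln)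
      hence "U \<le> a * exp (\<eta> * m)" using a by (simp add: pos_divide_le_eq mult.commute)
      ultimately show ?thesis unfolding nu by linarith
     qed
     have hi: "norm \<theta> ^ n * norm \<xi> * a \<le> exp (\<epsilon> * n)"
     proof -
      have "L * (2 * \<eta> * m / L + 1) = 2 * \<eta> * m + L" using L by (simp add: distrib_left)
      hence "L * real j \<le> 2 * \<eta> * m + L" using mult_left_mono[OF j(2), of L] L by linarith
      hence "a * (exp (L * real j) * z) \<le> exp (ln a) * (exp (2 * \<eta> * m + L) * exp (\<eta> * m))"
       using zu a z0 by (intro mult_mono) auto
      also have "... = exp (ln a + L + 3 * \<eta> * m)" by (simp add: exp_add[symmetric] algebra_simps del: exp_ln)
      also have "... \<le> exp (\<epsilon> * n)"
      proof -
       have "6 * \<eta> * m = 12 * \<eta> * (real m / 2)" by simp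
       also have "... \<le> \<epsilon> * n" using \<eta> n2 \<epsilon> by (intro mult_mono) auto
       finally show ?thesis using m(4) by simp
      qed
      finally show ?thesis unfolding nu .
     qed
     have "H \<le> q powr (\<epsilon> * n)" unfolding H_def using dec[OF n0n n(2), of \<xi>] lo hi unfolding a_def by blast
     also have "... \<le> q powr (\<epsilon> * (real m / 2))" using q \<epsilon> n2 by (intro powr_mono') auto
     finally have "H^2 \<le> (q powr (\<epsilon> * (real m / 2)))^2" using H by (intro power_mono)
     also have "... = exp (\<epsilon> * ln q * m)" using q by (simp add: powr_def flip: exp_double)
     also have "... \<le> exp (- c * m)" using c(3) mult_right_mono[of c "- \<epsilon> * ln q" "real m"] by simp
     also have "... \<le> exp (c * m0) * exp (- c * m)" using c by simp
     finally show ?thesis .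
    qed
    hence "H^2 * P^2 \<le> (exp (c * m0) * exp (- c * m)) * (4 * (g * g))"
     using P4 by (intro mult_mono) auto
    also have "... \<le> (exp (c * m0) * exp (- c * m)) * (4 * g)" using gg by (intro mult_left_mono) auto
    also have "... = 4 * exp (c * m0) * exp (- c * m) * g" by simp
    also have "... \<le> C * exp (- c * m) * g" using g l by (intro mult_right_mono) (auto simp: C_def)
    finally show ?thesis .
   qed
  qed
  thus ?thesis unfolding H_def P_def ge .
 qed
 show ?thesis using C0 c(1) main by (intro exI[of _ C] conjI exI[of _ c] allI) auto
qed

section \<open>Convergence of the iterates\<close>

lemma conv_pmf_L1:
 assumes fin: "finite (set_pmf \<beta>)" and f: "integrable lborel f"
 shows "integrable lborel (conv \<beta> f)" "(LBINT z. \<bar>conv \<beta> f z\<bar>) \<le> (LBINT z. \<bar>f z\<bar>)"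
  "(LBINT z. conv \<beta> f z) = (LBINT z. f z)"
proof -
 have [measurable]: "f \<in> borel_measurable borel" using f by auto
 have e: "conv \<beta> f = (\<lambda>z. \<Sum>y\<in>set_pmf \<beta>. pmf \<beta> y * f (z - y))" using fin by (auto simp: conv_pmf fun_eq_iff)
 have i: "integrable lborel (\<lambda>z. f (z - y))" for y by (rule integrable_shift[OF f])
 show 1: "integrable lborel (conv \<beta> f)" unfolding e using i by auto
 show "(LBINT z. conv \<beta> f z) = (LBINT z. f z)"
  unfolding e using i sum_pmf_1[OF fin] by (simp add: Bochner_Integration.integral_sum integral_shift flip: sum_distrib_right)
 have "(LBINT z. \<bar>conv \<beta> f z\<bar>) \<le> (LBINT z. (\<Sum>y\<in>set_pmf \<beta>. pmf \<beta> y * \<bar>f (z - y)\<bar>))"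
 proof (intro integral_mono integrable_abs 1 Bochner_Integration.integrable_sum integrable_mult_right i)
  fix z show "\<bar>conv \<beta> f z\<bar> \<le> (\<Sum>y\<in>set_pmf \<beta>. pmf \<beta> y * \<bar>f (z - y)\<bar>)"
   unfolding e by (rule order_trans[OF sum_abs]) (simp add: abs_mult)
 qed
 also have "... = (\<Sum>y\<in>set_pmf \<beta>. pmf \<beta> y * (LBINT z. \<bar>f (z - y)\<bar>))"
  using i by (simp add: Bochner_Integration.integral_sum)
 also have "... = (LBINT z. \<bar>f z\<bar>)"
  using integral_shift[of "\<lambda>z. \<bar>f z\<bar>"] sum_pmf_1[OF fin] by (simp flip: sum_distrib_right)
 finally show "(LBINT z. \<bar>conv \<beta> f z\<bar>) \<le> (LBINT z. \<bar>f z\<bar>)" .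
qed

lemma scl_L1:
 assumes c: "c \<noteq> 0" and f: "integrable lborel f"
 shows "integrable lborel (scl c f)" "(LBINT z. \<bar>scl c f z\<bar>) = (LBINT z. \<bar>f z\<bar>)"
  "(LBINT z. scl c f z) = (LBINT z. f z)"
proof -
 have [measurable]: "f \<in> borel_measurable borel" using f by auto
 have "integrable (density (distr lborel borel ((*) (1 / c))) (\<lambda>_. ennreal ((norm (1 / c))^2))) f"
  using f lborel_complex_mult[of "1 / c"] c by simp
 hence "integrable (distr lborel borel ((*) (1 / c))) (\<lambda>z. (norm (1 / c))^2 * f z)"
  by (subst (asm) integrable_real_density) auto
 hence "integrable lborel (\<lambda>z. (norm (1 / c))^2 * f (1 / c * z))"
  by (subst (asm) integrable_distr_eq) auto
 thus "integrable lborel (scl c f)"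
  by (simp add: scl_def[abs_def] norm_divide power_divide)
 show "(LBINT z. scl c f z) = (LBINT z. f z)"
  unfolding scl_def using integral_scl[of f c] c by simp
 show "(LBINT z. \<bar>scl c f z\<bar>) = (LBINT z. \<bar>f z\<bar>)"
  unfolding scl_def using integral_scl[of "\<lambda>z. \<bar>f z\<bar>" c] c by (simp add: abs_divide)
qed

lemma conv_pmf_commute:
 assumes "finite (set_pmf \<beta>)" "finite (set_pmf \<gamma>)"
 shows "conv \<beta> (conv \<gamma> f) = conv \<gamma> (conv \<beta> f)"
proof
 fix z
 have "conv \<beta> (conv \<gamma> f) z = (\<Sum>x\<in>set_pmf \<beta>. \<Sum>y\<in>set_pmf \<gamma>. pmf \<beta> x * (pmf \<gamma> y * f (z - x - y)))"
  using assms by (simp add: conv_pmf sum_distrib_left)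
 also have "... = (\<Sum>y\<in>set_pmf \<gamma>. \<Sum>x\<in>set_pmf \<beta>. pmf \<gamma> y * (pmf \<beta> x * f (z - y - x)))"
  by (subst sum.swap) (simp add: mult_ac diff_diff_eq add.commute)
 also have "... = conv \<gamma> (conv \<beta> f) z" using assms by (simp add: conv_pmf sum_distrib_left)
 finally show "conv \<beta> (conv \<gamma> f) z = conv \<gamma> (conv \<beta> f) z" .
qed

context ssys
begin

lemma P_L1:
 assumes f: "integrable lborel f"
 shows "integrable lborel (P f)" "(LBINT z. \<bar>P f z\<bar>) \<le> (LBINT z. \<bar>f z\<bar>)" "(LBINT z. P f z) = (LBINT z. f z)"
 unfolding P_def using conv_pmf_L1[OF fin scl_L1(1)[OF th0 f]] scl_L1(2,3)[OF th0 f] by auto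

lemma P_diff: "P (\<lambda>z. f z - g z) = (\<lambda>z. P f z - P g z)"
 by (auto simp: P_def conv_pmf[OF fin] scl_def fun_eq_iff diff_divide_distrib right_diff_distrib sum_subtractf)

lemma P_funpow_diff: "(P ^^ k) (\<lambda>z. f z - g z) = (\<lambda>z. (P ^^ k) f z - (P ^^ k) g z)"
 by (induction k) (auto simp: P_diff)

lemma P_funpow_L1:
 assumes f: "integrable lborel f"
 shows "integrable lborel ((P ^^ k) f) \<and> (LBINT z. \<bar>(P ^^ k) f z\<bar>) \<le> (LBINT z. \<bar>f z\<bar>) \<and> (LBINT z. (P ^^ k) f z) = (LBINT z. f z)"
proof (induction k)
 case (Suc k)
 thus ?case using P_L1[of "(P ^^ k) f"] by auto
qed (use f in simp)

lemma X_bound: "\<exists>R\<ge>0. \<forall>k. \<forall>y\<in>set_pmf (X k). norm y \<le> R"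
proof -
 obtain A where A: "0 \<le> A" "\<And>x. x \<in> set_pmf \<alpha> \<Longrightarrow> norm x \<le> A" using alpha_bound by blast
 define R where "R = A / (1 - norm \<theta>)"
 have R: "0 \<le> R" "A + norm \<theta> * R = R" using A th1 by (auto simp: R_def field_simps)
 have "\<forall>y\<in>set_pmf (X k). norm y \<le> R" for k
 proof (induction k)
  case (Suc k)
  have "norm (x + \<theta> * y) \<le> R" if "x \<in> set_pmf \<alpha>" "y \<in> set_pmf (X k)" for x y
  proof -
   have "norm (x + \<theta> * y) \<le> norm x + norm \<theta> * norm y" by (metis norm_mult norm_triangle_ineq)
   also have "... \<le> A + norm \<theta> * R" using A(2)[OF that(1)] Suc.IH that(2) by (intro add_mono mult_left_mono) auto
   finally show ?thesis using R by simp
  qed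
  thus ?case by auto
 qed (use R in auto)
 thus ?thesis using R by blast
qed

end

text \<open>In each block of \<open>N\<close> digits the leading one goes to the system with digit
  law \<open>\<mu>\<close> and the other \<open>N - 1\<close> to the one with law
  \<open>\<alpha>\<close>. Both systems have ratio \<open>lam ^ N\<close>, and the convolutions
  commute.\<close>

lemma P_power_split:
 assumes L: "ssys lam \<mu>" and N: "1 \<le> N" and A: "\<alpha> = map_pmf ((*) lam) (ssys.X lam \<mu> (N - 1))"
 shows "ssys (lam ^ N) \<alpha>" "ssys (lam ^ N) \<mu>"
  and "(ssys.P lam \<mu> ^^ (N * m)) f = conv (ssys.X (lam ^ N) \<alpha> m) (conv (ssys.X (lam ^ N) \<mu> m) (scl ((lam ^ N) ^ m) f))"
proof -
 interpret L: ssys lam \<mu> by fact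
 have th: "lam ^ N \<noteq> 0" "norm (lam ^ N) < 1" using L.th0 L.th1 N by (auto simp: norm_power power_less_one_iff)
 show "ssys (lam ^ N) \<alpha>" "ssys (lam ^ N) \<mu>" using th L.fin by (unfold_locales; simp add: A)+
 then interpret A: ssys "lam ^ N" \<alpha> + B: ssys "lam ^ N" \<mu> .
 have step: "(L.P ^^ N) f = conv \<alpha> (conv \<mu> (scl (lam ^ N) f))" for f
 proof -
  obtain N' where N': "N = Suc N'" using N by (cases N) auto
  have "(L.P ^^ N) f = conv \<mu> (scl lam (conv (L.X N') (scl (lam ^ N') f)))" unfolding N' funpow.simps o_apply L.P_funpow by (simp add: L.P_def)
  also have "... = conv \<mu> (conv \<alpha> (scl (lam ^ N) f))" by (simp add: scl_conv_pmf scl_scl A N')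
  finally show ?thesis using conv_pmf_commute[OF L.fin A.fin] by simp
 qed
 have "((L.P ^^ N) ^^ m) f = conv (A.X m) (conv (B.X m) (scl ((lam ^ N) ^ m) f))"
 proof (induction m)
  case 0
  thus ?case by (simp add: scl_1)
 next
  case (Suc m)
  have "((L.P ^^ N) ^^ Suc m) f = conv \<alpha> (conv \<mu> (scl (lam ^ N) (conv (A.X m) (conv (B.X m) (scl ((lam ^ N) ^ m) f)))))"
   unfolding funpow.simps o_apply Suc step ..
  also have "... = conv \<alpha> (conv \<mu> (conv (map_pmf ((*) (lam ^ N)) (A.X m)) (conv (map_pmf ((*) (lam ^ N)) (B.X m)) (scl ((lam ^ N) ^ Suc m) f))))"
   by (simp only: scl_conv_pmf[OF th(1)] scl_scl power_Suc)
  also have "conv \<mu> (conv (map_pmf ((*) (lam ^ N)) (A.X m)) (conv (map_pmf ((*) (lam ^ N)) (B.X m)) (scl ((lam ^ N) ^ Suc m) f)))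
    = conv (map_pmf ((*) (lam ^ N)) (A.X m)) (conv \<mu> (conv (map_pmf ((*) (lam ^ N)) (B.X m)) (scl ((lam ^ N) ^ Suc m) f)))"
   by (rule conv_pmf_commute) (use L.fin in auto)
  finally show ?case unfolding A.conv_X_Suc B.conv_X_Suc .
 qed
 thus "(ssys.P lam \<mu> ^^ (N * m)) f = conv (ssys.X (lam ^ N) \<alpha> m) (conv (ssys.X (lam ^ N) \<mu> m) (scl ((lam ^ N) ^ m) f))"
  by (simp only: funpow_mult)
qed

text \<open>\<open>large_deviation\<close> is available only at multiples of \<open>n\<close>, so
  the estimate is made there. Since \<open>P\<close> does not increase the L1 norm, the exponents in
  between cost only a constant factor.\<close>

theorem L1_decay:
 assumes L: "ssys lam \<mu>" and N: "1 \<le> N" and A: "\<alpha> = map_pmf ((*) lam) (ssys.X lam \<mu> (N - 1))"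
  and e: "ssys.e (lam ^ N) \<alpha> \<longlonglongrightarrow> 0"
  and d: "d1 \<in> set_pmf \<mu>" "d2 \<in> set_pmf \<mu>" "d1 \<noteq> d2" and \<kappa>: "0 < \<kappa>" and U: "0 < U" and \<epsilon>: "0 < \<epsilon>"
  and ek: "escapes \<kappa> U \<epsilon> n0 (inverse (lam ^ N))"
 shows "\<exists>C\<ge>0. \<exists>c>0. \<forall>l. (LBINT z. \<bar>(ssys.P lam \<mu> ^^ Suc l) (gau 1) z - (ssys.P lam \<mu> ^^ l) (gau 1) z\<bar>) \<le> C * exp (- c * real l)"
proof -
 define \<theta> where "\<theta> = lam ^ N"
 interpret L: ssys lam \<mu> by fact
 interpret A: ssys \<theta> \<alpha> unfolding \<theta>_def by (rule P_power_split(1)[OF L N A])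
 interpret B: ssys \<theta> \<mu> unfolding \<theta>_def by (rule P_power_split(2)[OF L N A])
 note split = P_power_split(3)[OF L N A, folded \<theta>_def]
 define t where "t = norm \<theta>"
 have t: "0 < t" "t < 1" using A.th0 A.th1 by (auto simp: t_def)
 define l where "l = norm lam"
 have l: "0 < l" "l \<le> 1" using L.th0 L.th1 by (auto simp: l_def)
 obtain C2 c2 where C2: "0 \<le> C2" "0 < c2" and fd: "\<And>m \<xi>. (norm (ch (B.X m) \<xi>))^2 * (norm (chP \<mu> lam (cnj (\<theta> ^ m) * \<xi>)))^2
  \<le> C2 * exp (- c2 * real m) * exp (- (norm lam * norm (\<theta> ^ m) * norm \<xi>)\<^sup>2 / 2)"
  using B.fourier_decay[OF L.th0 less_imp_le[OF L.th1] d \<kappa> U \<epsilon> ek[folded \<theta>_def]] by blast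
 \<comment> \<open>Ball masses may exceed the area scale by \<open>exp (c2 / 2 * m)\<close> and
   still lose against the Fourier decay \<open>exp (- c2 * m)\<close>.\<close>
 define \<tau> where "\<tau> = c2 / 2"
 have \<tau>: "0 < \<tau>" using C2 by (simp add: \<tau>_def)
 have r0: "0 < sqrt 2 * l" using l by simp
 obtain n c1 C1 where n: "1 \<le> n" and c1: "0 < c1" and C1: "0 \<le> C1" and ld: "\<And>k. ex (A.X (n * k))
   (\<lambda>y. if (norm \<theta> ^ (n * k))\<^sup>2 * exp (\<tau> * real (n * k)) < bm (A.X (n * k)) (sqrt 2 * l * norm \<theta> ^ (n * k)) y then 1 else 0) \<le> C1 * exp (- c1 * real k)"
  using A.large_deviation[OF e[folded \<theta>_def] \<tau> r0] by blast
 obtain RA where RA: "0 \<le> RA" "\<And>k y. y \<in> set_pmf (A.X k) \<Longrightarrow> norm y \<le> RA" using A.X_bound by blast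
 obtain RB where RB: "0 \<le> RB" "\<And>k y. y \<in> set_pmf (B.X k) \<Longrightarrow> norm y \<le> RB" using B.X_bound by blast
 obtain RM where RM: "0 \<le> RM" "\<And>y. y \<in> set_pmf \<mu> \<Longrightarrow> norm y \<le> RM" using L.alpha_bound by blast
 define R where "R = RA + RB + RM + 1"
 define \<phi> where "\<phi> = gau 1"
 have i\<phi>: "integrable lborel \<phi>" unfolding \<phi>_def by (rule gau_integral(1)) simp
 define D where "D k z = (L.P ^^ Suc k) \<phi> z - (L.P ^^ k) \<phi> z" for k z
 have iP: "integrable lborel ((L.P ^^ k) \<phi>)" for k using L.P_funpow_L1[OF i\<phi>, of k] by blast
 have iD: "integrable lborel (D k)" for k unfolding D_def using iP by (intro Bochner_Integration.integrable_diff)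
 have Dadd: "D (k + j) = (L.P ^^ j) (D k)" for k j
 proof -
  have 1: "(L.P ^^ (k + j)) \<phi> = (L.P ^^ j) ((L.P ^^ k) \<phi>)" by (simp only: add.commute[of k j] funpow_add o_apply)
  have 2: "(L.P ^^ Suc (k + j)) \<phi> = (L.P ^^ j) ((L.P ^^ Suc k) \<phi>)"
   using fun_cong[OF funpow_add[of j "Suc k" L.P], of \<phi>] by (simp only: o_apply) (simp add: add.commute)
  show ?thesis unfolding D_def[abs_def] L.P_funpow_diff 1 2 ..
 qed
 have Dmono: "(LBINT z. \<bar>D (k + j) z\<bar>) \<le> (LBINT z. \<bar>D k z\<bar>)" for k j
  unfolding Dadd using L.P_funpow_L1[OF iD] by blast
 define c where "c = min c1 (min (c2 / 4 * real n) (- 2 * ln t * n))"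
 have c: "0 < c" "c \<le> c1" "c \<le> c2 / 4 * real n" "c \<le> - 2 * ln t * n"
  using c1 C2 n t by (auto simp: c_def mult_less_0_iff)
 define C where "C = 2 * C1 + (pi * R^2 + C2 * (4 / l^2)) / 2 + 16"
 have C: "0 \<le> C" using C1 C2 by (simp add: C_def)
 have key: "(LBINT z. \<bar>D (N * (n * k)) z\<bar>) \<le> C * exp (- c * k)" for k
 proof -
  define m where "m = n * k"
  define K where "K = (t ^ m)^2 * exp (\<tau> * m)"
  define s where "s = norm lam * norm (\<theta> ^ m) / sqrt 2"
  have s2: "2 * s = sqrt 2 * l * t ^ m" by (simp add: s_def l_def t_def norm_power field_simps)
  have s2': "s^2 = l^2 * (t ^ m)^2 / 2" by (simp add: s_def l_def t_def norm_power power_divide power_mult_distrib)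
  \<comment> \<open>The weight that balances both terms:
    \<open>exp (- c2 * m) * exp (\<tau> * m) / T = T\<close>.\<close>
  define T where "T = exp (- (c2 / 4) * m)"
  have De: "D (N * m) = (\<lambda>z. conv (A.X m) (conv (B.X m) (scl (\<theta> ^ m) (conv \<mu> (scl lam (gau 1))))) z - conv (A.X m) (conv (B.X m) (scl (\<theta> ^ m) (gau 1))) z)"
  proof -
   have "(L.P ^^ Suc (N * m)) \<phi> = (L.P ^^ (N * m)) (L.P \<phi>)" by (simp only: funpow_Suc_right o_apply)
   thus ?thesis unfolding D_def[abs_def] split by (simp only: split L.P_def \<phi>_def)
  qed
  have "(LBINT z. \<bar>D (N * m) z\<bar>) \<le> 2 * ex (A.X m) (\<lambda>y. if K < bm (A.X m) (2 * s) y then 1 else 0)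
   + (T * (pi * R^2) + (C2 * exp (- c2 * real m)) * (2 * K / s^2) / T) / 2 + 16 * (norm (\<theta> ^ m))^2"
   unfolding De
  proof (rule L1_conv_gau_diff_le(2)[OF A.finite_X B.finite_X L.fin])
   show "norm y + norm b + norm d + 1 \<le> R" if "y \<in> set_pmf (A.X m)" "b \<in> set_pmf (B.X m)" "d \<in> set_pmf \<mu>" for y b d
    unfolding R_def using RA(2)[OF that(1)] RB(2)[OF that(2)] RM(2)[OF that(3)] by linarith
   show "norm (\<theta> ^ m) \<le> 1" using t unfolding norm_power t_def[symmetric] by (simp add: power_le_one)
   show "norm lam \<le> 1" using L.th1 by simp
   show "0 \<le> K" by (simp add: K_def)
   show "0 \<le> C2 * exp (- c2 * real m)" using C2 by simp
  qed (use fd in \<open>simp_all add: s_def T_def\<close>)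
  also have "ex (A.X m) (\<lambda>y. if K < bm (A.X m) (2 * s) y then 1 else 0) \<le> C1 * exp (- c1 * real k)"
   using ld[of k] unfolding s2 K_def m_def[symmetric] t_def[symmetric] .
  also have "(C2 * exp (- c2 * real m)) * (2 * K / s^2) / T = C2 * (4 / l^2) * T"
  proof -
   have "2 * K / s^2 = 4 / l^2 * exp (\<tau> * m)" using t l by (simp add: K_def s2' field_simps)
   hence "(C2 * exp (- c2 * real m)) * (2 * K / s^2) / T = C2 * (4 / l^2) * (exp (- c2 * real m) * exp (\<tau> * m) / T)" by simp
   also have "exp (- c2 * real m) * exp (\<tau> * m) / T = T"
    unfolding T_def \<tau>_def exp_add[symmetric] exp_diff[symmetric] by (rule arg_cong[of _ _ exp]) (simp add: field_simps)
   finally show ?thesis .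
  qed
  also have "norm (\<theta> ^ m) = t ^ m" by (simp add: t_def norm_power)
  also have "T * (pi * R^2) + C2 * (4 / l^2) * T = (pi * R^2 + C2 * (4 / l^2)) * T" by (simp add: algebra_simps)
  finally have "(LBINT z. \<bar>D (N * m) z\<bar>) \<le> 2 * (C1 * exp (- c1 * real k)) + (pi * R^2 + C2 * (4 / l^2)) * T / 2 + 16 * (t ^ m)^2"
   by simp
  also have "... \<le> 2 * (C1 * exp (- c * k)) + (pi * R^2 + C2 * (4 / l^2)) * exp (- c * k) / 2 + 16 * exp (- c * k)"
  proof (intro add_mono mult_left_mono divide_right_mono)
   show "exp (- c1 * real k) \<le> exp (- c * k)" using mult_right_mono[OF c(2), of "real k"] by simp
   show "T \<le> exp (- c * k)" using mult_right_mono[OF c(3), of "real k"] by (simp add: T_def m_def mult_ac)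
   have "t ^ m = exp (ln t * m)" using t by (simp add: exp_of_nat2_mult)
   hence "(t ^ m)^2 = exp (2 * ln t * m)" by (simp flip: exp_double add: mult.assoc)
   also have "... \<le> exp (- c * k)" using mult_right_mono[OF c(4), of "real k"] by (simp add: m_def mult_ac)
   finally show "(t ^ m)^2 \<le> exp (- c * k)" .
  qed (use C1 C2 in auto)
  also have "... = C * exp (- c * k)" by (simp add: C_def algebra_simps)
  finally show ?thesis by (simp only: m_def)
 qed
 define q where "q = N * n"
 have q: "0 < q" using N n by (simp add: q_def)
 show ?thesis
 proof (rule exI[of _ "C * exp c"], intro conjI)
  show "0 \<le> C * exp c" using C by simp
  show "\<exists>c'>0. \<forall>l. (LBINT z. \<bar>(L.P ^^ Suc l) (gau 1) z - (L.P ^^ l) (gau 1) z\<bar>) \<le> C * exp c * exp (- c' * l)"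
  proof (rule exI[of _ "c / real q"], intro conjI allI)
   show "0 < c / real q" using c q by simp
   fix l
   define k where "k = l div q"
   have lk: "l = N * (n * k) + l mod q" unfolding k_def q_def by (simp add: mult.assoc[symmetric])
   have "real l \<le> real q * (real k + 1)"
   proof -
    have "l \<le> q * k + q" using mod_less_divisor[OF q, of l] mult_div_mod_eq[of q l] unfolding k_def by linarith
    thus ?thesis by (simp add: distrib_left flip: of_nat_mult of_nat_add)
   qed
   hence "c / real q * l \<le> c / real q * (real q * (real k + 1))" using c q by (intro mult_left_mono) auto
   also have "... = c * k + c" using q by (simp add: distrib_left)
   finally have lq: "c / real q * l \<le> c * k + c" .
   have "(LBINT z. \<bar>D l z\<bar>) \<le> (LBINT z. \<bar>D (N * (n * k)) z\<bar>)"
    using Dmono[of "N * (n * k)" "l mod q"] by (subst lk)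
   also have "... \<le> C * exp (- c * k)" by (rule key)
   also have "... \<le> C * exp (c + - (c / real q) * l)" using lq C by (intro mult_left_mono) auto
   finally show "(LBINT z. \<bar>(L.P ^^ Suc l) (gau 1) z - (L.P ^^ l) (gau 1) z\<bar>) \<le> C * exp c * exp (- (c / real q) * l)"
    unfolding D_def \<phi>_def exp_add by (simp only: mult.assoc)
  qed
 qed
qed

lemma L1_suminf:
 fixes f :: "nat \<Rightarrow> 'a \<Rightarrow> real"
 assumes f: "\<And>k. integrable M (f k)" and a: "\<And>k. (\<integral>z. \<bar>f k z\<bar> \<partial>M) \<le> a k" "summable a"
 shows "AE z in M. summable (\<lambda>k. \<bar>f k z\<bar>)" "integrable M (\<lambda>z. \<Sum>k. f k z)" "(\<integral>z. \<bar>\<Sum>k. f k z\<bar> \<partial>M) \<le> suminf a"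
proof -
 have [measurable]: "\<And>k. f k \<in> borel_measurable M" using f by auto
 have s: "summable (\<lambda>k. \<integral>z. norm (f k z) \<partial>M)"
  by (rule summable_comparison_test'[OF a(2)]) (use a in auto)
 have "(\<integral>\<^sup>+z. (\<Sum>k. ennreal \<bar>f k z\<bar>) \<partial>M) = (\<Sum>k. \<integral>\<^sup>+z. ennreal \<bar>f k z\<bar> \<partial>M)" by (intro nn_integral_suminf) auto
 also have "... = (\<Sum>k. ennreal (\<integral>z. \<bar>f k z\<bar> \<partial>M))"
  by (intro arg_cong[where f = suminf] ext nn_integral_eq_integral integrable_abs f) auto
 also have "... \<noteq> \<infinity>" using s by (simp add: ennreal_suminf_neq_top)
 finally have "AE z in M. (\<Sum>k. ennreal \<bar>f k z\<bar>) \<noteq> \<infinity>" by (intro nn_integral_noteq_infinite) auto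
 thus ae: "AE z in M. summable (\<lambda>k. \<bar>f k z\<bar>)"
  by eventually_elim (auto intro: summable_suminf_not_top)
 hence ae': "AE z in M. summable (\<lambda>k. norm (f k z))" by simp
 show i: "integrable M (\<lambda>z. \<Sum>k. f k z)" by (rule integrable_suminf[OF f ae' s])
 have ae2: "AE z in M. summable (\<lambda>k. norm \<bar>f k z\<bar>)" using ae by simp
 have s2: "summable (\<lambda>k. \<integral>z. norm \<bar>f k z\<bar> \<partial>M)" using s by simp
 have "(\<integral>z. \<bar>\<Sum>k. f k z\<bar> \<partial>M) \<le> (\<integral>z. (\<Sum>k. \<bar>f k z\<bar>) \<partial>M)"
  using ae by (intro integral_mono_AE integrable_abs i integrable_suminf[OF integrable_abs[OF f] ae2 s2]) (auto elim!: eventually_mono intro: summable_rabs)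
 also have "... = (\<Sum>k. \<integral>z. \<bar>f k z\<bar> \<partial>M)" by (rule integral_suminf[OF integrable_abs[OF f] ae2 s2])
 also have "... \<le> suminf a" using s a by (intro suminf_le) auto
 finally show "(\<integral>z. \<bar>\<Sum>k. f k z\<bar> \<partial>M) \<le> suminf a" .
qed

lemma L1_limit:
 fixes \<rho> :: "nat \<Rightarrow> 'a \<Rightarrow> real"
 assumes i: "\<And>l. integrable M (\<rho> l)" and nn: "\<And>l z. 0 \<le> \<rho> l z"
  and C: "0 \<le> C" and c: "0 < c" and d: "\<And>l. (\<integral>z. \<bar>\<rho> (Suc l) z - \<rho> l z\<bar> \<partial>M) \<le> C * exp (- c * real l)"
 shows "\<exists>r C'. integrable M r \<and> (\<forall>z. 0 \<le> r z) \<and> 0 \<le> C' \<and> (\<forall>l. (\<integral>z. \<bar>r z - \<rho> l z\<bar> \<partial>M) \<le> C' * exp (- c * real l))"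
proof -
 define D where "D k z = \<rho> (Suc k) z - \<rho> k z" for k z
 have iD: "integrable M (D k)" for k unfolding D_def using i by auto
 define C' where "C' = C * (\<Sum>k. exp (- c) ^ k)"
 have c1: "exp (- c) < 1" using c by simp
 hence sg: "summable (\<lambda>k. exp (- c) ^ k)" by (intro summable_geometric) simp
 have C': "0 \<le> C'" unfolding C'_def using C sg by (intro mult_nonneg_nonneg suminf_nonneg) auto
 have e: "exp (- c * real (k + l)) = exp (- c) ^ k * exp (- c * l)" for k l
 proof -
  have "exp (- c) ^ k = exp (- c * k)" by (rule exp_of_nat2_mult[symmetric])
  thus ?thesis by (simp only: exp_add[symmetric]) (simp add: algebra_simps)
 qed
 have dk: "(\<integral>z. \<bar>D (k + l) z\<bar> \<partial>M) \<le> C * exp (- c * l) * exp (- c) ^ k" for k l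
  using d[of "k + l"] unfolding D_def e by (simp only: mult_ac)
 have tail: "(\<integral>z. \<bar>\<Sum>k. D (k + l) z\<bar> \<partial>M) \<le> C' * exp (- c * l)" for l
 proof -
  from L1_suminf(3)[OF iD dk summable_mult[OF sg]]
  have "(\<integral>z. \<bar>\<Sum>k. D (k + l) z\<bar> \<partial>M) \<le> (\<Sum>k. C * exp (- c * l) * exp (- c) ^ k)" .
  also have "... = C' * exp (- c * l)" unfolding suminf_mult[OF sg] C'_def by (simp only: mult_ac)
  finally show ?thesis .
 qed
 have d0: "(\<integral>z. \<bar>D k z\<bar> \<partial>M) \<le> C * exp (- c) ^ k" for k using d[of k] e[of k 0] by (simp add: D_def)
 define S where "S z = \<rho> 0 z + (\<Sum>k. D k z)" for z
 have iS: "integrable M S" unfolding S_def using i L1_suminf(2)[OF iD d0 summable_mult[OF sg]] by auto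
 have ae: "AE z in M. summable (\<lambda>k. \<bar>D k z\<bar>)" by (rule L1_suminf(1)[OF iD d0 summable_mult[OF sg]])
 \<comment> \<open>The density has to be nonnegative at every point. Cutting off at 0 achieves this
   and does not increase the distance to the nonnegative functions \<open>\<rho> l\<close>.\<close>
 define r where "r z = max 0 (S z)" for z
 have ir: "integrable M r" unfolding r_def using iS by simp
 have "(\<integral>z. \<bar>r z - \<rho> l z\<bar> \<partial>M) \<le> C' * exp (- c * l)" for l
 proof -
  have tele: "(\<Sum>k<l. D k z) = \<rho> l z - \<rho> 0 z" for z unfolding D_def by (rule sum_lessThan_telescope)
  have "AE z in M. \<bar>r z - \<rho> l z\<bar> \<le> \<bar>\<Sum>k. D (k + l) z\<bar>"
   using ae
  proof eventually_elim
   fix z assume "summable (\<lambda>k. \<bar>D k z\<bar>)"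
   hence "summable (\<lambda>k. D k z)" by (rule summable_rabs_cancel)
   hence "(\<Sum>k. D k z) = (\<Sum>k. D (k + l) z) + (\<Sum>k<l. D k z)" by (rule suminf_split_initial_segment)
   hence "S z - \<rho> l z = (\<Sum>k. D (k + l) z)" by (simp add: S_def tele)
   moreover have "\<bar>r z - \<rho> l z\<bar> \<le> \<bar>S z - \<rho> l z\<bar>" using nn[of l z] by (auto simp: r_def max_def)
   ultimately show "\<bar>r z - \<rho> l z\<bar> \<le> \<bar>\<Sum>k. D (k + l) z\<bar>" by simp
  qed
  moreover have "integrable M (\<lambda>z. \<Sum>k. D (k + l) z)" by (rule L1_suminf(2)[OF iD dk summable_mult[OF sg]])
  ultimately have "(\<integral>z. \<bar>r z - \<rho> l z\<bar> \<partial>M) \<le> (\<integral>z. \<bar>\<Sum>k. D (k + l) z\<bar> \<partial>M)"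
   using ir i by (intro integral_mono_AE) auto
  thus ?thesis using tail[of l] by linarith
 qed
 thus ?thesis using ir C' by (intro exI[of _ r] exI[of _ C']) (auto simp: r_def)
qed

text \<open>Where \<open>r\<close> lies between \<open>2 * b ^ (k + 1)\<close> and
  \<open>2 * b ^ (k + 2)\<close>, the bound \<open>\<rho> k \<le> b ^ k\<close> makes
  \<open>r\<close> at most \<open>2 * \<bar>r - \<rho> k\<bar>\<close>. The L1 error at stage
  \<open>k\<close> beats the additional factor \<open>r powr \<delta>\<close>, and the sum over
  \<open>k\<close> converges.\<close>

lemma Lq_of_L1_rate:
 fixes r :: "'a \<Rightarrow> real"
 assumes r: "integrable M r" "\<And>z. 0 \<le> r z" and i: "\<And>l. integrable M (\<rho> l)"
  and b: "1 < b" "\<And>l z. \<rho> l z \<le> b ^ l"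
  and C: "0 \<le> C" and c: "0 < c" and d: "\<And>l. (\<integral>z. \<bar>r z - \<rho> l z\<bar> \<partial>M) \<le> C * exp (- c * real l)"
 shows "\<exists>q>1. integrable M (\<lambda>z. r z powr q)"
proof -
 \<comment> \<open>Chosen so that \<open>b powr \<delta> = exp (c / 2)\<close>, which uses half of
   the available decay.\<close>
 define \<delta> where "\<delta> = c / (2 * ln b)"
 have \<delta>: "0 < \<delta>" using c b by (simp add: \<delta>_def)
 have b\<delta>: "b powr \<delta> = exp (c / 2)" using b by (simp add: powr_def \<delta>_def)
 define B where "B l = (2 * b ^ (l + 2)) powr \<delta> * 2" for l :: nat
 have B: "B l = (2 * b^2) powr \<delta> * 2 * exp (c / 2 * real l)" for l
 proof -
  have "2 * b ^ (l + 2) = 2 * b^2 * b powr real l" using b by (simp add: power_add powr_realpow power2_eq_square)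
  hence "(2 * b ^ (l + 2)) powr \<delta> = (2 * b^2) powr \<delta> * (b powr \<delta>) powr real l"
   using b by (simp add: powr_mult powr_powr mult.commute)
  also have "(b powr \<delta>) powr real l = exp (c / 2 * real l)" unfolding b\<delta> by (simp add: powr_def)
  finally show ?thesis by (simp add: B_def)
 qed
 have B0: "0 \<le> B l" for l by (simp add: B_def)
 define h where "h l z = B l * \<bar>r z - \<rho> l z\<bar>" for l z
 have ih: "integrable M (h l)" for l unfolding h_def using r i by auto
 have hb: "(\<integral>z. \<bar>h l z\<bar> \<partial>M) \<le> (2 * b^2) powr \<delta> * 2 * C * exp (- c / 2) ^ l" for l
 proof -
  have "(\<integral>z. \<bar>h l z\<bar> \<partial>M) = B l * (\<integral>z. \<bar>r z - \<rho> l z\<bar> \<partial>M)" using B0[of l] by (simp add: h_def abs_mult)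
  also have "... \<le> B l * (C * exp (- c * l))" by (intro mult_left_mono d B0)
  also have "... = (2 * b^2) powr \<delta> * 2 * C * (exp (c / 2 * real l) * exp (- c * l))" by (simp add: B mult_ac)
  also have "exp (c / 2 * real l) * exp (- c * l) = exp (- c / 2 * real l)"
   unfolding exp_add[symmetric] by (rule arg_cong[of _ _ exp]) (simp add: field_simps)
  also have "... = exp (- c / 2) ^ l" by (rule exp_of_nat2_mult)
  finally show ?thesis .
 qed
 have sg: "summable (\<lambda>l. (2 * b^2) powr \<delta> * 2 * C * exp (- c / 2) ^ l)"
  using c by (intro summable_mult summable_geometric) auto
 define F where "F z = (2 * b) powr \<delta> * r z + (\<Sum>l. h l z)" for z
 have iF: "integrable M F" unfolding F_def using r L1_suminf(2)[OF ih hb sg] by auto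
 have h0: "0 \<le> h l z" for l z using B0 by (simp add: h_def)
 have "AE z in M. norm (r z powr (1 + \<delta>)) \<le> norm (F z)"
  using L1_suminf(1)[OF ih hb sg]
 proof eventually_elim
  fix z assume "summable (\<lambda>l. \<bar>h l z\<bar>)"
  hence sh: "summable (\<lambda>l. h l z)" using h0 by simp
  have s0: "0 \<le> (\<Sum>l. h l z)" using sh h0 by (intro suminf_nonneg)
  have "r z powr (1 + \<delta>) \<le> F z"
  proof (cases "r z \<le> 2 * b")
   case True
   have "r z powr (1 + \<delta>) = r z powr \<delta> * r z" using r(2)[of z] \<delta> by (cases "r z = 0") (auto simp: powr_add)
   also have "... \<le> (2 * b) powr \<delta> * r z" using True r(2) \<delta> by (intro mult_right_mono powr_mono2) auto
   finally show ?thesis using s0 by (simp add: F_def)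
  next
   case False
   obtain n where n: "r z / 2 < b ^ n" using real_arch_pow[OF b(1)] by blast
   define k where "k = (LEAST k. r z \<le> 2 * b ^ (k + 2))"
   have ex: "r z \<le> 2 * b ^ (n + 2)"
   proof -
    have "b ^ n \<le> b ^ (n + 2)" using b by (intro power_increasing) auto
    thus ?thesis using n by linarith
   qed
   have k: "r z \<le> 2 * b ^ (k + 2)" unfolding k_def by (rule LeastI[of _ n]) (rule ex)
   have kl: "2 * b ^ (k + 1) < r z"
   proof (cases k)
    case 0 thus ?thesis using False by simp
   next
    case (Suc k')
    hence "\<not> r z \<le> 2 * b ^ (k' + 2)" using not_less_Least[of k' "\<lambda>k. r z \<le> 2 * b ^ (k + 2)"] unfolding k_def by simp
    thus ?thesis using Suc by simp
   qed
   have "b ^ k \<le> b ^ (k + 1)" using b by (intro power_increasing) auto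
   moreover have "x \<le> 2 * \<bar>x - y\<bar>" if "u \<le> v" "2 * v < x" "y \<le> u" for x y u v :: real using that by (smt (verit) field_sum_of_halves)
   ultimately have "r z \<le> 2 * \<bar>r z - \<rho> k z\<bar>" using kl b(2)[of k z] by blast
   moreover have rpos: "0 < r z" using False b by linarith
   ultimately have "r z powr \<delta> * r z \<le> (2 * b ^ (k + 2)) powr \<delta> * (2 * \<bar>r z - \<rho> k z\<bar>)"
    using k \<delta> by (intro mult_mono powr_mono2) auto
   hence "r z powr (1 + \<delta>) \<le> h k z" using rpos by (simp add: h_def B_def powr_add mult_ac)
   also have "... \<le> (\<Sum>l. h l z)"
    using sum_le_suminf[OF sh, of "{k}"] h0 by simp
   finally show ?thesis using r(2)[of z] by (simp add: F_def add_increasing)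
  qed
  thus "norm (r z powr (1 + \<delta>)) \<le> norm (F z)" by simp
 qed
 hence "integrable M (\<lambda>z. r z powr (1 + \<delta>))"
  using r by (intro Bochner_Integration.integrable_bound[OF iF]) auto
 thus ?thesis using \<delta> by (intro exI[of _ "1 + \<delta>"]) auto
qed

lemma gau_1_le_1: "gau 1 z \<le> 1"
proof -
 have "gau 1 z \<le> 1 / (2 * pi * 1)" by (rule gau_le) simp
 also have "... \<le> 1" using pi_gt3 by simp
 finally show ?thesis .
qed

theorem (in ssys) exists_invariant_density:
 assumes C: "0 \<le> C" and c: "0 < c"
  and d: "\<And>l. (LBINT z. \<bar>(P ^^ Suc l) (gau 1) z - (P ^^ l) (gau 1) z\<bar>) \<le> C * exp (- c * real l)"
 shows "\<exists>r. integrable lborel r \<and> (\<forall>z. 0 \<le> r z) \<and> integral\<^sup>L lborel r = 1 \<and> (AE z in lborel. P r z = r z) \<and> (\<exists>q>1. integrable lborel (\<lambda>z. r z powr q))"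
proof -
 define \<rho> where "\<rho> l = (P ^^ l) (gau 1)" for l
 have ig: "integrable lborel (gau 1)" "integral\<^sup>L lborel (gau 1) = 1" using gau_integral[of 1] by auto
 have i: "integrable lborel (\<rho> l)" and int1: "integral\<^sup>L lborel (\<rho> l) = 1" for l
  using P_funpow_L1[OF ig(1), of l] ig(2) by (auto simp: \<rho>_def)
 have Suc: "\<rho> (Suc l) = P (\<rho> l)" for l by (simp add: \<rho>_def)
 have nn: "0 \<le> \<rho> l z" for l z
 proof (induction l arbitrary: z)
  case 0
  thus ?case using gau_pos[of 1 z] by (simp add: \<rho>_def less_imp_le)
 next
  case (Suc l)
  thus ?case unfolding \<open>\<rho> (Suc l) = P (\<rho> l)\<close> P_def by (intro conv_nonneg) (auto simp: scl_def)
 qed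
 obtain r C' where r: "integrable lborel r" "\<And>z. 0 \<le> r z" and C': "0 \<le> C'" and rl: "\<And>l. (LBINT z. \<bar>r z - \<rho> l z\<bar>) \<le> C' * exp (- c * real l)"
  using L1_limit[of lborel \<rho>, OF i nn C c] d unfolding \<rho>_def[symmetric] by blast
 have lim0: "(\<lambda>l. K * exp (- c * real l)) \<longlonglongrightarrow> 0" for K
 proof -
  have "(\<lambda>l. exp (- c) ^ l) \<longlonglongrightarrow> 0" using c by (intro LIMSEQ_power_zero) simp
  hence "(\<lambda>l. K * exp (- c) ^ l) \<longlonglongrightarrow> 0" by (intro tendsto_mult_right_zero)
  thus ?thesis by (simp only: exp_of_nat2_mult[of "- c"])
 qed
 have small0: "x = 0" if "0 \<le> x" "\<And>l. x \<le> K * exp (- c * real l)" for x K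
  using LIMSEQ_le_const[OF lim0[of K], of x] that by (intro antisym) auto
 have "\<bar>integral\<^sup>L lborel r - 1\<bar> = 0"
 proof (rule small0)
  fix l
  have "\<bar>integral\<^sup>L lborel r - 1\<bar> = \<bar>\<integral>z. r z - \<rho> l z \<partial>lborel\<bar>" using r i int1 by simp
  also have "... \<le> (LBINT z. \<bar>r z - \<rho> l z\<bar>)" by (rule integral_abs_bound)
  also have "... \<le> C' * exp (- c * real l)" by (rule rl)
  finally show "\<bar>integral\<^sup>L lborel r - 1\<bar> \<le> C' * exp (- c * real l)" .
 qed simp
 moreover have "AE z in lborel. P r z = r z"
 proof -
  have iP: "integrable lborel (P r)" by (rule P_L1(1)[OF r(1)])
  have "(LBINT z. \<bar>P r z - r z\<bar>) = 0"
  proof (rule small0)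
   fix l
   have "(LBINT z. \<bar>P r z - r z\<bar>) \<le> (LBINT z. \<bar>P r z - P (\<rho> l) z\<bar> + \<bar>r z - \<rho> (Suc l) z\<bar>)"
    using iP r i P_L1(1)[OF i] by (intro integral_mono integrable_abs Bochner_Integration.integrable_add Bochner_Integration.integrable_diff) (auto simp: Suc)
   also have "... = (LBINT z. \<bar>P (\<lambda>z. r z - \<rho> l z) z\<bar>) + (LBINT z. \<bar>r z - \<rho> (Suc l) z\<bar>)"
    unfolding P_diff using iP r i P_L1(1)[OF i] by (intro Bochner_Integration.integral_add integrable_abs Bochner_Integration.integrable_diff) auto
   also have "(LBINT z. \<bar>P (\<lambda>z. r z - \<rho> l z) z\<bar>) \<le> (LBINT z. \<bar>r z - \<rho> l z\<bar>)"
    using r i by (intro P_L1(2)) auto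
   also have "... \<le> C' * exp (- c * real l)" by (rule rl)
   also have "(LBINT z. \<bar>r z - \<rho> (Suc l) z\<bar>) \<le> C' * exp (- c * real (Suc l))" by (rule rl)
   also have "... \<le> C' * exp (- c * real l)" using c C' by (intro mult_left_mono) auto
   finally show "(LBINT z. \<bar>P r z - r z\<bar>) \<le> (2 * C') * exp (- c * real l)" by simp
  qed simp
  hence "AE z in lborel. \<bar>P r z - r z\<bar> = 0"
   using iP r by (subst (asm) integral_nonneg_eq_0_iff_AE) auto
  thus ?thesis by simp
 qed
 moreover have "\<exists>q>1. integrable lborel (\<lambda>z. r z powr q)"
 proof (rule Lq_of_L1_rate[OF r i _ _ C' c rl])
  show "1 < 1 / (norm \<theta>)^2" using th0 th1 by (simp add: power_less_one_iff)
  fix l z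
  have "scl (\<theta> ^ l) (gau 1) y \<le> (1 / (norm \<theta>)^2) ^ l" for y
  proof -
   have "scl (\<theta> ^ l) (gau 1) y \<le> 1 / (norm (\<theta> ^ l))^2" unfolding scl_def by (intro divide_right_mono gau_1_le_1) simp
   also have "... = (1 / (norm \<theta>)^2) ^ l" by (simp add: norm_power power_divide flip: power_mult) (simp add: mult.commute)
   finally show ?thesis .
  qed
  hence "conv (X l) (scl (\<theta> ^ l) (gau 1)) z \<le> (\<Sum>y\<in>set_pmf (X l). pmf (X l) y * (1 / (norm \<theta>)^2) ^ l)"
   unfolding conv_pmf[OF finite_X] by (intro sum_mono mult_left_mono) auto
  also have "... = (1 / (norm \<theta>)^2) ^ l" using sum_pmf_1[OF finite_X] by (simp flip: sum_distrib_right)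
  finally show "\<rho> l z \<le> (1 / (norm \<theta>)^2) ^ l" unfolding \<rho>_def P_funpow .
 qed
 ultimately show ?thesis using r by (intro exI[of _ r]) auto
qed

section \<open>Absolute continuity\<close>

lemma exists_pmf_of_prob_simplex:
 assumes fin: "finite \<Lambda>" and p: "p \<in> prob_simplex \<Lambda>"
 shows "\<exists>pm. set_pmf pm = \<Lambda> \<and> (\<forall>i\<in>\<Lambda>. pmf pm i = p i)"
proof -
 define w where "w i = (if i \<in> \<Lambda> then p i else 0)" for i
 have w0: "0 \<le> w i" for i using p by (auto simp: w_def prob_simplex_def less_imp_le)
 have "(\<integral>\<^sup>+i. ennreal (w i) \<partial>count_space UNIV) = (\<Sum>i\<in>\<Lambda>. ennreal (w i))"
  using fin by (intro nn_integral_count_space') (auto simp: w_def)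
 also have "... = 1"
  using p w0 by (subst sum_ennreal) (auto simp: w_def prob_simplex_def cong: sum.cong)
 finally have pmf: "pmf (embed_pmf w) i = w i" for i by (rule pmf_embed_pmf[OF w0])
 have "set_pmf (embed_pmf w) = \<Lambda>"
  using p by (auto simp: set_pmf_eq pmf w_def prob_simplex_def)
 thus ?thesis using pmf by (intro exI[of _ "embed_pmf w"]) (simp add: w_def)
qed

lemma measure_density_lborel:
 fixes r :: "complex \<Rightarrow> real"
 assumes r: "integrable lborel r" "\<And>z. 0 \<le> r z" and B: "B \<in> sets borel"
 shows "measure (density lborel (\<lambda>z. ennreal (r z))) B = (LBINT z. r z * indicator B z)"
proof -
 have [measurable]: "r \<in> borel_measurable borel" using r by auto
 have "emeasure (density lborel (\<lambda>z. ennreal (r z))) B = (\<integral>\<^sup>+z. ennreal (r z * indicator B z) \<partial>lborel)"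
  using B r by (subst emeasure_density) (auto intro!: nn_integral_cong simp: indicator_def)
 also have "... = ennreal (LBINT z. r z * indicator B z)"
  using r B by (intro nn_integral_eq_integral integrable_mult_indicator[of B lborel r, simplified mult.commute[of _ "r _"] real_scaleR_def]) auto
 finally show ?thesis using r by (simp add: measure_def)
qed

text \<open>The equation \<open>P r = r\<close> is the self-similarity of the measure with density
  \<open>r\<close>, read through the substitution \<open>z = lam * w + a i\<close>.\<close>

lemma self_similar_density:
 assumes S: "ssys lam \<mu>" and \<mu>: "\<mu> = map_pmf a pm" and pm: "finite \<Lambda>" "set_pmf pm = \<Lambda>" "\<And>i. i \<in> \<Lambda> \<Longrightarrow> pmf pm i = p i"
  and r: "integrable lborel r" "\<And>z. 0 \<le> r z" "integral\<^sup>L lborel r = 1" "AE z in lborel. ssys.P lam \<mu> r z = r z"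
 shows "is_self_similar_measure \<Lambda> lam a p (density lborel (\<lambda>z. ennreal (r z)))"
 unfolding is_self_similar_measure_def
proof (intro conjI ballI)
 interpret ssys lam \<mu> by fact
 let ?\<nu> = "density lborel (\<lambda>z. ennreal (r z))"
 have rm[measurable]: "r \<in> borel_measurable borel" using r by auto
 show "prob_space ?\<nu>"
 proof (rule prob_spaceI)
  have "emeasure ?\<nu> (space ?\<nu>) = (\<integral>\<^sup>+z. ennreal (r z) \<partial>lborel)" by (simp add: emeasure_density)
  also have "... = 1" using r by (subst nn_integral_eq_integral) auto
  finally show "emeasure ?\<nu> (space ?\<nu>) = 1" .
 qed
 show "sets ?\<nu> = sets borel" by simp
 fix A :: "complex set" assume A[measurable]: "A \<in> sets borel"
 have sc: "integrable lborel (scl lam r)" by (rule scl_L1(1)[OF th0 r(1)])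
 have Pe: "P r z = (\<Sum>i\<in>\<Lambda>. p i * scl lam r (z - a i))" for z
 proof -
  have "P r z = (\<integral>i. scl lam r (z - a i) \<partial>measure_pmf pm)" unfolding P_def by (simp only: \<mu> conv_map_pmf)
  also have "... = (\<Sum>i\<in>\<Lambda>. p i * scl lam r (z - a i))"
   using pm by (subst integral_measure_pmf[OF pm(1)]) auto
  finally show ?thesis .
 qed
 have "measure ?\<nu> A = (LBINT z. r z * indicator A z)" by (rule measure_density_lborel[OF r(1,2) A])
 also have "... = (LBINT z. P r z * indicator A z)"
  using r(4) P_L1(1)[OF r(1)] by (intro integral_cong_AE) (auto elim: eventually_mono)
 also have "... = (LBINT z. (\<Sum>i\<in>\<Lambda>. p i * (scl lam r (z - a i) * indicator A z)))"
  unfolding Pe by (simp only: sum_distrib_right mult.assoc)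
 also have "... = (\<Sum>i\<in>\<Lambda>. p i * (LBINT z. scl lam r (z - a i) * indicator A z))"
 proof -
  have "integrable lborel (\<lambda>z. scl lam r (z - a i) * indicator A z)" for i
   using integrable_mult_indicator[of A lborel "\<lambda>z. scl lam r (z - a i)"] integrable_shift[OF sc, of "a i"] A by (simp add: mult.commute)
  thus ?thesis by (subst Bochner_Integration.integral_sum) auto
 qed
 also have "... = (\<Sum>i\<in>\<Lambda>. p i * measure (distr ?\<nu> borel (ifs_map lam a i)) A)"
 proof (intro sum.cong refl arg_cong2[of _ _ _ _ "(*)"])
  fix i
  have [measurable]: "scl lam r \<in> borel_measurable borel" using sc by auto
  have B: "ifs_map lam a i -` A \<in> sets borel" using measurable_sets[OF measurable_ifs_map A, of lam a i] by simp
  have "(LBINT z. scl lam r (z - a i) * indicator A z) = (LBINT z. scl lam r z * indicator A (z + a i))"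
   using integral_shift[of "\<lambda>z. scl lam r z * indicator A (z + a i)" "a i"] by simp
  also have "... = (LBINT z. (\<lambda>w. r w * indicator A (lam * w + a i) / (norm lam)^2) (z / lam))"
   using th0 by (simp add: scl_def)
  also have "... = (norm lam)^2 * (LBINT w. r w * indicator A (lam * w + a i) / (norm lam)^2)"
   by (rule integral_scl[OF _ th0]) measurable
  also have "... = (LBINT w. r w * indicator (ifs_map lam a i -` A) w)"
   using th0 by (simp add: ifs_map_def indicator_def)
  also have "... = measure ?\<nu> (ifs_map lam a i -` A)" by (rule measure_density_lborel[OF r(1,2) B, symmetric])
  also have "... = measure (distr ?\<nu> borel (ifs_map lam a i)) A" by (subst measure_distr) auto
  finally show "(LBINT z. scl lam r (z - a i) * indicator A z) = measure (distr ?\<nu> borel (ifs_map lam a i)) A" .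
 qed
 finally show "measure ?\<nu> A = (\<Sum>i\<in>\<Lambda>. p i * measure (distr ?\<nu> borel (ifs_map lam a i)) A)" .
qed

lemma (in ssys) Hp_map_inj:
 assumes "inj_on g (set_pmf \<beta>)" shows "Hp (map_pmf g \<beta>) = Hp \<beta>"
 unfolding Hp_def ex_def using assms by (simp add: sum.reindex pmf_map_inj)

text \<open>A digit of the system with ratio \<open>lam ^ N\<close> is a block of \<open>N\<close> digits of the system with ratio \<open>lam\<close>.\<close>

lemma separated_block:
 assumes L: "ssys lam \<mu>" and N: "1 \<le> N" and A: "\<alpha> = map_pmf ((*) lam) (ssys.X lam \<mu> (N - 1))"
  and sep: "\<And>c. (\<forall>n<k * N. c n \<in> {x - y |x y. x \<in> set_pmf \<mu> \<and> y \<in> set_pmf \<mu>}) \<Longrightarrow> (\<exists>n<k * N. c n \<noteq> 0) \<Longrightarrow>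
    norm lam ^ (M * (k * N)) < norm (\<Sum>n<k * N. c n * lam ^ n)"
 shows "ssys.separated (lam ^ N) \<alpha> k M"
proof -
 interpret L: ssys lam \<mu> by fact
 interpret A: ssys "lam ^ N" \<alpha> by (rule P_power_split(1)[OF L N A])
 obtain d0 where d0: "d0 \<in> set_pmf \<mu>" using set_pmf_not_empty by fast
 have dig: "\<exists>D. (\<forall>j<N - 1. D j \<in> set_pmf \<mu>) \<and> x = (\<Sum>j<N - 1. lam ^ Suc j * D j)" if x: "x \<in> set_pmf \<alpha>" for x
 proof -
  obtain y where y: "y \<in> set_pmf (L.X (N - 1))" "x = lam * y" using x by (auto simp: A)
  from L.set_X[OF y(1)] y(2) show ?thesis by (auto simp: sum_distrib_left mult.assoc)
 qed
 show ?thesis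
  unfolding A.separated_def
 proof (intro allI impI)
  fix x y assume xy: "\<forall>i<k. x i \<in> set_pmf \<alpha> \<and> y i \<in> set_pmf \<alpha>" and ne: "\<exists>i<k. x i \<noteq> y i"
  define Dg where "Dg v = (SOME D. (\<forall>j<N - 1. D j \<in> set_pmf \<mu>) \<and> v = (\<Sum>j<N - 1. lam ^ Suc j * D j))" for v
  have Dg: "(\<forall>j<N - 1. Dg v j \<in> set_pmf \<mu>) \<and> v = (\<Sum>j<N - 1. lam ^ Suc j * Dg v j)" if "v \<in> set_pmf \<alpha>" for v
   unfolding Dg_def by (rule someI_ex[OF dig[OF that]])
  \<comment> \<open>The leading place of each block belongs to the other system and gets coefficient
    0. The factor \<open>lam\<close> in \<open>\<alpha>\<close> puts the remaining digits in places
    1 to \<open>N - 1\<close>.\<close>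
  define c where "c n = (if n mod N = 0 then 0 else Dg (x (n div N)) (n mod N - 1) - Dg (y (n div N)) (n mod N - 1))" for n
  have cblock: "c (i * N + Suc j) = Dg (x i) j - Dg (y i) j" if "j < N - 1" for i j
  proof -
   have "Suc j < N" using that by simp
   hence "(i * N + Suc j) div N = i" "(i * N + Suc j) mod N = Suc j"
    by (simp_all only: div_mult_self3 mod_mult_self3 div_less mod_less add_0_right neq0_conv less_nat_zero_code gr_implies_not0 not_False_eq_True)
   thus ?thesis by (simp only: c_def) simp
  qed
  have c0: "c (i * N) = 0" for i by (simp add: c_def)
  have block: "(\<Sum>n\<in>{i * N..<i * N + N}. c n * lam ^ n) = (lam ^ N) ^ i * (x i - y i)" if i: "i < k" for i
  proof -
   obtain N' where N': "N = Suc N'" using N by (cases N) auto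
   have "(\<Sum>n\<in>{i * N..<i * N + N}. c n * lam ^ n) = (\<Sum>j<N. c (i * N + j) * lam ^ (i * N + j))"
    using sum.shift_bounds_nat_ivl[of "\<lambda>n. c n * lam ^ n" 0 "i * N" N] by (simp add: atLeast0LessThan add.commute)
   also have "... = (\<Sum>j<N'. c (i * N + Suc j) * lam ^ (i * N + Suc j))"
    unfolding N' using c0[of i] by (subst sum.lessThan_Suc_shift) (simp add: N')
   also have "... = (\<Sum>j<N'. (lam ^ N) ^ i * (lam ^ Suc j * Dg (x i) j - lam ^ Suc j * Dg (y i) j))"
   proof (intro sum.cong refl)
    fix j assume "j \<in> {..<N'}"
    hence "c (i * N + Suc j) = Dg (x i) j - Dg (y i) j" by (intro cblock) (simp add: N')
    moreover have "lam ^ (i * N + Suc j) = (lam ^ N) ^ i * lam ^ Suc j" by (simp only: power_add power_mult[symmetric] mult.commute[of i])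
    ultimately show "c (i * N + Suc j) * lam ^ (i * N + Suc j) = (lam ^ N) ^ i * (lam ^ Suc j * Dg (x i) j - lam ^ Suc j * Dg (y i) j)"
     by (simp only: right_diff_distrib left_diff_distrib mult_ac)
   qed
   also have "... = (lam ^ N) ^ i * (x i - y i)"
   proof -
    have "x i = (\<Sum>j<N'. lam ^ Suc j * Dg (x i) j)" "y i = (\<Sum>j<N'. lam ^ Suc j * Dg (y i) j)"
     using Dg[of "x i"] Dg[of "y i"] xy i by (simp_all add: N')
    thus ?thesis by (metis sum_distrib_left sum_subtractf)
   qed
   finally show ?thesis .
  qed
  have tot: "(\<Sum>n<k * N. c n * lam ^ n) = (\<Sum>i<k. (lam ^ N) ^ i * (x i - y i))"
   unfolding sum.nat_group[symmetric] using block by (intro sum.cong) auto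
  have cin: "c n \<in> {x - y |x y. x \<in> set_pmf \<mu> \<and> y \<in> set_pmf \<mu>}" if n: "n < k * N" for n
  proof (cases "n mod N = 0")
   case True
   hence "c n = d0 - d0" by (simp add: c_def)
   thus ?thesis using d0 by blast
  next
   case False
   have "n div N < k" using n N by (simp add: less_mult_imp_div_less)
   moreover have "n mod N - 1 < N - 1" using False mod_less_divisor[of N n] N by linarith
   ultimately have "Dg (x (n div N)) (n mod N - 1) \<in> set_pmf \<mu>" "Dg (y (n div N)) (n mod N - 1) \<in> set_pmf \<mu>"
    using Dg xy by blast+
   thus ?thesis using False unfolding c_def by auto
  qed
  obtain i where i: "i < k" "x i \<noteq> y i" using ne by blast
  have cne: "\<exists>n<k * N. c n \<noteq> 0"
  proof (rule ccontr)
   assume "\<not> ?thesis"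
   hence "c n = 0" if "n < k * N" for n using that by blast
   moreover have "i * N + N \<le> k * N" using i(1) by (metis Suc_leI add.commute mult_Suc mult_le_mono1)
   ultimately have "(\<Sum>n\<in>{i * N..<i * N + N}. c n * lam ^ n) = 0" by (intro sum.neutral) auto
   thus False using block[OF i(1)] i(2) A.th0 by simp
  qed
  have "norm (lam ^ N) ^ (M * k) = norm lam ^ (M * (k * N))" by (simp add: norm_power flip: power_mult) (simp add: mult_ac)
  thus "norm (lam ^ N) ^ (M * k) < norm (\<Sum>i<k. (lam ^ N) ^ i * (x i - y i))"
   using sep[of c] cin cne unfolding tot by simp
 qed
qed

text \<open>Giving up one digit in \<open>N\<close> costs little excess entropy when
  \<open>N\<close> is large. Two consecutive powers of a non-real number cannot both be real, so one
  of two consecutive exponents qualifies.\<close>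

lemma exists_good_power:
 assumes lam: "lam \<notin> \<real>" and H: "2 * L < H" and L: "0 < (L::real)"
 shows "\<exists>N\<ge>1. Im (lam ^ N) \<noteq> 0 \<and> 2 * (real N * L) < real (N - 1) * H"
proof -
 obtain N0 :: nat where N0: "H / (H - 2 * L) < real N0" using reals_Archimedean2 by blast
 have good: "2 * (real N * L) < real (N - 1) * H \<and> 1 \<le> N" if "N0 \<le> N" for N
 proof -
  have "0 < H / (H - 2 * L)" using H L by simp
  hence "1 \<le> N" using N0 that by (cases N) auto
  moreover have "H < real N * (H - 2 * L)"
   using N0 that H by (metis diff_gt_0_iff_gt of_nat_le_iff order_less_le_trans pos_divide_less_eq)
  ultimately show ?thesis by (simp add: of_nat_diff algebra_simps)
 qed
 have "Im (lam ^ N0) \<noteq> 0 \<or> Im (lam ^ Suc N0) \<noteq> 0"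
 proof (rule ccontr)
  assume "\<not> ?thesis"
  hence 1: "Im (lam ^ N0) = 0" "Im (lam * lam ^ N0) = 0" by auto
  hence "Im lam * Re (lam ^ N0) = 0" by simp
  moreover have "Im lam \<noteq> 0" using lam by (simp add: complex_is_Real_iff)
  ultimately have "lam ^ N0 = 0" using 1 by (simp add: complex_eq_iff)
  thus False using lam by auto
 qed
 thus ?thesis
 proof
  assume 0: "Im (lam ^ N0) \<noteq> 0"
  have g: "2 * (real N0 * L) < real (N0 - 1) * H \<and> 1 \<le> N0" by (rule good) simp
  show ?thesis by (rule exI[of _ N0]) (intro conjI g[THEN conjunct1] g[THEN conjunct2] 0)
 next
  assume 0: "Im (lam ^ Suc N0) \<noteq> 0"
  have g: "2 * (real (Suc N0) * L) < real (Suc N0 - 1) * H \<and> 1 \<le> Suc N0" by (rule good) simp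
  show ?thesis by (rule exI[of _ "Suc N0"]) (intro conjI g[THEN conjunct1] g[THEN conjunct2] 0)
 qed
qed

theorem self_similar_measure_Lq:
 fixes \<Lambda> :: "'i set" and a :: "'i \<Rightarrow> complex"
 assumes fin\<Lambda>: "finite \<Lambda>" and card: "2 \<le> card \<Lambda>" and inj: "inj_on a \<Lambda>"
 shows "\<exists>E. thin E \<and> (\<forall>lam \<in> ball 0 1 - (E \<union> \<real>). \<forall>p \<in> prob_simplex \<Lambda>. 2 < similarity_dim \<Lambda> lam p \<longrightarrow>
  (\<exists>q>1. has_Lq_density q (self_similar_measure \<Lambda> lam a p)))"
proof -
 \<comment> \<open>Only differences of translations enter, so the excluded set is fixed before
   \<open>p\<close> and \<open>N\<close>.\<close>
 define \<Delta> where "\<Delta> = {x - y |x y. x \<in> a ` \<Lambda> \<and> y \<in> a ` \<Lambda>}"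
 have "\<Delta> = (\<lambda>(x, y). x - y) ` (a ` \<Lambda> \<times> a ` \<Lambda>)" by (auto simp: \<Delta>_def)
 hence fin\<Delta>: "finite \<Delta>" using fin\<Lambda> by simp
 have "\<Lambda> \<noteq> {}" using card by auto
 hence "0 \<in> \<Delta>" by (force simp: \<Delta>_def)
 from thin_nonseparated[OF fin\<Delta> \<open>0 \<in> \<Delta>\<close>] obtain E1 where E1: "thin E1" and sep: "\<forall>x. x \<notin> E1 \<longrightarrow> 0 < norm x \<longrightarrow> norm x < 1 \<longrightarrow>
  (\<exists>M\<ge>1. \<exists>k0. \<forall>k\<ge>k0. \<not> near_coincidence \<Delta> x M k)"
  by (elim exE conjE)
 from thin_erdos_kahane obtain E2 where E2: "thin E2" and ek: "\<forall>x N. x \<notin> E2 \<longrightarrow> 0 < norm x \<longrightarrow> norm x < 1 \<longrightarrow> 1 \<le> N \<longrightarrow> Im (x ^ N) \<noteq> 0 \<longrightarrow>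
  (\<exists>\<kappa>>0. \<exists>U>0. \<exists>\<epsilon>>0. \<exists>n0. escapes \<kappa> U \<epsilon> n0 (inverse (x ^ N)))"
  by (elim exE conjE)
 have "\<exists>q>1. has_Lq_density q (self_similar_measure \<Lambda> lam a p)"
  if lam: "lam \<in> ball 0 1 - (E1 \<union> E2 \<union> \<real>)" and p: "p \<in> prob_simplex \<Lambda>" and dim: "2 < similarity_dim \<Lambda> lam p" for lam p
 proof -
  have lamR: "lam \<notin> \<real>" and lam1: "norm lam < 1" using lam by auto
  have lam0: "lam \<noteq> 0" using lamR by auto
  obtain pm where pm: "set_pmf pm = \<Lambda>" "\<And>i. i \<in> \<Lambda> \<Longrightarrow> pmf pm i = p i"
   using exists_pmf_of_prob_simplex[OF fin\<Lambda> p] by blast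
  define \<mu> where "\<mu> = map_pmf a pm"
  have set\<mu>: "set_pmf \<mu> = a ` \<Lambda>" by (simp add: \<mu>_def pm)
  interpret ssys lam \<mu> using lam0 lam1 fin\<Lambda> set\<mu> by unfold_locales auto
  define L where "L = - ln (norm lam)"
  have L: "0 < L" using lam0 lam1 by (simp add: L_def)
  have H: "Hp \<mu> = shannon_entropy \<Lambda> p"
  proof -
   have "Hp \<mu> = Hp pm' " if "pm' = \<mu>" for pm' using that by simp
   have "Hp \<mu> = - (\<Sum>i\<in>\<Lambda>. pmf \<mu> (a i) * ln (pmf \<mu> (a i)))"
    unfolding Hp_def ex_def set\<mu> using inj by (simp add: sum.reindex)
   also have "... = shannon_entropy \<Lambda> p"
    unfolding shannon_entropy_def using inj pm by (intro arg_cong[of _ _ uminus] sum.cong refl) (simp add: \<mu>_def pmf_map_inj)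
   finally show ?thesis .
  qed
  have "2 * L < Hp \<mu>" using dim L unfolding similarity_dim_def H L_def[symmetric] by (simp add: pos_less_divide_eq)
  then obtain N where N: "1 \<le> N" "Im (lam ^ N) \<noteq> 0" "2 * (real N * L) < real (N - 1) * Hp \<mu>"
   using exists_good_power[OF lamR _ L] by blast
  define \<alpha> where "\<alpha> = map_pmf ((*) lam) (X (N - 1))"
  obtain M k0 where M: "1 \<le> M" and sepM: "\<And>k c. k0 \<le> k \<Longrightarrow> (\<forall>i<k. c i \<in> \<Delta>) \<Longrightarrow> (\<exists>i<k. c i \<noteq> 0) \<Longrightarrow> norm lam ^ (M * k) < norm (\<Sum>i<k. c i * lam ^ i)"
  proof -
   have "lam \<notin> E1" "0 < norm lam" using lam lam0 by auto
   from sep[rule_format, OF this lam1] obtain M k0 where "1 \<le> M" "\<forall>k\<ge>k0. \<not> near_coincidence \<Delta> lam M k" by blast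
   thus thesis by (intro that[of M k0]) (auto simp: near_coincidence_def not_le)
  qed
  have sepL: "separated k M" if "k0 \<le> k" for k
   unfolding separated_def
  proof (intro allI impI)
   fix x y assume xy: "\<forall>i<k. x i \<in> set_pmf \<mu> \<and> y i \<in> set_pmf \<mu>" "\<exists>i<k. x i \<noteq> y i"
   have "norm lam ^ (M * k) < norm (\<Sum>i<k. (x i - y i) * lam ^ i)"
   proof (rule sepM[OF that])
    show "\<forall>i<k. x i - y i \<in> \<Delta>"
     unfolding \<Delta>_def by (intro allI impI CollectI exI conjI, rule refl) (simp_all add: xy(1)[unfolded set\<mu>])
    show "\<exists>i<k. x i - y i \<noteq> 0" using xy(2) by simp
   qed
   thus "norm lam ^ (M * k) < norm (\<Sum>i<k. lam ^ i * (x i - y i))" by (simp only: mult.commute)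
  qed
  interpret A: ssys "lam ^ N" \<alpha> by (rule P_power_split(1)[OF ssys_axioms N(1) \<alpha>_def])
  have "A.e \<longlonglongrightarrow> 0"
  proof (rule A.e_tendsto_0[OF N(2) _ M])
   have "Hp \<alpha> = Hp (X (N - 1))" unfolding \<alpha>_def using lam0 by (intro Hp_map_inj) (auto simp: inj_on_def)
   \<comment> \<open>Separation is known only from length \<open>k0\<close> on; through padding,
     \<open>Hp_X\<close> uses it at a longer length to get distinct sums of length
     \<open>N - 1\<close>.\<close>
   also have "... = real (N - 1) * Hp \<mu>" by (rule Hp_X[OF sepL[of "max k0 (N - 1)"]]) auto
   finally show "- 2 * ln (norm (lam ^ N)) < Hp \<alpha>" using N(3) lam0 by (simp add: norm_power ln_realpow L_def mult_ac)
   fix k1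
   have "A.separated (max k0 k1) M"
   proof (rule separated_block[OF ssys_axioms N(1) \<alpha>_def])
    fix c assume c: "\<forall>n<max k0 k1 * N. c n \<in> {x - y |x y. x \<in> set_pmf \<mu> \<and> y \<in> set_pmf \<mu>}" "\<exists>n<max k0 k1 * N. c n \<noteq> 0"
    have "k0 \<le> max k0 k1 * N" using N(1) mult_le_mono[of k0 "max k0 k1" 1 N] by simp
    thus "norm lam ^ (M * (max k0 k1 * N)) < norm (\<Sum>n<max k0 k1 * N. c n * lam ^ n)"
     using c by (intro sepM) (simp_all add: \<Delta>_def set\<mu>)
   qed
   thus "\<exists>k\<ge>k1. A.separated k M" by (intro exI[of _ "max k0 k1"]) simp
  qed
  obtain i j where ij: "i \<in> \<Lambda>" "j \<in> \<Lambda>" "i \<noteq> j"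
  proof -
   have "\<not> card \<Lambda> \<le> Suc 0" using card by simp
   hence "\<not> (\<forall>x\<in>\<Lambda>. \<forall>y\<in>\<Lambda>. x = y)" by (simp only: card_le_Suc0_iff_eq[OF fin\<Lambda>] simp_thms)
   then obtain i j where "i \<in> \<Lambda>" "j \<in> \<Lambda>" "i \<noteq> j" by blast
   thus thesis by (rule that)
  qed
  have d: "a i \<in> set_pmf \<mu>" "a j \<in> set_pmf \<mu>" "a i \<noteq> a j" using ij inj by (auto simp: set\<mu> inj_on_def)
  obtain \<kappa> U \<epsilon> n0 where ek': "0 < \<kappa>" "0 < U" "0 < \<epsilon>" "escapes \<kappa> U \<epsilon> n0 (inverse (lam ^ N))"
  proof -
   have "lam \<notin> E2" "0 < norm lam" using lam lam0 by auto
   from ek[rule_format, OF this lam1 N(1,2)] show thesis by (elim exE conjE) (rule that)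
  qed
  from L1_decay[OF ssys_axioms N(1) \<alpha>_def \<open>A.e \<longlonglongrightarrow> 0\<close> d ek'] obtain C c where C: "0 \<le> C" "0 < c"
   "\<forall>l. (LBINT z. \<bar>(P ^^ Suc l) (gau 1) z - (P ^^ l) (gau 1) z\<bar>) \<le> C * exp (- c * l)"
   by (elim exE conjE)
  from exists_invariant_density[OF C(1,2) C(3)[rule_format]]
  obtain r q where r: "integrable lborel r" "\<forall>z. 0 \<le> r z" "integral\<^sup>L lborel r = 1" "AE z in lborel. P r z = r z"
   and q: "1 < q" "integrable lborel (\<lambda>z. r z powr q)"
   by (elim exE conjE)
  have "is_self_similar_measure \<Lambda> lam a p (density lborel (\<lambda>z. ennreal (r z)))"
   by (rule self_similar_density[OF ssys_axioms \<mu>_def fin\<Lambda> pm r(1) r(2)[rule_format] r(3,4)])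
  hence "self_similar_measure \<Lambda> lam a p = density lborel (\<lambda>z. ennreal (r z))"
   using self_similar_measure[OF fin\<Lambda> p lam1] by blast
  hence "has_Lq_density q (self_similar_measure \<Lambda> lam a p)"
   unfolding has_Lq_density_def using r q by (intro exI[of _ r]) auto
  thus ?thesis using q by blast
 qed
 thus ?thesis using thin_Un[OF E1 E2] by (intro exI[of _ "E1 \<union> E2"]) auto
qed

lemma absolutely_continuous_of_has_Lq_density:
 "has_Lq_density q \<nu> \<Longrightarrow> absolutely_continuous lborel \<nu>"
 unfolding has_Lq_density_def by (auto intro: absolutely_continuousI_density)

text \<open>The attractor is the topological support of the measure, so its complement has measure
  0. If the attractor were Lebesgue null, absolute continuity would leave the measure no mass at
  all.\<close>

lemma attractor_pos_measure:
 assumes fin: "finite \<Lambda>" and p: "p \<in> prob_simplex \<Lambda>" and lam: "norm lam < 1"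
  and ac: "absolutely_continuous lborel (self_similar_measure \<Lambda> lam a p)"
 shows "0 < emeasure lborel (attractor \<Lambda> lam a)"
proof (rule ccontr)
 define \<nu> where "\<nu> = self_similar_measure \<Lambda> lam a p"
 define K where "K = attractor \<Lambda> lam a"
 have ss: "is_self_similar_measure \<Lambda> lam a p \<nu>" unfolding \<nu>_def by (rule self_similar_measure(2)[OF fin p lam])
 then interpret prob_space \<nu> by (simp add: is_self_similar_measure_def)
 have s: "sets \<nu> = sets borel" using ss by (simp add: is_self_similar_measure_def)
 have Ks: "K = topological_support \<nu>" unfolding K_def \<nu>_def by (rule topological_support_self_similar_measure[OF fin p lam, symmetric])
 have "compact K"
  using is_attractor_topological_support[OF fin p lam, of a] unfolding Ks \<nu>_def is_attractor_def by blast
 hence cl: "closed K" by (rule compact_imp_closed)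
 assume "\<not> 0 < emeasure lborel (attractor \<Lambda> lam a)"
 hence "K \<in> null_sets lborel" using cl by (auto simp: K_def[symmetric] null_sets_def)
 hence "emeasure \<nu> K = 0" using ac by (auto simp: absolutely_continuous_def \<nu>_def[symmetric])
 moreover have "emeasure \<nu> (- K) = 0"
  using cl by (intro emeasure_disjoint_topological_support[OF s]) (auto simp: Ks[symmetric] open_closed)
 moreover have "emeasure \<nu> (space \<nu>) \<le> emeasure \<nu> K + emeasure \<nu> (- K)"
  using emeasure_subadditive[of K \<nu> "- K"] cl s sets_eq_imp_space_eq[OF s] by simp
 ultimately show False by (simp add: emeasure_space_1)
qed

theorem theorem2:
 fixes \<Lambda> :: "'i set" and a :: "'i \<Rightarrow> complex"
 assumes "finite \<Lambda>" and "2 \<le> card \<Lambda>" and "inj_on a \<Lambda>"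
 shows "\<exists>E. E \<subseteq> ball 0 1 - \<real> \<and> hausdorff_dim E = 0 \<and>
  (\<forall>lam \<in> ball 0 1 - (E \<union> \<real>). \<forall>p \<in> prob_simplex \<Lambda>.
    2 < similarity_dim \<Lambda> lam p \<longrightarrow>
     absolutely_continuous lborel (self_similar_measure \<Lambda> lam a p) \<and>
     (\<exists>q>1. has_Lq_density q (self_similar_measure \<Lambda> lam a p))) \<and>
  (\<forall>lam \<in> ball 0 1 - (E \<union> \<real>).
    1 < (norm lam)\<^sup>2 * real (card \<Lambda>) \<longrightarrow>
     0 < emeasure lborel (attractor \<Lambda> lam a))"
proof -
 obtain E' where E': "thin E'" and Lq: "\<And>lam p. lam \<in> ball 0 1 - (E' \<union> \<real>) \<Longrightarrow> p \<in> prob_simplex \<Lambda> \<Longrightarrow> 2 < similarity_dim \<Lambda> lam p \<Longrightarrow>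
  \<exists>q>1. has_Lq_density q (self_similar_measure \<Lambda> lam a p)"
  using self_similar_measure_Lq[OF assms] by blast
 \<comment> \<open>The intersection gives the required inclusion and excludes the same parameters,
   since real points and points outside the disc are ruled out anyway.\<close>
 define E where "E = E' \<inter> (ball 0 1 - \<real>)"
 have main: "absolutely_continuous lborel (self_similar_measure \<Lambda> lam a p) \<and> (\<exists>q>1. has_Lq_density q (self_similar_measure \<Lambda> lam a p))"
  if "lam \<in> ball 0 1 - (E \<union> \<real>)" "p \<in> prob_simplex \<Lambda>" "2 < similarity_dim \<Lambda> lam p" for lam p
 proof -
  have "lam \<in> ball 0 1 - (E' \<union> \<real>)" using that(1) by (auto simp: E_def)
  from Lq[OF this that(2,3)] show ?thesis using absolutely_continuous_of_has_Lq_density by blast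
 qed
 have "0 < emeasure lborel (attractor \<Lambda> lam a)"
  if lam: "lam \<in> ball 0 1 - (E \<union> \<real>)" and m: "1 < (norm lam)\<^sup>2 * real (card \<Lambda>)" for lam
 proof -
  \<comment> \<open>Uniform weights have entropy \<open>ln (card \<Lambda>)\<close>, for which
    similarity dimension above 2 is the assumed inequality in logarithmic form.\<close>
  define p where "p = (\<lambda>_::'i. 1 / real (card \<Lambda>))"
  have p: "p \<in> prob_simplex \<Lambda>" using assms by (auto simp: p_def prob_simplex_def)
  have lam0: "0 < norm lam" "norm lam < 1" using lam by auto
  have "shannon_entropy \<Lambda> p = ln (real (card \<Lambda>))"
   using assms(2) by (simp add: shannon_entropy_def p_def ln_div)
  moreover have "0 < ln ((norm lam)\<^sup>2 * real (card \<Lambda>))" using m by (rule ln_gt_zero)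
  hence "0 < 2 * ln (norm lam) + ln (real (card \<Lambda>))" using lam0 assms(2) by (simp add: ln_mult ln_realpow)
  moreover have "0 < - ln (norm lam)" using lam0 by simp
  ultimately have "2 < similarity_dim \<Lambda> lam p" unfolding similarity_dim_def by (simp only: pos_less_divide_eq)
  thus ?thesis using main[OF lam p] lam0(2) by (intro attractor_pos_measure[OF assms(1) p]) auto
 qed
 thus ?thesis
 proof (intro exI[of _ E] conjI ballI impI)
  show "E \<subseteq> ball 0 1 - \<real>" by (auto simp: E_def)
  show "hausdorff_dim E = 0" by (rule thin_hausdorff_dim[OF thin_subset[OF E']]) (auto simp: E_def)
 qed (use main in blast)+
qed

end
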